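(* Let $k$ be a field, let $H$ be a finite dimensional Hopf algebra over $k$ and let $\mathfrak{H}_1,\dots,\mathfrak{H}_n$ be the composition factors of $H$. Then the composition factors of the dual Hopf algebra $H^*$ are $\mathfrak{H}_1^*, \dots, \mathfrak{H}_n^*$ (up to permutation and isomorphism of Hopf algebras). In particular the length of $H^*$ coincides with the length of $H$.
   Context: Normal Hopf subalgebra: a Hopf subalgebra stable under both adjoint actions $h.a=h_{(1)}a\mathcal S(h_{(2)})$ and $a.h=\mathcal S(h_{(1)})ah_{(2)}$. For a subalgebra $K$, $K^+=K\cap\ker\epsilon$. If $A\subseteq H$ is a normal Hopf subalgebra then $H/HA^+$ is a quotient Hopf algebra. A Hopf algebra is simple if it contains no normal Hopf subalgebra $A$ with $k\subsetneq A\subsetneq H$. A composition series of a finite dimensional Hopf algebra $H$ is a sequence of simple Hopf algebras defined recursively: if $H$ is simple, it is the one-term sequence $H$; if $k\subsetneq A\subsetneq H$ is a normal Hopf subalgebra, and $\mathfrak{A}_1,\dots,\mathfrak{A}_m$ and $\mathfrak{B}_1,\dots,\mathfrak{B}_l$ are composition series of $A$ and $H/HA^+$, then $\mathfrak{A}_1,\dots,\mathfrak{A}_m,\mathfrak{B}_1,\dots,\mathfrak{B}_l$ is a composition series of $H$. Up to permutation and isomorphism the terms of a composition series do not depend on the choice of the series; they are called the composition factors of $H$, and their number is the length of $H$. *)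

theory Defs
  imports Complex_Main "HOL-Library.Function_Algebras" "HOL-Library.Multiset"
begin

text \<open>
  Vector spaces over a field \<open>'k\<close> are subspaces \<open>V\<close> of an ambient abelian group carrying a scalar
  multiplication \<open>s\<close>.  Elements of the tensor powers of \<open>V\<close> are written as lists of pure tensors, a
  pure tensor being the list of its factors: \<open>[[x, y], [x', y']]\<close> stands for
  \<open>x \<otimes> y + x' \<otimes> y'\<close> (scalars are absorbed into the factors).  Two such formal sums denote
  the same tensor iff they agree in the free vector space on the lists over \<open>V\<close> modulo the span of
  the multilinearity relations.  This quotient is the direct sum of the tensor powers of \<open>V\<close>, the
  relations being homogeneous with respect to the length of the lists.
\<close>

definition formal_sum :: "'a list list \<Rightarrow> 'a list \<Rightarrow> 'k::field" where
  "formal_sum ts = (\<lambda>p. \<Sum>t\<leftarrow>ts. of_bool (p = t))"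

definition multilinear_relations ::
    "('k::field \<Rightarrow> 'a::ab_group_add \<Rightarrow> 'a) \<Rightarrow> 'a set \<Rightarrow> ('a list \<Rightarrow> 'k) set" where
  "multilinear_relations s V =
     {(\<lambda>p. of_bool (p = xs @ (a + b) # ys) - of_bool (p = xs @ a # ys) - of_bool (p = xs @ b # ys))
        | xs a b ys. set xs \<subseteq> V \<and> a \<in> V \<and> b \<in> V \<and> set ys \<subseteq> V} \<union>
     {(\<lambda>p. of_bool (p = xs @ s c a # ys) - c * of_bool (p = xs @ a # ys))
        | xs c a ys. set xs \<subseteq> V \<and> a \<in> V \<and> set ys \<subseteq> V}"

definition tensor_eq ::
    "('k::field \<Rightarrow> 'a::ab_group_add \<Rightarrow> 'a) \<Rightarrow> 'a set \<Rightarrow> 'a list list \<Rightarrow> 'a list list \<Rightarrow> bool" where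
  "tensor_eq s V ts us \<longleftrightarrow>
     (\<lambda>p. formal_sum ts p - formal_sum us p)
       \<in> module.span (\<lambda>c f p. c * f p) (multilinear_relations s V)"

abbreviation pair_tensor :: "('a \<times> 'a) list \<Rightarrow> 'a list list" where
  "pair_tensor t \<equiv> map (\<lambda>(x, y). [x, y]) t"

text \<open>
  The comultiplication is given in Sweedler form: \<open>comult H h\<close> is a list of pairs
  \<open>(h\<^sub>1, h\<^sub>2)\<close> such that \<open>\<Delta>(h)\<close> is the sum of the \<open>h\<^sub>1 \<otimes> h\<^sub>2\<close>.  Only the tensor it denotes
  matters; comultiplications are compared by \<open>tensor_eq\<close> throughout.
\<close>

record ('k, 'a) hopf =
  carrier :: "'a set"
  smult :: "'k \<Rightarrow> 'a \<Rightarrow> 'a"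
  mult :: "'a \<Rightarrow> 'a \<Rightarrow> 'a"
  unit :: "'a"
  comult :: "'a \<Rightarrow> ('a \<times> 'a) list"
  counit :: "'a \<Rightarrow> 'k"
  antipode :: "'a \<Rightarrow> 'a"

definition linear_from ::
    "'a set \<Rightarrow> ('k \<Rightarrow> 'a::ab_group_add \<Rightarrow> 'a) \<Rightarrow> ('k \<Rightarrow> 'b::ab_group_add \<Rightarrow> 'b) \<Rightarrow> ('a \<Rightarrow> 'b) \<Rightarrow> bool"
  where
  "linear_from V s s' f \<longleftrightarrow>
     (\<forall>x\<in>V. \<forall>y\<in>V. f (x + y) = f x + f y) \<and> (\<forall>c. \<forall>x\<in>V. f (s c x) = s' c (f x))"

locale hopf_algebra = vector_space "smult H"
  for H :: "('k::field, 'a::ab_group_add) hopf" +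
  assumes carrier_subspace: "subspace (carrier H)"
    and mult_closed: "x \<in> carrier H \<Longrightarrow> y \<in> carrier H \<Longrightarrow> mult H x y \<in> carrier H"
    and unit_closed: "unit H \<in> carrier H"
    and mult_linear_left:
      "y \<in> carrier H \<Longrightarrow> linear_from (carrier H) (smult H) (smult H) (\<lambda>x. mult H x y)"
    and mult_linear_right:
      "x \<in> carrier H \<Longrightarrow> linear_from (carrier H) (smult H) (smult H) (mult H x)"
    and mult_assoc:
      "x \<in> carrier H \<Longrightarrow> y \<in> carrier H \<Longrightarrow> z \<in> carrier H \<Longrightarrow>
         mult H (mult H x y) z = mult H x (mult H y z)"
    and mult_unit_left: "x \<in> carrier H \<Longrightarrow> mult H (unit H) x = x"
    and mult_unit_right: "x \<in> carrier H \<Longrightarrow> mult H x (unit H) = x"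
    and comult_closed: "x \<in> carrier H \<Longrightarrow> set (comult H x) \<subseteq> carrier H \<times> carrier H"
    and comult_add:
      "x \<in> carrier H \<Longrightarrow> y \<in> carrier H \<Longrightarrow>
         tensor_eq (smult H) (carrier H) (pair_tensor (comult H (x + y)))
           (pair_tensor (comult H x @ comult H y))"
    and comult_smult:
      "x \<in> carrier H \<Longrightarrow>
         tensor_eq (smult H) (carrier H) (pair_tensor (comult H (smult H c x)))
           [[smult H c x1, x2]. (x1, x2) \<leftarrow> comult H x]"
    and comult_unit:
      "tensor_eq (smult H) (carrier H) (pair_tensor (comult H (unit H))) [[unit H, unit H]]"
    and comult_mult:
      "x \<in> carrier H \<Longrightarrow> y \<in> carrier H \<Longrightarrow>
         tensor_eq (smult H) (carrier H) (pair_tensor (comult H (mult H x y)))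
           [[mult H x1 y1, mult H x2 y2]. (x1, x2) \<leftarrow> comult H x, (y1, y2) \<leftarrow> comult H y]"
    and comult_coassoc:
      "x \<in> carrier H \<Longrightarrow>
         tensor_eq (smult H) (carrier H)
           [[y1, y2, x2]. (x1, x2) \<leftarrow> comult H x, (y1, y2) \<leftarrow> comult H x1]
           [[x1, y1, y2]. (x1, x2) \<leftarrow> comult H x, (y1, y2) \<leftarrow> comult H x2]"
    and counit_linear: "linear_from (carrier H) (smult H) (*) (counit H)"
    and counit_unit: "counit H (unit H) = 1"
    and counit_mult:
      "x \<in> carrier H \<Longrightarrow> y \<in> carrier H \<Longrightarrow> counit H (mult H x y) = counit H x * counit H y"
    and counit_left:
      "x \<in> carrier H \<Longrightarrow> (\<Sum>(x1, x2)\<leftarrow>comult H x. smult H (counit H x1) x2) = x"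
    and counit_right:
      "x \<in> carrier H \<Longrightarrow> (\<Sum>(x1, x2)\<leftarrow>comult H x. smult H (counit H x2) x1) = x"
    and antipode_closed: "x \<in> carrier H \<Longrightarrow> antipode H x \<in> carrier H"
    and antipode_linear: "linear_from (carrier H) (smult H) (smult H) (antipode H)"
    and antipode_left:
      "x \<in> carrier H \<Longrightarrow>
         (\<Sum>(x1, x2)\<leftarrow>comult H x. mult H (antipode H x1) x2) = smult H (counit H x) (unit H)"
    and antipode_right:
      "x \<in> carrier H \<Longrightarrow>
         (\<Sum>(x1, x2)\<leftarrow>comult H x. mult H x1 (antipode H x2)) = smult H (counit H x) (unit H)"

definition finite_dimensional :: "('k::field, 'a::ab_group_add) hopf \<Rightarrow> bool" where
  "finite_dimensional H \<longleftrightarrow>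
     (\<exists>B \<subseteq> carrier H. finite B \<and> module.span (smult H) B = carrier H)"

definition hopf_hom ::
    "('k::field, 'a::ab_group_add) hopf \<Rightarrow> ('k, 'b::ab_group_add) hopf \<Rightarrow> ('a \<Rightarrow> 'b) \<Rightarrow> bool" where
  "hopf_hom H Q f \<longleftrightarrow>
     hopf_algebra H \<and> hopf_algebra Q \<and>
     f ` carrier H \<subseteq> carrier Q \<and>
     linear_from (carrier H) (smult H) (smult Q) f \<and>
     (\<forall>x\<in>carrier H. \<forall>y\<in>carrier H. f (mult H x y) = mult Q (f x) (f y)) \<and>
     f (unit H) = unit Q \<and>
     (\<forall>x\<in>carrier H. tensor_eq (smult Q) (carrier Q)
        (pair_tensor (comult Q (f x))) [[f x1, f x2]. (x1, x2) \<leftarrow> comult H x]) \<and>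
     (\<forall>x\<in>carrier H. counit Q (f x) = counit H x) \<and>
     (\<forall>x\<in>carrier H. f (antipode H x) = antipode Q (f x))"

definition hopf_iso ::
    "('k::field, 'a::ab_group_add) hopf \<Rightarrow> ('k, 'b::ab_group_add) hopf \<Rightarrow> bool" where
  "hopf_iso H Q \<longleftrightarrow> (\<exists>f. hopf_hom H Q f \<and> bij_betw f (carrier H) (carrier Q))"

definition hopf_subalgebra :: "('k::field, 'a::ab_group_add) hopf \<Rightarrow> 'a set \<Rightarrow> bool" where
  "hopf_subalgebra H A \<longleftrightarrow>
     hopf_algebra H \<and> A \<subseteq> carrier H \<and> module.subspace (smult H) A \<and>
     unit H \<in> A \<and> (\<forall>x\<in>A. \<forall>y\<in>A. mult H x y \<in> A) \<and>
     (\<forall>x\<in>A. \<exists>t. set t \<subseteq> A \<times> A \<and>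
        tensor_eq (smult H) (carrier H) (pair_tensor (comult H x)) (pair_tensor t)) \<and>
     (\<forall>x\<in>A. antipode H x \<in> A)"

text \<open>
  A Hopf subalgebra \<open>A\<close> as a Hopf algebra: \<open>\<Delta>(x)\<close> has to be rewritten with both tensor factors
  in \<open>A\<close>.  The resulting element of \<open>A \<otimes> A\<close> is unique, because \<open>A \<otimes> A\<close> embeds into
  \<open>H \<otimes> H\<close> over a field.
\<close>

definition sub_hopf :: "('k::field, 'a::ab_group_add) hopf \<Rightarrow> 'a set \<Rightarrow> ('k, 'a) hopf" where
  "sub_hopf H A = H\<lparr>carrier := A,
     comult := (\<lambda>x. SOME t. set t \<subseteq> A \<times> A \<and>
        tensor_eq (smult H) (carrier H) (pair_tensor (comult H x)) (pair_tensor t))\<rparr>"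

definition normal_hopf_subalgebra :: "('k::field, 'a::ab_group_add) hopf \<Rightarrow> 'a set \<Rightarrow> bool" where
  "normal_hopf_subalgebra H A \<longleftrightarrow>
     hopf_subalgebra H A \<and>
     (\<forall>h\<in>carrier H. \<forall>a\<in>A.
        (\<Sum>(h1, h2)\<leftarrow>comult H h. mult H (mult H h1 a) (antipode H h2)) \<in> A \<and>
        (\<Sum>(h1, h2)\<leftarrow>comult H h. mult H (mult H (antipode H h1) a) h2) \<in> A)"

definition scalars :: "('k::field, 'a::ab_group_add) hopf \<Rightarrow> 'a set" where
  "scalars H = range (\<lambda>c. smult H c (unit H))"

definition augmentation :: "('k::field, 'a::ab_group_add) hopf \<Rightarrow> 'a set \<Rightarrow> 'a set" where
  "augmentation H A = {a \<in> A. counit H a = 0}"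

definition augmentation_ideal :: "('k::field, 'a::ab_group_add) hopf \<Rightarrow> 'a set \<Rightarrow> 'a set" where
  "augmentation_ideal H A =
     module.span (smult H) {mult H h a | h a. h \<in> carrier H \<and> a \<in> augmentation H A}"

text \<open>
  \<open>Q\<close> is (a copy of) the quotient Hopf algebra \<open>H/HA\<^sup>+\<close>, with projection \<open>p\<close>: two elements of
  \<open>H\<close> have the same image iff they lie in the same coset of \<open>HA\<^sup>+\<close>, so that the elements of \<open>Q\<close>
  correspond to the cosets.  Such a \<open>Q\<close> is determined up to isomorphism, and one always exists on
  the same type, on a linear complement of \<open>HA\<^sup>+\<close> in \<open>H\<close>.  Working with copies lets
  \<open>composition_series\<close> below stay within one type.
\<close>

definition is_hopf_quotient ::
    "('k::field, 'a::ab_group_add) hopf \<Rightarrow> 'a set \<Rightarrow> ('k, 'a) hopf \<Rightarrow> ('a \<Rightarrow> 'a) \<Rightarrow> bool" where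
  "is_hopf_quotient H A Q p \<longleftrightarrow>
     hopf_hom H Q p \<and> p ` carrier H = carrier Q \<and>
     (\<forall>x\<in>carrier H. \<forall>y\<in>carrier H. p x = p y \<longleftrightarrow> x - y \<in> augmentation_ideal H A)"

definition simple_hopf :: "('k::field, 'a::ab_group_add) hopf \<Rightarrow> bool" where
  "simple_hopf H \<longleftrightarrow>
     hopf_algebra H \<and>
     \<not> (\<exists>A. normal_hopf_subalgebra H A \<and> scalars H \<subset> A \<and> A \<subset> carrier H)"

inductive composition_series ::
    "('k::field, 'a::ab_group_add) hopf \<Rightarrow> ('k, 'a) hopf list \<Rightarrow> bool" where
  simple: "simple_hopf H \<Longrightarrow> composition_series H [H]"
| extension:
    "normal_hopf_subalgebra H A \<Longrightarrow> scalars H \<subset> A \<Longrightarrow> A \<subset> carrier H \<Longrightarrow>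
     is_hopf_quotient H A Q p \<Longrightarrow>
     composition_series (sub_hopf H A) As \<Longrightarrow> composition_series Q Bs \<Longrightarrow>
     composition_series H (As @ Bs)"

definition same_factors ::
    "('k::field, 'a::ab_group_add) hopf list \<Rightarrow> ('k, 'b::ab_group_add) hopf list \<Rightarrow> bool" where
  "same_factors Fs Gs \<longleftrightarrow> rel_mset hopf_iso (mset Fs) (mset Gs)"

definition hopf_length :: "('k::field, 'a::ab_group_add) hopf \<Rightarrow> nat" where
  "hopf_length H = (THE n. \<exists>Fs. composition_series H Fs \<and> length Fs = n)"

text \<open>
  The dual Hopf algebra \<open>H\<^sup>*\<close>.  Functionals on \<open>H\<close> are extended by zero
  outside the carrier.  The comultiplication is dual to the multiplication, i.e.
  for finite dimensional \<open>H\<close>, \<open>\<Delta>(f)\<close> is the unique element of \<open>H\<^sup>* \<otimes> H\<^sup>*\<close> taking the value \<open>f (x y)\<close> at \<open>x \<otimes> y\<close>.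
\<close>

definition dual_space :: "('k::field, 'a::ab_group_add) hopf \<Rightarrow> ('a \<Rightarrow> 'k) set" where
  "dual_space H =
     {f. linear_from (carrier H) (smult H) (*) f \<and> (\<forall>x. x \<notin> carrier H \<longrightarrow> f x = 0)}"

definition dual_hopf :: "('k::field, 'a::ab_group_add) hopf \<Rightarrow> ('k, 'a \<Rightarrow> 'k) hopf" where
  "dual_hopf H =
     \<lparr>carrier = dual_space H,
      smult = (\<lambda>c f x. c * f x),
      mult = (\<lambda>f g x. if x \<in> carrier H then \<Sum>(x1, x2)\<leftarrow>comult H x. f x1 * g x2 else 0),
      unit = (\<lambda>x. if x \<in> carrier H then counit H x else 0),
      comult = (\<lambda>f. SOME t. set t \<subseteq> dual_space H \<times> dual_space H \<and>
         (\<forall>x\<in>carrier H. \<forall>y\<in>carrier H. (\<Sum>(g1, g2)\<leftarrow>t. g1 x * g2 y) = f (mult H x y))),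
      counit = (\<lambda>f. f (unit H)),
      antipode = (\<lambda>f x. if x \<in> carrier H then f (antipode H x) else 0)\<rparr>"

end

(*
  Idea.  Let A be a Hopf subalgebra of a finite dimensional Hopf algebra H.  Since A is self-injective,
  there is a right A-linear projection p of H onto A, and h |-> p(h1) S(h2) vanishes on HA+.  This shows that
  A consists of all coinvariants of H over H/HA+, that HA+ and B intersect in BA+ for A contained in B, and that
  HA+ = H+ only if A = H.  These three facts replace the Nichols-Zoeller theorem in the proof of the theorem of
  Jordan and Hoelder, which settles the uniqueness of the composition factors.

  If A is normal with quotient Q, then Q* is the normal Hopf subalgebra of H* formed by the functionals that
  vanish on HA+, and, by the description of A through coinvariants, the quotient of H* by it is A*.  So dualizing
  turns a composition series of H into one of H* with the order of the factors A*, Q* reversed.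
*)
theory Submission
  imports Defs
begin

subsection \<open>Linear maps on subspaces\<close>

text \<open>A tensor is seen only through the maps that it feeds: two formal sums agree iff every
  scalar-valued multilinear map has the same total on both, and then vector-valued maps agree on
  them too. So the axioms on a comultiplication are tested as equations of Sweedler sums against
  arbitrary forms, and the lists selected by \<open>SOME\<close> in \<open>sub_hopf\<close> and
  \<open>dual_hopf\<close> matter only through the tensors that they denote.

  The recurring obstacle is strictness: a proper \<open>A\<close> must have a nontrivial quotient,
  and a strict inclusion of \<open>A\<close> in \<open>B\<close> must stay strict modulo HA+.
  Instead of counting dimensions, the proof averages an arbitrary linear projection onto
  \<open>A\<close> by a partial trace and so makes it right \<open>A\<close>-linear.

  That the dual of a simple factor is simple is reached through the double dual. Moreover the
  theorem speaks about every series of the dual, and \<open>hopf_length\<close> is a definite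
  description, so one dualized series is not enough: existence and uniqueness are proved for all
  finite dimensional Hopf algebras and then applied to the dual as well.\<close>

lemma vector_space_field: "vector_space ((*) :: 'k::field \<Rightarrow> 'k \<Rightarrow> 'k)"
  by unfold_locales (auto simp: algebra_simps)

lemma vector_space_functions: "vector_space (\<lambda>(c::'k::field) (f::'a \<Rightarrow> 'k) p. c * f p)"
  by unfold_locales (auto simp: algebra_simps fun_eq_iff)

lemma module_of_vector_space: "vector_space s \<Longrightarrow> module s"
  by (simp add: module_iff_vector_space)

lemma linear_from_add: "linear_from V s s' f \<Longrightarrow> x \<in> V \<Longrightarrow> y \<in> V \<Longrightarrow> f (x + y) = f x + f y"
  and linear_from_scale: "linear_from V s s' f \<Longrightarrow> x \<in> V \<Longrightarrow> f (s c x) = s' c (f x)"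
  by (auto simp: linear_from_def)

lemma linear_from_zero: "linear_from V s s' f \<Longrightarrow> 0 \<in> V \<Longrightarrow> f 0 = 0"
  using linear_from_add[of V s s' f 0 0] by simp

lemma linear_from_diff:
  assumes "linear_from V s s' f" "module.subspace s V" "vector_space s" "x \<in> V" "y \<in> V"
  shows "f (x - y) = f x - f y"
proof -
  interpret vector_space s by fact
  have "f (x - y) + f y = f x"
    using linear_from_add[OF assms(1) subspace_diff[OF assms(2,4,5)] assms(5)] by simp
  then show ?thesis by (simp add: algebra_simps)
qed

lemma linear_from_sum_list:
  assumes "linear_from V s s' f" "module.subspace s V" "vector_space s" "\<And>t. t \<in> set ts \<Longrightarrow> g t \<in> V"
  shows "f (\<Sum>t\<leftarrow>ts. g t) = (\<Sum>t\<leftarrow>ts. f (g t))"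
proof -
  interpret vector_space s by fact
  have "(\<Sum>t\<leftarrow>ts. g t) \<in> V \<and> f (\<Sum>t\<leftarrow>ts. g t) = (\<Sum>t\<leftarrow>ts. f (g t))"
    using assms(4)
    by (induction ts) (auto simp: linear_from_zero[OF assms(1)] linear_from_add[OF assms(1)]
        subspace_0[OF assms(2)] subspace_add[OF assms(2)])
  then show ?thesis by simp
qed

lemma linear_from_sum:
  assumes "linear_from V s s' f" "module.subspace s V" "vector_space s" "\<And>t. t \<in> I \<Longrightarrow> g t \<in> V"
  shows "f (\<Sum>t\<in>I. g t) = (\<Sum>t\<in>I. f (g t))"
proof -
  interpret vector_space s by fact
  show ?thesis
  proof (cases "finite I")
    case True
    then show ?thesis using assms(4)
    proof (induction I)
      case empty
      show ?case by (simp add: linear_from_zero[OF assms(1)] subspace_0[OF assms(2)])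
    next
      case (insert i I)
      then show ?case
        by (simp add: linear_from_add[OF assms(1)] subspace_sum[OF assms(2)])
    qed
  qed (simp add: linear_from_zero[OF assms(1)] subspace_0[OF assms(2)])
qed

lemma linear_from_linear: "Vector_Spaces.linear s s' f \<Longrightarrow> linear_from V s s' f"
  by (auto simp: linear_from_def Vector_Spaces.linear_iff)

lemma linear_from_subset: "linear_from V s s' f \<Longrightarrow> U \<subseteq> V \<Longrightarrow> linear_from U s s' f"
  unfolding linear_from_def by blast

lemma subspace_linear_image:
  assumes "linear_from V s s' f" "module.subspace s V" "vector_space s" "vector_space s'"
  shows "module.subspace s' (f ` V)"
proof -
  interpret vector_space s by fact
  interpret W: vector_space s' by fact
  show ?thesis unfolding W.subspace_def
  proof (intro conjI ballI allI; (elim imageE)?)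
    show "0 \<in> f ` V" using linear_from_zero[OF assms(1)] subspace_0[OF assms(2)] by force
    show "x + y \<in> f ` V" if "x = f x'" "x' \<in> V" "y = f y'" "y' \<in> V" for x y x' y'
      using that linear_from_add[OF assms(1), of x' y'] subspace_add[OF assms(2), of x' y'] by (metis image_eqI)
    show "s' c x \<in> f ` V" if "x = f x'" "x' \<in> V" for c x x'
      using that linear_from_scale[OF assms(1), of x' c] subspace_scale[OF assms(2), of x' c] by force
  qed
qed

lemma subspace_linear_preimage:
  assumes "linear_from V s s' f" "module.subspace s V" "vector_space s" "vector_space s'"
    "module.subspace s' W"
  shows "module.subspace s {x \<in> V. f x \<in> W}"
proof -
  interpret vector_space s by fact
  interpret W: vector_space s' by fact
  show ?thesis
    using assms(2,5) unfolding W.subspace_def subspace_def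
    by (auto simp: linear_from_zero[OF assms(1)] linear_from_add[OF assms(1)]
        linear_from_scale[OF assms(1)])
qed

text \<open>The values on a basis of \<open>V\<close> are extended in such a way that the range
  stays in the span of these values. This control of the range is what makes the extension of the
  identity a projection onto \<open>V\<close> in \<open>linear_projection\<close>.\<close>

lemma linear_from_extend:
  assumes "vector_space s" "vector_space s'" "module.subspace s V" "linear_from V s s' f"
  obtains g where "Vector_Spaces.linear s s' g" "\<And>x. x \<in> V \<Longrightarrow> g x = f x" "range g = f ` V"
proof -
  interpret vector_space_pair s s'
    using assms by (simp add: vector_space_pair_def)
  obtain B where B: "B \<subseteq> V" "vs1.independent B" "V \<subseteq> vs1.span B"
    using vs1.maximal_independent_subset by blast
  obtain g where g: "Vector_Spaces.linear s s' g" "\<forall>x\<in>B. g x = f x" "range g = vs2.span (f ` B)"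
    using linear_independent_extend_subspace[OF B(2), of f] by blast
  have span: "vs1.span B = V"
    using B assms(3) vs1.span_minimal by blast
  have eq: "g x = f x" if "x \<in> V" for x
  proof -
    have "x \<in> V \<and> g x = f x" using that[folded span]
    proof (induction rule: vs1.span_induct_alt)
      case base
      show ?case
        using linear_from_zero[OF assms(4)] linear_from_zero[OF linear_from_linear[OF g(1), of UNIV]]
          vs1.subspace_0[OF assms(3)] by simp
    next
      case (step c x y)
      then have V: "x \<in> V" "y \<in> V" "s c x \<in> V"
        using B(1) vs1.subspace_scale[OF assms(3)] by auto
      show ?case
        using step V g(1,2) vs1.subspace_add[OF assms(3)]
        by (simp add: Vector_Spaces.linear_iff linear_from_add[OF assms(4)] linear_from_scale[OF assms(4)])
    qed
    then show ?thesis by simp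
  qed
  have "range g = f ` V"
  proof
    have "vs2.span (f ` B) \<subseteq> f ` V"
      using B(1) by (intro vs2.span_minimal subspace_linear_image[OF assms(4,3,1,2)] image_mono)
    then show "range g \<subseteq> f ` V" using g(3) by simp
    show "f ` V \<subseteq> range g"
    proof (rule image_subsetI)
      fix x assume "x \<in> V"
      from eq[OF this, symmetric] show "f x \<in> range g" by simp
    qed
  qed
  then show ?thesis using that g(1) eq by blast
qed

lemma linear_projection:
  assumes "vector_space s" "module.subspace s V"
  obtains q where "Vector_Spaces.linear s s q" "range q = V" "\<And>x. x \<in> V \<Longrightarrow> q x = x"
proof -
  have "linear_from V s s (\<lambda>x. x)" by (simp add: linear_from_def)
  from linear_from_extend[OF assms(1,1,2) this] show ?thesis using that by auto
qed

text \<open>A vector outside the span can be added to a basis of the span, and the functional is the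
  coordinate at this vector. Most membership proofs below argue by contradiction through such a
  functional.\<close>

lemma linear_separation:
  fixes s :: "'k::field \<Rightarrow> 'a::ab_group_add \<Rightarrow> 'a"
  assumes "vector_space s" "x \<notin> module.span s S"
  obtains \<phi> where "Vector_Spaces.linear s (*) \<phi>" "\<And>y. y \<in> S \<Longrightarrow> \<phi> y = 0" "\<phi> x = 1"
proof -
  interpret vector_space_pair s "(*) :: 'k \<Rightarrow> 'k \<Rightarrow> 'k"
    using assms vector_space_field by (auto simp: vector_space_pair_def)
  obtain B where B: "B \<subseteq> vs1.span S" "vs1.independent B" "vs1.span S \<subseteq> vs1.span B"
    using vs1.maximal_independent_subset by blast
  have span: "vs1.span B = vs1.span S"
    using B vs1.span_minimal vs1.subspace_span by blast
  then have x: "x \<notin> vs1.span B" using assms by simp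
  obtain \<phi> where \<phi>: "Vector_Spaces.linear s (*) \<phi>" "\<forall>y\<in>insert x B. \<phi> y = (if y = x then 1 else 0)"
    using linear_independent_extend[OF vs1.independent_insertI[OF x B(2)],
        of "\<lambda>y. if y = x then 1 else 0"] by blast
  interpret \<phi>: Vector_Spaces.linear s "(*)" \<phi> by fact
  have "\<phi> y = 0" if "y \<in> S" for y
  proof -
    have "y \<in> vs1.span B" using that span vs1.span_base by blast
    then show ?thesis
    proof (induction rule: vs1.span_induct_alt)
      case base show ?case by (rule \<phi>.zero)
    next
      case (step c b y)
      then have "b \<noteq> x" using x vs1.span_base by blast
      then show ?case using step \<phi>(2) by (simp add: \<phi>.add \<phi>.scale)
    qed
  qed
  then show ?thesis using that \<phi> by auto
qed

lemma linear_separation_subspace: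
  fixes s :: "'k::field \<Rightarrow> 'a::ab_group_add \<Rightarrow> 'a"
  assumes "vector_space s" "module.subspace s U" "x \<notin> U"
  obtains \<phi> where "Vector_Spaces.linear s (*) \<phi>" "\<And>y. y \<in> U \<Longrightarrow> \<phi> y = 0" "\<phi> x = 1"
  using linear_separation[OF assms(1), of x U] assms
  by (metis module.span_subspace module_of_vector_space order_refl module.span_superset)

subsection \<open>Multilinear maps\<close>

definition bilinear_from ::
    "'a set \<Rightarrow> ('k \<Rightarrow> 'a::ab_group_add \<Rightarrow> 'a) \<Rightarrow> ('k \<Rightarrow> 'b::ab_group_add \<Rightarrow> 'b) \<Rightarrow>
     ('a \<Rightarrow> 'a \<Rightarrow> 'b) \<Rightarrow> bool" where
  "bilinear_from V s s' \<beta> \<longleftrightarrow>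
     (\<forall>y\<in>V. linear_from V s s' (\<lambda>x. \<beta> x y)) \<and> (\<forall>x\<in>V. linear_from V s s' (\<beta> x))"

definition trilinear_from ::
    "'a set \<Rightarrow> ('k \<Rightarrow> 'a::ab_group_add \<Rightarrow> 'a) \<Rightarrow> ('k \<Rightarrow> 'b::ab_group_add \<Rightarrow> 'b) \<Rightarrow>
     ('a \<Rightarrow> 'a \<Rightarrow> 'a \<Rightarrow> 'b) \<Rightarrow> bool" where
  "trilinear_from V s s' \<tau> \<longleftrightarrow>
     (\<forall>x\<in>V. \<forall>y\<in>V. linear_from V s s' (\<lambda>z. \<tau> x y z)) \<and>
     (\<forall>x\<in>V. \<forall>z\<in>V. linear_from V s s' (\<lambda>y. \<tau> x y z)) \<and>
     (\<forall>y\<in>V. \<forall>z\<in>V. linear_from V s s' (\<lambda>x. \<tau> x y z))"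

text \<open>Lists of all lengths are treated at once, as in the direct sum of the tensor powers on
  which \<open>tensor_eq\<close> is defined. Bilinear and trilinear maps enter by being set to 0 on
  lists of other lengths.\<close>

definition multilinear_on ::
    "'a set \<Rightarrow> ('k \<Rightarrow> 'a::ab_group_add \<Rightarrow> 'a) \<Rightarrow> ('k \<Rightarrow> 'b::ab_group_add \<Rightarrow> 'b) \<Rightarrow>
     ('a list \<Rightarrow> 'b) \<Rightarrow> bool" where
  "multilinear_on V s s' \<phi> \<longleftrightarrow>
     (\<forall>xs ys. set xs \<subseteq> V \<longrightarrow> set ys \<subseteq> V \<longrightarrow> linear_from V s s' (\<lambda>x. \<phi> (xs @ x # ys)))"

lemma bilinear_fromI:
  "(\<And>y. y \<in> V \<Longrightarrow> linear_from V s s' (\<lambda>x. \<beta> x y)) \<Longrightarrow>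
   (\<And>x. x \<in> V \<Longrightarrow> linear_from V s s' (\<beta> x)) \<Longrightarrow> bilinear_from V s s' \<beta>"
  by (simp add: bilinear_from_def)

lemma bilinear_fromD:
  "bilinear_from V s s' \<beta> \<Longrightarrow> y \<in> V \<Longrightarrow> linear_from V s s' (\<lambda>x. \<beta> x y)"
  "bilinear_from V s s' \<beta> \<Longrightarrow> x \<in> V \<Longrightarrow> linear_from V s s' (\<beta> x)"
  by (simp_all add: bilinear_from_def)

lemma trilinear_fromI:
  "(\<And>x y. x \<in> V \<Longrightarrow> y \<in> V \<Longrightarrow> linear_from V s s' (\<lambda>z. \<tau> x y z)) \<Longrightarrow>
   (\<And>x z. x \<in> V \<Longrightarrow> z \<in> V \<Longrightarrow> linear_from V s s' (\<lambda>y. \<tau> x y z)) \<Longrightarrow>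
   (\<And>y z. y \<in> V \<Longrightarrow> z \<in> V \<Longrightarrow> linear_from V s s' (\<lambda>x. \<tau> x y z)) \<Longrightarrow> trilinear_from V s s' \<tau>"
  by (simp add: trilinear_from_def)

lemma formal_sum_eq_sum_list:
  "formal_sum ts = (\<Sum>t\<leftarrow>ts. (\<lambda>p. of_bool (p = t)))"
  by (induction ts) (simp_all add: formal_sum_def fun_eq_iff)

text \<open>The universal property of the tensor powers. Point masses on lists are linearly
  independent, so \<phi> determines a linear map on them; multilinearity says that this map kills
  the relations.\<close>

lemma tensor_eq_imp_sum_eq:
  fixes s :: "'k::field \<Rightarrow> 'a::ab_group_add \<Rightarrow> 'a" and s' :: "'k \<Rightarrow> 'b::ab_group_add \<Rightarrow> 'b"
  assumes eq: "tensor_eq s V ts us" and \<phi>: "multilinear_on V s s' \<phi>" and s': "vector_space s'"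
  shows "(\<Sum>t\<leftarrow>ts. \<phi> t) = (\<Sum>u\<leftarrow>us. \<phi> u)"
proof -
  interpret vector_space_pair "\<lambda>(c::'k) (f::'a list \<Rightarrow> 'k) p. c * f p" s'
    using s' vector_space_functions by (auto simp: vector_space_pair_def)
  define \<delta> :: "'a list \<Rightarrow> 'a list \<Rightarrow> 'k" where "\<delta> = (\<lambda>t p. of_bool (p = t))"
  have inj: "inj \<delta>" by (auto simp: inj_def \<delta>_def fun_eq_iff)
  have ind: "vs1.independent (range \<delta>)"
    unfolding vs1.independent_explicit_finite_subsets
  proof (intro allI impI ballI)
    fix A u v assume A: "A \<subseteq> range \<delta>" "finite A"
      and zero: "(\<Sum>v\<in>A. (\<lambda>p. u v * v p)) = 0" and v: "v \<in> A"
    obtain t where t: "v = \<delta> t" using A v by blast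
    have "0 = (\<Sum>w\<in>A. (\<lambda>p. u w * w p)) t" using zero by simp
    also have "\<dots> = (\<Sum>w\<in>A. u w * w t)" by (induction A rule: infinite_finite_induct) auto
    also have "\<dots> = (\<Sum>w\<in>A. if w = v then u v else 0)"
    proof (rule sum.cong)
      fix w assume "w \<in> A"
      then obtain t' where "w = \<delta> t'" using A by blast
      then show "u w * w t = (if w = v then u v else 0)"
        using t inj_eq[OF inj, of t' t] by (cases "t' = t") (simp_all add: \<delta>_def)
    qed simp
    finally show "u v = 0" using A v by simp
  qed
  \<comment> \<open>The point masses do not span all functions on lists in general, so
    \<open>L\<close> is some linear extension; only its values on point masses are used.\<close>
  obtain L where L: "Vector_Spaces.linear (\<lambda>(c::'k) (f::'a list \<Rightarrow> 'k) p. c * f p) s' L"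
    and L\<delta>: "\<forall>x\<in>range \<delta>. L x = \<phi> (inv \<delta> x)"
    using linear_independent_extend[OF ind, of "\<lambda>x. \<phi> (inv \<delta> x)"] by blast
  interpret L: Vector_Spaces.linear "\<lambda>(c::'k) (f::'a list \<Rightarrow> 'k) p. c * f p" s' L by fact
  have L_delta: "L (\<delta> t) = \<phi> t" for t using L\<delta> inj by simp
  have L_sum_list: "L (\<Sum>t\<leftarrow>ts. f t) = (\<Sum>t\<leftarrow>ts. L (f t))" for f :: "'a list \<Rightarrow> 'a list \<Rightarrow> 'k" and ts
    by (rule linear_from_sum_list[OF linear_from_linear[OF L, of UNIV] _ vector_space_functions])
      (simp_all add: module.subspace_UNIV[OF module_of_vector_space[OF vector_space_functions]])
  have L_sum: "L (formal_sum ts) = (\<Sum>t\<leftarrow>ts. \<phi> t)" for ts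
  proof -
    have "formal_sum ts = (\<Sum>t\<leftarrow>ts. \<delta> t)" by (simp add: formal_sum_eq_sum_list \<delta>_def)
    then show ?thesis by (simp add: L_sum_list L_delta)
  qed
  have rel: "L r = 0" if "r \<in> multilinear_relations s V" for r
    using that unfolding multilinear_relations_def
  proof (elim UnE CollectE exE conjE)
    fix xs a b ys
    assume r: "r = (\<lambda>p. of_bool (p = xs @ (a + b) # ys) - of_bool (p = xs @ a # ys)
        - of_bool (p = xs @ b # ys))" "set xs \<subseteq> V" "a \<in> V" "b \<in> V" "set ys \<subseteq> V"
    have "r = \<delta> (xs @ (a + b) # ys) - \<delta> (xs @ a # ys) - \<delta> (xs @ b # ys)"
      by (simp add: r(1) \<delta>_def fun_eq_iff)
    moreover have "\<phi> (xs @ (a + b) # ys) = \<phi> (xs @ a # ys) + \<phi> (xs @ b # ys)"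
      using \<phi> r linear_from_add[of V s s' "\<lambda>x. \<phi> (xs @ x # ys)"] unfolding multilinear_on_def by blast
    ultimately show ?thesis by (simp add: L.diff L_delta)
  next
    fix xs c a ys
    assume r: "r = (\<lambda>p. of_bool (p = xs @ s c a # ys) - c * of_bool (p = xs @ a # ys))"
        "set xs \<subseteq> V" "a \<in> V" "set ys \<subseteq> V"
    have "r = \<delta> (xs @ s c a # ys) - (\<lambda>p. c * \<delta> (xs @ a # ys) p)"
      by (simp add: r(1) \<delta>_def fun_eq_iff)
    moreover have "\<phi> (xs @ s c a # ys) = s' c (\<phi> (xs @ a # ys))"
      using \<phi> r linear_from_scale[of V s s' "\<lambda>x. \<phi> (xs @ x # ys)"] unfolding multilinear_on_def by blast
    ultimately show ?thesis by (simp add: L.diff L.scale L_delta)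
  qed
  have "L (formal_sum ts - formal_sum us) = 0"
  proof -
    have "formal_sum ts - formal_sum us \<in> vs1.span (multilinear_relations s V)"
      using eq by (simp add: tensor_eq_def fun_diff_def)
    then show ?thesis
    proof (induction rule: vs1.span_induct_alt)
      case base
      show ?case by (rule L.zero)
    next
      case (step c x y)
      then show ?case unfolding L.add L.scale by (simp add: rel)
    qed
  qed
  then show ?thesis by (simp add: L.diff L_sum)
qed

text \<open>Scalar-valued maps suffice: a difference outside the span of the relations is separated
  from it by a functional, and the composition of this functional with the point masses is
  multilinear because it kills the relations.\<close>

lemma tensor_eqI:
  fixes s :: "'k::field \<Rightarrow> 'a::ab_group_add \<Rightarrow> 'a"
  assumes "\<And>\<phi> :: 'a list \<Rightarrow> 'k. multilinear_on V s (*) \<phi> \<Longrightarrow> (\<Sum>t\<leftarrow>ts. \<phi> t) = (\<Sum>u\<leftarrow>us. \<phi> u)"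
  shows "tensor_eq s V ts us"
proof (rule ccontr)
  interpret F: vector_space "\<lambda>(c::'k) (f::'a list \<Rightarrow> 'k) p. c * f p" by (rule vector_space_functions)
  assume "\<not> tensor_eq s V ts us"
  then obtain L where L: "Vector_Spaces.linear (\<lambda>(c::'k) (f::'a list \<Rightarrow> 'k) p. c * f p) (*) L"
    and rel: "\<And>r. r \<in> multilinear_relations s V \<Longrightarrow> L r = 0"
    and one: "L (\<lambda>p. formal_sum ts p - formal_sum us p) = 1"
    unfolding tensor_eq_def using linear_separation[OF vector_space_functions] by metis
  interpret L: Vector_Spaces.linear "\<lambda>(c::'k) (f::'a list \<Rightarrow> 'k) p. c * f p" "(*)" L by fact
  define \<delta> :: "'a list \<Rightarrow> 'a list \<Rightarrow> 'k" where "\<delta> = (\<lambda>t p. of_bool (p = t))"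
  have L_sum_list: "L (\<Sum>t\<leftarrow>ts. f t) = (\<Sum>t\<leftarrow>ts. L (f t))" for f :: "'a list \<Rightarrow> 'a list \<Rightarrow> 'k" and ts
    by (rule linear_from_sum_list[OF linear_from_linear[OF L, of UNIV] _ vector_space_functions])
      (simp_all add: module.subspace_UNIV[OF module_of_vector_space[OF vector_space_functions]])
  have L_sum: "L (formal_sum ts) = (\<Sum>t\<leftarrow>ts. L (\<delta> t))" for ts
  proof -
    have "formal_sum ts = (\<Sum>t\<leftarrow>ts. \<delta> t)" by (simp add: formal_sum_eq_sum_list \<delta>_def)
    then show ?thesis by (simp add: L_sum_list)
  qed
  have "multilinear_on V s (*) (\<lambda>t. L (\<delta> t))"
    unfolding multilinear_on_def linear_from_def
  proof (intro allI impI conjI ballI)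
    fix xs ys a b assume V: "set xs \<subseteq> V" "set ys \<subseteq> V" "a \<in> V" "b \<in> V"
    have "L (\<delta> (xs @ (a + b) # ys) - \<delta> (xs @ a # ys) - \<delta> (xs @ b # ys)) = 0"
    proof (rule rel)
      show "\<delta> (xs @ (a + b) # ys) - \<delta> (xs @ a # ys) - \<delta> (xs @ b # ys) \<in> multilinear_relations s V"
        unfolding multilinear_relations_def \<delta>_def fun_diff_def using V by blast
    qed
    then show "L (\<delta> (xs @ (a + b) # ys)) = L (\<delta> (xs @ a # ys)) + L (\<delta> (xs @ b # ys))"
      by (simp add: L.diff L.add algebra_simps)
  next
    fix xs ys c a assume V: "set xs \<subseteq> V" "set ys \<subseteq> V" "a \<in> V"
    have "L (\<delta> (xs @ s c a # ys) - (\<lambda>p. c * \<delta> (xs @ a # ys) p)) = 0"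
    proof (rule rel)
      show "\<delta> (xs @ s c a # ys) - (\<lambda>p. c * \<delta> (xs @ a # ys) p) \<in> multilinear_relations s V"
        unfolding multilinear_relations_def \<delta>_def fun_diff_def using V by blast
    qed
    then show "L (\<delta> (xs @ s c a # ys)) = c * L (\<delta> (xs @ a # ys))"
      by (simp add: L.diff L.scale)
  qed
  from assms[OF this] have "L (formal_sum ts - formal_sum us) = 0"
    by (simp add: L.diff L_sum)
  then show False using one by (simp add: fun_diff_def)
qed

text \<open>The length of \<open>xs @ x # ys\<close> does not depend on \<open>x\<close>, so cutting
  off by 0 at other lengths is compatible with linearity in \<open>x\<close>.\<close>

lemma multilinear_on_pairs:
  assumes "bilinear_from V s s' \<beta>" "vector_space s'"
  shows "multilinear_on V s s' (\<lambda>t. case t of [x, y] \<Rightarrow> \<beta> x y | _ \<Rightarrow> 0)"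
proof -
  interpret W: vector_space s' by fact
  show ?thesis
    unfolding multilinear_on_def
  proof (intro allI impI)
    fix xs ys :: "'a list" assume V: "set xs \<subseteq> V" "set ys \<subseteq> V"
    consider z where "xs = [z]" "ys = []" | z where "xs = []" "ys = [z]"
      | "length xs + length ys \<noteq> 1"
      by (metis One_nat_def add_is_1 length_0_conv length_Suc_conv)
    then show "linear_from V s s' (\<lambda>x. case xs @ x # ys of [x, y] \<Rightarrow> \<beta> x y | _ \<Rightarrow> 0)"
    proof cases
      case 3
      then have "(case xs @ x # ys of [x, y] \<Rightarrow> \<beta> x y | _ \<Rightarrow> 0) = 0" for x
        by (auto split: list.split simp: append_eq_Cons_conv)
      then show ?thesis by (simp add: linear_from_def)
    qed (use V assms(1) in \<open>auto simp: bilinear_from_def\<close>)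
  qed
qed

lemma multilinear_on_triples:
  assumes "trilinear_from V s s' \<tau>" "vector_space s'"
  shows "multilinear_on V s s' (\<lambda>t. case t of [x, y, z] \<Rightarrow> \<tau> x y z | _ \<Rightarrow> 0)"
proof -
  interpret W: vector_space s' by fact
  show ?thesis
    unfolding multilinear_on_def
  proof (intro allI impI)
    fix xs ys :: "'a list" assume V: "set xs \<subseteq> V" "set ys \<subseteq> V"
    consider u v where "xs = [u, v]" "ys = []" | u v where "xs = [u]" "ys = [v]"
      | u v where "xs = []" "ys = [u, v]" | "length xs + length ys \<noteq> 2"
    proof -
      have "length xs + length ys = 2 \<Longrightarrow> (\<exists>u v. xs = [u, v] \<and> ys = []) \<or>
         (\<exists>u v. xs = [u] \<and> ys = [v]) \<or> (\<exists>u v. xs = [] \<and> ys = [u, v])"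
        by (cases xs; cases ys; cases "tl xs"; cases "tl ys") auto
      then show ?thesis using that by blast
    qed
    then show "linear_from V s s' (\<lambda>x. case xs @ x # ys of [x, y, z] \<Rightarrow> \<tau> x y z | _ \<Rightarrow> 0)"
    proof cases
      case 4
      then have "(case xs @ x # ys of [x, y, z] \<Rightarrow> \<tau> x y z | _ \<Rightarrow> 0) = 0" for x
        by (auto split: list.split simp: append_eq_Cons_conv)
      then show ?thesis by (simp add: linear_from_def)
    qed (use V assms(1) in \<open>auto simp: trilinear_from_def\<close>)
  qed
qed

lemma multilinear_on_imp_bilinear_from:
  assumes "multilinear_on V s s' \<phi>"
  shows "bilinear_from V s s' (\<lambda>x y. \<phi> [x, y])"
  unfolding bilinear_from_def
proof (intro conjI ballI)
  fix x assume V: "x \<in> V"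
  show "linear_from V s s' (\<lambda>y. \<phi> [x, y])" "linear_from V s s' (\<lambda>y. \<phi> [y, x])"
    using assms[unfolded multilinear_on_def, rule_format, of "[x]" "[]"]
      assms[unfolded multilinear_on_def, rule_format, of "[]" "[x]"] V by simp_all
qed

lemma multilinear_on_imp_trilinear_from:
  assumes "multilinear_on V s s' \<phi>"
  shows "trilinear_from V s s' (\<lambda>x y z. \<phi> [x, y, z])"
  unfolding trilinear_from_def
proof (intro conjI ballI)
  fix x y assume V: "x \<in> V" "y \<in> V"
  show "linear_from V s s' (\<lambda>z. \<phi> [x, y, z])" "linear_from V s s' (\<lambda>z. \<phi> [x, z, y])"
    "linear_from V s s' (\<lambda>z. \<phi> [z, x, y])"
    using assms[unfolded multilinear_on_def, rule_format, of "[x, y]" "[]"]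
      assms[unfolded multilinear_on_def, rule_format, of "[x]" "[y]"]
      assms[unfolded multilinear_on_def, rule_format, of "[]" "[x, y]"] V by simp_all
qed

lemma tensor_eq_pair_iff:
  fixes s :: "'k::field \<Rightarrow> 'a::ab_group_add \<Rightarrow> 'a"
  shows "tensor_eq s V (pair_tensor t) (pair_tensor u) \<longleftrightarrow>
    (\<forall>\<beta> :: 'a \<Rightarrow> 'a \<Rightarrow> 'k. bilinear_from V s (*) \<beta> \<longrightarrow>
       (\<Sum>(x, y)\<leftarrow>t. \<beta> x y) = (\<Sum>(x, y)\<leftarrow>u. \<beta> x y))"
proof
  assume eq: "tensor_eq s V (pair_tensor t) (pair_tensor u)"
  show "\<forall>\<beta> :: 'a \<Rightarrow> 'a \<Rightarrow> 'k. bilinear_from V s (*) \<beta> \<longrightarrow>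
       (\<Sum>(x, y)\<leftarrow>t. \<beta> x y) = (\<Sum>(x, y)\<leftarrow>u. \<beta> x y)"
  proof (intro allI impI)
    fix \<beta> :: "'a \<Rightarrow> 'a \<Rightarrow> 'k" assume "bilinear_from V s (*) \<beta>"
    from tensor_eq_imp_sum_eq[OF eq multilinear_on_pairs[OF this vector_space_field] vector_space_field]
    show "(\<Sum>(x, y)\<leftarrow>t. \<beta> x y) = (\<Sum>(x, y)\<leftarrow>u. \<beta> x y)"
      by (simp add: comp_def case_prod_unfold)
  qed
next
  assume eq: "\<forall>\<beta> :: 'a \<Rightarrow> 'a \<Rightarrow> 'k. bilinear_from V s (*) \<beta> \<longrightarrow>
       (\<Sum>(x, y)\<leftarrow>t. \<beta> x y) = (\<Sum>(x, y)\<leftarrow>u. \<beta> x y)"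
  show "tensor_eq s V (pair_tensor t) (pair_tensor u)"
  proof (rule tensor_eqI)
    fix \<phi> :: "'a list \<Rightarrow> 'k" assume "multilinear_on V s (*) \<phi>"
    from eq[rule_format, OF multilinear_on_imp_bilinear_from[OF this]]
    show "(\<Sum>t\<leftarrow>pair_tensor t. \<phi> t) = (\<Sum>u\<leftarrow>pair_tensor u. \<phi> u)"
      by (simp add: comp_def case_prod_unfold)
  qed
qed

subsection \<open>Sweedler sums\<close>

text \<open>The sum of \<beta>(x1, x2) in Sweedler notation. In general it depends on the chosen
  list \<open>comult H x\<close>; for bilinear \<beta> it depends only on the tensor. Leaving
  \<beta> arbitrary allows sums to be nested and exchanged without side conditions.\<close>

definition sweedler ::
    "('k, 'a) hopf \<Rightarrow> 'a \<Rightarrow> ('a \<Rightarrow> 'a \<Rightarrow> 'b::comm_monoid_add) \<Rightarrow> 'b" where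
  "sweedler H x \<beta> = (\<Sum>(x1, x2)\<leftarrow>comult H x. \<beta> x1 x2)"

lemma sum_list_exchange:
  fixes f :: "'a \<Rightarrow> 'b \<Rightarrow> 'c::comm_monoid_add"
  shows "(\<Sum>x\<leftarrow>xs. \<Sum>y\<leftarrow>ys. f x y) = (\<Sum>y\<leftarrow>ys. \<Sum>x\<leftarrow>xs. f x y)"
  by (induction xs) (simp_all add: sum_list_addf)

lemma sum_list_concat_map:
  "sum_list (map f (concat (map g xs))) = (\<Sum>x\<leftarrow>xs. sum_list (map f (g x)))"
  by (induction xs) auto

lemma sweedler_exchange:
  "sweedler H x (\<lambda>a b. sweedler K y (\<lambda>c d. \<beta> a b c d)) =
     sweedler K y (\<lambda>c d. sweedler H x (\<lambda>a b. \<beta> a b c d))"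
  unfolding sweedler_def case_prod_unfold by (rule sum_list_exchange)

lemma sum_list_sum_exchange: "(\<Sum>t\<leftarrow>ts. \<Sum>i\<in>I. f i t) = (\<Sum>i\<in>I. \<Sum>t\<leftarrow>ts. f i t)"
  by (induction ts) (simp_all add: sum.distrib)

lemma sweedler_sum: "sweedler H x (\<lambda>a b. \<Sum>i\<in>I. \<beta> i a b) = (\<Sum>i\<in>I. sweedler H x (\<beta> i))"
  unfolding sweedler_def case_prod_unfold by (rule sum_list_sum_exchange)

lemma sweedler_add:
  "sweedler H x (\<lambda>a b. \<beta> a b + \<gamma> a b) = sweedler H x \<beta> + sweedler H x \<gamma>"
  unfolding sweedler_def case_prod_unfold by (rule sum_list_addf)

lemma sweedler_zero [simp]: "sweedler H x (\<lambda>a b. 0) = 0"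
  by (simp add: sweedler_def case_prod_unfold)

lemma sweedler_scale:
  assumes "vector_space s"
  shows "sweedler H x (\<lambda>a b. s c (\<beta> a b)) = s c (sweedler H x \<beta>)"
proof -
  interpret vector_space s by fact
  have "(\<Sum>(a, b)\<leftarrow>t. s c (\<beta> a b)) = s c (\<Sum>(a, b)\<leftarrow>t. \<beta> a b)" for t
    by (induction t) (auto simp: scale_right_distrib)
  then show ?thesis by (simp add: sweedler_def)
qed

lemma sweedler_scale_right:
  assumes "vector_space s"
  shows "sweedler H x (\<lambda>a b. s (\<phi> a b) v) = s (sweedler H x \<phi>) v"
proof -
  interpret vector_space s by fact
  have "(\<Sum>(a, b)\<leftarrow>t. s (\<phi> a b) v) = s (\<Sum>(a, b)\<leftarrow>t. \<phi> a b) v" for t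
    by (induction t) (auto simp: scale_left_distrib)
  then show ?thesis by (simp add: sweedler_def)
qed

lemmas sweedler_mult_const =
  sweedler_scale[OF vector_space_field] sweedler_scale_right[OF vector_space_field]

section \<open>A calculus for the linearity of nested expressions\<close>

named_theorems lin

lemmas [lin] = vector_space_field bilinear_fromI trilinear_fromI

lemma linear_from_id [lin]: "linear_from V s s (\<lambda>x. x)"
  by (simp add: linear_from_def)

lemma linear_from_comp:
  "linear_from W s1 s' g \<Longrightarrow> linear_from V s s1 f \<Longrightarrow> (\<And>x. x \<in> V \<Longrightarrow> f x \<in> W) \<Longrightarrow>
     linear_from V s s' (\<lambda>x. g (f x))"
  by (simp add: linear_from_def)

lemma bilinear_from_comp_left:
  "bilinear_from W s1 s' \<beta> \<Longrightarrow> linear_from V s s1 f \<Longrightarrow> (\<And>x. x \<in> V \<Longrightarrow> f x \<in> W) \<Longrightarrow> y \<in> W \<Longrightarrow>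
     linear_from V s s' (\<lambda>x. \<beta> (f x) y)"
  by (simp add: linear_from_def bilinear_from_def)

lemma bilinear_from_comp_right:
  "bilinear_from W s1 s' \<beta> \<Longrightarrow> linear_from V s s1 f \<Longrightarrow> (\<And>x. x \<in> V \<Longrightarrow> f x \<in> W) \<Longrightarrow> y \<in> W \<Longrightarrow>
     linear_from V s s' (\<lambda>x. \<beta> y (f x))"
  by (simp add: linear_from_def bilinear_from_def)

lemma trilinear_from_comp:
  "trilinear_from W s1 s' \<tau> \<Longrightarrow> linear_from V s s1 f \<Longrightarrow> (\<And>x. x \<in> V \<Longrightarrow> f x \<in> W) \<Longrightarrow> y \<in> W \<Longrightarrow>
     z \<in> W \<Longrightarrow> linear_from V s s' (\<lambda>x. \<tau> (f x) y z)"
  "trilinear_from W s1 s' \<tau> \<Longrightarrow> linear_from V s s1 f \<Longrightarrow> (\<And>x. x \<in> V \<Longrightarrow> f x \<in> W) \<Longrightarrow> y \<in> W \<Longrightarrow>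
     z \<in> W \<Longrightarrow> linear_from V s s' (\<lambda>x. \<tau> y (f x) z)"
  "trilinear_from W s1 s' \<tau> \<Longrightarrow> linear_from V s s1 f \<Longrightarrow> (\<And>x. x \<in> V \<Longrightarrow> f x \<in> W) \<Longrightarrow> y \<in> W \<Longrightarrow>
     z \<in> W \<Longrightarrow> linear_from V s s' (\<lambda>x. \<tau> y z (f x))"
  by (simp_all add: linear_from_def trilinear_from_def)

lemma linear_from_scale_const [lin]:
  assumes "vector_space s'" "linear_from V s s' f"
  shows "linear_from V s s' (\<lambda>x. s' c (f x))"
proof -
  interpret vector_space s' by fact
  show ?thesis using assms(2) by (simp add: linear_from_def scale_right_distrib mult.commute)
qed

lemma linear_from_scale_vector [lin]:
  assumes "vector_space s'" "linear_from V s (*) \<phi>"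
  shows "linear_from V s s' (\<lambda>x. s' (\<phi> x) v)"
proof -
  interpret vector_space s' by fact
  show ?thesis using assms(2) by (simp add: linear_from_def scale_left_distrib)
qed

lemma linear_from_plus [lin]:
  assumes "vector_space s'" "linear_from V s s' f" "linear_from V s s' g"
  shows "linear_from V s s' (\<lambda>x. f x + g x)"
proof -
  interpret vector_space s' by fact
  show ?thesis using assms(2,3) by (simp add: linear_from_def scale_right_distrib)
qed

lemma linear_from_minus [lin]:
  assumes "vector_space s'" "linear_from V s s' f" "linear_from V s s' g"
  shows "linear_from V s s' (\<lambda>x. f x - g x)"
proof -
  interpret vector_space s' by fact
  show ?thesis using assms(2,3) by (simp add: linear_from_def scale_right_diff_distrib)
qed

lemma linear_from_sum_const [lin]:
  assumes "vector_space s'" "\<And>i. i \<in> I \<Longrightarrow> linear_from V s s' (\<lambda>x. f x i)"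
  shows "linear_from V s s' (\<lambda>x. \<Sum>i\<in>I. f x i)"
proof -
  interpret vector_space s' by fact
  show ?thesis using assms(2) by (simp add: linear_from_def scale_sum_right sum.distrib)
qed

lemma linear_from_sum_list_const [lin]:
  assumes "vector_space s'" "\<And>t. t \<in> set ts \<Longrightarrow> linear_from V s s' (\<lambda>x. f x t)"
  shows "linear_from V s s' (\<lambda>x. \<Sum>t\<leftarrow>ts. f x t)"
proof -
  interpret vector_space s' by fact
  show ?thesis using assms(2)
    by (induction ts) (simp_all add: linear_from_def scale_right_distrib algebra_simps)
qed

section \<open>Sweedler calculus inside a Hopf algebra\<close>

context hopf_algebra
begin

abbreviation hprod (infixl "\<odot>" 70) where "x \<odot> y \<equiv> mult H x y"
abbreviation hunit ("\<one>") where "\<one> \<equiv> unit H"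
abbreviation hcounit ("\<epsilon>") where "\<epsilon> \<equiv> counit H"
abbreviation hantipode ("\<S>") where "\<S> \<equiv> antipode H"
abbreviation sw where "sw \<equiv> sweedler H"

lemmas [simp] = mult_closed unit_closed antipode_closed
lemmas [lin] = vector_space_axioms

lemma carrier_add [simp]: "x \<in> carrier H \<Longrightarrow> y \<in> carrier H \<Longrightarrow> x + y \<in> carrier H"
  and carrier_diff [simp]: "x \<in> carrier H \<Longrightarrow> y \<in> carrier H \<Longrightarrow> x - y \<in> carrier H"
  and carrier_smult [simp]: "x \<in> carrier H \<Longrightarrow> smult H c x \<in> carrier H"
  and carrier_zero [simp]: "0 \<in> carrier H"
  using carrier_subspace by (simp_all add: subspace_add subspace_diff subspace_scale subspace_0)

lemma carrier_sum [simp]: "(\<And>i. i \<in> I \<Longrightarrow> f i \<in> carrier H) \<Longrightarrow> sum f I \<in> carrier H"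
  using carrier_subspace by (simp add: subspace_sum)

lemma comult_mem:
  assumes "x \<in> carrier H" "(a, b) \<in> set (comult H x)"
  shows "a \<in> carrier H" "b \<in> carrier H"
  using comult_closed[OF assms(1)] assms(2) by auto

lemma sw_cong:
  assumes "x \<in> carrier H" "\<And>a b. a \<in> carrier H \<Longrightarrow> b \<in> carrier H \<Longrightarrow> \<beta> a b = \<gamma> a b"
  shows "sw x \<beta> = sw x \<gamma>"
  unfolding sweedler_def
  by (rule arg_cong[where f = sum_list], rule map_cong)
    (use assms(2) comult_mem[OF assms(1)] in \<open>auto simp: case_prod_unfold\<close>)

lemma sw_in_subspace:
  assumes "x \<in> carrier H" "vector_space s" "module.subspace s W"
    and "\<And>a b. a \<in> carrier H \<Longrightarrow> b \<in> carrier H \<Longrightarrow> \<beta> a b \<in> W"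
  shows "sw x \<beta> \<in> W"
proof -
  interpret W: vector_space s by fact
  have "set t \<subseteq> carrier H \<times> carrier H \<Longrightarrow> (\<Sum>(a, b)\<leftarrow>t. \<beta> a b) \<in> W" for t
    by (induction t) (auto simp: W.subspace_0[OF assms(3)] assms(4) W.subspace_add[OF assms(3)])
  then show ?thesis using comult_closed[OF assms(1)] by (simp add: sweedler_def)
qed

lemma sw_closed [simp]:
  "x \<in> carrier H \<Longrightarrow> (\<And>a b. a \<in> carrier H \<Longrightarrow> b \<in> carrier H \<Longrightarrow> \<beta> a b \<in> carrier H) \<Longrightarrow>
     sw x \<beta> \<in> carrier H"
  by (rule sw_in_subspace[OF _ vector_space_axioms carrier_subspace])

lemma linear_sw:
  assumes "linear_from V s s' f" "vector_space s" "module.subspace s V" "x \<in> carrier H"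
    and "\<And>a b. a \<in> carrier H \<Longrightarrow> b \<in> carrier H \<Longrightarrow> \<beta> a b \<in> V"
  shows "f (sw x \<beta>) = sw x (\<lambda>a b. f (\<beta> a b))"
proof -
  have "f (sw x \<beta>) = (\<Sum>t\<leftarrow>comult H x. f (case t of (a, b) \<Rightarrow> \<beta> a b))"
    unfolding sweedler_def
    by (rule linear_from_sum_list[OF assms(1,3,2)]) (use assms(5) comult_mem[OF assms(4)] in auto)
  then show ?thesis by (simp add: sweedler_def case_prod_unfold)
qed

lemma linear_sw_carrier:
  assumes "linear_from (carrier H) (smult H) s' f" "x \<in> carrier H"
    and "\<And>a b. a \<in> carrier H \<Longrightarrow> b \<in> carrier H \<Longrightarrow> \<beta> a b \<in> carrier H"
  shows "f (sw x \<beta>) = sw x (\<lambda>a b. f (\<beta> a b))"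
  by (rule linear_sw[OF assms(1) vector_space_axioms carrier_subspace assms(2,3)])

lemma mult_sw_right:
  "x \<in> carrier H \<Longrightarrow> y \<in> carrier H \<Longrightarrow> (\<And>a b. a \<in> carrier H \<Longrightarrow> b \<in> carrier H \<Longrightarrow> \<beta> a b \<in> carrier H) \<Longrightarrow>
     y \<odot> sw x \<beta> = sw x (\<lambda>a b. y \<odot> \<beta> a b)"
  by (rule linear_sw_carrier[OF mult_linear_right])

lemma mult_sw_left:
  "x \<in> carrier H \<Longrightarrow> y \<in> carrier H \<Longrightarrow> (\<And>a b. a \<in> carrier H \<Longrightarrow> b \<in> carrier H \<Longrightarrow> \<beta> a b \<in> carrier H) \<Longrightarrow>
     sw x \<beta> \<odot> y = sw x (\<lambda>a b. \<beta> a b \<odot> y)"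
  by (rule linear_sw_carrier[OF mult_linear_left])

lemma lin_mult_left [lin]:
  "linear_from V s (smult H) f \<Longrightarrow> (\<And>x. x \<in> V \<Longrightarrow> f x \<in> carrier H) \<Longrightarrow> y \<in> carrier H \<Longrightarrow>
     linear_from V s (smult H) (\<lambda>x. f x \<odot> y)"
  by (rule linear_from_comp[OF mult_linear_left])

lemma lin_mult_right [lin]:
  "linear_from V s (smult H) f \<Longrightarrow> (\<And>x. x \<in> V \<Longrightarrow> f x \<in> carrier H) \<Longrightarrow> y \<in> carrier H \<Longrightarrow>
     linear_from V s (smult H) (\<lambda>x. y \<odot> f x)"
  by (rule linear_from_comp[OF mult_linear_right])

lemma lin_antipode [lin]:
  "linear_from V s (smult H) f \<Longrightarrow> (\<And>x. x \<in> V \<Longrightarrow> f x \<in> carrier H) \<Longrightarrow>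
     linear_from V s (smult H) (\<lambda>x. \<S> (f x))"
  by (rule linear_from_comp[OF antipode_linear])

lemma lin_counit [lin]:
  "linear_from V s (smult H) f \<Longrightarrow> (\<And>x. x \<in> V \<Longrightarrow> f x \<in> carrier H) \<Longrightarrow>
     linear_from V s (*) (\<lambda>x. \<epsilon> (f x))"
  by (rule linear_from_comp[OF counit_linear])

lemma lin_sw_body [lin]:
  assumes "vector_space s'" "y \<in> carrier H"
    and "\<And>a b. a \<in> carrier H \<Longrightarrow> b \<in> carrier H \<Longrightarrow> linear_from V s s' (\<lambda>x. \<beta> x a b)"
  shows "linear_from V s s' (\<lambda>x. sw y (\<beta> x))"
  unfolding sweedler_def
  by (rule linear_from_sum_list_const[OF assms(1)])
    (use assms(3) comult_mem[OF assms(2)] in auto)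

text \<open>As a list, \<open>comult H (x + y)\<close> is unrelated to the concatenation of the
  other two; only the tensors coincide. Hence \<beta> has to be bilinear here.\<close>

lemma sw_add_arg:
  fixes \<beta> :: "'a \<Rightarrow> 'a \<Rightarrow> 'b::ab_group_add"
  assumes "bilinear_from (carrier H) (smult H) s' \<beta>" "vector_space s'"
    and "x \<in> carrier H" "y \<in> carrier H"
  shows "sw (x + y) \<beta> = sw x \<beta> + sw y \<beta>"
  using tensor_eq_imp_sum_eq[OF comult_add[OF assms(3,4)] multilinear_on_pairs[OF assms(1,2)] assms(2)]
  by (simp add: sweedler_def comp_def case_prod_unfold)

lemma sw_smult_arg:
  fixes \<beta> :: "'a \<Rightarrow> 'a \<Rightarrow> 'b::ab_group_add"
  assumes "bilinear_from (carrier H) (smult H) s' \<beta>" "vector_space s'" "x \<in> carrier H"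
  shows "sw (smult H c x) \<beta> = s' c (sw x \<beta>)"
proof -
  have "sw (smult H c x) \<beta> = sw x (\<lambda>a b. \<beta> (smult H c a) b)"
    using tensor_eq_imp_sum_eq[OF comult_smult[OF assms(3)] multilinear_on_pairs[OF assms(1,2)] assms(2)]
    by (simp add: sweedler_def comp_def case_prod_unfold)
  also have "\<dots> = sw x (\<lambda>a b. s' c (\<beta> a b))"
    using assms(1) by (intro sw_cong[OF assms(3)]) (simp add: bilinear_from_def linear_from_def)
  finally show ?thesis by (simp add: sweedler_scale[OF assms(2)])
qed

text \<open>Counterpart of \<open>lin_sw_body\<close>: there the variable occurs in the summand,
  here in the element that is comultiplied. Together they prove linearity of iterated Sweedler sums
  in each of their variables.\<close>

lemma lin_sw_arg [lin]:
  fixes \<beta> :: "'a \<Rightarrow> 'a \<Rightarrow> 'b::ab_group_add"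
  assumes "vector_space s'" "linear_from V s (smult H) f" "\<And>x. x \<in> V \<Longrightarrow> f x \<in> carrier H"
    and "bilinear_from (carrier H) (smult H) s' \<beta>"
  shows "linear_from V s s' (\<lambda>x. sw (f x) \<beta>)"
proof -
  have "linear_from (carrier H) (smult H) s' (\<lambda>x. sw x \<beta>)"
    by (simp add: linear_from_def sw_add_arg[OF assms(4,1)] sw_smult_arg[OF assms(4,1)])
  from linear_from_comp[OF this assms(2,3)] show ?thesis .
qed

lemma sw_unit:
  fixes \<beta> :: "'a \<Rightarrow> 'a \<Rightarrow> 'b::ab_group_add"
  assumes "bilinear_from (carrier H) (smult H) s' \<beta>" "vector_space s'"
  shows "sw \<one> \<beta> = \<beta> \<one> \<one>"
  using tensor_eq_imp_sum_eq[OF comult_unit multilinear_on_pairs[OF assms] assms(2)]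
  by (simp add: sweedler_def comp_def case_prod_unfold)

lemma sw_mult:
  fixes \<beta> :: "'a \<Rightarrow> 'a \<Rightarrow> 'b::ab_group_add"
  assumes "bilinear_from (carrier H) (smult H) s' \<beta>" "vector_space s'"
    and "x \<in> carrier H" "y \<in> carrier H"
  shows "sw (x \<odot> y) \<beta> = sw x (\<lambda>a b. sw y (\<lambda>c d. \<beta> (a \<odot> c) (b \<odot> d)))"
  using tensor_eq_imp_sum_eq[OF comult_mult[OF assms(3,4)] multilinear_on_pairs[OF assms(1,2)] assms(2)]
  by (simp add: sweedler_def comp_def case_prod_unfold sum_list_concat_map)

lemma sw_coassoc:
  fixes \<tau> :: "'a \<Rightarrow> 'a \<Rightarrow> 'a \<Rightarrow> 'b::ab_group_add"
  assumes "trilinear_from (carrier H) (smult H) s' \<tau>" "vector_space s'" "x \<in> carrier H"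
  shows "sw x (\<lambda>u c. sw u (\<lambda>a b. \<tau> a b c)) = sw x (\<lambda>a u. sw u (\<lambda>b c. \<tau> a b c))"
  using tensor_eq_imp_sum_eq[OF comult_coassoc[OF assms(3)] multilinear_on_triples[OF assms(1,2)] assms(2)]
  by (simp add: sweedler_def comp_def case_prod_unfold sum_list_concat_map)

text \<open>Stated under a linear \<open>f\<close>, as are the three lemmas of this kind that
  follow, so that a counit or antipode axiom can be applied to Sweedler factors that occur deep
  inside an expression.\<close>

lemma sw_counit_left:
  assumes "linear_from (carrier H) (smult H) s' f" "x \<in> carrier H"
  shows "sw x (\<lambda>a b. s' (\<epsilon> a) (f b)) = f x"
proof -
  have "f x = f (sw x (\<lambda>a b. smult H (\<epsilon> a) b))"
    using counit_left[OF assms(2)] by (simp add: sweedler_def)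
  also have "\<dots> = sw x (\<lambda>a b. f (smult H (\<epsilon> a) b))"
    by (rule linear_sw_carrier[OF assms]) simp
  also have "\<dots> = sw x (\<lambda>a b. s' (\<epsilon> a) (f b))"
    using assms(1) by (intro sw_cong[OF assms(2)]) (simp add: linear_from_def)
  finally show ?thesis by simp
qed

lemma sw_counit_right:
  assumes "linear_from (carrier H) (smult H) s' f" "x \<in> carrier H"
  shows "sw x (\<lambda>a b. s' (\<epsilon> b) (f a)) = f x"
proof -
  have "f x = f (sw x (\<lambda>a b. smult H (\<epsilon> b) a))"
    using counit_right[OF assms(2)] by (simp add: sweedler_def)
  also have "\<dots> = sw x (\<lambda>a b. f (smult H (\<epsilon> b) a))"
    by (rule linear_sw_carrier[OF assms]) simp
  also have "\<dots> = sw x (\<lambda>a b. s' (\<epsilon> b) (f a))"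
    using assms(1) by (intro sw_cong[OF assms(2)]) (simp add: linear_from_def)
  finally show ?thesis by simp
qed

lemma sw_antipode_left:
  assumes "linear_from (carrier H) (smult H) s' f" "x \<in> carrier H"
  shows "sw x (\<lambda>a b. f (\<S> a \<odot> b)) = s' (\<epsilon> x) (f \<one>)"
proof -
  have "sw x (\<lambda>a b. f (\<S> a \<odot> b)) = f (sw x (\<lambda>a b. \<S> a \<odot> b))"
    by (rule linear_sw_carrier[OF assms, symmetric]) simp
  also have "\<dots> = f (smult H (\<epsilon> x) \<one>)" using antipode_left[OF assms(2)] by (simp add: sweedler_def)
  finally show ?thesis using assms(1) by (simp add: linear_from_def)
qed

lemma sw_antipode_right:
  assumes "linear_from (carrier H) (smult H) s' f" "x \<in> carrier H"
  shows "sw x (\<lambda>a b. f (a \<odot> \<S> b)) = s' (\<epsilon> x) (f \<one>)"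
proof -
  have "sw x (\<lambda>a b. f (a \<odot> \<S> b)) = f (sw x (\<lambda>a b. a \<odot> \<S> b))"
    by (rule linear_sw_carrier[OF assms, symmetric]) simp
  also have "\<dots> = f (smult H (\<epsilon> x) \<one>)" using antipode_right[OF assms(2)] by (simp add: sweedler_def)
  finally show ?thesis using assms(1) by (simp add: linear_from_def)
qed

lemma mult_smult_left: "x \<in> carrier H \<Longrightarrow> y \<in> carrier H \<Longrightarrow> smult H c x \<odot> y = smult H c (x \<odot> y)"
  and mult_smult_right: "x \<in> carrier H \<Longrightarrow> y \<in> carrier H \<Longrightarrow> x \<odot> smult H c y = smult H c (x \<odot> y)"
  using mult_linear_left mult_linear_right by (simp_all add: linear_from_def)

lemma mult_zero [simp]: "x \<in> carrier H \<Longrightarrow> 0 \<odot> x = 0" "x \<in> carrier H \<Longrightarrow> x \<odot> 0 = 0"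
  using linear_from_zero[OF mult_linear_left] linear_from_zero[OF mult_linear_right] by simp_all

lemma counit_zero [simp]: "\<epsilon> 0 = 0"
  by (rule linear_from_zero[OF counit_linear]) simp

lemma counit_smult: "x \<in> carrier H \<Longrightarrow> \<epsilon> (smult H c x) = c * \<epsilon> x"
  using counit_linear by (simp add: linear_from_def)

lemma counit_diff: "x \<in> carrier H \<Longrightarrow> y \<in> carrier H \<Longrightarrow> \<epsilon> (x - y) = \<epsilon> x - \<epsilon> y"
  by (rule linear_from_diff[OF counit_linear carrier_subspace vector_space_axioms])

section \<open>Elementary properties of the antipode\<close>

lemma antipode_unit: "\<S> \<one> = \<one>"
proof -
  have "sw \<one> (\<lambda>a b. \<S> a \<odot> b) = \<S> \<one> \<odot> \<one>"
    by (rule sw_unit) (auto intro!: lin)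
  then show ?thesis
    using antipode_left[of \<one>] by (simp add: sweedler_def mult_unit_right counit_unit)
qed

text \<open>Insert the counit, \<open>\<epsilon> (\<S> x)\<close> being the sum of
  \<open>\<epsilon> (\<S> x1) * \<epsilon> x2\<close>, and apply the multiplicative \<epsilon> to
  the antipode axiom.\<close>

lemma counit_antipode:
  assumes "x \<in> carrier H"
  shows "\<epsilon> (\<S> x) = \<epsilon> x"
proof -
  have "\<epsilon> (\<S> x) = sw x (\<lambda>a b. \<epsilon> b * \<epsilon> (\<S> a))"
    by (rule sw_counit_right[symmetric, where s' = "(*)"]) (auto intro!: lin assms)
  also have "\<dots> = sw x (\<lambda>a b. \<epsilon> (\<S> a \<odot> b))"
    by (rule sw_cong[OF assms]) (simp add: counit_mult mult.commute)
  also have "\<dots> = \<epsilon> x"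
    using sw_antipode_left[OF counit_linear assms] by (simp add: counit_unit)
  finally show ?thesis .
qed

text \<open>
  Both sides are convolution inverses of the multiplication in \<open>Hom(H \<otimes> H, H)\<close>.
\<close>

lemma antipode_mult:
  assumes x: "x \<in> carrier H" and y: "y \<in> carrier H"
  shows "\<S> (x \<odot> y) = \<S> y \<odot> \<S> x"
proof -
  \<comment> \<open>The triple convolution product of (x, y) -> S(xy), the multiplication, and (x,
    y) -> S(y)S(x), with \<open>y\<close> already summed and the three factors of \<open>x\<close>
    left open. Associating to the right collapses the last two maps, associating to the left the
    first two.\<close>
  define P where "P = (\<lambda>x1 x2 x3. sw y (\<lambda>y1 u. sw u (\<lambda>y2 y3.
      (\<S> (x1 \<odot> y1) \<odot> (x2 \<odot> y2)) \<odot> (\<S> y3 \<odot> \<S> x3))))"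
  have trilinear: "trilinear_from (carrier H) (smult H) (smult H) P"
    unfolding P_def using y by (auto intro!: lin)
  have "\<S> (x \<odot> y) = sw x (\<lambda>x1 u. sw u (\<lambda>x2 x3. P x1 x2 x3))"
  proof -
    have "sw u (\<lambda>x2 x3. P x1 x2 x3) = smult H (\<epsilon> u) (\<S> (x1 \<odot> y))"
      if [simp]: "x1 \<in> carrier H" "u \<in> carrier H" for x1 u
    proof -
      have "P x1 x2 x3 = \<S> (x1 \<odot> y) \<odot> (x2 \<odot> \<S> x3)"
        if [simp]: "x2 \<in> carrier H" "x3 \<in> carrier H" for x2 x3
      proof -
        have "P x1 x2 x3 = sw y (\<lambda>y1 v. smult H (\<epsilon> v) (\<S> (x1 \<odot> y1) \<odot> (x2 \<odot> \<S> x3)))"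
          unfolding P_def
        proof (rule sw_cong[OF y])
          fix y1 v assume [simp]: "y1 \<in> carrier H" "v \<in> carrier H"
          have "sw v (\<lambda>y2 y3. (\<S> (x1 \<odot> y1) \<odot> (x2 \<odot> y2)) \<odot> (\<S> y3 \<odot> \<S> x3)) =
              sw v (\<lambda>y2 y3. \<S> (x1 \<odot> y1) \<odot> (x2 \<odot> (y2 \<odot> \<S> y3 \<odot> \<S> x3)))"
            by (rule sw_cong) (simp_all add: mult_assoc)
          also have "\<dots> = smult H (\<epsilon> v) (\<S> (x1 \<odot> y1) \<odot> (x2 \<odot> (\<one> \<odot> \<S> x3)))"
            by (rule sw_antipode_right[where f = "\<lambda>z. \<S> (x1 \<odot> y1) \<odot> (x2 \<odot> (z \<odot> \<S> x3))"])
              (auto intro!: lin)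
          finally show "sw v (\<lambda>y2 y3. (\<S> (x1 \<odot> y1) \<odot> (x2 \<odot> y2)) \<odot> (\<S> y3 \<odot> \<S> x3)) =
              smult H (\<epsilon> v) (\<S> (x1 \<odot> y1) \<odot> (x2 \<odot> \<S> x3))" by (simp add: mult_unit_left)
        qed
        also have "\<dots> = \<S> (x1 \<odot> y) \<odot> (x2 \<odot> \<S> x3)"
          by (rule sw_counit_right[where f = "\<lambda>y1. \<S> (x1 \<odot> y1) \<odot> (x2 \<odot> \<S> x3)"])
            (auto intro!: lin simp: y)
        finally show ?thesis .
      qed
      then have "sw u (\<lambda>x2 x3. P x1 x2 x3) = sw u (\<lambda>x2 x3. \<S> (x1 \<odot> y) \<odot> (x2 \<odot> \<S> x3))"
        by (intro sw_cong) simp_all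
      also have "\<dots> = smult H (\<epsilon> u) (\<S> (x1 \<odot> y) \<odot> \<one>)"
        by (rule sw_antipode_right) (auto intro!: lin simp: y)
      finally show ?thesis by (simp add: mult_unit_right y)
    qed
    then have "sw x (\<lambda>x1 u. sw u (\<lambda>x2 x3. P x1 x2 x3)) =
        sw x (\<lambda>x1 u. smult H (\<epsilon> u) (\<S> (x1 \<odot> y)))" by (intro sw_cong[OF x])
    also have "\<dots> = \<S> (x \<odot> y)"
      by (rule sw_counit_right) (auto intro!: lin simp: x y)
    finally show ?thesis by simp
  qed
  also have "\<dots> = sw x (\<lambda>u x3. sw u (\<lambda>x1 x2. P x1 x2 x3))"
    by (rule sw_coassoc[OF trilinear vector_space_axioms x, symmetric])
  also have "\<dots> = sw x (\<lambda>u x3. smult H (\<epsilon> u) (\<S> y \<odot> \<S> x3))"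
  proof (rule sw_cong[OF x])
    fix u x3 assume [simp]: "u \<in> carrier H" "x3 \<in> carrier H"
    have "sw u (\<lambda>x1 x2. P x1 x2 x3) = sw u (\<lambda>x1 x2. sw y (\<lambda>v y3. sw v (\<lambda>y1 y2.
        (\<S> (x1 \<odot> y1) \<odot> (x2 \<odot> y2)) \<odot> (\<S> y3 \<odot> \<S> x3))))"
      unfolding P_def
      by (rule sw_cong[OF _ sw_coassoc[OF _ vector_space_axioms y, symmetric]]) (auto intro!: lin)
    also have "\<dots> = sw y (\<lambda>v y3. sw u (\<lambda>x1 x2. sw v (\<lambda>y1 y2.
        (\<S> (x1 \<odot> y1) \<odot> (x2 \<odot> y2)) \<odot> (\<S> y3 \<odot> \<S> x3))))"
      by (rule sweedler_exchange)
    also have "\<dots> = sw y (\<lambda>v y3. smult H (\<epsilon> u * \<epsilon> v) (\<S> y3 \<odot> \<S> x3))"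
    proof (rule sw_cong[OF y])
      fix v y3 assume [simp]: "v \<in> carrier H" "y3 \<in> carrier H"
      have "sw u (\<lambda>x1 x2. sw v (\<lambda>y1 y2. (\<S> (x1 \<odot> y1) \<odot> (x2 \<odot> y2)) \<odot> (\<S> y3 \<odot> \<S> x3))) =
          sw (u \<odot> v) (\<lambda>a b. (\<S> a \<odot> b) \<odot> (\<S> y3 \<odot> \<S> x3))"
        by (rule sw_mult[symmetric, where \<beta> = "\<lambda>a b. (\<S> a \<odot> b) \<odot> (\<S> y3 \<odot> \<S> x3)"]) (auto intro!: lin)
      also have "\<dots> = smult H (\<epsilon> (u \<odot> v)) (\<one> \<odot> (\<S> y3 \<odot> \<S> x3))"
        by (rule sw_antipode_left) (auto intro!: lin)
      finally show "sw u (\<lambda>x1 x2. sw v (\<lambda>y1 y2. (\<S> (x1 \<odot> y1) \<odot> (x2 \<odot> y2)) \<odot> (\<S> y3 \<odot> \<S> x3))) =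
          smult H (\<epsilon> u * \<epsilon> v) (\<S> y3 \<odot> \<S> x3)" by (simp add: counit_mult mult_unit_left)
    qed
    also have "\<dots> = sw y (\<lambda>v y3. smult H (\<epsilon> v) (smult H (\<epsilon> u) (\<S> y3 \<odot> \<S> x3)))"
      by (simp add: mult.commute)
    also have "\<dots> = smult H (\<epsilon> u) (\<S> y \<odot> \<S> x3)"
      by (rule sw_counit_left[where f = "\<lambda>y3. smult H (\<epsilon> u) (\<S> y3 \<odot> \<S> x3)"]) (auto intro!: lin simp: y)
    finally show "sw u (\<lambda>x1 x2. P x1 x2 x3) = smult H (\<epsilon> u) (\<S> y \<odot> \<S> x3)" .
  qed
  also have "\<dots> = \<S> y \<odot> \<S> x"
    by (rule sw_counit_left) (auto intro!: lin simp: x y)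
  finally show ?thesis .
qed

end

subsection \<open>Finite dimensional Hopf algebras are self-injective\<close>

lemma finite_coordinates:
  fixes s :: "'k::field \<Rightarrow> 'a::ab_group_add \<Rightarrow> 'a"
  assumes "vector_space s" "finite B" "module.span s B = V"
  obtains E c where "finite E" "E \<subseteq> V" "\<not> module.dependent s E" "module.span s E = V"
    "\<And>e. Vector_Spaces.linear s (*) (c e)" "\<And>x. x \<in> V \<Longrightarrow> (\<Sum>e\<in>E. s (c e x) e) = x"
    "\<And>e e'. e \<in> E \<Longrightarrow> e' \<in> E \<Longrightarrow> c e e' = of_bool (e = e')"
proof -
  interpret vector_space_pair s "(*) :: 'k \<Rightarrow> 'k \<Rightarrow> 'k"
    using assms vector_space_field by (auto simp: vector_space_pair_def)
  obtain E where E: "E \<subseteq> B" "vs1.independent E" "B \<subseteq> vs1.span E"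
    using vs1.maximal_independent_subset by blast
  have span: "vs1.span E = V"
    using E assms(3) vs1.span_minimal[OF E(3) vs1.subspace_span] vs1.span_mono[OF E(1)] by blast
  have "\<exists>g. Vector_Spaces.linear s (*) g \<and> (\<forall>x\<in>E. g x = of_bool (e = x))" for e
    by (rule linear_independent_extend[OF E(2)])
  then obtain c where c: "\<And>e. Vector_Spaces.linear s (*) (c e)"
    "\<And>e x. x \<in> E \<Longrightarrow> c e x = of_bool (e = x)" by metis
  have finE: "finite E" using E(1) assms(2) finite_subset by blast
  have "(\<Sum>e\<in>E. s (c e x) e) = x" if "x \<in> V" for x
    using that[folded span]
  proof (induction rule: vs1.span_induct_alt)
    case base
    have "c e 0 = 0" for e
      by (rule linear_from_zero[OF linear_from_linear[OF c(1), of UNIV]]) simp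
    then show ?case by simp
  next
    case (step k b y)
    have "c e (s k b + y) = k * of_bool (e = b) + c e y" for e
      using c(1)[of e] c(2)[OF step(1), of e] by (simp add: Vector_Spaces.linear_iff)
    then have "(\<Sum>e\<in>E. s (c e (s k b + y)) e) =
        (\<Sum>e\<in>E. s (k * of_bool (e = b)) e) + (\<Sum>e\<in>E. s (c e y) e)"
      by (simp add: vs1.scale_left_distrib sum.distrib)
    also have "(\<Sum>e\<in>E. s (k * of_bool (e = b)) e) = (\<Sum>e\<in>E. if e = b then s k b else 0)"
      by (rule sum.cong) auto
    finally show ?case using step finE by simp
  qed
  moreover have "E \<subseteq> V" using span vs1.span_superset by blast
  ultimately show ?thesis using that finE E(2) span c by blast
qed

context hopf_algebra
begin

lemma coordinates:
  assumes "finite_dimensional H"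
  obtains E c where "finite E" "E \<subseteq> carrier H" "independent E" "span E = carrier H"
    "\<And>e. linear_from (carrier H) (smult H) (*) (c e)"
    "\<And>x. x \<in> carrier H \<Longrightarrow> (\<Sum>e\<in>E. smult H (c e x) e) = x"
    "\<And>e e'. e \<in> E \<Longrightarrow> e' \<in> E \<Longrightarrow> c e e' = of_bool (e = e')"
proof -
  obtain B where B: "finite B" "span B = carrier H"
    using assms unfolding finite_dimensional_def by blast
  obtain E c where Ec: "finite E" "E \<subseteq> carrier H" "independent E" "span E = carrier H"
    "\<And>e. Vector_Spaces.linear (smult H) (*) (c e)"
    "\<And>x. x \<in> carrier H \<Longrightarrow> (\<Sum>e\<in>E. smult H (c e x) e) = x"
    "\<And>e e'. e \<in> E \<Longrightarrow> e' \<in> E \<Longrightarrow> c e e' = of_bool (e = e')"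
    by (rule finite_coordinates[OF vector_space_axioms B]) blast
  show ?thesis
    by (rule that[OF Ec(1-4) linear_from_linear[OF Ec(5)] Ec(6-7)])
qed

text \<open>
  For \<open>x\<close> in \<open>H\<close> and \<open>m\<close> in the module put \<open>G(m, x) = q(m x\<^sub>1) \<S>(x\<^sub>2)\<close>; the antipode makes
  \<open>G(m, a\<^sub>1 x) a\<^sub>2 = G(m a, x)\<close> hold.  The map \<open>p(m)\<close> is the partial trace over a basis
  \<open>e\<close> with dual basis \<open>e\<^sup>*\<close>, the sum of the \<open>e\<^sup>*(\<S>(g\<^sub>1)) g\<^sub>2\<close> for \<open>g = G(m, e)\<close>, which turns this
  identity into right linearity.
\<close>

lemma self_injective:
  fixes s' :: "'k \<Rightarrow> 'm::ab_group_add \<Rightarrow> 'm"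
  assumes fd: "finite_dimensional H" and vs': "vector_space s'"
    and act_closed: "\<And>m x. m \<in> M \<Longrightarrow> x \<in> carrier H \<Longrightarrow> act m x \<in> M"
    and act_assoc: "\<And>m x y. m \<in> M \<Longrightarrow> x \<in> carrier H \<Longrightarrow> y \<in> carrier H \<Longrightarrow>
        act (act m x) y = act m (x \<odot> y)"
    and act_lin_right: "\<And>m. m \<in> M \<Longrightarrow> linear_from (carrier H) (smult H) s' (act m)"
    and act_lin_left: "\<And>x. x \<in> carrier H \<Longrightarrow> linear_from M s' s' (\<lambda>m. act m x)"
    and q_lin: "linear_from M s' (smult H) q" and q_closed: "\<And>m. m \<in> M \<Longrightarrow> q m \<in> carrier H"
  obtains p where "linear_from M s' (smult H) p" "\<And>m. m \<in> M \<Longrightarrow> p m \<in> carrier H"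
    "\<And>m x. m \<in> M \<Longrightarrow> x \<in> carrier H \<Longrightarrow> p (act m x) = p m \<odot> x"
    "\<And>m. m \<in> M \<Longrightarrow> (\<And>x. x \<in> carrier H \<Longrightarrow> q (act m x) = x) \<Longrightarrow> p m = \<one>"
proof -
  obtain E c where E: "finite E" "E \<subseteq> carrier H"
    and c_lin: "\<And>e. linear_from (carrier H) (smult H) (*) (c e)"
    and c_sum: "\<And>x. x \<in> carrier H \<Longrightarrow> (\<Sum>e\<in>E. smult H (c e x) e) = x"
    using coordinates[OF fd] by metis
  have E' [simp]: "e \<in> carrier H" if "e \<in> E" for e using that E by blast
  note [simp] = act_closed q_closed
  have qact [lin]: "linear_from V t (smult H) (\<lambda>x. q (act m (f x)))"
    if "linear_from V t (smult H) f" "\<And>x. x \<in> V \<Longrightarrow> f x \<in> carrier H" "m \<in> M" for V t f m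
    using linear_from_comp[OF q_lin linear_from_comp[OF act_lin_right that(1,2)]] that by simp
  have qact' [lin]: "linear_from M s' (smult H) (\<lambda>m. q (act m x))" if "x \<in> carrier H" for x
    using linear_from_comp[OF q_lin act_lin_left[OF that]] that by simp
  note [lin] = linear_from_comp[OF c_lin]
  define G where "G m x = sw x (\<lambda>x1 x2. q (act m x1) \<odot> \<S> x2)" for m x
  define \<Phi> where "\<Phi> = (\<lambda>e g1 g2. smult H (c e (\<S> g1)) g2)"
  define p where "p m = (\<Sum>e\<in>E. sw (G m e) (\<Phi> e))" for m
  have G_closed [simp]: "G m x \<in> carrier H" if "m \<in> M" "x \<in> carrier H" for m x
    unfolding G_def using that by simp
  have \<Phi>_bil [lin]: "bilinear_from (carrier H) (smult H) (smult H) (\<Phi> e)" for e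
    unfolding \<Phi>_def by (auto intro!: lin)
  note [lin] = bilinear_from_comp_left[OF \<Phi>_bil] bilinear_from_comp_right[OF \<Phi>_bil]
  have G_lin [lin]: "linear_from V t (smult H) (\<lambda>x. G m (f x))"
    if "linear_from V t (smult H) f" "\<And>x. x \<in> V \<Longrightarrow> f x \<in> carrier H" "m \<in> M" for V t f m
    unfolding G_def using that by (auto intro!: lin)
  \<comment> \<open>Since S(v x2) = S(x2) S(v), the factor \<open>v\<close> of \<open>a\<close>
    meets the next factor \<open>w\<close> of \<open>a\<close> and cancels; what remains is q(m a
    x1) S(x2).\<close>
  have G_twist: "G (act m a) x = sw a (\<lambda>a1 a2. G m (a1 \<odot> x) \<odot> a2)"
    if [simp]: "m \<in> M" "a \<in> carrier H" "x \<in> carrier H" for m a x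
  proof -
    define P where "P = (\<lambda>u v w. sw x (\<lambda>x1 x2. q (act m (u \<odot> x1)) \<odot> \<S> (v \<odot> x2) \<odot> w))"
    have "sw a (\<lambda>a1 a2. G m (a1 \<odot> x) \<odot> a2) = sw a (\<lambda>a1 w. sw a1 (\<lambda>u v. P u v w))"
    proof (rule sw_cong[OF that(2)])
      fix a1 w assume [simp]: "a1 \<in> carrier H" "w \<in> carrier H"
      have "G m (a1 \<odot> x) = sw a1 (\<lambda>u v. sw x (\<lambda>x1 x2. q (act m (u \<odot> x1)) \<odot> \<S> (v \<odot> x2)))"
        unfolding G_def by (rule sw_mult) (auto intro!: lin)
      then show "G m (a1 \<odot> x) \<odot> w = sw a1 (\<lambda>u v. P u v w)"
        unfolding P_def by (simp add: mult_sw_left cong: sw_cong)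
    qed
    also have "\<dots> = sw a (\<lambda>u a2. sw a2 (\<lambda>v w. P u v w))"
      unfolding P_def by (rule sw_coassoc) (auto intro!: lin)
    also have "\<dots> = sw a (\<lambda>u a2. smult H (\<epsilon> a2) (sw x (\<lambda>x1 x2. q (act m (u \<odot> x1)) \<odot> \<S> x2)))"
    proof (rule sw_cong[OF that(2)])
      fix u a2 assume [simp]: "u \<in> carrier H" "a2 \<in> carrier H"
      have "sw a2 (\<lambda>v w. P u v w) =
          sw x (\<lambda>x1 x2. sw a2 (\<lambda>v w. q (act m (u \<odot> x1)) \<odot> \<S> (v \<odot> x2) \<odot> w))"
        unfolding P_def by (rule sweedler_exchange)
      also have "\<dots> = sw x (\<lambda>x1 x2. smult H (\<epsilon> a2) (q (act m (u \<odot> x1)) \<odot> \<S> x2))"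
      proof (rule sw_cong[OF that(3)])
        fix x1 x2 assume [simp]: "x1 \<in> carrier H" "x2 \<in> carrier H"
        have "sw a2 (\<lambda>v w. q (act m (u \<odot> x1)) \<odot> \<S> (v \<odot> x2) \<odot> w) =
            sw a2 (\<lambda>v w. q (act m (u \<odot> x1)) \<odot> (\<S> x2 \<odot> (\<S> v \<odot> w)))"
          by (rule sw_cong) (simp_all add: antipode_mult mult_assoc)
        also have "\<dots> = smult H (\<epsilon> a2) (q (act m (u \<odot> x1)) \<odot> (\<S> x2 \<odot> \<one>))"
          by (rule sw_antipode_left[where f = "\<lambda>z. q (act m (u \<odot> x1)) \<odot> (\<S> x2 \<odot> z)"])
            (auto intro!: lin)
        finally show "sw a2 (\<lambda>v w. q (act m (u \<odot> x1)) \<odot> \<S> (v \<odot> x2) \<odot> w) =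
            smult H (\<epsilon> a2) (q (act m (u \<odot> x1)) \<odot> \<S> x2)" by (simp add: mult_unit_right)
      qed
      finally show "sw a2 (\<lambda>v w. P u v w) =
          smult H (\<epsilon> a2) (sw x (\<lambda>x1 x2. q (act m (u \<odot> x1)) \<odot> \<S> x2))"
        by (simp add: sweedler_scale[OF vector_space_axioms])
    qed
    also have "\<dots> = sw x (\<lambda>x1 x2. q (act m (a \<odot> x1)) \<odot> \<S> x2)"
      by (rule sw_counit_right[where f = "\<lambda>u. sw x (\<lambda>x1 x2. q (act m (u \<odot> x1)) \<odot> \<S> x2)"])
        (auto intro!: lin)
    also have "\<dots> = G (act m a) x"
      unfolding G_def by (rule sw_cong) (simp_all add: act_assoc)
    finally show ?thesis by simp
  qed
  \<comment> \<open>Cyclicity of the partial trace. With T(x) the tensor of b S(g1) and g2 d for g =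
    G(m, x), both sides trace over the first tensor factor: on the left T after left multiplication
    by \<open>a\<close>, on the right left multiplication by \<open>a\<close> on the first factor
    after T.\<close>
  have trace: "(\<Sum>e\<in>E. sw (G m (a \<odot> e)) (\<lambda>g1 g2. smult H (c e (b \<odot> \<S> g1)) (g2 \<odot> d))) =
      (\<Sum>e\<in>E. sw (G m e) (\<lambda>g1 g2. smult H (c e (a \<odot> b \<odot> \<S> g1)) (g2 \<odot> d)))"
    if [simp]: "m \<in> M" "a \<in> carrier H" "b \<in> carrier H" "d \<in> carrier H" for m a b d
  proof -
    have "sw (G m (a \<odot> e)) (\<lambda>g1 g2. smult H (c e (b \<odot> \<S> g1)) (g2 \<odot> d)) =
        (\<Sum>e'\<in>E. smult H (c e' (a \<odot> e)) (sw (G m e') (\<lambda>g1 g2. smult H (c e (b \<odot> \<S> g1)) (g2 \<odot> d))))"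
      if [simp]: "e \<in> E" for e
    proof -
      have lin_f: "linear_from (carrier H) (smult H) (smult H)
          (\<lambda>x. sw (G m x) (\<lambda>g1 g2. smult H (c e (b \<odot> \<S> g1)) (g2 \<odot> d)))"
        by (auto intro!: lin)
      have "sw (G m (a \<odot> e)) (\<lambda>g1 g2. smult H (c e (b \<odot> \<S> g1)) (g2 \<odot> d)) =
          sw (G m (\<Sum>e'\<in>E. smult H (c e' (a \<odot> e)) e')) (\<lambda>g1 g2. smult H (c e (b \<odot> \<S> g1)) (g2 \<odot> d))"
        by (simp add: c_sum)
      also have "\<dots> = (\<Sum>e'\<in>E. sw (G m (smult H (c e' (a \<odot> e)) e'))
            (\<lambda>g1 g2. smult H (c e (b \<odot> \<S> g1)) (g2 \<odot> d)))"
        by (rule linear_from_sum[OF lin_f carrier_subspace vector_space_axioms]) simp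
      also have "\<dots> = (\<Sum>e'\<in>E. smult H (c e' (a \<odot> e)) (sw (G m e') (\<lambda>g1 g2. smult H (c e (b \<odot> \<S> g1)) (g2 \<odot> d))))"
        using linear_from_scale[OF lin_f] by (intro sum.cong) simp_all
      finally show ?thesis .
    qed
    then have "(\<Sum>e\<in>E. sw (G m (a \<odot> e)) (\<lambda>g1 g2. smult H (c e (b \<odot> \<S> g1)) (g2 \<odot> d))) =
      (\<Sum>e\<in>E. \<Sum>e'\<in>E. smult H (c e' (a \<odot> e)) (sw (G m e') (\<lambda>g1 g2. smult H (c e (b \<odot> \<S> g1)) (g2 \<odot> d))))"
      by simp
    also have "\<dots> = (\<Sum>e'\<in>E. sw (G m e') (\<lambda>g1 g2. \<Sum>e\<in>E. smult H (c e' (a \<odot> e)) (smult H (c e (b \<odot> \<S> g1)) (g2 \<odot> d))))"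
      by (subst sum.swap) (simp only: sweedler_sum sweedler_scale[OF vector_space_axioms])
    also have "\<dots> = (\<Sum>e'\<in>E. sw (G m e') (\<lambda>g1 g2. smult H (c e' (a \<odot> b \<odot> \<S> g1)) (g2 \<odot> d)))"
    proof (rule sum.cong[OF refl], rule sw_cong)
      fix e' g1 g2 assume [simp]: "e' \<in> E" "g1 \<in> carrier H" "g2 \<in> carrier H"
      have "c e' (a \<odot> (b \<odot> \<S> g1)) = c e' (a \<odot> (\<Sum>e\<in>E. smult H (c e (b \<odot> \<S> g1)) e))"
        by (simp add: c_sum)
      also have "\<dots> = (\<Sum>e\<in>E. c e' (a \<odot> smult H (c e (b \<odot> \<S> g1)) e))"
        by (rule linear_from_sum[where f = "\<lambda>x. c e' (a \<odot> x)", OF _ carrier_subspace vector_space_axioms])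
          (auto intro!: lin)
      also have "\<dots> = (\<Sum>e\<in>E. c e' (a \<odot> e) * c e (b \<odot> \<S> g1))"
        by (rule sum.cong) (simp_all add: mult_smult_right linear_from_scale[OF c_lin])
      finally show "(\<Sum>e\<in>E. smult H (c e' (a \<odot> e)) (smult H (c e (b \<odot> \<S> g1)) (g2 \<odot> d))) =
          smult H (c e' (a \<odot> b \<odot> \<S> g1)) (g2 \<odot> d)"
        by (simp add: mult_assoc scale_sum_left)
    qed simp
    finally show ?thesis .
  qed
  show ?thesis
  proof
    show "linear_from M s' (smult H) p"
      unfolding p_def G_def by (auto intro!: lin)
    show "p m \<in> carrier H" if "m \<in> M" for m
      unfolding p_def \<Phi>_def using that by auto
    show "p (act m a) = p m \<odot> a" if [simp]: "m \<in> M" "a \<in> carrier H" for m a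
    proof -
      have 1: "sw (G (act m a) e) (\<Phi> e) = sw a (\<lambda>a1 a2. sw a2 (\<lambda>b d.
          sw (G m (a1 \<odot> e)) (\<lambda>g1 g2. smult H (c e (\<S> b \<odot> \<S> g1)) (g2 \<odot> d))))" if [simp]: "e \<in> E" for e
      proof -
        have "sw (G (act m a) e) (\<Phi> e) = sw a (\<lambda>a1 a2. sw (G m (a1 \<odot> e) \<odot> a2) (\<Phi> e))"
          unfolding G_twist[OF \<open>m \<in> M\<close> \<open>a \<in> carrier H\<close> E'[OF \<open>e \<in> E\<close>]]
          by (rule linear_sw_carrier[where f = "\<lambda>z. sw z (\<Phi> e)"]) (auto intro!: lin)
        also have "\<dots> = sw a (\<lambda>a1 a2. sw (G m (a1 \<odot> e)) (\<lambda>g1 g2. sw a2 (\<lambda>b d. \<Phi> e (g1 \<odot> b) (g2 \<odot> d))))"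
          by (rule sw_cong, simp, rule sw_mult) (auto intro!: lin)
        also have "\<dots> = sw a (\<lambda>a1 a2. sw a2 (\<lambda>b d. sw (G m (a1 \<odot> e)) (\<lambda>g1 g2. \<Phi> e (g1 \<odot> b) (g2 \<odot> d))))"
          by (rule sw_cong[OF _ sweedler_exchange]) simp
        also have "\<dots> = sw a (\<lambda>a1 a2. sw a2 (\<lambda>b d.
            sw (G m (a1 \<odot> e)) (\<lambda>g1 g2. smult H (c e (\<S> b \<odot> \<S> g1)) (g2 \<odot> d))))"
          by (intro sw_cong) (simp_all add: \<Phi>_def antipode_mult)
        finally show ?thesis .
      qed
      have "p (act m a) = (\<Sum>e\<in>E. sw a (\<lambda>a1 a2. sw a2 (\<lambda>b d.
          sw (G m (a1 \<odot> e)) (\<lambda>g1 g2. smult H (c e (\<S> b \<odot> \<S> g1)) (g2 \<odot> d)))))"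
        unfolding p_def using 1 by simp
      also have "\<dots> = sw a (\<lambda>a1 a2. sw a2 (\<lambda>b d. \<Sum>e\<in>E.
          sw (G m (a1 \<odot> e)) (\<lambda>g1 g2. smult H (c e (\<S> b \<odot> \<S> g1)) (g2 \<odot> d))))"
        by (simp only: sweedler_sum)
      \<comment> \<open>The trace identity carries \<open>a1\<close> from inside G to the place in
        front of \<open>\<S> b\<close>. As \<open>a1\<close> and \<open>b\<close> are consecutive
        factors of \<open>a\<close>, they cancel next, and the last factor \<open>d\<close> becomes
        \<open>a\<close> on the right.\<close>
      also have "\<dots> = sw a (\<lambda>a1 a2. sw a2 (\<lambda>b d. \<Sum>e\<in>E.
          sw (G m e) (\<lambda>g1 g2. smult H (c e (a1 \<odot> \<S> b \<odot> \<S> g1)) (g2 \<odot> d))))"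
        by (intro sw_cong) (simp_all add: trace)
      also have "\<dots> = sw a (\<lambda>u d. sw u (\<lambda>a1 b. \<Sum>e\<in>E.
          sw (G m e) (\<lambda>g1 g2. smult H (c e (a1 \<odot> \<S> b \<odot> \<S> g1)) (g2 \<odot> d))))"
        by (rule sw_coassoc[symmetric]) (auto intro!: lin)
      also have "\<dots> = sw a (\<lambda>u d. smult H (\<epsilon> u) (\<Sum>e\<in>E.
          sw (G m e) (\<lambda>g1 g2. smult H (c e (\<one> \<odot> \<S> g1)) (g2 \<odot> d))))"
        by (rule sw_cong, simp, rule sw_antipode_right[where f = "\<lambda>z. \<Sum>e\<in>E.
          sw (G m e) (\<lambda>g1 g2. smult H (c e (z \<odot> \<S> g1)) (g2 \<odot> _))"]) (auto intro!: lin)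
      also have "\<dots> = (\<Sum>e\<in>E. sw (G m e) (\<lambda>g1 g2. smult H (c e (\<one> \<odot> \<S> g1)) (g2 \<odot> a)))"
        by (rule sw_counit_left[where f = "\<lambda>d. \<Sum>e\<in>E.
          sw (G m e) (\<lambda>g1 g2. smult H (c e (\<one> \<odot> \<S> g1)) (g2 \<odot> d))"]) (auto intro!: lin)
      also have "\<dots> = (\<Sum>e\<in>E. sw (G m e) (\<lambda>g1 g2. \<Phi> e g1 g2 \<odot> a))"
        by (intro sum.cong refl sw_cong) (simp_all add: mult_unit_left \<Phi>_def mult_smult_left)
      also have "\<dots> = (\<Sum>e\<in>E. sw (G m e) (\<Phi> e) \<odot> a)"
        by (intro sum.cong refl mult_sw_left[symmetric]) (simp_all add: \<Phi>_def)
      also have "\<dots> = p m \<odot> a"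
        unfolding p_def
        by (rule linear_from_sum[OF mult_linear_left carrier_subspace vector_space_axioms, symmetric])
          (simp_all add: \<Phi>_def)
      finally show ?thesis .
    qed
    \<comment> \<open>Here G(m, e) = e1 S(e2) = \<epsilon>(e) 1, so the trace reduces to \<epsilon>
      of the basis expansion of the unit.\<close>
    show "p m = \<one>" if [simp]: "m \<in> M" and q: "\<And>x. x \<in> carrier H \<Longrightarrow> q (act m x) = x" for m
    proof -
      have "G m e = smult H (\<epsilon> e) \<one>" if "e \<in> E" for e
      proof -
        have "G m e = sw e (\<lambda>x1 x2. x1 \<odot> \<S> x2)"
          unfolding G_def by (rule sw_cong) (simp_all add: q that)
        then show ?thesis using antipode_right[of e] that by (simp add: sweedler_def)
      qed
      moreover have "sw (smult H k \<one>) (\<Phi> e) = smult H (k * c e \<one>) \<one>" for e k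
      proof -
        have "sw (smult H k \<one>) (\<Phi> e) = smult H k (sw \<one> (\<Phi> e))"
          by (rule sw_smult_arg) (auto intro!: lin)
        also have "sw \<one> (\<Phi> e) = \<Phi> e \<one> \<one>" by (rule sw_unit) (auto intro!: lin)
        finally show ?thesis by (simp add: \<Phi>_def antipode_unit)
      qed
      ultimately have "p m = (\<Sum>e\<in>E. smult H (\<epsilon> e * c e \<one>) \<one>)"
        unfolding p_def by simp
      also have "\<dots> = smult H (\<epsilon> (\<Sum>e\<in>E. smult H (c e \<one>) e)) \<one>"
        by (subst linear_from_sum[OF counit_linear carrier_subspace vector_space_axioms])
          (simp_all add: counit_smult scale_sum_left mult.commute)
      also have "\<dots> = \<one>" by (simp add: c_sum counit_unit)
      finally show ?thesis .
    qed
  qed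
qed

end

subsection \<open>Homomorphisms and Hopf subalgebras\<close>

lemma bilinear_from_comp:
  "bilinear_from W s1 s' \<beta> \<Longrightarrow> linear_from V s s1 f \<Longrightarrow> (\<And>x. x \<in> V \<Longrightarrow> f x \<in> W) \<Longrightarrow>
     bilinear_from V s s' (\<lambda>x y. \<beta> (f x) (f y))"
  by (simp add: linear_from_def bilinear_from_def)

lemma linear_from_projection:
  assumes "vector_space s" "module.subspace s U"
  obtains q where "linear_from V s s q" "\<And>x. q x \<in> U" "\<And>x. x \<in> U \<Longrightarrow> q x = x"
proof -
  obtain q where "Vector_Spaces.linear s s q" "range q = U" "\<And>x. x \<in> U \<Longrightarrow> q x = x"
    using linear_projection[OF assms] by metis
  then show ?thesis using that[of q] linear_from_linear by blast
qed

text \<open>The axioms on the comultiplication are replaced by their pairings with scalar-valued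
  bilinear and trilinear forms, which is enough by \<open>tensor_eqI\<close>. In this form they can
  be checked for Hopf subalgebras, quotients and duals by computing Sweedler sums.\<close>

lemma hopf_algebraI:
  fixes H :: "('k::field, 'a::ab_group_add) hopf"
  assumes vs: "vector_space (smult H)" and sub: "module.subspace (smult H) (carrier H)"
    and mult: "\<And>x y. x \<in> carrier H \<Longrightarrow> y \<in> carrier H \<Longrightarrow> mult H x y \<in> carrier H"
    and unit: "unit H \<in> carrier H"
    and lin_l: "\<And>y. y \<in> carrier H \<Longrightarrow> linear_from (carrier H) (smult H) (smult H) (\<lambda>x. mult H x y)"
    and lin_r: "\<And>x. x \<in> carrier H \<Longrightarrow> linear_from (carrier H) (smult H) (smult H) (mult H x)"
    and assoc: "\<And>x y z. x \<in> carrier H \<Longrightarrow> y \<in> carrier H \<Longrightarrow> z \<in> carrier H \<Longrightarrow>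
         mult H (mult H x y) z = mult H x (mult H y z)"
    and unit_l: "\<And>x. x \<in> carrier H \<Longrightarrow> mult H (unit H) x = x"
    and unit_r: "\<And>x. x \<in> carrier H \<Longrightarrow> mult H x (unit H) = x"
    and comult: "\<And>x. x \<in> carrier H \<Longrightarrow> set (comult H x) \<subseteq> carrier H \<times> carrier H"
    and comult_add: "\<And>x y \<beta>. x \<in> carrier H \<Longrightarrow> y \<in> carrier H \<Longrightarrow>
         bilinear_from (carrier H) (smult H) (*) (\<beta> :: 'a \<Rightarrow> 'a \<Rightarrow> 'k) \<Longrightarrow>
         sweedler H (x + y) \<beta> = sweedler H x \<beta> + sweedler H y \<beta>"
    and comult_smult: "\<And>c x \<beta>. x \<in> carrier H \<Longrightarrow>
         bilinear_from (carrier H) (smult H) (*) (\<beta> :: 'a \<Rightarrow> 'a \<Rightarrow> 'k) \<Longrightarrow>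
         sweedler H (smult H c x) \<beta> = c * sweedler H x \<beta>"
    and comult_unit: "\<And>\<beta>. bilinear_from (carrier H) (smult H) (*) (\<beta> :: 'a \<Rightarrow> 'a \<Rightarrow> 'k) \<Longrightarrow>
         sweedler H (unit H) \<beta> = \<beta> (unit H) (unit H)"
    and comult_mult: "\<And>x y \<beta>. x \<in> carrier H \<Longrightarrow> y \<in> carrier H \<Longrightarrow>
         bilinear_from (carrier H) (smult H) (*) (\<beta> :: 'a \<Rightarrow> 'a \<Rightarrow> 'k) \<Longrightarrow>
         sweedler H (mult H x y) \<beta> =
           sweedler H x (\<lambda>a b. sweedler H y (\<lambda>c d. \<beta> (mult H a c) (mult H b d)))"
    and coassoc: "\<And>x \<tau>. x \<in> carrier H \<Longrightarrow>
         trilinear_from (carrier H) (smult H) (*) (\<tau> :: 'a \<Rightarrow> 'a \<Rightarrow> 'a \<Rightarrow> 'k) \<Longrightarrow>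
         sweedler H x (\<lambda>u c. sweedler H u (\<lambda>a b. \<tau> a b c)) =
           sweedler H x (\<lambda>a u. sweedler H u (\<lambda>b c. \<tau> a b c))"
    and counit: "linear_from (carrier H) (smult H) (*) (counit H)" "counit H (unit H) = 1"
      "\<And>x y. x \<in> carrier H \<Longrightarrow> y \<in> carrier H \<Longrightarrow> counit H (mult H x y) = counit H x * counit H y"
    and counit_l: "\<And>x. x \<in> carrier H \<Longrightarrow> sweedler H x (\<lambda>a b. smult H (counit H a) b) = x"
    and counit_r: "\<And>x. x \<in> carrier H \<Longrightarrow> sweedler H x (\<lambda>a b. smult H (counit H b) a) = x"
    and S: "\<And>x. x \<in> carrier H \<Longrightarrow> antipode H x \<in> carrier H"
      "linear_from (carrier H) (smult H) (smult H) (antipode H)"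
    and S_l: "\<And>x. x \<in> carrier H \<Longrightarrow>
         sweedler H x (\<lambda>a b. mult H (antipode H a) b) = smult H (counit H x) (unit H)"
    and S_r: "\<And>x. x \<in> carrier H \<Longrightarrow>
         sweedler H x (\<lambda>a b. mult H a (antipode H b)) = smult H (counit H x) (unit H)"
  shows "hopf_algebra H"
proof (intro hopf_algebra.intro hopf_algebra_axioms.intro vs sub mult unit lin_l lin_r assoc unit_l
    unit_r comult counit S)
  interpret vector_space "smult H" by fact
  show "tensor_eq (smult H) (carrier H) (pair_tensor (comult H (x + y)))
           (pair_tensor (comult H x @ comult H y))" if "x \<in> carrier H" "y \<in> carrier H" for x y
    unfolding tensor_eq_pair_iff using comult_add[OF that] by (simp add: sweedler_def)
  show "tensor_eq (smult H) (carrier H) (pair_tensor (comult H (smult H c x)))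
           [[smult H c x1, x2]. (x1, x2) \<leftarrow> comult H x]" if x: "x \<in> carrier H" for c x
  proof (rule tensor_eqI)
    fix \<phi> :: "'a list \<Rightarrow> 'k" assume "multilinear_on (carrier H) (smult H) (*) \<phi>"
    then have bil: "bilinear_from (carrier H) (smult H) (*) (\<lambda>x y. \<phi> [x, y])"
      by (rule multilinear_on_imp_bilinear_from)
    have "(\<Sum>t\<leftarrow>comult H x. \<phi> [smult H c (fst t), snd t]) = (\<Sum>t\<leftarrow>comult H x. c * \<phi> [fst t, snd t])"
      using comult[OF x] bil by (intro arg_cong[where f = sum_list] map_cong refl)
        (auto simp: bilinear_from_def linear_from_def)
    then show "(\<Sum>t\<leftarrow>pair_tensor (comult H (smult H c x)). \<phi> t) =
        (\<Sum>t\<leftarrow>[[smult H c x1, x2]. (x1, x2) \<leftarrow> comult H x]. \<phi> t)"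
      using comult_smult[OF x bil] by (simp add: sweedler_def comp_def case_prod_unfold
          sum_list_const_mult)
  qed
  show "tensor_eq (smult H) (carrier H) (pair_tensor (comult H (unit H))) [[unit H, unit H]]"
  proof (rule tensor_eqI)
    fix \<phi> :: "'a list \<Rightarrow> 'k" assume "multilinear_on (carrier H) (smult H) (*) \<phi>"
    from comult_unit[OF multilinear_on_imp_bilinear_from[OF this]]
    show "(\<Sum>t\<leftarrow>pair_tensor (comult H (unit H)). \<phi> t) = (\<Sum>t\<leftarrow>[[unit H, unit H]]. \<phi> t)"
      by (simp add: sweedler_def comp_def case_prod_unfold)
  qed
  show "tensor_eq (smult H) (carrier H) (pair_tensor (comult H (mult H x y)))
           [[mult H x1 y1, mult H x2 y2]. (x1, x2) \<leftarrow> comult H x, (y1, y2) \<leftarrow> comult H y]"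
    if "x \<in> carrier H" "y \<in> carrier H" for x y
  proof (rule tensor_eqI)
    fix \<phi> :: "'a list \<Rightarrow> 'k" assume "multilinear_on (carrier H) (smult H) (*) \<phi>"
    from comult_mult[OF that multilinear_on_imp_bilinear_from[OF this]]
    show "(\<Sum>t\<leftarrow>pair_tensor (comult H (mult H x y)). \<phi> t) = (\<Sum>t\<leftarrow>
        [[mult H x1 y1, mult H x2 y2]. (x1, x2) \<leftarrow> comult H x, (y1, y2) \<leftarrow> comult H y]. \<phi> t)"
      by (simp add: sweedler_def comp_def case_prod_unfold sum_list_concat_map)
  qed
  show "tensor_eq (smult H) (carrier H)
           [[y1, y2, x2]. (x1, x2) \<leftarrow> comult H x, (y1, y2) \<leftarrow> comult H x1]
           [[x1, y1, y2]. (x1, x2) \<leftarrow> comult H x, (y1, y2) \<leftarrow> comult H x2]" if "x \<in> carrier H" for x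
  proof (rule tensor_eqI)
    fix \<phi> :: "'a list \<Rightarrow> 'k" assume "multilinear_on (carrier H) (smult H) (*) \<phi>"
    from coassoc[OF that multilinear_on_imp_trilinear_from[OF this]]
    show "(\<Sum>t\<leftarrow>[[y1, y2, x2]. (x1, x2) \<leftarrow> comult H x, (y1, y2) \<leftarrow> comult H x1]. \<phi> t) =
        (\<Sum>t\<leftarrow>[[x1, y1, y2]. (x1, x2) \<leftarrow> comult H x, (y1, y2) \<leftarrow> comult H x2]. \<phi> t)"
      by (simp add: sweedler_def comp_def case_prod_unfold sum_list_concat_map)
  qed
qed (use counit_l counit_r S_l S_r in \<open>simp_all add: sweedler_def\<close>)

lemma hopf_homD:
  assumes "hopf_hom H Q f"
  shows "hopf_algebra H" "hopf_algebra Q" "\<And>x. x \<in> carrier H \<Longrightarrow> f x \<in> carrier Q"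
    "linear_from (carrier H) (smult H) (smult Q) f"
    "\<And>x y. x \<in> carrier H \<Longrightarrow> y \<in> carrier H \<Longrightarrow> f (mult H x y) = mult Q (f x) (f y)"
    "f (unit H) = unit Q" "\<And>x. x \<in> carrier H \<Longrightarrow> counit Q (f x) = counit H x"
    "\<And>x. x \<in> carrier H \<Longrightarrow> f (antipode H x) = antipode Q (f x)"
  using assms by (auto simp: hopf_hom_def)

lemma hopf_hom_sweedler:
  fixes \<beta> :: "'b::ab_group_add \<Rightarrow> 'b \<Rightarrow> 'c::ab_group_add"
  assumes "hopf_hom H Q f" "bilinear_from (carrier Q) (smult Q) s' \<beta>" "vector_space s'"
    and "x \<in> carrier H"
  shows "sweedler Q (f x) \<beta> = sweedler H x (\<lambda>a b. \<beta> (f a) (f b))"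
proof -
  have "tensor_eq (smult Q) (carrier Q)
        (pair_tensor (comult Q (f x))) [[f x1, f x2]. (x1, x2) \<leftarrow> comult H x]"
    using assms(1,4) by (simp add: hopf_hom_def)
  from tensor_eq_imp_sum_eq[OF this multilinear_on_pairs[OF assms(2,3)] assms(3)]
  show ?thesis by (simp add: sweedler_def comp_def case_prod_unfold)
qed

lemma hopf_homI:
  fixes H :: "('k::field, 'a::ab_group_add) hopf" and Q :: "('k, 'b::ab_group_add) hopf"
  assumes "hopf_algebra H" "hopf_algebra Q" "\<And>x. x \<in> carrier H \<Longrightarrow> f x \<in> carrier Q"
    "linear_from (carrier H) (smult H) (smult Q) f"
    "\<And>x y. x \<in> carrier H \<Longrightarrow> y \<in> carrier H \<Longrightarrow> f (mult H x y) = mult Q (f x) (f y)"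
    "f (unit H) = unit Q" "\<And>x. x \<in> carrier H \<Longrightarrow> counit Q (f x) = counit H x"
    "\<And>x. x \<in> carrier H \<Longrightarrow> f (antipode H x) = antipode Q (f x)"
    and sw: "\<And>x \<beta>. x \<in> carrier H \<Longrightarrow> bilinear_from (carrier Q) (smult Q) (*) (\<beta> :: 'b \<Rightarrow> 'b \<Rightarrow> 'k) \<Longrightarrow>
      sweedler Q (f x) \<beta> = sweedler H x (\<lambda>a b. \<beta> (f a) (f b))"
  shows "hopf_hom H Q f"
  unfolding hopf_hom_def
proof (intro conjI ballI)
  show "tensor_eq (smult Q) (carrier Q)
        (pair_tensor (comult Q (f x))) [[f x1, f x2]. (x1, x2) \<leftarrow> comult H x]"
    if "x \<in> carrier H" for x
  proof (rule tensor_eqI)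
    fix \<phi> :: "'b list \<Rightarrow> 'k" assume "multilinear_on (carrier Q) (smult Q) (*) \<phi>"
    from sw[OF that multilinear_on_imp_bilinear_from[OF this]]
    show "(\<Sum>t\<leftarrow>pair_tensor (comult Q (f x)). \<phi> t) =
        (\<Sum>t\<leftarrow>[[f x1, f x2]. (x1, x2) \<leftarrow> comult H x]. \<phi> t)"
      by (simp add: sweedler_def comp_def case_prod_unfold)
  qed
qed (use assms in auto)

lemma hopf_hom_comp:
  fixes H :: "('k::field, 'a::ab_group_add) hopf" and Q :: "('k, 'b::ab_group_add) hopf"
    and R :: "('k, 'c::ab_group_add) hopf"
  assumes f: "hopf_hom H Q f" and g: "hopf_hom Q R g"
  shows "hopf_hom H R (\<lambda>x. g (f x))"
proof (rule hopf_homI)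
  fix x and \<beta> :: "'c \<Rightarrow> 'c \<Rightarrow> 'k"
  assume x: "x \<in> carrier H" and \<beta>: "bilinear_from (carrier R) (smult R) (*) \<beta>"
  have "bilinear_from (carrier Q) (smult Q) (*) (\<lambda>a b. \<beta> (g a) (g b))"
    by (rule bilinear_from_comp[OF \<beta> hopf_homD(4,3)[OF g]])
  from hopf_hom_sweedler[OF f this vector_space_field x]
  show "sweedler R (g (f x)) \<beta> = sweedler H x (\<lambda>a b. \<beta> (g (f a)) (g (f b)))"
    using hopf_hom_sweedler[OF g \<beta> vector_space_field] hopf_homD(3)[OF f x] by simp
qed (use hopf_homD[OF f] hopf_homD[OF g] in \<open>auto intro: linear_from_comp\<close>)

lemma hopf_hom_id: "hopf_algebra H \<Longrightarrow> hopf_hom H H (\<lambda>x. x)"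
  by (rule hopf_homI) (auto intro: lin)

lemma linear_from_inverse:
  assumes f: "linear_from V s s' f" and V: "module.subspace s V" "vector_space s"
    and bij: "bij_betw f V W" and g: "\<And>x. x \<in> V \<Longrightarrow> g (f x) = x"
  shows "linear_from W s' s g"
proof -
  interpret vector_space s by fact
  have W: "W = f ` V" using bij by (simp add: bij_betw_def)
  show ?thesis unfolding linear_from_def W
  proof (intro conjI ballI allI; (elim imageE)?)
    fix x y x' y' assume "x = f x'" "x' \<in> V" "y = f y'" "y' \<in> V"
    then show "g (x + y) = g x + g y"
      using linear_from_add[OF f, of x' y'] g[OF subspace_add[OF V(1), of x' y']] g by simp
  next
    fix c x x' assume "x = f x'" "x' \<in> V"
    then show "g (s' c x) = s c (g x)"
      using linear_from_scale[OF f, of x' c] g[OF subspace_scale[OF V(1), of x' c]] g by simp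
  qed
qed

lemma hopf_hom_inverse:
  fixes H :: "('k::field, 'a::ab_group_add) hopf" and Q :: "('k, 'b::ab_group_add) hopf"
  assumes f: "hopf_hom H Q f" and bij: "bij_betw f (carrier H) (carrier Q)"
    and g: "\<And>x. x \<in> carrier H \<Longrightarrow> g (f x) = x"
  shows "hopf_hom Q H g"
proof -
  interpret H: hopf_algebra H using f by (rule hopf_homD)
  note fD = hopf_homD[OF f]
  have Q: "carrier Q = f ` carrier H" using bij by (simp add: bij_betw_def)
  have gc: "g y \<in> carrier H" if "y \<in> carrier Q" for y using that g unfolding Q by auto
  have fg: "f (g y) = y" if "y \<in> carrier Q" for y using that g unfolding Q by auto
  have g_lin: "linear_from (carrier Q) (smult Q) (smult H) g"
    by (rule linear_from_inverse[OF fD(4) H.carrier_subspace H.vector_space_axioms bij g])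
  show ?thesis
  proof (rule hopf_homI)
    fix y and \<beta> :: "'a \<Rightarrow> 'a \<Rightarrow> 'k"
    assume y: "y \<in> carrier Q" and \<beta>: "bilinear_from (carrier H) (smult H) (*) \<beta>"
    have "bilinear_from (carrier Q) (smult Q) (*) (\<lambda>a b. \<beta> (g a) (g b))"
      by (rule bilinear_from_comp[OF \<beta> g_lin gc])
    from hopf_hom_sweedler[OF f this vector_space_field gc[OF y]]
    have "sweedler Q y (\<lambda>a b. \<beta> (g a) (g b)) = sweedler H (g y) (\<lambda>a b. \<beta> (g (f a)) (g (f b)))"
      by (simp add: fg y)
    also have "\<dots> = sweedler H (g y) \<beta>" by (rule H.sw_cong[OF gc[OF y]]) (simp add: g)
    finally show "sweedler H (g y) \<beta> = sweedler Q y (\<lambda>a b. \<beta> (g a) (g b))" by simp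
  next
    show "g (mult Q x y) = mult H (g x) (g y)" if "x \<in> carrier Q" "y \<in> carrier Q" for x y
      using that fD(5)[of "g x" "g y"] gc fg g[of "mult H (g x) (g y)"] by simp
    show "g (unit Q) = unit H" using fD(6) g[of "unit H"] by simp
    show "counit H (g x) = counit Q x" if "x \<in> carrier Q" for x
      using fD(7)[OF gc[OF that]] fg[OF that] by simp
    show "g (antipode Q x) = antipode H (g x)" if "x \<in> carrier Q" for x
      using fD(8)[OF gc[OF that]] fg[OF that] g[of "antipode H (g x)"] gc[OF that] by simp
  qed (use fD g_lin gc in auto)
qed

lemma hopf_iso_refl: "hopf_algebra H \<Longrightarrow> hopf_iso H H"
  unfolding hopf_iso_def using hopf_hom_id bij_betw_id[unfolded id_def] by blast

lemma hopf_iso_sym: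
  assumes "hopf_iso H Q"
  shows "hopf_iso Q H"
proof -
  obtain f where f: "hopf_hom H Q f" "bij_betw f (carrier H) (carrier Q)"
    using assms by (auto simp: hopf_iso_def)
  have "hopf_hom Q H (inv_into (carrier H) f)"
    by (rule hopf_hom_inverse[OF f]) (use f(2) in \<open>simp add: bij_betw_def\<close>)
  then show ?thesis unfolding hopf_iso_def using bij_betw_inv_into[OF f(2)] by blast
qed

lemma hopf_iso_trans: "hopf_iso H Q \<Longrightarrow> hopf_iso Q R \<Longrightarrow> hopf_iso H R"
  unfolding hopf_iso_def using hopf_hom_comp bij_betw_trans[unfolded comp_def] by metis

section \<open>Hopf subalgebras as Hopf algebras\<close>

lemma sub_hopf_simps [simp]:
  "carrier (sub_hopf H A) = A" "smult (sub_hopf H A) = smult H" "mult (sub_hopf H A) = mult H"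
  "unit (sub_hopf H A) = unit H" "counit (sub_hopf H A) = counit H"
  "antipode (sub_hopf H A) = antipode H"
  by (simp_all add: sub_hopf_def)

lemma hopf_subalgebraD:
  assumes "hopf_subalgebra H A"
  shows "hopf_algebra H" "A \<subseteq> carrier H" "module.subspace (smult H) A" "unit H \<in> A"
    "\<And>x y. x \<in> A \<Longrightarrow> y \<in> A \<Longrightarrow> mult H x y \<in> A" "\<And>x. x \<in> A \<Longrightarrow> antipode H x \<in> A"
  using assms by (auto simp: hopf_subalgebra_def)

text \<open>Over a field the tensor square of \<open>U\<close> embeds into that of \<open>V\<close>:
  a form on \<open>U\<close> extends to \<open>V\<close> by composition with a linear projection
  onto \<open>U\<close>.\<close>

lemma tensor_eq_restrict:
  fixes s :: "'k::field \<Rightarrow> 'a::ab_group_add \<Rightarrow> 'a"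
  assumes "vector_space s" "module.subspace s U" "set t \<subseteq> U \<times> U" "set u \<subseteq> U \<times> U"
    and eq: "tensor_eq s V (pair_tensor t) (pair_tensor u)"
  shows "tensor_eq s U (pair_tensor t) (pair_tensor u)"
  unfolding tensor_eq_pair_iff
proof (intro allI impI)
  fix \<beta> :: "'a \<Rightarrow> 'a \<Rightarrow> 'k" assume \<beta>: "bilinear_from U s (*) \<beta>"
  obtain q where q: "Vector_Spaces.linear s s q" "range q = U" "\<And>x. x \<in> U \<Longrightarrow> q x = x"
    using linear_projection[OF assms(1,2)] by metis
  have "bilinear_from V s (*) (\<lambda>x y. \<beta> (q x) (q y))"
    by (rule bilinear_from_comp[OF \<beta> linear_from_linear[OF q(1)]]) (use q(2) in auto)
  then have "(\<Sum>(x, y)\<leftarrow>t. \<beta> (q x) (q y)) = (\<Sum>(x, y)\<leftarrow>u. \<beta> (q x) (q y))"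
    using eq by (simp add: tensor_eq_pair_iff)
  moreover have "(\<Sum>(x, y)\<leftarrow>t. \<beta> (q x) (q y)) = (\<Sum>(x, y)\<leftarrow>t. \<beta> x y)" if "set t \<subseteq> U \<times> U" for t
    using that q(3) by (intro arg_cong[where f = sum_list] map_cong refl) auto
  ultimately show "(\<Sum>(x, y)\<leftarrow>t. \<beta> x y) = (\<Sum>(x, y)\<leftarrow>u. \<beta> x y)"
    using assms(3,4) by simp
qed

lemma sub_hopf_comult:
  assumes "hopf_subalgebra H A" "x \<in> A"
  shows "set (comult (sub_hopf H A) x) \<subseteq> A \<times> A"
    "tensor_eq (smult H) (carrier H) (pair_tensor (comult H x)) (pair_tensor (comult (sub_hopf H A) x))"
proof -
  have "\<exists>t. set t \<subseteq> A \<times> A \<and> tensor_eq (smult H) (carrier H) (pair_tensor (comult H x)) (pair_tensor t)"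
    using assms by (simp add: hopf_subalgebra_def)
  from someI_ex[OF this] show "set (comult (sub_hopf H A) x) \<subseteq> A \<times> A"
    "tensor_eq (smult H) (carrier H) (pair_tensor (comult H x)) (pair_tensor (comult (sub_hopf H A) x))"
    by (simp_all add: sub_hopf_def)
qed

text \<open>The list selected for \<open>sub_hopf H A\<close> denotes the same tensor over
  \<open>H\<close> as \<open>comult H x\<close>, and a form bilinear on the whole carrier sees only
  this tensor.\<close>

lemma sweedler_sub_hopf:
  fixes \<beta> :: "'a::ab_group_add \<Rightarrow> 'a \<Rightarrow> 'b::ab_group_add"
  assumes "hopf_subalgebra H A" "x \<in> A"
    and "bilinear_from (carrier H) (smult H) s' \<beta>" "vector_space s'"
  shows "sweedler (sub_hopf H A) x \<beta> = sweedler H x \<beta>"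
  using tensor_eq_imp_sum_eq[OF sub_hopf_comult(2)[OF assms(1,2)] multilinear_on_pairs[OF assms(3,4)] assms(4)]
  by (simp add: sweedler_def comp_def case_prod_unfold)

text \<open>The reason for passing to \<open>sub_hopf H A\<close> in computations: there the
  Sweedler factors of an element of \<open>A\<close> may be assumed to lie in \<open>A\<close>, so
  identities valid only on \<open>A\<close> can be used before returning to
  \<open>H\<close>.\<close>

lemma sweedler_sub_hopf_cong:
  assumes "hopf_subalgebra H A" "x \<in> A" "\<And>a b. a \<in> A \<Longrightarrow> b \<in> A \<Longrightarrow> \<beta> a b = \<gamma> a b"
  shows "sweedler (sub_hopf H A) x \<beta> = sweedler (sub_hopf H A) x \<gamma>"
  unfolding sweedler_def
  by (rule arg_cong[where f = sum_list], rule map_cong)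
    (use assms(3) sub_hopf_comult(1)[OF assms(1,2)] in \<open>auto simp: case_prod_unfold\<close>)

lemma sweedler_sub_hopf_projection:
  fixes \<beta> :: "'a::ab_group_add \<Rightarrow> 'a \<Rightarrow> 'b::ab_group_add"
  assumes A: "hopf_subalgebra H A" and x: "x \<in> A"
    and \<beta>: "bilinear_from A (smult H) s' \<beta>" "vector_space s'"
    and q: "linear_from (carrier H) (smult H) (smult H) q" "\<And>x. x \<in> carrier H \<Longrightarrow> q x \<in> A"
      "\<And>x. x \<in> A \<Longrightarrow> q x = x"
  shows "sweedler (sub_hopf H A) x \<beta> = sweedler H x (\<lambda>a b. \<beta> (q a) (q b))"
    "bilinear_from (carrier H) (smult H) s' (\<lambda>a b. \<beta> (q a) (q b))"
proof -
  show bil: "bilinear_from (carrier H) (smult H) s' (\<lambda>a b. \<beta> (q a) (q b))"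
    by (rule bilinear_from_comp[OF \<beta>(1) q(1,2)])
  have "sweedler (sub_hopf H A) x \<beta> = sweedler (sub_hopf H A) x (\<lambda>a b. \<beta> (q a) (q b))"
    by (rule sweedler_sub_hopf_cong[OF A x]) (simp add: q)
  also have "\<dots> = sweedler H x (\<lambda>a b. \<beta> (q a) (q b))"
    by (rule sweedler_sub_hopf[OF A x bil \<beta>(2)])
  finally show "sweedler (sub_hopf H A) x \<beta> = sweedler H x (\<lambda>a b. \<beta> (q a) (q b))" .
qed

text \<open>A form that is given on \<open>A\<close> only is composed with a linear projection
  \<open>q\<close> onto \<open>A\<close>. It then becomes a form on \<open>H\<close>, to which the
  axioms of \<open>H\<close> apply, and \<open>q\<close> disappears again on factors from
  \<open>A\<close>.\<close>

lemma hopf_algebra_sub_hopf: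
  fixes H :: "('k::field, 'a::ab_group_add) hopf"
  assumes A: "hopf_subalgebra H A"
  shows "hopf_algebra (sub_hopf H A)"
proof -
  note AD = hopf_subalgebraD[OF A]
  interpret H: hopf_algebra H by (rule AD)
  have AH [simp]: "x \<in> A \<Longrightarrow> x \<in> carrier H" for x using AD(2) by blast
  obtain q where q: "linear_from (carrier H) (smult H) (smult H) q"
      "\<And>x. x \<in> carrier H \<Longrightarrow> q x \<in> A" "\<And>x. x \<in> A \<Longrightarrow> q x = x"
    using linear_from_projection[OF H.vector_space_axioms AD(3)] by metis
  note proj = sweedler_sub_hopf_projection[OF A _ _ _ q]
  show ?thesis
  proof (rule hopf_algebraI; (unfold sub_hopf_simps)?)
    fix x assume "x \<in> A"
    then show "set (comult (sub_hopf H A) x) \<subseteq> A \<times> A"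
      by (rule sub_hopf_comult[OF A])
  next
    fix x y and \<beta> :: "'a \<Rightarrow> 'a \<Rightarrow> 'k"
    assume xy: "x \<in> A" "y \<in> A" and \<beta>: "bilinear_from A (smult H) (*) \<beta>"
    note bil = proj(2)[OF xy(1) \<beta> vector_space_field]
    note [simp] = proj(1)[OF _ \<beta> vector_space_field]
    have [simp]: "x + y \<in> A" "mult H x y \<in> A"
      using xy AD(3,5) by (auto simp: H.subspace_add)
    show "sweedler (sub_hopf H A) (x + y) \<beta> =
        sweedler (sub_hopf H A) x \<beta> + sweedler (sub_hopf H A) y \<beta>"
      using xy by (simp add: H.sw_add_arg[OF bil vector_space_field])
    have inner: "sweedler (sub_hopf H A) y (\<lambda>c d. \<beta> (mult H a c) (mult H b d)) =
        sweedler H y (\<lambda>c d. \<beta> (q (mult H a c)) (q (mult H b d)))" if "a \<in> A" "b \<in> A" for a b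
    proof -
      have "sweedler (sub_hopf H A) y (\<lambda>c d. \<beta> (mult H a c) (mult H b d)) =
          sweedler (sub_hopf H A) y (\<lambda>c d. \<beta> (q (mult H a c)) (q (mult H b d)))"
        by (rule sweedler_sub_hopf_cong[OF A xy(2)]) (simp add: q that AD(5))
      also have "\<dots> = sweedler H y (\<lambda>c d. \<beta> (q (mult H a c)) (q (mult H b d)))"
        by (rule sweedler_sub_hopf[OF A xy(2)])
          (use that in \<open>auto intro!: lin bilinear_from_comp_left[OF bil] bilinear_from_comp_right[OF bil]\<close>)
      finally show ?thesis .
    qed
    have "sweedler (sub_hopf H A) (mult H x y) \<beta> =
        sweedler H x (\<lambda>a b. sweedler H y (\<lambda>c d. \<beta> (q (mult H a c)) (q (mult H b d))))"
      using xy by (simp add: H.sw_mult[OF bil vector_space_field])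
    also have "\<dots> = sweedler (sub_hopf H A) x (\<lambda>a b. sweedler H y (\<lambda>c d. \<beta> (q (mult H a c)) (q (mult H b d))))"
      by (rule sweedler_sub_hopf[OF A xy(1), symmetric])
        (use xy(2) in \<open>auto intro!: lin bilinear_from_comp_left[OF bil] bilinear_from_comp_right[OF bil]\<close>)
    also have "\<dots> = sweedler (sub_hopf H A) x (\<lambda>a b. sweedler (sub_hopf H A) y (\<lambda>c d. \<beta> (mult H a c) (mult H b d)))"
      by (rule sweedler_sub_hopf_cong[OF A xy(1)]) (simp add: inner)
    finally show "sweedler (sub_hopf H A) (mult H x y) \<beta> =
        sweedler (sub_hopf H A) x (\<lambda>a b. sweedler (sub_hopf H A) y (\<lambda>c d. \<beta> (mult H a c) (mult H b d)))" .
  next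
    fix c x and \<beta> :: "'a \<Rightarrow> 'a \<Rightarrow> 'k"
    assume x: "x \<in> A" and \<beta>: "bilinear_from A (smult H) (*) \<beta>"
    note bil = proj(2)[OF x \<beta> vector_space_field]
    have "smult H c x \<in> A" using x AD(3) by (simp add: H.subspace_scale)
    then show "sweedler (sub_hopf H A) (smult H c x) \<beta> = c * sweedler (sub_hopf H A) x \<beta>"
      using x by (simp add: proj(1)[OF _ \<beta> vector_space_field] H.sw_smult_arg[OF bil vector_space_field])
  next
    fix \<beta> :: "'a \<Rightarrow> 'a \<Rightarrow> 'k"
    assume \<beta>: "bilinear_from A (smult H) (*) \<beta>"
    note bil = proj(2)[OF AD(4) \<beta> vector_space_field]
    show "sweedler (sub_hopf H A) (unit H) \<beta> = \<beta> (unit H) (unit H)"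
      by (simp add: proj(1)[OF AD(4) \<beta> vector_space_field] H.sw_unit[OF bil vector_space_field] q AD(4))
  next
    fix x and \<tau> :: "'a \<Rightarrow> 'a \<Rightarrow> 'a \<Rightarrow> 'k"
    assume x: "x \<in> A" and \<tau>: "trilinear_from A (smult H) (*) \<tau>"
    have tri: "trilinear_from (carrier H) (smult H) (*) (\<lambda>a b c. \<tau> (q a) (q b) (q c))"
      using q by (auto intro!: trilinear_fromI trilinear_from_comp[OF \<tau>])
    note [lin] = trilinear_from_comp[OF tri]
    have "sweedler (sub_hopf H A) x (\<lambda>u c. sweedler (sub_hopf H A) u (\<lambda>a b. \<tau> a b c)) =
        sweedler (sub_hopf H A) x (\<lambda>u c. sweedler H u (\<lambda>a b. \<tau> (q a) (q b) (q c)))"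
      using q(3) \<tau> by (intro sweedler_sub_hopf_cong[OF A x])
        (auto simp: trilinear_from_def intro!: proj(1) bilinear_fromI vector_space_field)
    also have "\<dots> = sweedler H x (\<lambda>u c. sweedler H u (\<lambda>a b. \<tau> (q a) (q b) (q c)))"
      by (rule sweedler_sub_hopf[OF A x]) (auto intro!: lin)
    also have "\<dots> = sweedler H x (\<lambda>a u. sweedler H u (\<lambda>b c. \<tau> (q a) (q b) (q c)))"
      using x by (intro H.sw_coassoc[OF tri vector_space_field]) simp
    also have "\<dots> = sweedler (sub_hopf H A) x (\<lambda>a u. sweedler H u (\<lambda>b c. \<tau> (q a) (q b) (q c)))"
      by (rule sweedler_sub_hopf[OF A x, symmetric]) (auto intro!: lin)
    also have "\<dots> = sweedler (sub_hopf H A) x (\<lambda>a u. sweedler (sub_hopf H A) u (\<lambda>b c. \<tau> a b c))"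
      using q(3) \<tau> by (intro sweedler_sub_hopf_cong[OF A x])
        (auto simp: trilinear_from_def intro!: proj(1)[symmetric] bilinear_fromI vector_space_field)
    finally show "sweedler (sub_hopf H A) x (\<lambda>u c. sweedler (sub_hopf H A) u (\<lambda>a b. \<tau> a b c)) =
        sweedler (sub_hopf H A) x (\<lambda>a u. sweedler (sub_hopf H A) u (\<lambda>b c. \<tau> a b c))" .
  next
    fix x assume x: "x \<in> A"
    have "sweedler (sub_hopf H A) x (\<lambda>a b. smult H (counit H a) b) = sweedler H x (\<lambda>a b. smult H (counit H a) b)"
      by (rule sweedler_sub_hopf[OF A x]) (auto intro!: lin)
    then show "sweedler (sub_hopf H A) x (\<lambda>a b. smult H (counit H a) b) = x"
      using H.counit_left[of x] x by (simp add: sweedler_def)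
    have "sweedler (sub_hopf H A) x (\<lambda>a b. smult H (counit H b) a) = sweedler H x (\<lambda>a b. smult H (counit H b) a)"
      by (rule sweedler_sub_hopf[OF A x]) (auto intro!: lin)
    then show "sweedler (sub_hopf H A) x (\<lambda>a b. smult H (counit H b) a) = x"
      using H.counit_right[of x] x by (simp add: sweedler_def)
    have "sweedler (sub_hopf H A) x (\<lambda>a b. mult H (antipode H a) b) = sweedler H x (\<lambda>a b. mult H (antipode H a) b)"
      by (rule sweedler_sub_hopf[OF A x]) (auto intro!: lin)
    then show "sweedler (sub_hopf H A) x (\<lambda>a b. mult H (antipode H a) b) = smult H (counit H x) (unit H)"
      using H.antipode_left[of x] x by (simp add: sweedler_def)
    have "sweedler (sub_hopf H A) x (\<lambda>a b. mult H a (antipode H b)) = sweedler H x (\<lambda>a b. mult H a (antipode H b))"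
      by (rule sweedler_sub_hopf[OF A x]) (auto intro!: lin)
    then show "sweedler (sub_hopf H A) x (\<lambda>a b. mult H a (antipode H b)) = smult H (counit H x) (unit H)"
      using H.antipode_right[of x] x by (simp add: sweedler_def)
  qed (use AD H.mult_assoc H.counit_unit H.counit_mult H.mult_unit_left H.mult_unit_right
      H.vector_space_axioms linear_from_subset[OF H.mult_linear_left AD(2)]
      linear_from_subset[OF H.mult_linear_right AD(2)] linear_from_subset[OF H.counit_linear AD(2)]
      linear_from_subset[OF H.antipode_linear AD(2)] in auto)
qed

lemma hopf_hom_inclusion:
  assumes A: "hopf_subalgebra H A"
  shows "hopf_hom (sub_hopf H A) H (\<lambda>x. x)"
  by (rule hopf_homI)
    (use hopf_subalgebraD[OF A] hopf_algebra_sub_hopf[OF A] in \<open>auto intro: linear_from_id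
      sweedler_sub_hopf[OF A _ _ vector_space_field, symmetric]\<close>)

lemma hopf_hom_corestrict:
  fixes H :: "('k::field, 'a::ab_group_add) hopf" and Q :: "('k, 'b::ab_group_add) hopf"
  assumes f: "hopf_hom H Q f" and B: "hopf_subalgebra Q B" and fB: "f ` carrier H \<subseteq> B"
  shows "hopf_hom H (sub_hopf Q B) f"
proof -
  note fD = hopf_homD[OF f]
  interpret H: hopf_algebra H by (rule fD)
  interpret Q: hopf_algebra Q by (rule fD)
  obtain q where q: "linear_from (carrier Q) (smult Q) (smult Q) q"
      "\<And>x. x \<in> carrier Q \<Longrightarrow> q x \<in> B" "\<And>x. x \<in> B \<Longrightarrow> q x = x"
    using linear_from_projection[OF Q.vector_space_axioms hopf_subalgebraD(3)[OF B]] by metis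
  show ?thesis
  proof (rule hopf_homI)
    fix x and \<beta> :: "'b \<Rightarrow> 'b \<Rightarrow> 'k"
    assume x: "x \<in> carrier H"
      and \<beta>: "bilinear_from (carrier (sub_hopf Q B)) (smult (sub_hopf Q B)) (*) \<beta>"
    have fx: "f x \<in> B" using x fB by blast
    note proj = sweedler_sub_hopf_projection[OF B fx \<beta>[simplified] vector_space_field q]
    have "sweedler (sub_hopf Q B) (f x) \<beta> = sweedler H x (\<lambda>a b. \<beta> (q (f a)) (q (f b)))"
      by (rule trans[OF proj(1) hopf_hom_sweedler[OF f proj(2) vector_space_field x]])
    also have "\<dots> = sweedler H x (\<lambda>a b. \<beta> (f a) (f b))"
      by (rule H.sw_cong[OF x]) (use q(3) fB in \<open>simp add: image_subset_iff\<close>)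
    finally show "sweedler (sub_hopf Q B) (f x) \<beta> = sweedler H x (\<lambda>a b. \<beta> (f a) (f b))" .
  qed (use fD fB hopf_algebra_sub_hopf[OF B] in auto)
qed

lemma hopf_subalgebra_image:
  assumes f: "hopf_hom H Q f"
  shows "hopf_subalgebra Q (f ` carrier H)"
proof -
  note fD = hopf_homD[OF f]
  interpret H: hopf_algebra H by (rule fD)
  interpret Q: hopf_algebra Q by (rule fD)
  show ?thesis unfolding hopf_subalgebra_def
  proof (intro conjI ballI; (elim imageE)?)
    show "module.subspace (smult Q) (f ` carrier H)"
      by (rule subspace_linear_image[OF fD(4) H.carrier_subspace H.vector_space_axioms Q.vector_space_axioms])
    show "unit Q \<in> f ` carrier H" using fD(6)[symmetric] by simp
    show "mult Q x y \<in> f ` carrier H" if "x = f x'" "x' \<in> carrier H" "y = f y'" "y' \<in> carrier H" for x x' y y'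
      using that fD(5)[of x' y', symmetric] by simp
    show "antipode Q x \<in> f ` carrier H" if "x = f x'" "x' \<in> carrier H" for x x'
      using that fD(8)[of x', symmetric] by simp
    show "\<exists>t. set t \<subseteq> f ` carrier H \<times> f ` carrier H \<and>
        tensor_eq (smult Q) (carrier Q) (pair_tensor (comult Q x)) (pair_tensor t)"
      if "x = f x'" "x' \<in> carrier H" for x x'
    proof (intro exI conjI)
      show "set (map (\<lambda>(a, b). (f a, f b)) (comult H x')) \<subseteq> f ` carrier H \<times> f ` carrier H"
        using H.comult_closed[OF that(2)] by auto
      have "tensor_eq (smult Q) (carrier Q)
          (pair_tensor (comult Q (f x'))) [[f x1, f x2]. (x1, x2) \<leftarrow> comult H x']"
        using f that by (simp add: hopf_hom_def)
      moreover have "[[f x1, f x2]. (x1, x2) \<leftarrow> comult H x'] =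
          pair_tensor (map (\<lambda>(a, b). (f a, f b)) (comult H x'))"
        by (simp add: case_prod_unfold comp_def)
      ultimately show "tensor_eq (smult Q) (carrier Q) (pair_tensor (comult Q x))
          (pair_tensor (map (\<lambda>(a, b). (f a, f b)) (comult H x')))"
        using that by simp
    qed
  qed (use fD in auto)
qed

lemma hopf_subalgebra_image_sub:
  assumes f: "hopf_hom H Q f" and A: "hopf_subalgebra H A"
  shows "hopf_subalgebra Q (f ` A)" "hopf_hom (sub_hopf H A) (sub_hopf Q (f ` A)) f"
proof -
  have hom: "hopf_hom (sub_hopf H A) Q f"
    by (rule hopf_hom_comp[OF hopf_hom_inclusion[OF A] f])
  then show "hopf_subalgebra Q (f ` A)" using hopf_subalgebra_image by force
  from hopf_hom_corestrict[OF hom this] show "hopf_hom (sub_hopf H A) (sub_hopf Q (f ` A)) f" by simp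
qed

lemma hopf_subalgebra_sub:
  assumes A: "hopf_subalgebra H A" and B: "hopf_subalgebra H B" and AB: "A \<subseteq> B"
  shows "hopf_subalgebra (sub_hopf H B) A"
  unfolding hopf_subalgebra_def
proof (intro conjI ballI)
  note AD = hopf_subalgebraD[OF A]
  interpret H: hopf_algebra H by (rule AD)
  fix x assume x: "x \<in> A"
  then have xB: "x \<in> B" using AB by blast
  have "tensor_eq (smult H) (carrier H) (pair_tensor (comult (sub_hopf H B) x))
      (pair_tensor (comult (sub_hopf H A) x))"
    using sub_hopf_comult(2)[OF A x] sub_hopf_comult(2)[OF B xB] by (simp add: tensor_eq_pair_iff)
  moreover have "set (comult (sub_hopf H A) x) \<subseteq> B \<times> B"
    using sub_hopf_comult(1)[OF A x] AB by blast
  ultimately have "tensor_eq (smult H) B (pair_tensor (comult (sub_hopf H B) x))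
      (pair_tensor (comult (sub_hopf H A) x))"
    by (intro tensor_eq_restrict[OF H.vector_space_axioms hopf_subalgebraD(3)[OF B]
          sub_hopf_comult(1)[OF B xB]])
  then show "\<exists>t. set t \<subseteq> A \<times> A \<and> tensor_eq (smult (sub_hopf H B)) (carrier (sub_hopf H B))
      (pair_tensor (comult (sub_hopf H B) x)) (pair_tensor t)"
    using sub_hopf_comult(1)[OF A x] by auto
qed (use hopf_subalgebraD[OF A] hopf_algebra_sub_hopf[OF B] AB in auto)

text \<open>An isomorphism instead of an equation, because the two comultiplications are selected
  independently of each other; the identity map is the isomorphism.\<close>

lemma hopf_iso_sub_sub:
  assumes A: "hopf_subalgebra H A" and B: "hopf_subalgebra H B" and AB: "A \<subseteq> B"
  shows "hopf_iso (sub_hopf H A) (sub_hopf (sub_hopf H B) A)"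
proof -
  have "hopf_hom (sub_hopf H A) (sub_hopf H B) (\<lambda>x. x)"
    by (rule hopf_hom_corestrict[OF hopf_hom_inclusion[OF A] B]) (use AB in simp)
  from hopf_hom_corestrict[OF this hopf_subalgebra_sub[OF A B AB]]
  have "hopf_hom (sub_hopf H A) (sub_hopf (sub_hopf H B) A) (\<lambda>x. x)" by simp
  then show ?thesis unfolding hopf_iso_def using bij_betw_id[unfolded id_def, of A] by auto
qed

subsection \<open>Dimension\<close>

text \<open>The induction measure for existence and uniqueness of composition series.\<close>

definition hopf_dim :: "('k::field, 'a::ab_group_add) hopf \<Rightarrow> nat" where
  "hopf_dim H = vector_space.dim (smult H) (carrier H)"

lemma (in vector_space) finite_basis_of_subspace:
  assumes "finite B" "span B = V" "subspace U" "U \<subseteq> V" "S \<subseteq> U" "independent S"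
  obtains E where "finite E" "S \<subseteq> E" "E \<subseteq> U" "independent E" "span E = U"
proof -
  obtain E where E: "S \<subseteq> E" "E \<subseteq> U" "independent E" "U \<subseteq> span E"
    using maximal_independent_subset_extend[OF assms(5,6)] by blast
  have "E \<subseteq> span B" using E(2) assms(2,4) by blast
  then have "finite E" using independent_span_bound[OF assms(1) E(3)] by simp
  moreover have "span E = U" using E(2,4) assms(3) span_minimal by blast
  ultimately show ?thesis using that E by blast
qed

lemma finite_dimensional_sub_hopf:
  assumes "finite_dimensional H" "hopf_subalgebra H A"
  shows "finite_dimensional (sub_hopf H A)"
proof -
  note AD = hopf_subalgebraD[OF assms(2)]
  interpret H: hopf_algebra H by (rule AD)
  obtain B where B: "finite B" "H.span B = carrier H"
    using assms(1) by (auto simp: finite_dimensional_def)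
  obtain E where "finite E" "E \<subseteq> A" "H.span E = A"
    by (rule H.finite_basis_of_subspace[OF B AD(3,2) empty_subsetI H.independent_empty])
  then show ?thesis unfolding finite_dimensional_def sub_hopf_simps by blast
qed

lemma hopf_dim_sub_hopf_less:
  assumes "finite_dimensional H" "hopf_subalgebra H A" "A \<subset> carrier H"
  shows "hopf_dim (sub_hopf H A) < hopf_dim H"
proof -
  note AD = hopf_subalgebraD[OF assms(2)]
  interpret H: hopf_algebra H by (rule AD)
  obtain B where B: "finite B" "H.span B = carrier H"
    using assms(1) by (auto simp: finite_dimensional_def)
  obtain E where E: "finite E" "E \<subseteq> A" "H.independent E" "H.span E = A"
    by (rule H.finite_basis_of_subspace[OF B AD(3,2) empty_subsetI H.independent_empty])
  obtain F where F: "finite F" "E \<subseteq> F" "F \<subseteq> carrier H" "H.independent F" "H.span F = carrier H"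
    by (rule H.finite_basis_of_subspace[OF B H.carrier_subspace subset_refl _ E(3)]) (use E AD in blast)+
  have "E \<subset> F" using F(2,5) E(4) assms(3) by blast
  then have "card E < card F" using F(1) by (rule psubset_card_mono[rotated])
  moreover have "H.dim A = card E" using H.dim_span_eq_card_independent[OF E(3)] E(4) by simp
  moreover have "H.dim (carrier H) = card F" using H.dim_span_eq_card_independent[OF F(4)] F(5) by simp
  ultimately show ?thesis by (simp add: hopf_dim_def)
qed

lemma finite_dimensional_image:
  assumes "finite_dimensional H" "hopf_hom H Q p" "p ` carrier H = carrier Q"
  shows "finite_dimensional Q"
    "x \<in> carrier H \<Longrightarrow> x \<noteq> 0 \<Longrightarrow> p x = 0 \<Longrightarrow> hopf_dim Q < hopf_dim H"
proof -
  note pD = hopf_homD[OF assms(2)]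
  interpret H: hopf_algebra H by (rule pD)
  interpret Q: hopf_algebra Q by (rule pD)
  obtain B where B: "finite B" "H.span B = carrier H"
    using assms(1) by (auto simp: finite_dimensional_def)
  have spans: "carrier Q \<subseteq> Q.span (p ` {e \<in> E. p e \<noteq> 0})"
    if E: "finite E" "E \<subseteq> carrier H" "H.independent E" "H.span E = carrier H" for E
  proof
    fix y assume "y \<in> carrier Q"
    then obtain z where z: "z \<in> carrier H" "y = p z" using assms(3) by blast
    have "y = p (\<Sum>e\<in>E. smult H (H.representation E z e) e)"
      using H.sum_representation_eq[OF E(3) _ E(1) subset_refl, of z] z E(4) by simp
    also have "\<dots> = (\<Sum>e\<in>E. p (smult H (H.representation E z e) e))"
      by (rule linear_from_sum[OF pD(4) H.carrier_subspace H.vector_space_axioms]) (use E(2) in auto)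
    also have "\<dots> = (\<Sum>e\<in>E. smult Q (H.representation E z e) (p e))"
      by (rule sum.cong) (use E(2) linear_from_scale[OF pD(4)] in auto)
    finally have y: "y = (\<Sum>e\<in>E. smult Q (H.representation E z e) (p e))" .
    show "y \<in> Q.span (p ` {e \<in> E. p e \<noteq> 0})"
      unfolding y
    proof (rule Q.span_sum)
      fix e assume "e \<in> E"
      then show "smult Q (H.representation E z e) (p e) \<in> Q.span (p ` {e \<in> E. p e \<noteq> 0})"
        by (cases "p e = 0") (simp_all add: Q.span_zero Q.span_scale[OF Q.span_base])
    qed
  qed
  obtain E where E: "finite E" "E \<subseteq> carrier H" "H.independent E" "H.span E = carrier H"
    by (rule H.finite_basis_of_subspace[OF B H.carrier_subspace subset_refl empty_subsetI H.independent_empty])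
  have sub: "p ` {e \<in> E. p e \<noteq> 0} \<subseteq> carrier Q" using E(2) pD(3) by auto
  have "Q.span (p ` {e \<in> E. p e \<noteq> 0}) = carrier Q"
    using spans[OF E] Q.span_minimal[OF sub Q.carrier_subspace] by blast
  then show "finite_dimensional Q"
    unfolding finite_dimensional_def using sub E(1)
    by (intro exI[of _ "p ` {e \<in> E. p e \<noteq> 0}"]) simp
  show "hopf_dim Q < hopf_dim H" if x: "x \<in> carrier H" "x \<noteq> 0" "p x = 0"
  proof -
    \<comment> \<open>A basis of \<open>H\<close> through the kernel element \<open>x\<close>. Its
      nonzero images still span \<open>Q\<close>, and \<open>x\<close> contributes none of
      them.\<close>
    obtain F where F: "finite F" "{x} \<subseteq> F" "F \<subseteq> carrier H" "H.independent F" "H.span F = carrier H"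
      by (rule H.finite_basis_of_subspace[OF B H.carrier_subspace subset_refl, of "{x}"]) (use x in auto)
    have "Q.dim (carrier Q) \<le> card (p ` {e \<in> F. p e \<noteq> 0})"
      using spans[OF F(1,3-5)] F(1) by (intro Q.dim_le_card) auto
    also have "\<dots> \<le> card {e \<in> F. p e \<noteq> 0}" using F(1) by (intro card_image_le) auto
    also have "\<dots> < card F" using F(1,2) x by (intro psubset_card_mono) auto
    also have "\<dots> = H.dim (carrier H)" using H.dim_span_eq_card_independent[OF F(4)] F(5) by simp
    finally show ?thesis by (simp add: hopf_dim_def)
  qed
qed

subsection \<open>Augmentation ideals and coinvariants\<close>

context hopf_algebra
begin

lemma augmentation_ideal_subspace: "subspace (augmentation_ideal H A)"
  by (simp add: augmentation_ideal_def)

lemma augmentation_ideal_mem: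
  "h \<in> carrier H \<Longrightarrow> a \<in> A \<Longrightarrow> \<epsilon> a = 0 \<Longrightarrow> h \<odot> a \<in> augmentation_ideal H A"
  unfolding augmentation_ideal_def augmentation_def by (rule span_base) blast

lemma augmentation_ideal_induct:
  assumes "x \<in> augmentation_ideal H A" "subspace W"
    and "\<And>h a. h \<in> carrier H \<Longrightarrow> a \<in> A \<Longrightarrow> \<epsilon> a = 0 \<Longrightarrow> h \<odot> a \<in> W"
  shows "x \<in> W"
proof -
  have "augmentation_ideal H A \<subseteq> W"
    unfolding augmentation_ideal_def augmentation_def using assms(2,3) by (intro span_minimal) auto
  then show ?thesis using assms(1) by blast
qed

lemma augmentation_ideal_carrier:
  assumes "A \<subseteq> carrier H"
  shows "augmentation_ideal H A \<subseteq> {x \<in> carrier H. \<epsilon> x = 0}"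
proof
  fix x assume "x \<in> augmentation_ideal H A"
  then show "x \<in> {x \<in> carrier H. \<epsilon> x = 0}"
  proof (rule augmentation_ideal_induct)
    show "subspace {x \<in> carrier H. \<epsilon> x = 0}"
      using subspace_linear_preimage[OF counit_linear carrier_subspace vector_space_axioms
          vector_space_field module.subspace_single_0[OF module_of_vector_space[OF vector_space_field]]]
      by simp
  qed (use assms in \<open>auto simp: counit_mult\<close>)
qed

lemma augmentation_mem:
  assumes "hopf_subalgebra H A" "a \<in> A"
  shows "a - smult H (\<epsilon> a) \<one> \<in> A" "\<epsilon> (a - smult H (\<epsilon> a) \<one>) = 0"
proof -
  note AD = hopf_subalgebraD[OF assms(1)]
  show "a - smult H (\<epsilon> a) \<one> \<in> A"
    using assms(2) AD(3,4) by (simp add: subspace_diff subspace_scale)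
  show "\<epsilon> (a - smult H (\<epsilon> a) \<one>) = 0"
    using assms(2) AD(2) by (subst counit_diff) (auto simp: counit_smult counit_unit)
qed

lemma augmentation_ideal_mult_diff:
  assumes A: "hopf_subalgebra H A" and [simp]: "a \<in> A" "h \<in> carrier H"
  shows "h \<odot> a - smult H (\<epsilon> a) h \<in> augmentation_ideal H A"
proof -
  have [simp]: "a \<in> carrier H" using hopf_subalgebraD(2)[OF A] by auto
  have "h \<odot> (a - smult H (\<epsilon> a) \<one>) = h \<odot> a - smult H (\<epsilon> a) h"
    by (subst linear_from_diff[OF mult_linear_right carrier_subspace vector_space_axioms])
      (simp_all add: mult_smult_right mult_unit_right)
  then show ?thesis
    using augmentation_ideal_mem[OF \<open>h \<in> carrier H\<close> augmentation_mem[OF A \<open>a \<in> A\<close>]] by simp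
qed

text \<open>\<open>self_injective\<close> over the Hopf algebra \<open>A\<close>, with
  \<open>H\<close> as right \<open>A\<close>-module and \<open>q\<close> any linear projection onto
  \<open>A\<close>. Since \<open>q\<close> is the identity on \<open>A\<close>, the averaged map
  sends the unit to the unit, and right linearity makes it the identity on \<open>A\<close>.\<close>

lemma right_linear_projection:
  assumes fd: "finite_dimensional H" and A: "hopf_subalgebra H A"
  obtains p where "linear_from (carrier H) (smult H) (smult H) p"
    "\<And>h. h \<in> carrier H \<Longrightarrow> p h \<in> A"
    "\<And>h a. h \<in> carrier H \<Longrightarrow> a \<in> A \<Longrightarrow> p (h \<odot> a) = p h \<odot> a"
    "\<And>a. a \<in> A \<Longrightarrow> p a = a"
proof -
  note AD = hopf_subalgebraD[OF A]
  have [simp]: "a \<in> carrier H" if "a \<in> A" for a using AD(2) that by blast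
  obtain q where q: "linear_from (carrier H) (smult H) (smult H) q"
      "\<And>x. q x \<in> A" "\<And>x. x \<in> A \<Longrightarrow> q x = x"
    using linear_from_projection[OF vector_space_axioms AD(3)] by metis
  obtain p where p: "linear_from (carrier H) (smult H) (smult H) p"
    "\<And>m. m \<in> carrier H \<Longrightarrow> p m \<in> A"
    "\<And>m x. m \<in> carrier H \<Longrightarrow> x \<in> A \<Longrightarrow> p (m \<odot> x) = p m \<odot> x"
    "\<And>m. m \<in> carrier H \<Longrightarrow> (\<And>x. x \<in> A \<Longrightarrow> q (m \<odot> x) = x) \<Longrightarrow> p m = \<one>"
    by (rule hopf_algebra.self_injective[OF hopf_algebra_sub_hopf[OF A]
          finite_dimensional_sub_hopf[OF fd A] vector_space_axioms, where M = "carrier H" and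
          act = "mult H" and q = q, unfolded sub_hopf_simps])
      (use q in \<open>auto simp: mult_assoc mult_linear_left linear_from_subset[OF mult_linear_right AD(2)]\<close>)
  have "p \<one> = \<one>" by (rule p(4)) (simp_all add: mult_unit_left q)
  then have "p a = a" if "a \<in> A" for a
    using p(3)[of \<one> a] that by (simp add: mult_unit_left)
  then show ?thesis using that p by blast
qed

text \<open>
  The hypothesis says that \<open>x\<^sub>1 \<otimes> x\<^sub>2\<close> and \<open>1 \<otimes> x\<close> agree in \<open>H/HA\<^sup>+ \<otimes> H\<close>.  With \<open>p\<close> as above,
  \<open>T(h) = p(h\<^sub>1) \<S>(h\<^sub>2)\<close> vanishes on \<open>HA\<^sup>+\<close>, hence \<open>p(x) = T(x\<^sub>1) x\<^sub>2 = T(1) x = x\<close>.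
\<close>

lemma coinvariant_mem:
  assumes fd: "finite_dimensional H" and A: "hopf_subalgebra H A" and x: "x \<in> carrier H"
    and coinv: "\<And>\<phi>. linear_from (carrier H) (smult H) (*) \<phi> \<Longrightarrow>
        (\<And>y. y \<in> augmentation_ideal H A \<Longrightarrow> \<phi> y = 0) \<Longrightarrow>
        sw x (\<lambda>a b. smult H (\<phi> a) b) = smult H (\<phi> \<one>) x"
  shows "x \<in> A"
proof -
  note AD = hopf_subalgebraD[OF A]
  have AH [simp]: "a \<in> carrier H" if "a \<in> A" for a using AD(2) that by blast
  obtain p where p: "linear_from (carrier H) (smult H) (smult H) p"
    "\<And>h. h \<in> carrier H \<Longrightarrow> p h \<in> A"
    "\<And>h a. h \<in> carrier H \<Longrightarrow> a \<in> A \<Longrightarrow> p (h \<odot> a) = p h \<odot> a"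
    "\<And>a. a \<in> A \<Longrightarrow> p a = a"
    using right_linear_projection[OF fd A] by metis
  obtain E c where E: "finite E" "E \<subseteq> carrier H"
    and c_lin: "\<And>e. linear_from (carrier H) (smult H) (*) (c e)"
    and c_sum: "\<And>x. x \<in> carrier H \<Longrightarrow> (\<Sum>e\<in>E. smult H (c e x) e) = x"
    using coordinates[OF fd] by metis
  have [simp]: "e \<in> carrier H" if "e \<in> E" for e using that E by blast
  note [simp] = p(2)
  note [lin] = linear_from_comp[OF p(1)] linear_from_comp[OF c_lin]
  define T where "T g = sw g (\<lambda>a b. p a \<odot> \<S> b)" for g
  have T_closed [simp]: "T g \<in> carrier H" if "g \<in> carrier H" for g
    unfolding T_def using that by simp
  have T_lin: "linear_from (carrier H) (smult H) (smult H) T"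
    unfolding T_def by (auto intro!: lin)
  note [lin] = linear_from_comp[OF T_lin]
  have T_gen: "T (h \<odot> a) = smult H (\<epsilon> a) (T h)" if [simp]: "h \<in> carrier H" and a: "a \<in> A" for h a
  proof -
    have [simp]: "a \<in> carrier H" using a by simp
    have "T (h \<odot> a) = sw h (\<lambda>h1 h2. sw a (\<lambda>a1 a2. p (h1 \<odot> a1) \<odot> \<S> (h2 \<odot> a2)))"
      unfolding T_def by (rule sw_mult) (auto intro!: lin)
    also have "\<dots> = sw h (\<lambda>h1 h2. smult H (\<epsilon> a) (p h1 \<odot> \<S> h2))"
    proof (rule sw_cong)
      fix h1 h2 assume [simp]: "h1 \<in> carrier H" "h2 \<in> carrier H"
      \<comment> \<open>Right linearity of \<open>p\<close> applies only to factors of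
        \<open>a\<close> that lie in \<open>A\<close>, hence the detour through
        \<open>sub_hopf H A\<close>. It leaves a1 S(a2) between p(h1) and S(h2), which
        cancels.\<close>
      have "sw a (\<lambda>a1 a2. p (h1 \<odot> a1) \<odot> \<S> (h2 \<odot> a2)) =
          sweedler (sub_hopf H A) a (\<lambda>a1 a2. p (h1 \<odot> a1) \<odot> \<S> (h2 \<odot> a2))"
        by (rule sweedler_sub_hopf[OF A a, symmetric]) (auto intro!: lin)
      also have "\<dots> = sweedler (sub_hopf H A) a (\<lambda>a1 a2. p h1 \<odot> (a1 \<odot> \<S> a2 \<odot> \<S> h2))"
        by (rule sweedler_sub_hopf_cong[OF A a]) (simp add: p(3) antipode_mult mult_assoc)
      also have "\<dots> = sw a (\<lambda>a1 a2. p h1 \<odot> (a1 \<odot> \<S> a2 \<odot> \<S> h2))"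
        by (rule sweedler_sub_hopf[OF A a]) (auto intro!: lin)
      also have "\<dots> = smult H (\<epsilon> a) (p h1 \<odot> (\<one> \<odot> \<S> h2))"
        by (rule sw_antipode_right[where f = "\<lambda>z. p h1 \<odot> (z \<odot> \<S> h2)"]) (auto intro!: lin)
      finally show "sw a (\<lambda>a1 a2. p (h1 \<odot> a1) \<odot> \<S> (h2 \<odot> a2)) = smult H (\<epsilon> a) (p h1 \<odot> \<S> h2)"
        by (simp add: mult_unit_left)
    qed simp
    finally show ?thesis by (simp add: T_def sweedler_scale[OF vector_space_axioms])
  qed
  have T_zero: "T y = 0" if "y \<in> augmentation_ideal H A" for y
  proof -
    have "y \<in> {x \<in> carrier H. T x \<in> {0}}"
      using that
    proof (rule augmentation_ideal_induct)
      show "subspace {x \<in> carrier H. T x \<in> {0}}"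
        by (rule subspace_linear_preimage[OF T_lin carrier_subspace vector_space_axioms vector_space_axioms]) simp
    qed (simp add: T_gen)
    then show ?thesis by simp
  qed
  have "T \<one> = p \<one> \<odot> \<S> \<one>" unfolding T_def by (rule sw_unit) (auto intro!: lin)
  then have T_one: "T \<one> = \<one>" using p(4)[OF AD(4)] by (simp add: antipode_unit mult_unit_left)
  \<comment> \<open>The hypothesis \<open>coinv\<close> speaks about functionals, whereas
    \<open>T\<close> takes values in \<open>H\<close>. Each coordinate of \<open>T\<close> is a
    functional that vanishes on HA+.\<close>
  have "sw x (\<lambda>a b. T a \<odot> b) = sw x (\<lambda>a b. \<Sum>e\<in>E. e \<odot> smult H (c e (T a)) b)"
  proof (rule sw_cong[OF x])
    fix a b assume [simp]: "a \<in> carrier H" "b \<in> carrier H"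
    have "T a \<odot> b = (\<Sum>e\<in>E. smult H (c e (T a)) e) \<odot> b" by (simp add: c_sum)
    also have "\<dots> = (\<Sum>e\<in>E. smult H (c e (T a)) e \<odot> b)"
      by (rule linear_from_sum[OF mult_linear_left carrier_subspace vector_space_axioms]) simp_all
    also have "\<dots> = (\<Sum>e\<in>E. e \<odot> smult H (c e (T a)) b)"
      by (rule sum.cong) (simp_all add: mult_smult_left mult_smult_right)
    finally show "T a \<odot> b = (\<Sum>e\<in>E. e \<odot> smult H (c e (T a)) b)" .
  qed
  also have "\<dots> = (\<Sum>e\<in>E. e \<odot> sw x (\<lambda>a b. smult H (c e (T a)) b))"
    using x by (simp add: sweedler_sum mult_sw_right)
  also have "\<dots> = (\<Sum>e\<in>E. e \<odot> smult H (c e (T \<one>)) x)"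
  proof (rule sum.cong[OF refl])
    fix e assume "e \<in> E"
    have "sw x (\<lambda>a b. smult H (c e (T a)) b) = smult H (c e (T \<one>)) x"
      by (rule coinv) (auto intro!: lin simp: T_zero linear_from_zero[OF c_lin])
    then show "e \<odot> sw x (\<lambda>a b. smult H (c e (T a)) b) = e \<odot> smult H (c e (T \<one>)) x" by simp
  qed
  also have "\<dots> = (\<Sum>e\<in>E. smult H (c e (T \<one>)) e \<odot> x)"
    by (rule sum.cong) (simp_all add: mult_smult_left mult_smult_right x)
  also have "\<dots> = (\<Sum>e\<in>E. smult H (c e (T \<one>)) e) \<odot> x"
    by (rule linear_from_sum[OF mult_linear_left carrier_subspace vector_space_axioms, symmetric])
      (simp_all add: x)
  also have "\<dots> = x" using x by (simp add: c_sum T_one mult_unit_left)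
  finally have "x = sw x (\<lambda>a b. T a \<odot> b)" by simp
  \<comment> \<open>The same sum in the other way: p(x1) S(x2) x3 collapses to p(x), which lies in
    \<open>A\<close>.\<close>
  also have "\<dots> = sw x (\<lambda>a b. sw a (\<lambda>u v. p u \<odot> \<S> v \<odot> b))"
    by (rule sw_cong[OF x]) (simp add: T_def mult_sw_left)
  also have "\<dots> = sw x (\<lambda>u w. sw w (\<lambda>v b. p u \<odot> \<S> v \<odot> b))"
    by (rule sw_coassoc[OF _ vector_space_axioms x]) (auto intro!: lin)
  also have "\<dots> = sw x (\<lambda>u w. smult H (\<epsilon> w) (p u))"
  proof (rule sw_cong[OF x])
    fix u w assume [simp]: "u \<in> carrier H" "w \<in> carrier H"
    have "sw w (\<lambda>v b. p u \<odot> \<S> v \<odot> b) = sw w (\<lambda>v b. p u \<odot> (\<S> v \<odot> b))"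
      by (rule sw_cong) (simp_all add: mult_assoc)
    also have "\<dots> = smult H (\<epsilon> w) (p u \<odot> \<one>)"
      by (rule sw_antipode_left) (auto intro!: lin)
    finally show "sw w (\<lambda>v b. p u \<odot> \<S> v \<odot> b) = smult H (\<epsilon> w) (p u)" by (simp add: mult_unit_right)
  qed
  also have "\<dots> = p x" by (rule sw_counit_right[OF p(1) x])
  finally show ?thesis using p(2)[OF x] by simp
qed

text \<open>The right \<open>B\<close>-linear projection \<open>p\<close> onto \<open>B\<close>
  sends a generator h a of HA+ to p(h) a in BA+, because \<open>a\<close> lies in \<open>B\<close>;
  and it fixes the elements of \<open>B\<close>.\<close>

lemma augmentation_ideal_inter:
  assumes fd: "finite_dimensional H" and B: "hopf_subalgebra H B" and AB: "A \<subseteq> B"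
  shows "augmentation_ideal H A \<inter> B = augmentation_ideal (sub_hopf H B) A"
proof -
  note BD = hopf_subalgebraD[OF B]
  have BH: "b \<in> carrier H" if "b \<in> B" for b using BD(2) that by blast
  interpret B: hopf_algebra "sub_hopf H B" by (rule hopf_algebra_sub_hopf[OF B])
  obtain p where p: "linear_from (carrier H) (smult H) (smult H) p"
    "\<And>h. h \<in> carrier H \<Longrightarrow> p h \<in> B"
    "\<And>h a. h \<in> carrier H \<Longrightarrow> a \<in> B \<Longrightarrow> p (h \<odot> a) = p h \<odot> a"
    "\<And>a. a \<in> B \<Longrightarrow> p a = a"
    using right_linear_projection[OF fd B] by metis
  have "x \<in> augmentation_ideal (sub_hopf H B) A" if x: "x \<in> augmentation_ideal H A" "x \<in> B" for x
  proof -
    have "x \<in> {x \<in> carrier H. p x \<in> augmentation_ideal (sub_hopf H B) A}"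
      using x(1)
    proof (rule augmentation_ideal_induct)
      show "subspace {x \<in> carrier H. p x \<in> augmentation_ideal (sub_hopf H B) A}"
        using subspace_linear_preimage[OF p(1) carrier_subspace vector_space_axioms
            vector_space_axioms] B.augmentation_ideal_subspace by simp
      fix h a assume "h \<in> carrier H" "a \<in> A" "\<epsilon> a = 0"
      then show "h \<odot> a \<in> {x \<in> carrier H. p x \<in> augmentation_ideal (sub_hopf H B) A}"
        using p(2)[of h] p(3)[of h a] AB BH B.augmentation_ideal_mem[of "p h" a A] by auto
    qed
    then show ?thesis using p(4)[OF x(2)] by simp
  qed
  moreover have "augmentation_ideal (sub_hopf H B) A \<subseteq> augmentation_ideal H A"
  proof
    fix x assume "x \<in> augmentation_ideal (sub_hopf H B) A"
    then show "x \<in> augmentation_ideal H A"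
      by (rule B.augmentation_ideal_induct)
        (use BH augmentation_ideal_mem augmentation_ideal_subspace in auto)
  qed
  moreover have "augmentation_ideal (sub_hopf H B) A \<subseteq> B"
    using B.augmentation_ideal_carrier[of A] AB by auto
  ultimately show ?thesis by blast
qed

text \<open>If HA+ is the whole augmentation ideal of \<open>H\<close>, then a functional vanishing
  on it is a multiple of \<epsilon>, so the counit axiom makes every element of \<open>H\<close>
  coinvariant.\<close>

lemma eq_carrier_of_augmentation_ideal:
  assumes fd: "finite_dimensional H" and A: "hopf_subalgebra H A"
    and full: "\<And>x. x \<in> carrier H \<Longrightarrow> \<epsilon> x = 0 \<Longrightarrow> x \<in> augmentation_ideal H A"
  shows "A = carrier H"
proof -
  have "x \<in> A" if x: "x \<in> carrier H" for x
  proof (rule coinvariant_mem[OF fd A x])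
    fix \<phi> assume \<phi>: "linear_from (carrier H) (smult H) (*) \<phi>"
      "\<And>y. y \<in> augmentation_ideal H A \<Longrightarrow> \<phi> y = 0"
    have \<phi>_eq: "\<phi> a = \<epsilon> a * \<phi> \<one>" if [simp]: "a \<in> carrier H" for a
    proof -
      have "\<epsilon> (a - smult H (\<epsilon> a) \<one>) = 0"
        by (simp add: counit_diff counit_smult counit_unit)
      then have "\<phi> (a - smult H (\<epsilon> a) \<one>) = 0" using \<phi>(2) full by simp
      then show ?thesis
        by (simp add: linear_from_diff[OF \<phi>(1) carrier_subspace vector_space_axioms]
            linear_from_scale[OF \<phi>(1)])
    qed
    have "sw x (\<lambda>a b. smult H (\<phi> a) b) = sw x (\<lambda>a b. smult H (\<epsilon> a) (smult H (\<phi> \<one>) b))"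
      by (rule sw_cong[OF x]) (metis \<phi>_eq scale_scale)
    also have "\<dots> = smult H (\<phi> \<one>) x" by (rule sw_counit_left) (auto intro!: lin x)
    finally show "sw x (\<lambda>a b. smult H (\<phi> a) b) = smult H (\<phi> \<one>) x" .
  qed
  then show ?thesis using hopf_subalgebraD(2)[OF A] by blast
qed

end

subsection \<open>Normal Hopf subalgebras and quotients\<close>

definition adjoint_left :: "('k, 'a::ab_group_add) hopf \<Rightarrow> 'a \<Rightarrow> 'a \<Rightarrow> 'a" where
  "adjoint_left H h a = sweedler H h (\<lambda>u v. mult H (mult H u a) (antipode H v))"

definition adjoint_right :: "('k, 'a::ab_group_add) hopf \<Rightarrow> 'a \<Rightarrow> 'a \<Rightarrow> 'a" where
  "adjoint_right H h a = sweedler H h (\<lambda>u v. mult H (mult H (antipode H u) a) v)"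

lemma normal_hopf_subalgebra_iff:
  "normal_hopf_subalgebra H A \<longleftrightarrow> hopf_subalgebra H A \<and>
     (\<forall>h\<in>carrier H. \<forall>a\<in>A. adjoint_left H h a \<in> A \<and> adjoint_right H h a \<in> A)"
  by (simp add: normal_hopf_subalgebra_def adjoint_left_def adjoint_right_def sweedler_def)

lemma normal_hopf_subalgebraD:
  assumes "normal_hopf_subalgebra H A"
  shows "hopf_subalgebra H A" "\<And>h a. h \<in> carrier H \<Longrightarrow> a \<in> A \<Longrightarrow> adjoint_left H h a \<in> A"
    "\<And>h a. h \<in> carrier H \<Longrightarrow> a \<in> A \<Longrightarrow> adjoint_right H h a \<in> A"
  using assms by (auto simp: normal_hopf_subalgebra_iff)

section \<open>Adjoint actions and the ideal of a normal Hopf subalgebra\<close>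

context hopf_algebra
begin

abbreviation adl where "adl \<equiv> adjoint_left H"
abbreviation adr where "adr \<equiv> adjoint_right H"

lemma adjoint_closed [simp]:
  "h \<in> carrier H \<Longrightarrow> a \<in> carrier H \<Longrightarrow> adl h a \<in> carrier H"
  "h \<in> carrier H \<Longrightarrow> a \<in> carrier H \<Longrightarrow> adr h a \<in> carrier H"
  by (simp_all add: adjoint_left_def adjoint_right_def)

lemma lin_adjoint [lin]:
  assumes "linear_from V s (smult H) f" "\<And>x. x \<in> V \<Longrightarrow> f x \<in> carrier H" "y \<in> carrier H"
  shows "linear_from V s (smult H) (\<lambda>x. adl (f x) y)" "linear_from V s (smult H) (\<lambda>x. adr (f x) y)"
    "linear_from V s (smult H) (\<lambda>x. adl y (f x))" "linear_from V s (smult H) (\<lambda>x. adr y (f x))"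
  using assms by (auto simp: adjoint_left_def adjoint_right_def intro!: lin)

text \<open>In h1 a S(h2) h3 the last two factors cancel. For normal \<open>A\<close> this rewrites
  a product h a with the factor from \<open>A\<close> on the left.\<close>

lemma mult_eq_adjoint_left:
  assumes [simp]: "h \<in> carrier H" "a \<in> carrier H"
  shows "sw h (\<lambda>u w. adl u a \<odot> w) = h \<odot> a"
proof -
  have "sw h (\<lambda>u w. adl u a \<odot> w) = sw h (\<lambda>u w. sw u (\<lambda>h1 h2. h1 \<odot> a \<odot> \<S> h2 \<odot> w))"
    by (rule sw_cong) (simp_all add: adjoint_left_def mult_sw_left)
  also have "\<dots> = sw h (\<lambda>h1 v. sw v (\<lambda>h2 w. h1 \<odot> a \<odot> \<S> h2 \<odot> w))"
    by (rule sw_coassoc) (auto intro!: lin)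
  also have "\<dots> = sw h (\<lambda>h1 v. smult H (\<epsilon> v) (h1 \<odot> a))"
  proof (rule sw_cong)
    fix h1 v assume [simp]: "h1 \<in> carrier H" "v \<in> carrier H"
    have "sw v (\<lambda>h2 w. h1 \<odot> a \<odot> \<S> h2 \<odot> w) = sw v (\<lambda>h2 w. h1 \<odot> a \<odot> (\<S> h2 \<odot> w))"
      by (rule sw_cong) (simp_all add: mult_assoc)
    also have "\<dots> = smult H (\<epsilon> v) (h1 \<odot> a \<odot> \<one>)"
      by (rule sw_antipode_left) (auto intro!: lin)
    finally show "sw v (\<lambda>h2 w. h1 \<odot> a \<odot> \<S> h2 \<odot> w) = smult H (\<epsilon> v) (h1 \<odot> a)"
      by (simp add: mult_unit_right)
  qed simp
  also have "\<dots> = h \<odot> a" by (rule sw_counit_right) (auto intro!: lin)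
  finally show ?thesis .
qed

text \<open>Mirror image: in h1 S(h2) a h3 the first two factors cancel, and the factor from
  \<open>A\<close> moves to the right.\<close>

lemma mult_eq_adjoint_right:
  assumes [simp]: "h \<in> carrier H" "a \<in> carrier H"
  shows "sw h (\<lambda>u w. u \<odot> adr w a) = a \<odot> h"
proof -
  have "sw h (\<lambda>u w. u \<odot> adr w a) = sw h (\<lambda>u w. sw w (\<lambda>v t. u \<odot> (\<S> v \<odot> a \<odot> t)))"
    by (rule sw_cong) (simp_all add: adjoint_right_def mult_sw_right)
  also have "\<dots> = sw h (\<lambda>w t. sw w (\<lambda>u v. u \<odot> (\<S> v \<odot> a \<odot> t)))"
    by (rule sw_coassoc[symmetric]) (auto intro!: lin)
  also have "\<dots> = sw h (\<lambda>w t. smult H (\<epsilon> w) (a \<odot> t))"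
  proof (rule sw_cong)
    fix w t assume [simp]: "w \<in> carrier H" "t \<in> carrier H"
    have "sw w (\<lambda>u v. u \<odot> (\<S> v \<odot> a \<odot> t)) = sw w (\<lambda>u v. u \<odot> \<S> v \<odot> (a \<odot> t))"
      by (rule sw_cong) (simp_all add: mult_assoc)
    also have "\<dots> = smult H (\<epsilon> w) (\<one> \<odot> (a \<odot> t))"
      by (rule sw_antipode_right) (auto intro!: lin)
    finally show "sw w (\<lambda>u v. u \<odot> (\<S> v \<odot> a \<odot> t)) = smult H (\<epsilon> w) (a \<odot> t)"
      by (simp add: mult_unit_left)
  qed simp
  also have "\<dots> = a \<odot> h" by (rule sw_counit_left) (auto intro!: lin)
  finally show ?thesis .
qed

lemma counit_adjoint:
  assumes [simp]: "h \<in> carrier H" "a \<in> carrier H"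
  shows "\<epsilon> (adl h a) = \<epsilon> h * \<epsilon> a" "\<epsilon> (adr h a) = \<epsilon> h * \<epsilon> a"
proof -
  have *: "sw h (\<lambda>u v. \<epsilon> u * \<epsilon> v) = \<epsilon> h"
    by (rule sw_counit_left[OF counit_linear]) simp
  have "\<epsilon> (adl h a) = sw h (\<lambda>u v. \<epsilon> (u \<odot> a \<odot> \<S> v))"
    unfolding adjoint_left_def by (rule linear_sw_carrier[OF counit_linear]) simp_all
  also have "\<dots> = sw h (\<lambda>u v. (\<epsilon> u * \<epsilon> v) * \<epsilon> a)"
    by (rule sw_cong) (simp_all add: counit_mult counit_antipode)
  finally show "\<epsilon> (adl h a) = \<epsilon> h * \<epsilon> a" by (simp add: sweedler_mult_const *)
  have "\<epsilon> (adr h a) = sw h (\<lambda>u v. \<epsilon> (\<S> u \<odot> a \<odot> v))"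
    unfolding adjoint_right_def by (rule linear_sw_carrier[OF counit_linear]) simp_all
  also have "\<dots> = sw h (\<lambda>u v. (\<epsilon> u * \<epsilon> v) * \<epsilon> a)"
    by (rule sw_cong) (simp_all add: counit_mult counit_antipode)
  finally show "\<epsilon> (adr h a) = \<epsilon> h * \<epsilon> a" by (simp add: sweedler_mult_const *)
qed

text \<open>By \<open>mult_eq_adjoint_left\<close> a generator h a is a sum of products ad(h1)(a)
  h2, and ad(h1)(a) stays in the augmentation ideal of \<open>A\<close>. So HA+ may be treated as if
  generated by the products a h.\<close>

lemma normal_augmentation_ideal_induct:
  assumes A: "normal_hopf_subalgebra H A" and x: "x \<in> augmentation_ideal H A" and W: "subspace W"
    and gen: "\<And>h a. h \<in> carrier H \<Longrightarrow> a \<in> A \<Longrightarrow> \<epsilon> a = 0 \<Longrightarrow> a \<odot> h \<in> W"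
  shows "x \<in> W"
  using x W
proof (rule augmentation_ideal_induct)
  note AD = normal_hopf_subalgebraD[OF A]
  fix h a assume h: "h \<in> carrier H" and a: "a \<in> A" "\<epsilon> a = 0"
  have [simp]: "a \<in> carrier H" using a hopf_subalgebraD(2)[OF AD(1)] by blast
  have "sw h (\<lambda>u w. adl u a \<odot> w) \<in> W"
    by (rule sw_in_subspace[OF h vector_space_axioms W], rule gen)
      (simp_all add: AD(2) a counit_adjoint)
  then show "h \<odot> a \<in> W" using mult_eq_adjoint_left h by simp
qed

text \<open>Everything but the left ideal property rests on the inclusion of A+H in HA+, which is
  where the right adjoint action enters: right multiplication is tested on generators a h, and the
  antipode sends h a to S(a) S(h).\<close>

lemma normal_augmentation_ideal:
  assumes A: "normal_hopf_subalgebra H A" and x: "x \<in> augmentation_ideal H A" and g: "g \<in> carrier H"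
  shows "g \<odot> x \<in> augmentation_ideal H A" "x \<odot> g \<in> augmentation_ideal H A"
    "\<S> x \<in> augmentation_ideal H A"
proof -
  note AD = normal_hopf_subalgebraD[OF A]
  note ASD = hopf_subalgebraD[OF AD(1)]
  have [simp]: "a \<in> carrier H" if "a \<in> A" for a using ASD(2) that by blast
  note pre = subspace_linear_preimage[OF _ carrier_subspace vector_space_axioms vector_space_axioms
      augmentation_ideal_subspace]
  have left: "a \<odot> h \<in> augmentation_ideal H A" if [simp]: "h \<in> carrier H" "a \<in> A" "\<epsilon> a = 0" for h a
  proof -
    have "sw h (\<lambda>u w. u \<odot> adr w a) \<in> augmentation_ideal H A"
      by (rule sw_in_subspace[OF _ vector_space_axioms augmentation_ideal_subspace],
        simp, rule augmentation_ideal_mem) (simp_all add: AD(3) counit_adjoint)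
    then show ?thesis by (simp add: mult_eq_adjoint_right)
  qed
  have "x \<in> {x \<in> carrier H. g \<odot> x \<in> augmentation_ideal H A}"
    by (rule augmentation_ideal_induct[OF x pre[OF mult_linear_right[OF g]]])
      (simp add: g mult_assoc[symmetric] augmentation_ideal_mem)
  then show "g \<odot> x \<in> augmentation_ideal H A" by simp
  have "x \<in> {x \<in> carrier H. x \<odot> g \<in> augmentation_ideal H A}"
    by (rule normal_augmentation_ideal_induct[OF A x pre[OF mult_linear_left[OF g]]])
      (simp add: g mult_assoc left)
  then show "x \<odot> g \<in> augmentation_ideal H A" by simp
  have "x \<in> {x \<in> carrier H. \<S> x \<in> augmentation_ideal H A}"
    by (rule augmentation_ideal_induct[OF x pre[OF antipode_linear]])
      (simp add: antipode_mult left ASD(6) counit_antipode)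
  then show "\<S> x \<in> augmentation_ideal H A" by simp
qed

text \<open>HA+ is a coideal, expressed by forms: a \<beta> that vanishes when one argument lies in
  HA+ cannot distinguish h1 a1 and h2 a2 from \<epsilon>(a1) h1 and \<epsilon>(a2) h2, so its value
  on the comultiplied h a carries the factor \<epsilon>(a) = 0.\<close>

lemma sw_augmentation_ideal:
  fixes \<beta> :: "'a \<Rightarrow> 'a \<Rightarrow> 'b::ab_group_add"
  assumes A: "hopf_subalgebra H A" and \<beta>: "bilinear_from (carrier H) (smult H) s' \<beta>" "vector_space s'"
    and vanish: "\<And>y z. y \<in> augmentation_ideal H A \<Longrightarrow> z \<in> carrier H \<Longrightarrow> \<beta> y z = 0"
      "\<And>y z. y \<in> augmentation_ideal H A \<Longrightarrow> z \<in> carrier H \<Longrightarrow> \<beta> z y = 0"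
    and x: "x \<in> augmentation_ideal H A"
  shows "sw x \<beta> = 0"
proof -
  interpret W: vector_space s' by fact
  note AD = hopf_subalgebraD[OF A]
  have AH [simp]: "a \<in> carrier H" if "a \<in> A" for a using AD(2) that by blast
  note [lin] = bilinear_from_comp_left[OF \<beta>(1)] bilinear_from_comp_right[OF \<beta>(1)] \<beta>(2)
  note diff = linear_from_diff[OF _ carrier_subspace vector_space_axioms]
  have "x \<in> {x \<in> carrier H. sw x \<beta> \<in> {0}}"
    using x
  proof (rule augmentation_ideal_induct)
    show "subspace {x \<in> carrier H. sw x \<beta> \<in> {0}}"
      by (rule subspace_linear_preimage[OF _ carrier_subspace vector_space_axioms \<beta>(2)
            W.subspace_single_0]) (auto intro!: lin \<beta>(1))
    fix h a assume [simp]: "h \<in> carrier H" and a: "a \<in> A" "\<epsilon> a = 0"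
    have "sw (h \<odot> a) \<beta> = sw h (\<lambda>h1 h2. sw a (\<lambda>a1 a2. \<beta> (h1 \<odot> a1) (h2 \<odot> a2)))"
      by (rule sw_mult[OF \<beta>]) (simp_all add: a)
    also have "\<dots> = sw h (\<lambda>h1 h2. 0)"
    proof (rule sw_cong)
      fix h1 h2 assume [simp]: "h1 \<in> carrier H" "h2 \<in> carrier H"
      have step: "\<beta> (h1 \<odot> a1) (h2 \<odot> a2) = s' (\<epsilon> a1) (s' (\<epsilon> a2) (\<beta> h1 h2))"
        if [simp]: "a1 \<in> A" "a2 \<in> A" for a1 a2
      proof -
        have "\<beta> (h1 \<odot> a1 - smult H (\<epsilon> a1) h1) (h2 \<odot> a2) = 0"
          by (rule vanish(1)[OF augmentation_ideal_mult_diff[OF A]]) simp_all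
        then have 1: "\<beta> (h1 \<odot> a1) (h2 \<odot> a2) = s' (\<epsilon> a1) (\<beta> h1 (h2 \<odot> a2))"
          by (subst (asm) diff[OF bilinear_fromD(1)[OF \<beta>(1)]])
            (simp_all add: linear_from_scale[OF bilinear_fromD(1)[OF \<beta>(1)]])
        have "\<beta> h1 (h2 \<odot> a2 - smult H (\<epsilon> a2) h2) = 0"
          by (rule vanish(2)[OF augmentation_ideal_mult_diff[OF A]]) simp_all
        then have 2: "\<beta> h1 (h2 \<odot> a2) = s' (\<epsilon> a2) (\<beta> h1 h2)"
          by (subst (asm) diff[OF bilinear_fromD(2)[OF \<beta>(1)]])
            (simp_all add: linear_from_scale[OF bilinear_fromD(2)[OF \<beta>(1)]])
        show ?thesis by (simp add: 1 2)
      qed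
      have "sw a (\<lambda>a1 a2. \<beta> (h1 \<odot> a1) (h2 \<odot> a2)) =
          sweedler (sub_hopf H A) a (\<lambda>a1 a2. \<beta> (h1 \<odot> a1) (h2 \<odot> a2))"
        by (rule sweedler_sub_hopf[OF A a(1), symmetric]) (auto intro!: lin)
      also have "\<dots> = sweedler (sub_hopf H A) a (\<lambda>a1 a2. s' (\<epsilon> a1) (s' (\<epsilon> a2) (\<beta> h1 h2)))"
        by (rule sweedler_sub_hopf_cong[OF A a(1)]) (rule step)
      also have "\<dots> = sw a (\<lambda>a1 a2. s' (\<epsilon> a1) (s' (\<epsilon> a2) (\<beta> h1 h2)))"
        by (rule sweedler_sub_hopf[OF A a(1)]) (auto intro!: lin)
      also have "\<dots> = s' (\<epsilon> a) (\<beta> h1 h2)"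
        by (rule sw_counit_left[where f = "\<lambda>a2. s' (\<epsilon> a2) (\<beta> h1 h2)"]) (auto intro!: lin simp: a)
      finally show "sw a (\<lambda>a1 a2. \<beta> (h1 \<odot> a1) (h2 \<odot> a2)) = 0" using a(2) by simp
    qed simp
    finally show "h \<odot> a \<in> {x \<in> carrier H. sw x \<beta> \<in> {0}}" using a by simp
  qed
  then show ?thesis by simp
qed

theorem hopf_quotient_exists:
  assumes A: "normal_hopf_subalgebra H A"
  shows "\<exists>Q p. is_hopf_quotient H A Q p"
proof -
  note AD = normal_hopf_subalgebraD[OF A]
  let ?I = "augmentation_ideal H A"
  have IH: "x \<in> carrier H" "\<epsilon> x = 0" if "x \<in> ?I" for x
    using augmentation_ideal_carrier[OF hopf_subalgebraD(2)[OF AD(1)]] that by auto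
  \<comment> \<open>The complement of HA+ that carries the quotient is the image of x -> x - r(x);
    this map picks a representative of each coset and serves as the projection
    \<open>p\<close>.\<close>
  obtain r where r: "linear_from (carrier H) (smult H) (smult H) r" "\<And>x. r x \<in> ?I" "\<And>x. x \<in> ?I \<Longrightarrow> r x = x"
    using linear_from_projection[OF vector_space_axioms augmentation_ideal_subspace] by metis
  define p where "p x = x - r x" for x
  have p_lin: "linear_from (carrier H) (smult H) (smult H) p"
    unfolding p_def using r(1) by (auto intro!: lin)
  note [lin] = linear_from_comp[OF p_lin]
  have p_closed [simp]: "p x \<in> carrier H" if "x \<in> carrier H" for x
    unfolding p_def using that IH r(2) by simp
  have p_zero: "p x = 0" if "x \<in> ?I" for x unfolding p_def using r(3) that by simp
  have p_diff: "x - p x \<in> ?I" for x unfolding p_def using r(2) by simp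
  have p_eq: "p x = p y \<longleftrightarrow> x - y \<in> ?I" if "x \<in> carrier H" "y \<in> carrier H" for x y
  proof
    assume eq: "p x = p y"
    have "x - y = r x - r y" using eq by (simp add: p_def algebra_simps)
    then show "x - y \<in> ?I" using r(2) subspace_diff[OF augmentation_ideal_subspace] by simp
  next
    assume "x - y \<in> ?I"
    then show "p x = p y"
      using p_zero[of "x - y"] linear_from_diff[OF p_lin carrier_subspace vector_space_axioms that] by simp
  qed
  have pp [simp]: "p (p x) = p x" if "x \<in> carrier H" for x
  proof -
    have "x - p x \<in> ?I" by (rule p_diff)
    then show ?thesis using that p_eq[of x "p x"] by simp
  qed
  have p_mult_l [simp]: "p (p x \<odot> y) = p (x \<odot> y)" if "x \<in> carrier H" "y \<in> carrier H" for x y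
  proof -
    have "x \<odot> y - p x \<odot> y = (x - p x) \<odot> y"
      using that by (subst linear_from_diff[OF mult_linear_left carrier_subspace vector_space_axioms]) simp_all
    also have "\<dots> \<in> ?I" by (rule normal_augmentation_ideal(2)[OF A p_diff that(2)])
    finally show ?thesis using that p_eq[of "x \<odot> y" "p x \<odot> y"] by simp
  qed
  have p_mult_r [simp]: "p (x \<odot> p y) = p (x \<odot> y)" if "x \<in> carrier H" "y \<in> carrier H" for x y
  proof -
    have "x \<odot> y - x \<odot> p y = x \<odot> (y - p y)"
      using that by (subst linear_from_diff[OF mult_linear_right carrier_subspace vector_space_axioms]) simp_all
    also have "\<dots> \<in> ?I" by (rule normal_augmentation_ideal(1)[OF A p_diff that(1)])
    finally show ?thesis using that p_eq[of "x \<odot> y" "x \<odot> p y"] by simp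
  qed
  have p_S [simp]: "p (\<S> (p x)) = p (\<S> x)" if "x \<in> carrier H" for x
  proof -
    have "\<S> x - \<S> (p x) = \<S> (x - p x)"
      using that by (subst linear_from_diff[OF antipode_linear carrier_subspace vector_space_axioms]) simp_all
    also have "\<dots> \<in> ?I" by (rule normal_augmentation_ideal(3)[OF A p_diff that])
    finally show ?thesis using that p_eq[of "\<S> x" "\<S> (p x)"] by simp
  qed
  have eps_p [simp]: "\<epsilon> (p x) = \<epsilon> x" if "x \<in> carrier H" for x
    using that IH[OF p_diff, of x] counit_diff[of x "p x"] by simp
  define W where "W = p ` carrier H"
  have WH [simp]: "x \<in> carrier H" if "x \<in> W" for x using that by (auto simp: W_def)
  have pW [simp]: "p x \<in> W" if "x \<in> carrier H" for x using that by (simp add: W_def)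
  have p_id [simp]: "p x = x" if "x \<in> W" for x using that by (auto simp: W_def)
  have W: "subspace W"
    unfolding W_def by (rule subspace_linear_image[OF p_lin carrier_subspace vector_space_axioms vector_space_axioms])
  have Wsub: "W \<subseteq> carrier H" by auto
  define Q :: "('k, 'a) hopf" where
    "Q = \<lparr>carrier = W, smult = smult H, mult = (\<lambda>x y. p (x \<odot> y)), unit = p \<one>,
      comult = (\<lambda>x. map (\<lambda>(a, b). (p a, p b)) (comult H x)), counit = \<epsilon>, antipode = (\<lambda>x. p (\<S> x))\<rparr>"
  have Q_simps [simp]: "carrier Q = W" "smult Q = smult H" "mult Q = (\<lambda>x y. p (x \<odot> y))" "unit Q = p \<one>"
    "counit Q = \<epsilon>" "antipode Q = (\<lambda>x. p (\<S> x))"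
    by (simp_all add: Q_def)
  have swQ: "sweedler Q x \<beta> = sw x (\<lambda>a b. \<beta> (p a) (p b))" for x and \<beta> :: "'a \<Rightarrow> 'a \<Rightarrow> 'b::ab_group_add"
    by (simp add: sweedler_def Q_def comp_def case_prod_unfold)
  \<comment> \<open>This is where the coideal property is needed: \<open>x\<close> and its
    representative \<open>p x\<close> have the same comultiplication once \<open>p\<close> is
    applied to both factors.\<close>
  have sw_p: "sw (p x) (\<lambda>a b. \<beta> (p a) (p b)) = sw x (\<lambda>a b. \<beta> (p a) (p b))"
    if \<beta>: "bilinear_from W (smult H) (*) \<beta>" and x: "x \<in> carrier H" for x and \<beta> :: "'a \<Rightarrow> 'a \<Rightarrow> 'k"
  proof -
    have bil: "bilinear_from (carrier H) (smult H) (*) (\<lambda>a b. \<beta> (p a) (p b))"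
      by (rule bilinear_from_comp[OF \<beta> p_lin]) simp
    have "sw (x - p x) (\<lambda>a b. \<beta> (p a) (p b)) = 0"
    proof (rule sw_augmentation_ideal[OF AD(1) bil vector_space_field _ _ p_diff])
      fix y z assume "y \<in> ?I" "z \<in> carrier H"
      then show "\<beta> (p y) (p z) = 0" "\<beta> (p z) (p y) = 0"
        using linear_from_zero[OF bilinear_fromD(1)[OF \<beta>]] linear_from_zero[OF bilinear_fromD(2)[OF \<beta>]]
          subspace_0[OF W] by (simp_all add: p_zero)
    qed
    then show ?thesis
      using linear_from_diff[OF lin_sw_arg[OF vector_space_field linear_from_id _ bil] carrier_subspace
          vector_space_axioms, of x "p x"] x by simp
  qed
  have bil_p: "bilinear_from (carrier H) (smult H) (*) (\<lambda>a b. \<beta> (p a) (p b))"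
    if "bilinear_from W (smult H) (*) \<beta>" for \<beta> :: "'a \<Rightarrow> 'a \<Rightarrow> 'k"
    by (rule bilinear_from_comp[OF that p_lin]) simp
  have hopf_Q: "hopf_algebra Q"
  proof (rule hopf_algebraI; (unfold Q_simps swQ)?)
    fix x y :: 'a and \<beta> :: "'a \<Rightarrow> 'a \<Rightarrow> 'k"
    assume xy [simp]: "x \<in> W" "y \<in> W" and \<beta>: "bilinear_from W (smult H) (*) \<beta>"
    show "sw (x + y) (\<lambda>a b. \<beta> (p a) (p b)) = sw x (\<lambda>a b. \<beta> (p a) (p b)) + sw y (\<lambda>a b. \<beta> (p a) (p b))"
      by (rule sw_add_arg[OF bil_p[OF \<beta>] vector_space_field]) simp_all
    have "sw (p (x \<odot> y)) (\<lambda>a b. \<beta> (p a) (p b)) =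
        sw x (\<lambda>a b. sw y (\<lambda>c d. \<beta> (p (a \<odot> c)) (p (b \<odot> d))))"
      by (simp add: sw_p[OF \<beta>] sw_mult[OF bil_p[OF \<beta>] vector_space_field])
    then show "sw (p (x \<odot> y)) (\<lambda>a b. \<beta> (p a) (p b)) =
        sw x (\<lambda>a b. sw y (\<lambda>c d. \<beta> (p (p a \<odot> p c)) (p (p b \<odot> p d))))"
      by (simp cong: sw_cong)
  next
    fix c x and \<beta> :: "'a \<Rightarrow> 'a \<Rightarrow> 'k"
    assume [simp]: "x \<in> W" and \<beta>: "bilinear_from W (smult H) (*) \<beta>"
    show "sw (smult H c x) (\<lambda>a b. \<beta> (p a) (p b)) = c * sw x (\<lambda>a b. \<beta> (p a) (p b))"
      by (rule sw_smult_arg[OF bil_p[OF \<beta>] vector_space_field]) simp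
  next
    fix \<beta> :: "'a \<Rightarrow> 'a \<Rightarrow> 'k"
    assume \<beta>: "bilinear_from W (smult H) (*) \<beta>"
    show "sw (p \<one>) (\<lambda>a b. \<beta> (p a) (p b)) = \<beta> (p \<one>) (p \<one>)"
      by (simp add: sw_p[OF \<beta>] sw_unit[OF bil_p[OF \<beta>] vector_space_field])
  next
    fix x and \<tau> :: "'a \<Rightarrow> 'a \<Rightarrow> 'a \<Rightarrow> 'k"
    assume [simp]: "x \<in> W" and \<tau>: "trilinear_from W (smult H) (*) \<tau>"
    have tri: "trilinear_from (carrier H) (smult H) (*) (\<lambda>a b c. \<tau> (p a) (p b) (p c))"
      by (auto intro!: lin trilinear_from_comp[OF \<tau>])
    have "sw x (\<lambda>u c. sw (p u) (\<lambda>a b. \<tau> (p a) (p b) (p c))) = sw x (\<lambda>u c. sw u (\<lambda>a b. \<tau> (p a) (p b) (p c)))"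
    proof (rule sw_cong)
      fix u c assume uc: "u \<in> carrier H" "c \<in> carrier H"
      have "bilinear_from W (smult H) (*) (\<lambda>a b. \<tau> a b (p c))"
        using \<tau> uc by (auto simp: trilinear_from_def intro!: bilinear_fromI)
      from sw_p[OF this uc(1)]
      show "sw (p u) (\<lambda>a b. \<tau> (p a) (p b) (p c)) = sw u (\<lambda>a b. \<tau> (p a) (p b) (p c))" .
    qed simp
    also have "\<dots> = sw x (\<lambda>a u. sw u (\<lambda>b c. \<tau> (p a) (p b) (p c)))"
      by (rule sw_coassoc[OF tri vector_space_field]) simp
    also have "\<dots> = sw x (\<lambda>a u. sw (p u) (\<lambda>b c. \<tau> (p a) (p b) (p c)))"
    proof (rule sw_cong)
      fix a u assume au: "a \<in> carrier H" "u \<in> carrier H"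
      have "bilinear_from W (smult H) (*) (\<lambda>b c. \<tau> (p a) b c)"
        using \<tau> au by (auto simp: trilinear_from_def intro!: bilinear_fromI)
      from sw_p[OF this au(2)]
      show "sw u (\<lambda>b c. \<tau> (p a) (p b) (p c)) = sw (p u) (\<lambda>b c. \<tau> (p a) (p b) (p c))" by (rule sym)
    qed simp
    finally show "sw x (\<lambda>u c. sw (p u) (\<lambda>a b. \<tau> (p a) (p b) (p c))) =
        sw x (\<lambda>a u. sw (p u) (\<lambda>b c. \<tau> (p a) (p b) (p c)))" .
  next
    fix x assume [simp]: "x \<in> W"
    have "sw x (\<lambda>a b. smult H (\<epsilon> (p a)) (p b)) = sw x (\<lambda>a b. smult H (\<epsilon> a) (p b))"
      by (rule sw_cong) simp_all
    also have "\<dots> = p x" by (rule sw_counit_left[OF p_lin]) simp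
    finally show "sw x (\<lambda>a b. smult H (\<epsilon> (p a)) (p b)) = x" by simp
    have "sw x (\<lambda>a b. smult H (\<epsilon> (p b)) (p a)) = sw x (\<lambda>a b. smult H (\<epsilon> b) (p a))"
      by (rule sw_cong) simp_all
    also have "\<dots> = p x" by (rule sw_counit_right[OF p_lin]) simp
    finally show "sw x (\<lambda>a b. smult H (\<epsilon> (p b)) (p a)) = x" by simp
    have "sw x (\<lambda>a b. p (p (\<S> (p a)) \<odot> p b)) = sw x (\<lambda>a b. p (\<S> a \<odot> b))"
      by (rule sw_cong) simp_all
    also have "\<dots> = smult H (\<epsilon> x) (p \<one>)" by (rule sw_antipode_left[OF p_lin]) simp
    finally show "sw x (\<lambda>a b. p (p (\<S> (p a)) \<odot> p b)) = smult H (\<epsilon> x) (p \<one>)" .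
    have "sw x (\<lambda>a b. p (p a \<odot> p (\<S> (p b)))) = sw x (\<lambda>a b. p (a \<odot> \<S> b))"
      by (rule sw_cong) simp_all
    also have "\<dots> = smult H (\<epsilon> x) (p \<one>)" by (rule sw_antipode_right[OF p_lin]) simp
    finally show "sw x (\<lambda>a b. p (p a \<odot> p (\<S> (p b)))) = smult H (\<epsilon> x) (p \<one>)" .
  next
    fix x assume "x \<in> W"
    then show "set (comult Q x) \<subseteq> W \<times> W"
      using comult_closed[of x] by (auto simp: Q_def)
  qed (auto simp: vector_space_axioms W mult_assoc mult_unit_left mult_unit_right counit_unit
      counit_mult intro!: lin intro: linear_from_subset[OF _ Wsub])
  have hom: "hopf_hom H Q p"
  proof (rule hopf_homI)
    fix x and \<beta> :: "'a \<Rightarrow> 'a \<Rightarrow> 'k"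
    assume "x \<in> carrier H" "bilinear_from (carrier Q) (smult Q) (*) \<beta>"
    then show "sweedler Q (p x) \<beta> = sw x (\<lambda>a b. \<beta> (p a) (p b))" by (simp add: swQ sw_p)
  qed (simp_all add: hopf_Q hopf_algebra_axioms p_lin)
  have "p ` carrier H = carrier Q" by (simp only: Q_simps(1) W_def)
  then show ?thesis unfolding is_hopf_quotient_def using hom p_eq by blast
qed

end

subsection \<open>Images, intersections and products of normal Hopf subalgebras\<close>

lemma hopf_hom_adjoint:
  assumes f: "hopf_hom H Q f" and h: "h \<in> carrier H" and a: "a \<in> carrier H"
  shows "f (adjoint_left H h a) = adjoint_left Q (f h) (f a)"
    "f (adjoint_right H h a) = adjoint_right Q (f h) (f a)"
proof -
  note fD = hopf_homD[OF f]
  interpret H: hopf_algebra H by (rule fD)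
  interpret Q: hopf_algebra Q by (rule fD)
  note [simp] = fD(3) h a
  have "adjoint_left Q (f h) (f a) =
      sweedler H h (\<lambda>u v. mult Q (mult Q (f u) (f a)) (antipode Q (f v)))"
    unfolding adjoint_left_def
    by (rule hopf_hom_sweedler[OF f _ Q.vector_space_axioms h]) (auto intro!: lin)
  also have "\<dots> = sweedler H h (\<lambda>u v. f (mult H (mult H u a) (antipode H v)))"
    by (rule H.sw_cong[OF h]) (simp add: fD)
  also have "\<dots> = f (adjoint_left H h a)"
    unfolding adjoint_left_def by (rule H.linear_sw_carrier[OF fD(4) h, symmetric]) simp
  finally show "f (adjoint_left H h a) = adjoint_left Q (f h) (f a)" by simp
  have "adjoint_right Q (f h) (f a) =
      sweedler H h (\<lambda>u v. mult Q (mult Q (antipode Q (f u)) (f a)) (f v))"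
    unfolding adjoint_right_def
    by (rule hopf_hom_sweedler[OF f _ Q.vector_space_axioms h]) (auto intro!: lin)
  also have "\<dots> = sweedler H h (\<lambda>u v. f (mult H (mult H (antipode H u) a) v))"
    by (rule H.sw_cong[OF h]) (simp add: fD)
  also have "\<dots> = f (adjoint_right H h a)"
    unfolding adjoint_right_def by (rule H.linear_sw_carrier[OF fD(4) h, symmetric]) simp
  finally show "f (adjoint_right H h a) = adjoint_right Q (f h) (f a)" by simp
qed

lemma normal_hopf_subalgebra_image:
  assumes f: "hopf_hom H Q f" and surj: "f ` carrier H = carrier Q" and A: "normal_hopf_subalgebra H A"
  shows "normal_hopf_subalgebra Q (f ` A)"
  unfolding normal_hopf_subalgebra_iff
proof (intro conjI ballI)
  note AD = normal_hopf_subalgebraD[OF A]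
  show "hopf_subalgebra Q (f ` A)" by (rule hopf_subalgebra_image_sub[OF f AD(1)])
  fix k b assume "k \<in> carrier Q" "b \<in> f ` A"
  then obtain h a where "h \<in> carrier H" "k = f h" "a \<in> A" "b = f a" using surj by blast
  moreover then have "a \<in> carrier H" using hopf_subalgebraD(2)[OF AD(1)] by blast
  ultimately show "adjoint_left Q k b \<in> f ` A" "adjoint_right Q k b \<in> f ` A"
    using hopf_hom_adjoint[OF f, of h a, symmetric] AD(2,3)[of h a] by simp_all
qed

lemma normal_hopf_subalgebra_sub:
  assumes A: "normal_hopf_subalgebra H A" and B: "hopf_subalgebra H B" and AB: "A \<subseteq> B"
  shows "normal_hopf_subalgebra (sub_hopf H B) A"
  unfolding normal_hopf_subalgebra_iff
proof (intro conjI ballI)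
  note AD = normal_hopf_subalgebraD[OF A]
  show "hopf_subalgebra (sub_hopf H B) A" by (rule hopf_subalgebra_sub[OF AD(1) B AB])
  fix h a assume h: "h \<in> carrier (sub_hopf H B)" and a: "a \<in> A"
  have "h \<in> carrier H" using h hopf_subalgebraD(2)[OF B] by auto
  moreover have "adjoint_left (sub_hopf H B) h a = adjoint_left H h a"
    "adjoint_right (sub_hopf H B) h a = adjoint_right H h a"
    using hopf_hom_adjoint[OF hopf_hom_inclusion[OF B], of h a] h a AB by auto
  ultimately show "adjoint_left (sub_hopf H B) h a \<in> A" "adjoint_right (sub_hopf H B) h a \<in> A"
    using AD(2,3) a by simp_all
qed

section \<open>Intersections and products\<close>

context hopf_algebra
begin

text \<open>A tensor lies in the square of \<open>U\<close> iff its left and its right factors do,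
  and each of these conditions can be tested by functionals vanishing on \<open>U\<close>. With a
  projection \<open>q\<close> onto \<open>U\<close> and r = 1 - q, the tests remove every term that
  contains \<open>r\<close>.\<close>

lemma comult_in_subspaceI:
  assumes fd: "finite_dimensional H" and U: "subspace U" and x: "x \<in> carrier H"
    and left: "\<And>\<phi>. linear_from (carrier H) (smult H) (*) \<phi> \<Longrightarrow> (\<And>y. y \<in> U \<Longrightarrow> \<phi> y = 0) \<Longrightarrow>
        sw x (\<lambda>a b. smult H (\<phi> a) b) = 0"
    and right: "\<And>\<phi>. linear_from (carrier H) (smult H) (*) \<phi> \<Longrightarrow> (\<And>y. y \<in> U \<Longrightarrow> \<phi> y = 0) \<Longrightarrow>
        sw x (\<lambda>a b. smult H (\<phi> b) a) = 0"
    and sub: "U \<subseteq> carrier H"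
  shows "\<exists>t. set t \<subseteq> U \<times> U \<and>
        tensor_eq (smult H) (carrier H) (pair_tensor (comult H x)) (pair_tensor t)"
proof -
  obtain q where q: "linear_from (carrier H) (smult H) (smult H) q"
      "\<And>x. q x \<in> U" "\<And>x. x \<in> U \<Longrightarrow> q x = x"
    using linear_from_projection[OF vector_space_axioms U] by metis
  obtain E c where E: "finite E" "E \<subseteq> carrier H"
    and c_lin: "\<And>e. linear_from (carrier H) (smult H) (*) (c e)"
    and c_sum: "\<And>x. x \<in> carrier H \<Longrightarrow> (\<Sum>e\<in>E. smult H (c e x) e) = x"
    using coordinates[OF fd] by metis
  have [simp]: "e \<in> carrier H" if "e \<in> E" for e using that E by blast
  have qH [simp]: "q y \<in> carrier H" for y using q(2) sub by blast
  define r where "r y = y - q y" for y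
  have r_lin: "linear_from (carrier H) (smult H) (smult H) r"
    unfolding r_def using q(1) by (auto intro!: lin)
  have rH [simp]: "r y \<in> carrier H" if "y \<in> carrier H" for y unfolding r_def using that by simp
  have r_zero: "r y = 0" if "y \<in> U" for y unfolding r_def using that q(3) by simp
  note [lin] = linear_from_comp[OF q(1)] linear_from_comp[OF r_lin] linear_from_comp[OF c_lin]
  have cr: "linear_from (carrier H) (smult H) (*) (\<lambda>y. c e (r y))" "\<And>y. y \<in> U \<Longrightarrow> c e (r y) = 0" for e
    by (auto intro!: lin simp: r_zero linear_from_zero[OF c_lin])
  have "sw x \<beta> = sw x (\<lambda>a b. \<beta> (q a) (q b))"
    if \<beta>: "bilinear_from (carrier H) (smult H) (*) \<beta>" for \<beta> :: "'a \<Rightarrow> 'a \<Rightarrow> 'k"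
  proof -
    note bl = bilinear_fromD(1)[OF \<beta>] and br = bilinear_fromD(2)[OF \<beta>]
    note [lin] = bilinear_from_comp_left[OF \<beta>] bilinear_from_comp_right[OF \<beta>]
    have expand_l: "\<beta> (r a) b = (\<Sum>e\<in>E. \<beta> e (smult H (c e (r a)) b))"
      if [simp]: "a \<in> carrier H" "b \<in> carrier H" for a b
    proof -
      have "\<beta> (r a) b = \<beta> (\<Sum>e\<in>E. smult H (c e (r a)) e) b" by (simp add: c_sum)
      also have "\<dots> = (\<Sum>e\<in>E. \<beta> (smult H (c e (r a)) e) b)"
        by (rule linear_from_sum[OF bl carrier_subspace vector_space_axioms]) simp_all
      also have "\<dots> = (\<Sum>e\<in>E. \<beta> e (smult H (c e (r a)) b))"
        by (rule sum.cong) (simp_all add: linear_from_scale[OF bl] linear_from_scale[OF br])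
      finally show ?thesis .
    qed
    have expand_r: "\<beta> (q a) (r b) = (\<Sum>e\<in>E. \<beta> (q (smult H (c e (r b)) a)) e)"
      if [simp]: "a \<in> carrier H" "b \<in> carrier H" for a b
    proof -
      have "\<beta> (q a) (r b) = \<beta> (q a) (\<Sum>e\<in>E. smult H (c e (r b)) e)" by (simp add: c_sum)
      also have "\<dots> = (\<Sum>e\<in>E. \<beta> (q a) (smult H (c e (r b)) e))"
        by (rule linear_from_sum[OF br carrier_subspace vector_space_axioms]) simp_all
      also have "\<dots> = (\<Sum>e\<in>E. \<beta> (q (smult H (c e (r b)) a)) e)"
        by (rule sum.cong) (simp_all add: linear_from_scale[OF bl] linear_from_scale[OF br]
            linear_from_scale[OF q(1)])
      finally show ?thesis .
    qed
    have "sw x (\<lambda>a b. \<beta> (r a) b) = (\<Sum>e\<in>E. sw x (\<lambda>a b. \<beta> e (smult H (c e (r a)) b)))"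
      by (simp add: expand_l sweedler_sum[symmetric] x cong: sw_cong)
    also have "\<dots> = (\<Sum>e\<in>E. \<beta> e (sw x (\<lambda>a b. smult H (c e (r a)) b)))"
      by (rule sum.cong) (simp_all add: linear_sw_carrier[OF br] x)
    also have "\<dots> = 0"
      by (rule sum.neutral) (simp add: left[OF cr] linear_from_zero[OF br])
    finally have 1: "sw x (\<lambda>a b. \<beta> (r a) b) = 0" .
    have "sw x (\<lambda>a b. \<beta> (q a) (r b)) = (\<Sum>e\<in>E. sw x (\<lambda>a b. \<beta> (q (smult H (c e (r b)) a)) e))"
      by (simp add: expand_r sweedler_sum[symmetric] x cong: sw_cong)
    also have "\<dots> = (\<Sum>e\<in>E. \<beta> (q (sw x (\<lambda>a b. smult H (c e (r b)) a))) e)"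
      by (rule sum.cong, simp, rule linear_sw_carrier[where f = "\<lambda>y. \<beta> (q y) _", symmetric])
        (auto intro!: lin simp: x)
    also have "\<dots> = 0"
      by (rule sum.neutral) (simp add: right[OF cr] linear_from_zero[OF bl] linear_from_zero[OF q(1)])
    finally have 2: "sw x (\<lambda>a b. \<beta> (q a) (r b)) = 0" .
    \<comment> \<open>The decomposition of the identity of the tensor square as q \<otimes> q + q
      \<otimes> r + r \<otimes> 1.\<close>
    have "sw x \<beta> = sw x (\<lambda>a b. \<beta> (q a) (q b) + (\<beta> (q a) (r b) + \<beta> (r a) b))"
    proof (rule sw_cong[OF x])
      fix a b assume [simp]: "a \<in> carrier H" "b \<in> carrier H"
      have "\<beta> a b = \<beta> (q a + r a) b" "\<beta> (q a) b = \<beta> (q a) (q b + r b)" by (simp_all add: r_def)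
      then show "\<beta> a b = \<beta> (q a) (q b) + (\<beta> (q a) (r b) + \<beta> (r a) b)"
        by (simp add: linear_from_add[OF bl] linear_from_add[OF br])
    qed
    then show ?thesis by (simp add: sweedler_add 1 2)
  qed
  then have "tensor_eq (smult H) (carrier H) (pair_tensor (comult H x))
      (pair_tensor (map (\<lambda>(a, b). (q a, q b)) (comult H x)))"
    unfolding tensor_eq_pair_iff by (simp add: sweedler_def comp_def case_prod_unfold)
  moreover have "set (map (\<lambda>(a, b). (q a, q b)) (comult H x)) \<subseteq> U \<times> U"
    using q(2) by auto
  ultimately show ?thesis by blast
qed

lemma hopf_subalgebra_functional:
  assumes A: "hopf_subalgebra H A" and x: "x \<in> A"
    and \<phi>: "linear_from (carrier H) (smult H) (*) \<phi>" "\<And>y. y \<in> A \<Longrightarrow> \<phi> y = 0"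
  shows "sw x (\<lambda>a b. smult H (\<phi> a) b) = 0" "sw x (\<lambda>a b. smult H (\<phi> b) a) = 0"
proof -
  note [lin] = linear_from_comp[OF \<phi>(1)]
  have "sw x (\<lambda>a b. smult H (\<phi> a) b) = sweedler (sub_hopf H A) x (\<lambda>a b. smult H (\<phi> a) b)"
    by (rule sweedler_sub_hopf[OF A x, symmetric]) (auto intro!: lin)
  also have "\<dots> = sweedler (sub_hopf H A) x (\<lambda>a b. 0)"
    by (rule sweedler_sub_hopf_cong[OF A x]) (simp add: \<phi>(2))
  finally show "sw x (\<lambda>a b. smult H (\<phi> a) b) = 0" by simp
  have "sw x (\<lambda>a b. smult H (\<phi> b) a) = sweedler (sub_hopf H A) x (\<lambda>a b. smult H (\<phi> b) a)"
    by (rule sweedler_sub_hopf[OF A x, symmetric]) (auto intro!: lin)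
  also have "\<dots> = sweedler (sub_hopf H A) x (\<lambda>a b. 0)"
    by (rule sweedler_sub_hopf_cong[OF A x]) (simp add: \<phi>(2))
  finally show "sw x (\<lambda>a b. smult H (\<phi> b) a) = 0" by simp
qed

text \<open>Functionals vanishing on \<open>A \<inter> B\<close> are sums of one vanishing on
  \<open>A\<close> and one vanishing on \<open>B\<close>: the summands are \<phi> - \<psi> and
  \<psi>.\<close>

lemma functional_split:
  assumes A: "subspace A" "A \<subseteq> carrier H" and B: "subspace B" "B \<subseteq> carrier H"
    and \<phi>: "linear_from (carrier H) (smult H) (*) \<phi>" "\<And>y. y \<in> A \<inter> B \<Longrightarrow> \<phi> y = 0"
  obtains \<psi> where "linear_from (carrier H) (smult H) (*) \<psi>" "\<And>y. y \<in> B \<Longrightarrow> \<psi> y = 0"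
    "\<And>y. y \<in> A \<Longrightarrow> \<psi> y = \<phi> y"
proof -
  let ?S = "{a + b | a b. a \<in> A \<and> b \<in> B}"
  \<comment> \<open>The \<open>A\<close>-component of an element of A + B. It is determined up to
    \<open>A \<inter> B\<close>, where \<phi> vanishes, so \<phi>(\<alpha> z) is well defined and
    linear although \<alpha> is only a choice.\<close>
  define \<alpha> where "\<alpha> z = (SOME a. a \<in> A \<and> z - a \<in> B)" for z
  have \<alpha>: "\<alpha> z \<in> A \<and> z - \<alpha> z \<in> B" if "z \<in> ?S" for z
  proof -
    obtain a b where "a \<in> A" "b \<in> B" "z = a + b" using \<open>z \<in> ?S\<close> by blast
    then have "a \<in> A \<and> z - a \<in> B" by simp
    then show ?thesis unfolding \<alpha>_def by (rule someI)
  qed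
  have S: "subspace ?S" by (rule subspace_sums[OF A(1) B(1)])
  have unique: "\<phi> a = \<phi> a'" if "a \<in> A" "a' \<in> A" "a - a' \<in> B" for a a'
  proof -
    have "a - a' \<in> A \<inter> B" using that subspace_diff[OF A(1)] by simp
    then have "\<phi> (a - a') = 0" by (rule \<phi>(2))
    then show ?thesis
      using that A(2) linear_from_diff[OF \<phi>(1) carrier_subspace vector_space_axioms, of a a'] by auto
  qed
  have "linear_from ?S (smult H) (*) (\<lambda>z. \<phi> (\<alpha> z))"
    unfolding linear_from_def
  proof (intro conjI ballI allI)
    fix z w assume zw: "z \<in> ?S" "w \<in> ?S"
    note * = \<alpha>[OF zw(1)] \<alpha>[OF zw(2)] \<alpha>[OF subspace_add[OF S zw]]
    have "z + w - \<alpha> (z + w) - ((z - \<alpha> z) + (w - \<alpha> w)) \<in> B"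
      using subspace_diff[OF B(1) conjunct2[OF *(3)] subspace_add[OF B(1) conjunct2[OF *(1)] conjunct2[OF *(2)]]] .
    then have "(\<alpha> z + \<alpha> w) - \<alpha> (z + w) \<in> B" by (simp add: algebra_simps)
    then have "\<phi> (\<alpha> z + \<alpha> w) = \<phi> (\<alpha> (z + w))"
      using * A(1) by (intro unique) (auto intro: subspace_add)
    then show "\<phi> (\<alpha> (z + w)) = \<phi> (\<alpha> z) + \<phi> (\<alpha> w)"
      using * A(2) linear_from_add[OF \<phi>(1), of "\<alpha> z" "\<alpha> w"] by auto
  next
    fix c z assume z: "z \<in> ?S"
    note * = \<alpha>[OF z] \<alpha>[OF subspace_scale[OF S z, of c]]
    have "smult H c z - \<alpha> (smult H c z) - smult H c (z - \<alpha> z) \<in> B"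
      using subspace_diff[OF B(1) conjunct2[OF *(2)] subspace_scale[OF B(1) conjunct2[OF *(1)]]] .
    then have "smult H c (\<alpha> z) - \<alpha> (smult H c z) \<in> B" by (simp add: scale_right_diff_distrib)
    then have "\<phi> (smult H c (\<alpha> z)) = \<phi> (\<alpha> (smult H c z))"
      using * A(1) by (intro unique) (auto intro: subspace_scale)
    then show "\<phi> (\<alpha> (smult H c z)) = c * \<phi> (\<alpha> z)"
      using * A(2) linear_from_scale[OF \<phi>(1), of "\<alpha> z" c] by auto
  qed
  then obtain \<psi> where \<psi>: "Vector_Spaces.linear (smult H) (*) \<psi>" "\<And>x. x \<in> ?S \<Longrightarrow> \<psi> x = \<phi> (\<alpha> x)"
    by (rule linear_from_extend[OF vector_space_axioms vector_space_field S]) blast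
  have zero: "0 \<in> A" "0 \<in> B" using A(1) B(1) subspace_0 by auto
  show ?thesis
  proof
    show "linear_from (carrier H) (smult H) (*) \<psi>" by (rule linear_from_linear[OF \<psi>(1)])
    show "\<psi> y = 0" if "y \<in> B" for y
    proof -
      have y: "y \<in> ?S" using that zero by force
      have "y - (y - \<alpha> y) \<in> B" using subspace_diff[OF B(1) that conjunct2[OF \<alpha>[OF y]]] .
      then show ?thesis using \<psi>(2)[OF y] \<alpha>[OF y] \<phi>(2)[of "\<alpha> y"] by simp
    qed
    show "\<psi> y = \<phi> y" if "y \<in> A" for y
    proof -
      have y: "y \<in> ?S" using that zero by force
      show ?thesis using \<psi>(2)[OF y] unique[of y "\<alpha> y"] \<alpha>[OF y] that by simp
    qed
  qed
qed

text \<open>Only the comultiplication needs an argument. A functional \<phi> vanishing on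
  \<open>A \<inter> B\<close> splits into a part vanishing on \<open>A\<close> and a part vanishing
  on \<open>B\<close>, and each part kills a factor of the comultiplied \<open>x\<close>, which lies
  in both Hopf subalgebras.\<close>

lemma normal_hopf_subalgebra_Int:
  assumes fd: "finite_dimensional H" and A: "normal_hopf_subalgebra H A" and B: "normal_hopf_subalgebra H B"
  shows "normal_hopf_subalgebra H (A \<inter> B)"
proof -
  note AD = normal_hopf_subalgebraD[OF A] and BD = normal_hopf_subalgebraD[OF B]
  note ASD = hopf_subalgebraD[OF AD(1)] and BSD = hopf_subalgebraD[OF BD(1)]
  have sub: "subspace (A \<inter> B)" using ASD(3) BSD(3) by (rule subspace_inter)
  have "\<exists>t. set t \<subseteq> (A \<inter> B) \<times> (A \<inter> B) \<and>
        tensor_eq (smult H) (carrier H) (pair_tensor (comult H x)) (pair_tensor t)" if x: "x \<in> A \<inter> B" for x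
  proof (rule comult_in_subspaceI[OF fd sub])
    fix \<phi> assume \<phi>: "linear_from (carrier H) (smult H) (*) \<phi>" "\<And>y. y \<in> A \<inter> B \<Longrightarrow> \<phi> y = 0"
    obtain \<psi> where \<psi>: "linear_from (carrier H) (smult H) (*) \<psi>" "\<And>y. y \<in> B \<Longrightarrow> \<psi> y = 0"
      "\<And>y. y \<in> A \<Longrightarrow> \<psi> y = \<phi> y"
      by (rule functional_split[OF ASD(3,2) BSD(3,2) \<phi>], assumption) (rule that)
    have diff: "linear_from (carrier H) (smult H) (*) (\<lambda>y. \<phi> y - \<psi> y)"
      using \<phi>(1) \<psi>(1) by (auto intro!: lin)
    have zero: "\<phi> y - \<psi> y = 0" if "y \<in> A" for y using \<psi>(3)[OF that] by simp
    have xx: "x \<in> A" "x \<in> B" using x by auto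
    have "sw x (\<lambda>a b. smult H (\<phi> a) b) = sw x (\<lambda>a b. smult H (\<phi> a - \<psi> a) b + smult H (\<psi> a) b)"
      "sw x (\<lambda>a b. smult H (\<phi> b) a) = sw x (\<lambda>a b. smult H (\<phi> b - \<psi> b) a + smult H (\<psi> b) a)"
      by (simp_all add: scale_left_diff_distrib)
    then show "sw x (\<lambda>a b. smult H (\<phi> a) b) = 0" "sw x (\<lambda>a b. smult H (\<phi> b) a) = 0"
      by (simp_all only: sweedler_add hopf_subalgebra_functional[OF AD(1) xx(1) diff zero]
          hopf_subalgebra_functional[OF BD(1) xx(2) \<psi>(1,2)] add_0)
  qed (use x ASD(2) in auto)
  then show ?thesis
    unfolding normal_hopf_subalgebra_iff hopf_subalgebra_def
    using ASD BSD AD BD sub by (auto simp: hopf_algebra_axioms)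
qed

definition product_span :: "'a set \<Rightarrow> 'a set \<Rightarrow> 'a set" where
  "product_span A B = span {a \<odot> b | a b. a \<in> A \<and> b \<in> B}"

lemma product_span_subspace: "subspace (product_span A B)"
  by (simp add: product_span_def)

lemma product_span_mem: "a \<in> A \<Longrightarrow> b \<in> B \<Longrightarrow> a \<odot> b \<in> product_span A B"
  unfolding product_span_def by (rule span_base) blast

lemma product_span_induct:
  assumes "x \<in> product_span A B" "subspace W" "\<And>a b. a \<in> A \<Longrightarrow> b \<in> B \<Longrightarrow> a \<odot> b \<in> W"
  shows "x \<in> W"
proof -
  have "product_span A B \<subseteq> W"
    unfolding product_span_def using assms(2,3) by (intro span_minimal) auto
  then show ?thesis using assms(1) by blast
qed

text \<open>\<open>H\<close> is a module algebra under both adjoint actions: in u1 a S(u2) v1 b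
  S(v2), and in S(u1) a u2 S(v1) b v2, the two adjacent factors of \<open>h\<close> in the middle
  cancel.\<close>

lemma sw_adjoint_product:
  assumes [simp]: "h \<in> carrier H" "a \<in> carrier H" "b \<in> carrier H"
  shows "sw h (\<lambda>u v. adl u a \<odot> adl v b) = adl h (a \<odot> b)"
    "sw h (\<lambda>u v. adr u a \<odot> adr v b) = adr h (a \<odot> b)"
proof -
  \<comment> \<open>Common form of both cases: \<open>f\<close> is the pair that cancels,
    \<open>K\<close> the expression around it. Coassociativity is applied twice to make the two
    arguments of \<open>f\<close> the factors of one element \<open>z\<close>.\<close>
  have cancel: "sw h (\<lambda>u v. sw u (\<lambda>u1 u2. sw v (\<lambda>v1 v2. K u1 (f u2 v1) v2))) =
      sw h (\<lambda>u v. K u \<one> v)"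
    if K1: "\<And>y z. y \<in> carrier H \<Longrightarrow> z \<in> carrier H \<Longrightarrow> linear_from (carrier H) (smult H) (smult H) (\<lambda>x. K x y z)"
    and K2: "\<And>x z. x \<in> carrier H \<Longrightarrow> z \<in> carrier H \<Longrightarrow> linear_from (carrier H) (smult H) (smult H) (\<lambda>y. K x y z)"
    and K3: "\<And>x y. x \<in> carrier H \<Longrightarrow> y \<in> carrier H \<Longrightarrow> linear_from (carrier H) (smult H) (smult H) (\<lambda>z. K x y z)"
    and f: "bilinear_from (carrier H) (smult H) (smult H) f"
      "\<And>x y. x \<in> carrier H \<Longrightarrow> y \<in> carrier H \<Longrightarrow> f x y \<in> carrier H"
    and fs: "\<And>z. z \<in> carrier H \<Longrightarrow> sw z f = smult H (\<epsilon> z) \<one>"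
    for K f
  proof -
    note [simp] = f(2)
    have tri: "trilinear_from (carrier H) (smult H) (smult H) K"
      by (rule trilinear_fromI) (rule K3 K2 K1; assumption)+
    note [lin] = trilinear_from_comp[OF tri] bilinear_from_comp_left[OF f(1)] bilinear_from_comp_right[OF f(1)]
    have "sw h (\<lambda>u v. sw u (\<lambda>u1 u2. sw v (\<lambda>v1 v2. K u1 (f u2 v1) v2))) =
        sw h (\<lambda>u1 w. sw w (\<lambda>u2 v. sw v (\<lambda>v1 v2. K u1 (f u2 v1) v2)))"
      by (rule sw_coassoc) (auto intro!: lin)
    also have "\<dots> = sw h (\<lambda>u1 w. sw w (\<lambda>z v2. sw z (\<lambda>u2 v1. K u1 (f u2 v1) v2)))"
      by (rule sw_cong, simp, rule sw_coassoc[symmetric]) (auto intro!: lin)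
    also have "\<dots> = sw h (\<lambda>u1 w. K u1 \<one> w)"
    proof (rule sw_cong)
      fix u1 w assume [simp]: "u1 \<in> carrier H" "w \<in> carrier H"
      have "sw w (\<lambda>z v2. sw z (\<lambda>u2 v1. K u1 (f u2 v1) v2)) = sw w (\<lambda>z v2. smult H (\<epsilon> z) (K u1 \<one> v2))"
      proof (rule sw_cong)
        fix z v2 assume [simp]: "z \<in> carrier H" "v2 \<in> carrier H"
        have "sw z (\<lambda>u2 v1. K u1 (f u2 v1) v2) = K u1 (sw z f) v2"
          by (rule linear_sw_carrier[OF K2, symmetric]) simp_all
        then show "sw z (\<lambda>u2 v1. K u1 (f u2 v1) v2) = smult H (\<epsilon> z) (K u1 \<one> v2)"
          by (simp add: fs linear_from_scale[OF K2])
      qed simp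
      also have "\<dots> = K u1 \<one> w" by (rule sw_counit_left[OF K3]) simp_all
      finally show "sw w (\<lambda>z v2. sw z (\<lambda>u2 v1. K u1 (f u2 v1) v2)) = K u1 \<one> w" .
    qed simp
    finally show ?thesis .
  qed
  have "sw h (\<lambda>u v. adl u a \<odot> adl v b) =
      sw h (\<lambda>u v. sw u (\<lambda>u1 u2. sw v (\<lambda>v1 v2. (\<lambda>x y z. x \<odot> a \<odot> y \<odot> (b \<odot> \<S> z)) u1 (\<S> u2 \<odot> v1) v2)))"
  proof (rule sw_cong)
    fix u v assume [simp]: "u \<in> carrier H" "v \<in> carrier H"
    have "adl u a \<odot> adl v b = sw u (\<lambda>u1 u2. (u1 \<odot> a \<odot> \<S> u2) \<odot> adl v b)"
      unfolding adjoint_left_def[of H u a] by (rule mult_sw_left) simp_all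
    then show "adl u a \<odot> adl v b = sw u (\<lambda>u1 u2. sw v (\<lambda>v1 v2. (\<lambda>x y z. x \<odot> a \<odot> y \<odot> (b \<odot> \<S> z)) u1 (\<S> u2 \<odot> v1) v2))"
      by (simp add: adjoint_left_def mult_sw_right mult_assoc cong: sw_cong)
  qed simp
  also have "\<dots> = sw h (\<lambda>u v. (\<lambda>x y z. x \<odot> a \<odot> y \<odot> (b \<odot> \<S> z)) u \<one> v)"
    using antipode_left
    by (intro cancel[of "\<lambda>x y z. x \<odot> a \<odot> y \<odot> (b \<odot> \<S> z)" "\<lambda>u2 v1. \<S> u2 \<odot> v1"]) (auto intro!: lin simp: sweedler_def)
  also have "\<dots> = adl h (a \<odot> b)"
    unfolding adjoint_left_def by (rule sw_cong) (simp_all add: mult_unit_right mult_assoc)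
  finally show "sw h (\<lambda>u v. adl u a \<odot> adl v b) = adl h (a \<odot> b)" .
  have "sw h (\<lambda>u v. adr u a \<odot> adr v b) =
      sw h (\<lambda>u v. sw u (\<lambda>u1 u2. sw v (\<lambda>v1 v2. (\<lambda>x y z. \<S> x \<odot> a \<odot> y \<odot> (b \<odot> z)) u1 (u2 \<odot> \<S> v1) v2)))"
  proof (rule sw_cong)
    fix u v assume [simp]: "u \<in> carrier H" "v \<in> carrier H"
    have "adr u a \<odot> adr v b = sw u (\<lambda>u1 u2. (\<S> u1 \<odot> a \<odot> u2) \<odot> adr v b)"
      unfolding adjoint_right_def[of H u a] by (rule mult_sw_left) simp_all
    then show "adr u a \<odot> adr v b = sw u (\<lambda>u1 u2. sw v (\<lambda>v1 v2. (\<lambda>x y z. \<S> x \<odot> a \<odot> y \<odot> (b \<odot> z)) u1 (u2 \<odot> \<S> v1) v2))"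
      by (simp add: adjoint_right_def mult_sw_right mult_assoc cong: sw_cong)
  qed simp
  also have "\<dots> = sw h (\<lambda>u v. (\<lambda>x y z. \<S> x \<odot> a \<odot> y \<odot> (b \<odot> z)) u \<one> v)"
    using antipode_right
    by (intro cancel[of "\<lambda>x y z. \<S> x \<odot> a \<odot> y \<odot> (b \<odot> z)" "\<lambda>u2 v1. u2 \<odot> \<S> v1"]) (auto intro!: lin simp: sweedler_def)
  also have "\<dots> = adr h (a \<odot> b)"
    unfolding adjoint_right_def by (rule sw_cong) (simp_all add: mult_unit_right mult_assoc)
  finally show "sw h (\<lambda>u v. adr u a \<odot> adr v b) = adr h (a \<odot> b)" .
qed

text \<open>Normality of \<open>A\<close> gives the inclusion of BA in AB, and with it closure under
  multiplication and antipode. Normality of the product follows from the module algebra property of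
  the adjoint actions.\<close>

lemma normal_hopf_subalgebra_product:
  assumes fd: "finite_dimensional H" and A: "normal_hopf_subalgebra H A" and B: "normal_hopf_subalgebra H B"
  shows "normal_hopf_subalgebra H (product_span A B)"
    "A \<subseteq> product_span A B" "B \<subseteq> product_span A B"
proof -
  note AD = normal_hopf_subalgebraD[OF A] and BD = normal_hopf_subalgebraD[OF B]
  note ASD = hopf_subalgebraD[OF AD(1)] and BSD = hopf_subalgebraD[OF BD(1)]
  have AH [simp]: "a \<in> carrier H" if "a \<in> A" for a using that ASD(2) by blast
  have BH [simp]: "b \<in> carrier H" if "b \<in> B" for b using that BSD(2) by blast
  let ?P = "product_span A B"
  interpret B: hopf_algebra "sub_hopf H B" by (rule hopf_algebra_sub_hopf[OF BD(1)])
  have PH: "?P \<subseteq> carrier H"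
    using product_span_induct[OF _ carrier_subspace] by (metis AH BH mult_closed subsetI)
  have PH' [simp]: "x \<in> carrier H" if "x \<in> ?P" for x using that PH by blast
  note pre = subspace_linear_preimage[OF _ carrier_subspace vector_space_axioms vector_space_axioms
      product_span_subspace]
  \<comment> \<open>b a is the sum of ad(b1)(a) b2. Taken in \<open>sub_hopf H B\<close>, the factor
    b2 remains in \<open>B\<close>, while ad(b1)(a) lies in \<open>A\<close>.\<close>
  have BA: "b \<odot> a \<in> ?P" if [simp]: "b \<in> B" "a \<in> A" for a b
  proof -
    have "b \<odot> a = sweedler (sub_hopf H B) b (\<lambda>u w. adl u a \<odot> w)"
      by (subst sweedler_sub_hopf[OF BD(1) _ _ vector_space_axioms])
        (auto intro!: lin simp: mult_eq_adjoint_left)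
    also have "\<dots> \<in> ?P"
      by (rule B.sw_in_subspace[OF _ vector_space_axioms product_span_subspace])
        (simp_all add: product_span_mem AD(2))
    finally show ?thesis .
  qed
  have m1: "a \<odot> y \<in> ?P" if [simp]: "a \<in> A" and y: "y \<in> ?P" for a y
    using product_span_induct[OF y pre[OF mult_linear_right[of a]]]
    by (auto simp: mult_assoc[symmetric] ASD(5) product_span_mem)
  have m2: "x \<odot> b \<in> ?P" if [simp]: "b \<in> B" and x: "x \<in> ?P" for x b
    using product_span_induct[OF x pre[OF mult_linear_left[of b]]]
    by (auto simp: mult_assoc BSD(5) product_span_mem)
  have m3: "b \<odot> y \<in> ?P" if [simp]: "b \<in> B" and y: "y \<in> ?P" for b y
    using product_span_induct[OF y pre[OF mult_linear_right[of b]]]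
    by (auto simp: mult_assoc[symmetric] m2 BA)
  have m4: "x \<odot> y \<in> ?P" if x: "x \<in> ?P" and y [simp]: "y \<in> ?P" for x y
    using product_span_induct[OF x pre[OF mult_linear_left[of y]]]
    by (auto simp: mult_assoc m1 m3)
  have S: "\<S> x \<in> ?P" if x: "x \<in> ?P" for x
    using product_span_induct[OF x pre[OF antipode_linear]]
    by (auto simp: antipode_mult BA ASD(6) BSD(6))
  have unit: "\<one> \<in> ?P" using product_span_mem[OF ASD(4) BSD(4)] by (simp add: mult_unit_left)
  have comult: "\<exists>t. set t \<subseteq> ?P \<times> ?P \<and>
        tensor_eq (smult H) (carrier H) (pair_tensor (comult H x)) (pair_tensor t)" if x: "x \<in> ?P" for x
  proof (rule comult_in_subspaceI[OF fd product_span_subspace _ _ _ PH])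
    show "x \<in> carrier H" using x by simp
    fix \<phi> assume \<phi>: "linear_from (carrier H) (smult H) (*) \<phi>" "\<And>y. y \<in> ?P \<Longrightarrow> \<phi> y = 0"
    note [lin] = linear_from_comp[OF \<phi>(1)]
    \<comment> \<open>The element a b comultiplies to the sum of a1 b1 \<otimes> a2 b2, both factors
      being products from A and B. So a form that is 0 on pairs from the product space gives
      0.\<close>
    have vanish: "sw x \<beta> = 0" if \<beta>: "bilinear_from (carrier H) (smult H) (smult H) \<beta>"
      and zero: "\<And>y z. y \<in> ?P \<Longrightarrow> z \<in> ?P \<Longrightarrow> \<beta> y z = 0" for \<beta>
    proof -
      note [lin] = bilinear_from_comp_left[OF \<beta>] bilinear_from_comp_right[OF \<beta>]
      have "x \<in> {x \<in> carrier H. sw x \<beta> \<in> {0}}"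
        using x
      proof (rule product_span_induct)
        show "subspace {x \<in> carrier H. sw x \<beta> \<in> {0}}"
          by (rule subspace_linear_preimage[OF _ carrier_subspace vector_space_axioms vector_space_axioms])
            (auto intro!: lin \<beta>)
        fix a b assume [simp]: "a \<in> A" "b \<in> B"
        have "sw (a \<odot> b) \<beta> = sw a (\<lambda>a1 a2. sw b (\<lambda>b1 b2. \<beta> (a1 \<odot> b1) (a2 \<odot> b2)))"
          by (rule sw_mult[OF \<beta> vector_space_axioms]) simp_all
        also have "\<dots> = sweedler (sub_hopf H A) a (\<lambda>a1 a2. sw b (\<lambda>b1 b2. \<beta> (a1 \<odot> b1) (a2 \<odot> b2)))"
          by (rule sweedler_sub_hopf[OF AD(1), symmetric]) (auto intro!: lin)
        also have "\<dots> = sweedler (sub_hopf H A) a (\<lambda>a1 a2. 0)"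
        proof (rule sweedler_sub_hopf_cong[OF AD(1)])
          fix a1 a2 assume [simp]: "a1 \<in> A" "a2 \<in> A"
          have "sw b (\<lambda>b1 b2. \<beta> (a1 \<odot> b1) (a2 \<odot> b2)) =
              sweedler (sub_hopf H B) b (\<lambda>b1 b2. \<beta> (a1 \<odot> b1) (a2 \<odot> b2))"
            by (rule sweedler_sub_hopf[OF BD(1), symmetric]) (auto intro!: lin)
          also have "\<dots> = sweedler (sub_hopf H B) b (\<lambda>b1 b2. 0)"
            by (rule sweedler_sub_hopf_cong[OF BD(1)]) (simp_all add: zero product_span_mem)
          finally show "sw b (\<lambda>b1 b2. \<beta> (a1 \<odot> b1) (a2 \<odot> b2)) = 0" by simp
        qed simp
        finally show "a \<odot> b \<in> {x \<in> carrier H. sw x \<beta> \<in> {0}}" by simp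
      qed
      then show ?thesis by simp
    qed
    show "sw x (\<lambda>a b. smult H (\<phi> a) b) = 0" "sw x (\<lambda>a b. smult H (\<phi> b) a) = 0"
      by (rule vanish; auto intro!: lin simp: \<phi>(2))+
  qed
  have sub: "hopf_subalgebra H ?P"
    unfolding hopf_subalgebra_def
    using m4 S unit comult PH product_span_subspace by (simp add: hopf_algebra_axioms)
  have "adl h x \<in> ?P" if [simp]: "h \<in> carrier H" and x: "x \<in> ?P" for h x
  proof -
    have lin_adl: "linear_from (carrier H) (smult H) (smult H) (adl h)" by (rule lin_adjoint) (auto intro!: lin)
    have "x \<in> {x \<in> carrier H. adl h x \<in> ?P}"
    proof (rule product_span_induct[OF x pre[OF lin_adl]])
      fix a b assume [simp]: "a \<in> A" "b \<in> B"
      have "sw h (\<lambda>u v. adl u a \<odot> adl v b) \<in> ?P"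
        by (rule sw_in_subspace[OF _ vector_space_axioms product_span_subspace])
          (simp_all add: product_span_mem AD(2) BD(2))
      then show "a \<odot> b \<in> {x \<in> carrier H. adl h x \<in> ?P}" by (simp add: sw_adjoint_product)
    qed
    then show ?thesis by simp
  qed
  moreover have "adr h x \<in> ?P" if [simp]: "h \<in> carrier H" and x: "x \<in> ?P" for h x
  proof -
    have lin_adr: "linear_from (carrier H) (smult H) (smult H) (adr h)" by (rule lin_adjoint) (auto intro!: lin)
    have "x \<in> {x \<in> carrier H. adr h x \<in> ?P}"
    proof (rule product_span_induct[OF x pre[OF lin_adr]])
      fix a b assume [simp]: "a \<in> A" "b \<in> B"
      have "sw h (\<lambda>u v. adr u a \<odot> adr v b) \<in> ?P"
        by (rule sw_in_subspace[OF _ vector_space_axioms product_span_subspace])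
          (simp_all add: product_span_mem AD(3) BD(3))
      then show "a \<odot> b \<in> {x \<in> carrier H. adr h x \<in> ?P}" by (simp add: sw_adjoint_product)
    qed
    then show ?thesis by simp
  qed
  ultimately show "normal_hopf_subalgebra H ?P" using sub by (simp add: normal_hopf_subalgebra_iff)
  show "A \<subseteq> ?P" using product_span_mem[OF _ BSD(4)] by (metis AH mult_unit_right subsetI)
  show "B \<subseteq> ?P" using product_span_mem[OF ASD(4)] by (metis BH mult_unit_left subsetI)
qed

end

subsection \<open>The dual Hopf algebra\<close>

lemma dual_hopf_simps [simp]:
  "carrier (dual_hopf H) = dual_space H" "smult (dual_hopf H) = (\<lambda>c f x. c * f x)"
  "unit (dual_hopf H) = (\<lambda>x. if x \<in> carrier H then counit H x else 0)"
  "counit (dual_hopf H) = (\<lambda>f. f (unit H))"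
  "antipode (dual_hopf H) = (\<lambda>f x. if x \<in> carrier H then f (antipode H x) else 0)"
  by (simp_all add: dual_hopf_def)

lemma dual_hopf_mult [simp]:
  "mult (dual_hopf H) f g = (\<lambda>x. if x \<in> carrier H then sweedler H x (\<lambda>a b. f a * g b) else 0)"
  unfolding dual_hopf_def sweedler_def by simp

lemma sum_apply: "(\<Sum>i\<in>I. f i) x = (\<Sum>i\<in>I. f i x)"
  by (induction I rule: infinite_finite_induct) simp_all

lemma sum_list_apply: "(\<Sum>t\<leftarrow>ts. f t) x = (\<Sum>t\<leftarrow>ts. f t x)"
  by (induction ts) simp_all

lemma sweedler_apply: "sweedler H x \<beta> y = sweedler H x (\<lambda>a b. \<beta> a b y)"
  unfolding sweedler_def case_prod_unfold by (rule sum_list_apply)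

lemma linear_from_apply: "linear_from V (\<lambda>c f x. c * f x) (*) (\<lambda>f. f x)"
  by (simp add: linear_from_def)

lemma linear_from_fun:
  "(\<And>y. linear_from V s (*) (\<lambda>x. f x y)) \<Longrightarrow> linear_from V s (\<lambda>c f x. c * f x) f"
  by (simp add: linear_from_def fun_eq_iff)

lemma dual_spaceD: "f \<in> dual_space H \<Longrightarrow> linear_from (carrier H) (smult H) (*) f"
  "f \<in> dual_space H \<Longrightarrow> x \<notin> carrier H \<Longrightarrow> f x = 0"
  by (auto simp: dual_space_def)

lemma dual_space_ext:
  "f \<in> dual_space H \<Longrightarrow> g \<in> dual_space H \<Longrightarrow> (\<And>x. x \<in> carrier H \<Longrightarrow> f x = g x) \<Longrightarrow> f = g"
  by (rule ext) (metis dual_spaceD(2))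

lemma sum_list_case_prod_exchange:
  "(\<Sum>(f, g)\<leftarrow>t. \<Sum>i\<in>I. h f g i) = (\<Sum>i\<in>I. \<Sum>(f, g)\<leftarrow>t. h f g i)"
  unfolding case_prod_unfold by (rule sum_list_sum_exchange)

section \<open>Dual bases and the dual comultiplication\<close>

context hopf_algebra
begin

lemma dual_spaceI:
  assumes "linear_from (carrier H) (smult H) (*) \<phi>"
  shows "(\<lambda>x. if x \<in> carrier H then \<phi> x else 0) \<in> dual_space H"
  using assms by (simp add: dual_space_def linear_from_def)

lemma dual_subspace: "module.subspace (\<lambda>c f x. c * f x) (dual_space H)"
proof -
  interpret F: vector_space "\<lambda>(c::'k) (f::'a \<Rightarrow> 'k) x. c * f x" by (rule vector_space_functions)
  show ?thesis
    unfolding F.subspace_def dual_space_def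
    by (auto intro!: lin simp: linear_from_def algebra_simps)
qed

lemma dual_coordinates:
  assumes fd: "finite_dimensional H"
  obtains E c where "finite E" "E \<subseteq> carrier H" "\<And>e. c e \<in> dual_space H"
    "\<And>x. x \<in> carrier H \<Longrightarrow> (\<Sum>e\<in>E. smult H (c e x) e) = x"
    "\<And>f. f \<in> dual_space H \<Longrightarrow> f = (\<Sum>e\<in>E. (\<lambda>x. f e * c e x))"
proof -
  obtain E c where E: "finite E" "E \<subseteq> carrier H"
    and c_lin: "\<And>e. linear_from (carrier H) (smult H) (*) (c e)"
    and c_sum: "\<And>x. x \<in> carrier H \<Longrightarrow> (\<Sum>e\<in>E. smult H (c e x) e) = x"
    using coordinates[OF fd] by metis
  define d where "d e = (\<lambda>x. if x \<in> carrier H then c e x else 0)" for e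
  have dD: "d e \<in> dual_space H" for e unfolding d_def by (rule dual_spaceI[OF c_lin])
  have d_sum: "(\<Sum>e\<in>E. smult H (d e x) e) = x" if "x \<in> carrier H" for x
    using c_sum[OF that] that by (simp add: d_def)
  have "f = (\<Sum>e\<in>E. (\<lambda>x. f e * d e x))" if f: "f \<in> dual_space H" for f
  proof
    fix x
    show "f x = (\<Sum>e\<in>E. (\<lambda>x. f e * d e x)) x"
    proof (cases "x \<in> carrier H")
      case True
      have "f x = f (\<Sum>e\<in>E. smult H (d e x) e)" using d_sum[OF True] by simp
      also have "\<dots> = (\<Sum>e\<in>E. f (smult H (d e x) e))"
        by (rule linear_from_sum[OF dual_spaceD(1)[OF f] carrier_subspace vector_space_axioms])
          (use E(2) in auto)
      also have "\<dots> = (\<Sum>e\<in>E. f e * d e x)"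
        by (rule sum.cong) (use E(2) linear_from_scale[OF dual_spaceD(1)[OF f]] in \<open>auto simp: mult.commute\<close>)
      finally show ?thesis by (simp add: sum_apply)
    qed (simp add: sum_apply d_def dual_spaceD(2)[OF f])
  qed
  then show ?thesis using that[of E d] E dD d_sum by blast
qed

text \<open>Expanding both arguments of \<beta> in the dual basis leaves only the values f(e) g(e').
  So a tensor over the dual is determined by its values at pairs of points, which is the uniqueness
  behind the comultiplication of \<open>dual_hopf\<close>.\<close>

lemma dual_pairs_eq:
  fixes \<beta> :: "('a \<Rightarrow> 'k) \<Rightarrow> ('a \<Rightarrow> 'k) \<Rightarrow> 'k"
  assumes fd: "finite_dimensional H"
    and \<beta>: "bilinear_from (dual_space H) (\<lambda>c f x. c * f x) (*) \<beta>"
    and tu: "set t \<subseteq> dual_space H \<times> dual_space H" "set u \<subseteq> dual_space H \<times> dual_space H"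
    and eq: "\<And>x y. x \<in> carrier H \<Longrightarrow> y \<in> carrier H \<Longrightarrow>
      (\<Sum>(f, g)\<leftarrow>t. f x * g y) = (\<Sum>(f, g)\<leftarrow>u. f x * g y)"
  shows "(\<Sum>(f, g)\<leftarrow>t. \<beta> f g) = (\<Sum>(f, g)\<leftarrow>u. \<beta> f g)"
proof -
  obtain E c where E: "finite E" "E \<subseteq> carrier H" and c: "\<And>e. c e \<in> dual_space H"
    and c_sum: "\<And>x. x \<in> carrier H \<Longrightarrow> (\<Sum>e\<in>E. smult H (c e x) e) = x"
    and expand: "\<And>f. f \<in> dual_space H \<Longrightarrow> f = (\<Sum>e\<in>E. (\<lambda>x. f e * c e x))"
    by (rule dual_coordinates[OF fd]) (rule that)
  note sum_lin = linear_from_sum[OF _ dual_subspace vector_space_functions]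
  have scD: "(\<lambda>x. k * c e x) \<in> dual_space H" for k e
    using module.subspace_scale[OF module_of_vector_space[OF vector_space_functions] dual_subspace c] .
  have \<beta>_expand: "\<beta> f g = (\<Sum>e\<in>E. \<Sum>e'\<in>E. f e * g e' * \<beta> (c e) (c e'))"
    if f: "f \<in> dual_space H" and g: "g \<in> dual_space H" for f g
  proof -
    have "\<beta> f g = \<beta> (\<Sum>e\<in>E. (\<lambda>x. f e * c e x)) g" using expand[OF f] by simp
    also have "\<dots> = (\<Sum>e\<in>E. \<beta> (\<lambda>x. f e * c e x) g)"
      by (rule sum_lin[OF bilinear_fromD(1)[OF \<beta> g]]) (rule scD)
    also have "\<dots> = (\<Sum>e\<in>E. f e * \<beta> (c e) g)"
      by (rule sum.cong) (simp_all add: linear_from_scale[OF bilinear_fromD(1)[OF \<beta> g] c])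
    also have "\<dots> = (\<Sum>e\<in>E. f e * (\<Sum>e'\<in>E. g e' * \<beta> (c e) (c e')))"
    proof (rule sum.cong[OF refl])
      fix e
      have "\<beta> (c e) g = \<beta> (c e) (\<Sum>e'\<in>E. (\<lambda>x. g e' * c e' x))" using expand[OF g] by simp
      also have "\<dots> = (\<Sum>e'\<in>E. \<beta> (c e) (\<lambda>x. g e' * c e' x))"
        by (rule sum_lin[OF bilinear_fromD(2)[OF \<beta> c]]) (rule scD)
      also have "\<dots> = (\<Sum>e'\<in>E. g e' * \<beta> (c e) (c e'))"
        by (rule sum.cong) (simp_all add: linear_from_scale[OF bilinear_fromD(2)[OF \<beta> c] c])
      finally show "f e * \<beta> (c e) g = f e * (\<Sum>e'\<in>E. g e' * \<beta> (c e) (c e'))" by simp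
    qed
    finally show ?thesis by (simp add: sum_distrib_left mult.assoc)
  qed
  have "(\<Sum>(f, g)\<leftarrow>t. \<beta> f g) = (\<Sum>e\<in>E. \<Sum>e'\<in>E. (\<Sum>(f, g)\<leftarrow>t. f e * g e') * \<beta> (c e) (c e'))"
    if t: "set t \<subseteq> dual_space H \<times> dual_space H" for t
  proof -
    have "(\<Sum>(f, g)\<leftarrow>t. \<beta> f g) = (\<Sum>(f, g)\<leftarrow>t. \<Sum>e\<in>E. \<Sum>e'\<in>E. f e * g e' * \<beta> (c e) (c e'))"
      using t by (intro arg_cong[where f = sum_list] map_cong refl) (auto simp: \<beta>_expand)
    also have "\<dots> = (\<Sum>e\<in>E. \<Sum>e'\<in>E. \<Sum>(f, g)\<leftarrow>t. f e * g e' * \<beta> (c e) (c e'))"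
      by (simp only: sum_list_case_prod_exchange)
    finally show ?thesis by (simp add: sum_list_mult_const case_prod_unfold)
  qed
  from this[OF tu(1)] this[OF tu(2)] show ?thesis
    using E(2) by (auto intro!: sum.cong simp: eq subset_iff)
qed

lemma dual_comult:
  assumes fd: "finite_dimensional H" and f: "f \<in> dual_space H"
  shows "set (comult (dual_hopf H) f) \<subseteq> dual_space H \<times> dual_space H"
    "\<And>x y. x \<in> carrier H \<Longrightarrow> y \<in> carrier H \<Longrightarrow>
      (\<Sum>(g, k)\<leftarrow>comult (dual_hopf H) f. g x * k y) = f (x \<odot> y)"
proof -
  obtain E c where E: "finite E" "E \<subseteq> carrier H" and c: "\<And>e. c e \<in> dual_space H"
    and c_sum: "\<And>x. x \<in> carrier H \<Longrightarrow> (\<Sum>e\<in>E. smult H (c e x) e) = x"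
    and expand: "\<And>f. f \<in> dual_space H \<Longrightarrow> f = (\<Sum>e\<in>E. (\<lambda>x. f e * c e x))"
    by (rule dual_coordinates[OF fd]) (rule that)
  have EH [simp]: "e \<in> carrier H" if "e \<in> E" for e using E(2) that by blast
  obtain es where es: "set es = E" "distinct es" using finite_distinct_list[OF E(1)] by blast
  \<comment> \<open>From the expansion of \<open>x\<close> in the basis, f(x y) is the sum of c_e(x)
    f(e y). This list witnesses the existence that the \<open>SOME\<close> in
    \<open>dual_hopf\<close> relies on.\<close>
  define t where "t = map (\<lambda>e. (c e, \<lambda>y. if y \<in> carrier H then f (e \<odot> y) else 0)) es"
  note f_lin = dual_spaceD(1)[OF f]
  have "(\<Sum>(g, k)\<leftarrow>t. g x * k y) = f (x \<odot> y)" if xy: "x \<in> carrier H" "y \<in> carrier H" for x y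
  proof -
    have "(\<Sum>(g, k)\<leftarrow>t. g x * k y) = (\<Sum>e\<leftarrow>es. c e x * f (e \<odot> y))"
      using xy by (simp add: t_def comp_def)
    also have "\<dots> = (\<Sum>e\<in>E. c e x * f (e \<odot> y))"
      using es by (simp add: sum_list_distinct_conv_sum_set)
    also have "\<dots> = (\<Sum>e\<in>E. f (smult H (c e x) e \<odot> y))"
      by (rule sum.cong) (simp_all add: xy mult_smult_left linear_from_scale[OF f_lin])
    also have "\<dots> = f ((\<Sum>e\<in>E. smult H (c e x) e) \<odot> y)"
      by (rule linear_from_sum[OF _ carrier_subspace vector_space_axioms, symmetric])
        (auto intro!: lin linear_from_comp[OF f_lin] simp: xy)
    finally show ?thesis by (simp add: c_sum xy)
  qed
  moreover have "set t \<subseteq> dual_space H \<times> dual_space H"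
    unfolding t_def using es(1) c
    by (auto intro!: dual_spaceI linear_from_comp[OF f_lin] lin)
  ultimately have "\<exists>t. set t \<subseteq> dual_space H \<times> dual_space H \<and>
      (\<forall>x\<in>carrier H. \<forall>y\<in>carrier H. (\<Sum>(g1, g2)\<leftarrow>t. g1 x * g2 y) = f (x \<odot> y))" by blast
  from someI_ex[OF this] show "set (comult (dual_hopf H) f) \<subseteq> dual_space H \<times> dual_space H"
    "\<And>x y. x \<in> carrier H \<Longrightarrow> y \<in> carrier H \<Longrightarrow>
      (\<Sum>(g, k)\<leftarrow>comult (dual_hopf H) f. g x * k y) = f (x \<odot> y)"
    by (simp_all add: dual_hopf_def)
qed

lemma sweedler_dual:
  assumes "finite_dimensional H" "f \<in> dual_space H" "x \<in> carrier H" "y \<in> carrier H"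
  shows "sweedler (dual_hopf H) f (\<lambda>g k. g x * k y) = f (x \<odot> y)"
  using dual_comult(2)[OF assms] by (simp add: sweedler_def)

text \<open>The working rule for the dual comultiplication: any list with the right values at pairs
  of points may replace the selected one under a bilinear form.\<close>

lemma sweedler_dual_eqI:
  fixes \<beta> :: "('a \<Rightarrow> 'k) \<Rightarrow> ('a \<Rightarrow> 'k) \<Rightarrow> 'k"
  assumes fd: "finite_dimensional H" and f: "f \<in> dual_space H"
    and \<beta>: "bilinear_from (dual_space H) (\<lambda>c f x. c * f x) (*) \<beta>"
    and t: "set t \<subseteq> dual_space H \<times> dual_space H"
    and eq: "\<And>x y. x \<in> carrier H \<Longrightarrow> y \<in> carrier H \<Longrightarrow> (\<Sum>(g, k)\<leftarrow>t. g x * k y) = f (x \<odot> y)"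
  shows "sweedler (dual_hopf H) f \<beta> = (\<Sum>(g, k)\<leftarrow>t. \<beta> g k)"
  unfolding sweedler_def
  by (rule dual_pairs_eq[OF fd \<beta> dual_comult(1)[OF fd f] t]) (simp add: dual_comult(2)[OF fd f] eq)

lemma dual_triples_eq:
  fixes \<tau> :: "('a \<Rightarrow> 'k) \<Rightarrow> ('a \<Rightarrow> 'k) \<Rightarrow> ('a \<Rightarrow> 'k) \<Rightarrow> 'k"
  assumes fd: "finite_dimensional H"
    and \<tau>: "trilinear_from (dual_space H) (\<lambda>c f x. c * f x) (*) \<tau>"
    and tu: "set t \<subseteq> dual_space H \<times> dual_space H \<times> dual_space H"
      "set u \<subseteq> dual_space H \<times> dual_space H \<times> dual_space H"
    and eq: "\<And>x y z. x \<in> carrier H \<Longrightarrow> y \<in> carrier H \<Longrightarrow> z \<in> carrier H \<Longrightarrow>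
      (\<Sum>(f, g, k)\<leftarrow>t. f x * g y * k z) = (\<Sum>(f, g, k)\<leftarrow>u. f x * g y * k z)"
  shows "(\<Sum>(f, g, k)\<leftarrow>t. \<tau> f g k) = (\<Sum>(f, g, k)\<leftarrow>u. \<tau> f g k)"
proof -
  obtain E c where E: "finite E" "E \<subseteq> carrier H" and c: "\<And>e. c e \<in> dual_space H"
    and c_sum: "\<And>x. x \<in> carrier H \<Longrightarrow> (\<Sum>e\<in>E. smult H (c e x) e) = x"
    and expand: "\<And>f. f \<in> dual_space H \<Longrightarrow> f = (\<Sum>e\<in>E. (\<lambda>x. f e * c e x))"
    by (rule dual_coordinates[OF fd]) (rule that)
  have scD: "(\<lambda>x. k * c e x) \<in> dual_space H" for k e
    using module.subspace_scale[OF module_of_vector_space[OF vector_space_functions] dual_subspace c] .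
  have lin_expand: "\<phi> f = (\<Sum>e\<in>E. f e * \<phi> (c e))"
    if \<phi>: "linear_from (dual_space H) (\<lambda>c f x. c * f x) (*) \<phi>" and f: "f \<in> dual_space H" for \<phi> f
  proof -
    have "\<phi> f = \<phi> (\<Sum>e\<in>E. (\<lambda>x. f e * c e x))" using expand[OF f] by simp
    also have "\<dots> = (\<Sum>e\<in>E. \<phi> (\<lambda>x. f e * c e x))"
      by (rule linear_from_sum[OF \<phi> dual_subspace vector_space_functions]) (rule scD)
    finally show ?thesis by (simp add: linear_from_scale[OF \<phi> c])
  qed
  have \<tau>_expand: "\<tau> f g k = (\<Sum>e\<in>E. \<Sum>e'\<in>E. \<Sum>e''\<in>E. f e * g e' * k e'' * \<tau> (c e) (c e') (c e''))"
    if fgk: "f \<in> dual_space H" "g \<in> dual_space H" "k \<in> dual_space H" for f g k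
  proof -
    have l1: "linear_from (dual_space H) (\<lambda>c f x. c * f x) (*) (\<lambda>f. \<tau> f g k)"
      and l2: "linear_from (dual_space H) (\<lambda>c f x. c * f x) (*) (\<lambda>g. \<tau> (c e) g k)"
      and l3: "linear_from (dual_space H) (\<lambda>c f x. c * f x) (*) (\<lambda>k. \<tau> (c e) (c e') k)" for e e'
      using \<tau> fgk c by (simp_all add: trilinear_from_def)
    have "\<tau> f g k = (\<Sum>e\<in>E. f e * \<tau> (c e) g k)" by (rule lin_expand[OF l1 fgk(1)])
    also have "\<dots> = (\<Sum>e\<in>E. f e * (\<Sum>e'\<in>E. g e' * \<tau> (c e) (c e') k))"
      by (simp only: lin_expand[OF l2 fgk(2)])
    also have "\<dots> = (\<Sum>e\<in>E. f e * (\<Sum>e'\<in>E. g e' * (\<Sum>e''\<in>E. k e'' * \<tau> (c e) (c e') (c e''))))"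
      by (simp only: lin_expand[OF l3 fgk(3)])
    finally show ?thesis by (simp add: sum_distrib_left mult.assoc)
  qed
  have "(\<Sum>(f, g, k)\<leftarrow>t. \<tau> f g k) = (\<Sum>e\<in>E. \<Sum>e'\<in>E. \<Sum>e''\<in>E.
      (\<Sum>(f, g, k)\<leftarrow>t. f e * g e' * k e'') * \<tau> (c e) (c e') (c e''))"
    if t: "set t \<subseteq> dual_space H \<times> dual_space H \<times> dual_space H" for t
  proof -
    have "(\<Sum>(f, g, k)\<leftarrow>t. \<tau> f g k) = (\<Sum>(f, g, k)\<leftarrow>t. \<Sum>e\<in>E. \<Sum>e'\<in>E. \<Sum>e''\<in>E.
        f e * g e' * k e'' * \<tau> (c e) (c e') (c e''))"
      using t by (intro arg_cong[where f = sum_list] map_cong refl) (auto simp: \<tau>_expand)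
    also have "\<dots> = (\<Sum>e\<in>E. \<Sum>e'\<in>E. \<Sum>e''\<in>E. \<Sum>(f, g, k)\<leftarrow>t.
        f e * g e' * k e'' * \<tau> (c e) (c e') (c e''))"
      by (simp only: case_prod_unfold sum_list_sum_exchange)
    finally show ?thesis by (simp add: sum_list_mult_const case_prod_unfold)
  qed
  from this[OF tu(1)] this[OF tu(2)] show ?thesis
    using E(2) by (auto intro!: sum.cong simp: eq subset_iff)
qed

lemma hopf_algebra_dual:
  assumes fd: "finite_dimensional H"
  shows "hopf_algebra (dual_hopf H)"
proof -
  let ?D = "dual_hopf H"
  let ?s = "\<lambda>(c::'k) (f::'a \<Rightarrow> 'k) x. c * f x"
  interpret F: vector_space ?s by (rule vector_space_functions)
  note comultD = dual_comult(1)[OF fd]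
  note sumD = dual_comult(2)[OF fd]
  note lin_comp = linear_from_comp[OF dual_spaceD(1)]
  have comult_memD: "a \<in> dual_space H" "b \<in> dual_space H"
    if "(a, b) \<in> set (comult ?D f)" "f \<in> dual_space H" for a b f
    using comultD[OF that(2)] that(1) by auto
  have bil: "bilinear_from (carrier H) (smult H) (*) (\<lambda>a b. f a * g b)"
    if "f \<in> dual_space H" "g \<in> dual_space H" for f g
    using dual_spaceD(1)[OF that(1)] dual_spaceD(1)[OF that(2)] by (auto intro!: lin)
  have mult_lin: "linear_from (carrier H) (smult H) (*) (\<lambda>x. sw x (\<lambda>a b. f a * g b))"
    if "f \<in> dual_space H" "g \<in> dual_space H" for f g
    by (rule lin_sw_arg[OF vector_space_field linear_from_id _ bil[OF that]])
  have multD [simp]: "mult ?D f g \<in> dual_space H" if "f \<in> dual_space H" "g \<in> dual_space H" for f g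
    using dual_spaceI[OF mult_lin[OF that]] by simp
  have lin_mult_l: "linear_from (dual_space H) ?s ?s (\<lambda>f. mult ?D f g)" for g
    unfolding linear_from_def
  proof (intro conjI ballI allI ext)
    fix f f' and c :: 'k and x
    show "mult ?D (f + f') g x = (mult ?D f g + mult ?D f' g) x"
      by (simp add: distrib_right sweedler_add)
    have "sw x (\<lambda>a b. c * f a * g b) = c * sw x (\<lambda>a b. f a * g b)"
      unfolding mult.assoc by (rule sweedler_scale[OF vector_space_field])
    then show "mult ?D (?s c f) g x = c * mult ?D f g x" by simp
  qed
  have lin_mult_r: "linear_from (dual_space H) ?s ?s (mult ?D g)" for g
    unfolding linear_from_def
  proof (intro conjI ballI allI ext)
    fix f f' and c :: 'k and x
    show "mult ?D g (f + f') x = (mult ?D g f + mult ?D g f') x"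
      by (simp add: distrib_left sweedler_add)
    have "sw x (\<lambda>a b. g a * (c * f b)) = c * sw x (\<lambda>a b. g a * f b)"
      unfolding mult.left_commute[of _ c] by (rule sweedler_scale[OF vector_space_field])
    then show "mult ?D g (?s c f) x = c * mult ?D g f x" by simp
  qed
  \<comment> \<open>A product in the dual is itself a Sweedler sum over the point \<open>x\<close>.
    Exchanging the two sums recombines the factors of \<open>f\<close> into a single value; with the
    antipode for \<open>u\<close> or \<open>v\<close> this reduces the antipode axioms of the dual
    to those of \<open>H\<close>.\<close>
  have mult_eval: "sweedler ?D f (\<lambda>g k. sw x (\<lambda>a b. g (u a) * k (v b))) = sw x (\<lambda>a b. f (u a \<odot> v b))"
    if f: "f \<in> dual_space H" and x: "x \<in> carrier H" and uv: "\<And>y. y \<in> carrier H \<Longrightarrow> u y \<in> carrier H"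
      "\<And>y. y \<in> carrier H \<Longrightarrow> v y \<in> carrier H" for f x u v
  proof -
    have "sweedler ?D f (\<lambda>g k. sw x (\<lambda>a b. g (u a) * k (v b))) =
        sw x (\<lambda>a b. sweedler ?D f (\<lambda>g k. g (u a) * k (v b)))" by (rule sweedler_exchange)
    also have "\<dots> = sw x (\<lambda>a b. f (u a \<odot> v b))"
      by (rule sw_cong[OF x]) (simp add: sweedler_dual[OF fd f] uv)
    finally show ?thesis .
  qed
  show ?thesis
  proof (rule hopf_algebraI; (unfold dual_hopf_simps)?)
    show "vector_space ?s" by (rule vector_space_functions)
    show "F.subspace (dual_space H)" by (rule dual_subspace)
    show "mult ?D f g \<in> dual_space H" if "f \<in> dual_space H" "g \<in> dual_space H" for f g
      using that by (rule multD)
    show "(\<lambda>x. if x \<in> carrier H then \<epsilon> x else 0) \<in> dual_space H" by (rule dual_spaceI[OF counit_linear])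
    show "linear_from (dual_space H) ?s ?s (\<lambda>f. mult ?D f g)" for g by (rule lin_mult_l)
    show "linear_from (dual_space H) ?s ?s (mult ?D g)" for g by (rule lin_mult_r)
    show "mult ?D (mult ?D f g) k = mult ?D f (mult ?D g k)"
      if fgk: "f \<in> dual_space H" "g \<in> dual_space H" "k \<in> dual_space H" for f g k
    proof (rule dual_space_ext)
      fix x assume x: "x \<in> carrier H"
      have tri: "trilinear_from (carrier H) (smult H) (*) (\<lambda>a b c. f a * g b * k c)"
        using dual_spaceD(1)[OF fgk(1)] dual_spaceD(1)[OF fgk(2)] dual_spaceD(1)[OF fgk(3)]
        by (auto intro!: lin)
      have "mult ?D (mult ?D f g) k x = sw x (\<lambda>u c. sw u (\<lambda>a b. f a * g b * k c))"
        by (simp add: x sweedler_mult_const cong: sw_cong)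
      also have "\<dots> = sw x (\<lambda>a u. sw u (\<lambda>b c. f a * g b * k c))"
        by (rule sw_coassoc[OF tri vector_space_field x])
      also have "\<dots> = sw x (\<lambda>a u. f a * sw u (\<lambda>b c. g b * k c))"
        unfolding mult.assoc by (rule sw_cong[OF x sweedler_scale[OF vector_space_field]])
      also have "\<dots> = mult ?D f (mult ?D g k) x"
        by (simp add: x cong: sw_cong)
      finally show "mult ?D (mult ?D f g) k x = mult ?D f (mult ?D g k) x" .
    qed (use fgk multD in blast)+
    show "mult ?D (\<lambda>x. if x \<in> carrier H then \<epsilon> x else 0) f = f"
      "mult ?D f (\<lambda>x. if x \<in> carrier H then \<epsilon> x else 0) = f" if f: "f \<in> dual_space H" for f
    proof -
      have 1: "sw x (\<lambda>a b. \<epsilon> a * f b) = f x" "sw x (\<lambda>a b. \<epsilon> b * f a) = f x" if "x \<in> carrier H" for x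
        using sw_counit_left[OF dual_spaceD(1)[OF f] that] sw_counit_right[OF dual_spaceD(1)[OF f] that]
        by simp_all
      show "mult ?D (\<lambda>x. if x \<in> carrier H then \<epsilon> x else 0) f = f"
        "mult ?D f (\<lambda>x. if x \<in> carrier H then \<epsilon> x else 0) = f"
        using 1 dual_spaceD(2)[OF f] by (auto simp: fun_eq_iff mult.commute cong: sw_cong)
    qed
    show "set (comult ?D f) \<subseteq> dual_space H \<times> dual_space H" if "f \<in> dual_space H" for f
      by (rule comultD[OF that])
  next
    fix f g and \<beta> :: "('a \<Rightarrow> 'k) \<Rightarrow> ('a \<Rightarrow> 'k) \<Rightarrow> 'k"
    assume fg: "f \<in> dual_space H" "g \<in> dual_space H" and \<beta>: "bilinear_from (dual_space H) ?s (*) \<beta>"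
    have "sweedler ?D (f + g) \<beta> = (\<Sum>(g, k)\<leftarrow>comult ?D f @ comult ?D g. \<beta> g k)"
      by (rule sweedler_dual_eqI[OF fd F.subspace_add[OF dual_subspace fg] \<beta>])
        (use comultD[OF fg(1)] comultD[OF fg(2)] in \<open>auto simp: sumD fg\<close>)
    then show "sweedler ?D (f + g) \<beta> = sweedler ?D f \<beta> + sweedler ?D g \<beta>" by (simp add: sweedler_def)
    \<comment> \<open>The product of the two comultiplied functionals. Evaluated at points
      \<open>x\<close> and \<open>y\<close> it gives the value of f g at x y, by multiplicativity of
      the comultiplication of \<open>H\<close>.\<close>
    define t where "t = concat (map (\<lambda>(f1, f2). map (\<lambda>(g1, g2). (mult ?D f1 g1, mult ?D f2 g2))
      (comult ?D g)) (comult ?D f))"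
    have t_sum: "(\<Sum>(a, b)\<leftarrow>t. \<gamma> a b) = sweedler ?D f (\<lambda>f1 f2. sweedler ?D g (\<lambda>g1 g2.
        \<gamma> (mult ?D f1 g1) (mult ?D f2 g2)))" for \<gamma> :: "('a \<Rightarrow> 'k) \<Rightarrow> ('a \<Rightarrow> 'k) \<Rightarrow> 'k"
      unfolding t_def sweedler_def
      by (simp add: sum_list_concat_map case_prod_unfold comp_def del: dual_hopf_mult)
    have "sweedler ?D (mult ?D f g) \<beta> = (\<Sum>(a, b)\<leftarrow>t. \<beta> a b)"
    proof (rule sweedler_dual_eqI[OF fd multD[OF fg] \<beta>])
      show "set t \<subseteq> dual_space H \<times> dual_space H"
        unfolding t_def using comultD[OF fg(1)] comultD[OF fg(2)] by (auto simp del: dual_hopf_mult intro!: multD dest!: subsetD)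
      fix x y assume xy: "x \<in> carrier H" "y \<in> carrier H"
      have "(\<Sum>(a, b)\<leftarrow>t. a x * b y) = sweedler ?D f (\<lambda>f1 f2. sweedler ?D g (\<lambda>g1 g2.
          sw x (\<lambda>x1 x2. f1 x1 * g1 x2) * sw y (\<lambda>y1 y2. f2 y1 * g2 y2)))"
        using xy by (simp add: t_sum)
      also have "\<dots> = sweedler ?D f (\<lambda>f1 f2. sweedler ?D g (\<lambda>g1 g2.
          sw x (\<lambda>x1 x2. sw y (\<lambda>y1 y2. (f1 x1 * f2 y1) * (g1 x2 * g2 y2)))))"
      proof -
        have "sw x (\<lambda>x1 x2. f1 x1 * g1 x2) * sw y (\<lambda>y1 y2. f2 y1 * g2 y2) =
          sw x (\<lambda>x1 x2. sw y (\<lambda>y1 y2. (f1 x1 * f2 y1) * (g1 x2 * g2 y2)))" for f1 f2 g1 g2 :: "'a \<Rightarrow> 'k"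
        proof -
          have "sw x (\<lambda>x1 x2. f1 x1 * g1 x2) * sw y (\<lambda>y1 y2. f2 y1 * g2 y2) =
              sw x (\<lambda>x1 x2. (f1 x1 * g1 x2) * sw y (\<lambda>y1 y2. f2 y1 * g2 y2))"
            by (rule sweedler_scale_right[OF vector_space_field, symmetric])
          also have "\<dots> = sw x (\<lambda>x1 x2. sw y (\<lambda>y1 y2. (f1 x1 * f2 y1) * (g1 x2 * g2 y2)))"
          proof (rule sw_cong[OF xy(1)])
            fix x1 x2
            have "(f1 x1 * g1 x2) * sw y (\<lambda>y1 y2. f2 y1 * g2 y2) =
                sw y (\<lambda>y1 y2. (f1 x1 * g1 x2) * (f2 y1 * g2 y2))"
              by (rule sweedler_scale[OF vector_space_field, symmetric])
            then show "(f1 x1 * g1 x2) * sw y (\<lambda>y1 y2. f2 y1 * g2 y2) =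
                sw y (\<lambda>y1 y2. (f1 x1 * f2 y1) * (g1 x2 * g2 y2))" by (simp only: mult_ac)
          qed
          finally show ?thesis .
        qed
        then show ?thesis by simp
      qed
      also have "\<dots> = sweedler ?D f (\<lambda>f1 f2. sw x (\<lambda>x1 x2. sw y (\<lambda>y1 y2. sweedler ?D g (\<lambda>g1 g2.
          (f1 x1 * f2 y1) * (g1 x2 * g2 y2)))))"
        by (subst sweedler_exchange[of ?D g], subst sweedler_exchange[of ?D g]) (rule refl)
      also have "\<dots> = sw x (\<lambda>x1 x2. sw y (\<lambda>y1 y2. sweedler ?D f (\<lambda>f1 f2. sweedler ?D g (\<lambda>g1 g2.
          (f1 x1 * f2 y1) * (g1 x2 * g2 y2)))))"
        by (subst sweedler_exchange[of ?D f], subst sweedler_exchange[of ?D f]) (rule refl)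
      also have "\<dots> = sw x (\<lambda>x1 x2. sw y (\<lambda>y1 y2. f (x1 \<odot> y1) * g (x2 \<odot> y2)))"
        by (intro sw_cong xy) (simp add: sweedler_mult_const sweedler_dual[OF fd] fg)
      also have "\<dots> = sw (x \<odot> y) (\<lambda>a b. f a * g b)"
        by (rule sw_mult[OF bil[OF fg] vector_space_field xy, symmetric])
      finally show "(\<Sum>(a, b)\<leftarrow>t. a x * b y) = mult ?D f g (x \<odot> y)" using xy by simp
    qed
    then show "sweedler ?D (mult ?D f g) \<beta> = sweedler ?D f (\<lambda>a b. sweedler ?D g (\<lambda>c d.
        \<beta> (mult ?D a c) (mult ?D b d)))" by (simp only: t_sum)
  next
    fix c f and \<beta> :: "('a \<Rightarrow> 'k) \<Rightarrow> ('a \<Rightarrow> 'k) \<Rightarrow> 'k"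
    assume f: "f \<in> dual_space H" and \<beta>: "bilinear_from (dual_space H) ?s (*) \<beta>"
    define t where "t = map (\<lambda>(g, k). (?s c g, k)) (comult ?D f)"
    have t_sum: "(\<Sum>(a, b)\<leftarrow>t. \<gamma> a b) = sweedler ?D f (\<lambda>g k. \<gamma> (?s c g) k)"
      for \<gamma> :: "('a \<Rightarrow> 'k) \<Rightarrow> ('a \<Rightarrow> 'k) \<Rightarrow> 'k"
      unfolding t_def sweedler_def by (simp add: case_prod_unfold comp_def)
    have "sweedler ?D (?s c f) \<beta> = (\<Sum>(a, b)\<leftarrow>t. \<beta> a b)"
    proof (rule sweedler_dual_eqI[OF fd F.subspace_scale[OF dual_subspace f] \<beta>])
      show "set t \<subseteq> dual_space H \<times> dual_space H"
        unfolding t_def using comultD[OF f] F.subspace_scale[OF dual_subspace] by auto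
      show "(\<Sum>(a, b)\<leftarrow>t. a x * b y) = c * f (x \<odot> y)" if "x \<in> carrier H" "y \<in> carrier H" for x y
        unfolding t_sum by (simp add: mult.assoc sweedler_mult_const sweedler_dual[OF fd f that])
    qed
    also have "\<dots> = sweedler ?D f (\<lambda>g k. c * \<beta> g k)"
      unfolding t_sum sweedler_def
      by (rule arg_cong[where f = sum_list], rule map_cong)
        (use comultD[OF f] linear_from_scale[OF bilinear_fromD(1)[OF \<beta>]] in auto)
    finally show "sweedler ?D (?s c f) \<beta> = c * sweedler ?D f \<beta>" by (simp add: sweedler_mult_const)
  next
    fix \<beta> :: "('a \<Rightarrow> 'k) \<Rightarrow> ('a \<Rightarrow> 'k) \<Rightarrow> 'k"
    let ?e = "\<lambda>x. if x \<in> carrier H then \<epsilon> x else 0"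
    assume \<beta>: "bilinear_from (dual_space H) ?s (*) \<beta>"
    have eD: "?e \<in> dual_space H" by (rule dual_spaceI[OF counit_linear])
    have "sweedler ?D ?e \<beta> = (\<Sum>(a, b)\<leftarrow>[(?e, ?e)]. \<beta> a b)"
      by (rule sweedler_dual_eqI[OF fd eD \<beta>]) (use eD in \<open>auto simp: counit_mult\<close>)
    then show "sweedler ?D ?e \<beta> = \<beta> ?e ?e" by simp
  next
    fix f and \<tau> :: "('a \<Rightarrow> 'k) \<Rightarrow> ('a \<Rightarrow> 'k) \<Rightarrow> ('a \<Rightarrow> 'k) \<Rightarrow> 'k"
    assume f: "f \<in> dual_space H" and \<tau>: "trilinear_from (dual_space H) ?s (*) \<tau>"
    define t where "t = concat (map (\<lambda>(u, c). map (\<lambda>(a, b). (a, b, c)) (comult ?D u)) (comult ?D f))"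
    define t' where "t' = concat (map (\<lambda>(a, u). map (\<lambda>(b, c). (a, b, c)) (comult ?D u)) (comult ?D f))"
    have t_sum: "(\<Sum>(a, b, c)\<leftarrow>t. \<gamma> a b c) = sweedler ?D f (\<lambda>u c. sweedler ?D u (\<lambda>a b. \<gamma> a b c))"
      "(\<Sum>(a, b, c)\<leftarrow>t'. \<gamma> a b c) = sweedler ?D f (\<lambda>a u. sweedler ?D u (\<lambda>b c. \<gamma> a b c))"
      for \<gamma> :: "('a \<Rightarrow> 'k) \<Rightarrow> ('a \<Rightarrow> 'k) \<Rightarrow> ('a \<Rightarrow> 'k) \<Rightarrow> 'k"
      unfolding t_def t'_def sweedler_def by (simp_all add: sum_list_concat_map case_prod_unfold comp_def)
    have congD: "sweedler ?D f \<gamma> = sweedler ?D f \<delta>"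
      if "\<And>a b. a \<in> dual_space H \<Longrightarrow> b \<in> dual_space H \<Longrightarrow> \<gamma> a b = \<delta> a b"
      for \<gamma> \<delta> :: "('a \<Rightarrow> 'k) \<Rightarrow> ('a \<Rightarrow> 'k) \<Rightarrow> 'k"
      unfolding sweedler_def
      by (rule arg_cong[where f = sum_list], rule map_cong) (use comultD[OF f] that in auto)
    have "(\<Sum>(a, b, c)\<leftarrow>t. \<tau> a b c) = (\<Sum>(a, b, c)\<leftarrow>t'. \<tau> a b c)"
    proof (rule dual_triples_eq[OF fd \<tau>])
      show "set t \<subseteq> dual_space H \<times> dual_space H \<times> dual_space H"
        "set t' \<subseteq> dual_space H \<times> dual_space H \<times> dual_space H"
        unfolding t_def t'_def using f by (auto dest: comult_memD)
      fix x y z assume xyz: "x \<in> carrier H" "y \<in> carrier H" "z \<in> carrier H"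
      have "sweedler ?D f (\<lambda>u c. sweedler ?D u (\<lambda>a b. a x * b y * c z)) = sweedler ?D f (\<lambda>u c. u (x \<odot> y) * c z)"
        by (rule congD) (simp add: sweedler_mult_const sweedler_dual[OF fd] xyz)
      also have "\<dots> = f (x \<odot> (y \<odot> z))" using xyz by (simp add: sweedler_dual[OF fd f] mult_assoc)
      also have "\<dots> = sweedler ?D f (\<lambda>a u. a x * u (y \<odot> z))" using xyz by (simp add: sweedler_dual[OF fd f])
      also have "\<dots> = sweedler ?D f (\<lambda>a u. sweedler ?D u (\<lambda>b c. a x * b y * c z))"
        by (rule congD) (simp add: sweedler_mult_const sweedler_dual[OF fd] xyz mult.assoc)
      finally show "(\<Sum>(a, b, c)\<leftarrow>t. a x * b y * c z) = (\<Sum>(a, b, c)\<leftarrow>t'. a x * b y * c z)"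
        by (simp only: t_sum)
    qed
    then show "sweedler ?D f (\<lambda>u c. sweedler ?D u (\<lambda>a b. \<tau> a b c)) =
        sweedler ?D f (\<lambda>a u. sweedler ?D u (\<lambda>b c. \<tau> a b c))" by (simp only: t_sum)
  next
    show "linear_from (dual_space H) ?s (*) (\<lambda>f. f \<one>)" by (rule linear_from_apply)
    show "(if \<one> \<in> carrier H then \<epsilon> \<one> else 0) = 1" by (simp add: counit_unit)
    show "mult ?D f g \<one> = f \<one> * g \<one>" if "f \<in> dual_space H" "g \<in> dual_space H" for f g
      using sw_unit[OF bil[OF that] vector_space_field] by simp
  next
    fix f assume f: "f \<in> dual_space H"
    have "sweedler ?D f (\<lambda>g k x. g \<one> * k x) y = f y" "sweedler ?D f (\<lambda>g k x. k \<one> * g x) y = f y" for y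
    proof -
      have "sweedler ?D f (\<lambda>g k. g \<one> * k y) = f y \<and> sweedler ?D f (\<lambda>g k. k \<one> * g y) = f y"
      proof (cases "y \<in> carrier H")
        case True
        then show ?thesis
          using sweedler_dual[OF fd f unit_closed True] sweedler_dual[OF fd f True unit_closed]
          by (simp add: mult_unit_left mult_unit_right mult.commute)
      next
        case False
        \<comment> \<open>Off the carrier the equation survives because of the convention that
          members of \<open>dual_space\<close> are 0 there, applied to the factors of
          \<open>f\<close> as well as to \<open>f\<close>.\<close>
        have "sweedler ?D f (\<lambda>g k. g \<one> * k y) = sweedler ?D f (\<lambda>g k. 0)"
          "sweedler ?D f (\<lambda>g k. k \<one> * g y) = sweedler ?D f (\<lambda>g k. 0)"
          unfolding sweedler_def
          by (rule arg_cong[where f = sum_list], rule map_cong,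
              use comultD[OF f] dual_spaceD(2)[OF _ False] in auto)+
        then show ?thesis using dual_spaceD(2)[OF f False] by simp
      qed
      then show "sweedler ?D f (\<lambda>g k x. g \<one> * k x) y = f y" "sweedler ?D f (\<lambda>g k x. k \<one> * g x) y = f y"
        by (simp_all add: sweedler_apply)
    qed
    then show "sweedler ?D f (\<lambda>g k x. g \<one> * k x) = f" "sweedler ?D f (\<lambda>g k x. k \<one> * g x) = f"
      by (simp_all add: fun_eq_iff)
    show "(\<lambda>x. if x \<in> carrier H then f (\<S> x) else 0) \<in> dual_space H"
      by (auto intro!: dual_spaceI lin_comp[OF f] lin)
    show "sweedler ?D f (\<lambda>g k. mult ?D (\<lambda>x. if x \<in> carrier H then g (\<S> x) else 0) k) =
        (\<lambda>x. f \<one> * (if x \<in> carrier H then \<epsilon> x else 0))"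
    proof
      fix x
      show "sweedler ?D f (\<lambda>g k. mult ?D (\<lambda>x. if x \<in> carrier H then g (\<S> x) else 0) k) x =
        f \<one> * (if x \<in> carrier H then \<epsilon> x else 0)"
      proof (cases "x \<in> carrier H")
        case True
        have "sweedler ?D f (\<lambda>g k. mult ?D (\<lambda>x. if x \<in> carrier H then g (\<S> x) else 0) k) x =
            sweedler ?D f (\<lambda>g k. sw x (\<lambda>a b. g (\<S> a) * k b))"
          by (simp add: sweedler_apply True cong: sw_cong)
        also have "\<dots> = sw x (\<lambda>a b. f (\<S> a \<odot> b))" by (rule mult_eval[OF f True]) simp_all
        also have "\<dots> = \<epsilon> x * f \<one>" by (rule sw_antipode_left[OF dual_spaceD(1)[OF f] True])
        finally show ?thesis using True by simp
      qed (simp add: sweedler_apply)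
    qed
    show "sweedler ?D f (\<lambda>g k. mult ?D g (\<lambda>x. if x \<in> carrier H then k (\<S> x) else 0)) =
        (\<lambda>x. f \<one> * (if x \<in> carrier H then \<epsilon> x else 0))"
    proof
      fix x
      show "sweedler ?D f (\<lambda>g k. mult ?D g (\<lambda>x. if x \<in> carrier H then k (\<S> x) else 0)) x =
        f \<one> * (if x \<in> carrier H then \<epsilon> x else 0)"
      proof (cases "x \<in> carrier H")
        case True
        have "sweedler ?D f (\<lambda>g k. mult ?D g (\<lambda>x. if x \<in> carrier H then k (\<S> x) else 0)) x =
            sweedler ?D f (\<lambda>g k. sw x (\<lambda>a b. g a * k (\<S> b)))"
          by (simp add: sweedler_apply True cong: sw_cong)
        also have "\<dots> = sw x (\<lambda>a b. f (a \<odot> \<S> b))" by (rule mult_eval[OF f True]) simp_all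
        also have "\<dots> = \<epsilon> x * f \<one>" by (rule sw_antipode_right[OF dual_spaceD(1)[OF f] True])
        finally show ?thesis using True by simp
      qed (simp add: sweedler_apply)
    qed
  next
    show "linear_from (dual_space H) ?s ?s (\<lambda>f x. if x \<in> carrier H then f (\<S> x) else 0)"
      by (rule linear_from_fun) (simp add: linear_from_def)
  qed
qed

lemma finite_dimensional_dual:
  assumes fd: "finite_dimensional H"
  shows "finite_dimensional (dual_hopf H)"
proof -
  interpret F: vector_space "\<lambda>(c::'k) (f::'a \<Rightarrow> 'k) x. c * f x" by (rule vector_space_functions)
  obtain E c where E: "finite E" "E \<subseteq> carrier H" and c: "\<And>e. c e \<in> dual_space H"
    and c_sum: "\<And>x. x \<in> carrier H \<Longrightarrow> (\<Sum>e\<in>E. smult H (c e x) e) = x"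
    and expand: "\<And>f. f \<in> dual_space H \<Longrightarrow> f = (\<Sum>e\<in>E. (\<lambda>x. f e * c e x))"
    by (rule dual_coordinates[OF fd]) (rule that)
  have "f \<in> F.span (c ` E)" if "f \<in> dual_space H" for f
    by (subst expand[OF that]) (auto intro!: F.span_sum F.span_scale[OF F.span_base])
  moreover have sub: "c ` E \<subseteq> dual_space H" using c by blast
  ultimately have "F.span (c ` E) = dual_space H"
    using F.span_minimal[OF sub dual_subspace] by blast
  then show ?thesis
    unfolding finite_dimensional_def dual_hopf_simps using E sub by blast
qed

end

subsection \<open>Duality of homomorphisms and normal Hopf subalgebras\<close>

text \<open>The transpose of \<open>p\<close>, cut off to 0 outside the carrier as
  \<open>dual_space\<close> demands. For the inclusion \<open>\<lambda>x. x\<close> of a Hopf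
  subalgebra it is the restriction of functionals.\<close>

definition dual_map :: "('k, 'a) hopf \<Rightarrow> ('a \<Rightarrow> 'b) \<Rightarrow> ('b \<Rightarrow> 'k::zero) \<Rightarrow> 'a \<Rightarrow> 'k" where
  "dual_map H p f = (\<lambda>x. if x \<in> carrier H then f (p x) else 0)"

lemma dual_map_apply [simp]: "x \<in> carrier H \<Longrightarrow> dual_map H p f x = f (p x)"
  by (simp add: dual_map_def)

lemma dual_map_mem:
  assumes p: "hopf_hom H Q p" and f: "f \<in> dual_space Q"
  shows "dual_map H p f \<in> dual_space H"
proof -
  interpret H: hopf_algebra H using p by (rule hopf_homD)
  show ?thesis
    unfolding dual_map_def
    by (rule H.dual_spaceI, rule linear_from_comp[OF dual_spaceD(1)[OF f] hopf_homD(4,3)[OF p]])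
qed

lemma linear_dual_map:
  fixes H :: "('k::field, 'a) hopf"
  shows "linear_from V (\<lambda>c f x. c * f x) (\<lambda>c f x. c * f x) (dual_map H p)"
  by (auto simp: linear_from_def dual_map_def fun_eq_iff)

lemma hopf_hom_dual:
  fixes H :: "('k::field, 'a::ab_group_add) hopf" and Q :: "('k, 'b::ab_group_add) hopf"
  assumes p: "hopf_hom H Q p" and fdH: "finite_dimensional H" and fdQ: "finite_dimensional Q"
  shows "hopf_hom (dual_hopf Q) (dual_hopf H) (dual_map H p)"
proof -
  note pD = hopf_homD[OF p]
  interpret H: hopf_algebra H by (rule pD)
  interpret Q: hopf_algebra Q by (rule pD)
  show ?thesis
  proof (rule hopf_homI; (unfold dual_hopf_simps)?)
    show "hopf_algebra (dual_hopf Q)" "hopf_algebra (dual_hopf H)"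
      by (rule Q.hopf_algebra_dual[OF fdQ], rule H.hopf_algebra_dual[OF fdH])
    show "dual_map H p f \<in> dual_space H" if "f \<in> dual_space Q" for f
      by (rule dual_map_mem[OF p that])
    show "linear_from (dual_space Q) (\<lambda>c f x. c * f x) (\<lambda>c f x. c * f x) (dual_map H p)"
      by (rule linear_dual_map)
    show "dual_map H p (mult (dual_hopf Q) f g) = mult (dual_hopf H) (dual_map H p f) (dual_map H p g)"
      if fg: "f \<in> dual_space Q" "g \<in> dual_space Q" for f g
    proof
      fix x
      have bil: "bilinear_from (carrier Q) (smult Q) (*) (\<lambda>a b. f a * g b)"
        using dual_spaceD(1)[OF fg(1)] dual_spaceD(1)[OF fg(2)] by (auto intro!: lin)
      show "dual_map H p (mult (dual_hopf Q) f g) x =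
          mult (dual_hopf H) (dual_map H p f) (dual_map H p g) x"
      proof (cases "x \<in> carrier H")
        case True
        have "sweedler Q (p x) (\<lambda>a b. f a * g b) = sweedler H x (\<lambda>a b. f (p a) * g (p b))"
          by (rule hopf_hom_sweedler[OF p bil vector_space_field True])
        also have "\<dots> = sweedler H x (\<lambda>a b. dual_map H p f a * dual_map H p g b)"
          by (rule H.sw_cong[OF True]) simp
        finally show ?thesis using True pD(3) by simp
      qed (simp add: dual_map_def)
    qed
    show "dual_map H p (\<lambda>x. if x \<in> carrier Q then counit Q x else 0) =
        (\<lambda>x. if x \<in> carrier H then counit H x else 0)"
      using pD(3,7) by (auto simp: dual_map_def fun_eq_iff)
    show "dual_map H p f (unit H) = f (unit Q)" for f using pD(6) by simp
    show "dual_map H p (\<lambda>x. if x \<in> carrier Q then f (antipode Q x) else 0) =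
        (\<lambda>x. if x \<in> carrier H then dual_map H p f (antipode H x) else 0)" for f
      using pD(3,8) by (auto simp: dual_map_def fun_eq_iff)
  next
    fix f and \<beta> :: "('a \<Rightarrow> 'k) \<Rightarrow> ('a \<Rightarrow> 'k) \<Rightarrow> 'k"
    assume f: "f \<in> dual_space Q" and \<beta>: "bilinear_from (dual_space H) (\<lambda>c f x. c * f x) (*) \<beta>"
    define t where "t = map (\<lambda>(g, k). (dual_map H p g, dual_map H p k)) (comult (dual_hopf Q) f)"
    have t_sum: "(\<Sum>(g, k)\<leftarrow>t. \<gamma> g k) =
        sweedler (dual_hopf Q) f (\<lambda>g k. \<gamma> (dual_map H p g) (dual_map H p k))" for \<gamma> :: "('a \<Rightarrow> 'k) \<Rightarrow> ('a \<Rightarrow> 'k) \<Rightarrow> 'k"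
      unfolding t_def sweedler_def by (simp add: case_prod_unfold comp_def)
    have "sweedler (dual_hopf H) (dual_map H p f) \<beta> = (\<Sum>(g, k)\<leftarrow>t. \<beta> g k)"
    proof (rule H.sweedler_dual_eqI[OF fdH dual_map_mem[OF p f] \<beta>])
      show "set t \<subseteq> dual_space H \<times> dual_space H"
        unfolding t_def using Q.dual_comult(1)[OF fdQ f] dual_map_mem[OF p] by auto
      show "(\<Sum>(g, k)\<leftarrow>t. g x * k y) = dual_map H p f (mult H x y)"
        if "x \<in> carrier H" "y \<in> carrier H" for x y
        unfolding t_sum using that pD(3,5) by (simp add: Q.sweedler_dual[OF fdQ f])
    qed
    then show "sweedler (dual_hopf H) (dual_map H p f) \<beta> =
        sweedler (dual_hopf Q) f (\<lambda>g k. \<beta> (dual_map H p g) (dual_map H p k))"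
      by (simp only: t_sum)
  qed
qed

section \<open>Biduality and annihilators\<close>

context hopf_algebra
begin

lemma dual_separates:
  assumes "x \<in> carrier H" "\<And>f. f \<in> dual_space H \<Longrightarrow> f x = 0"
  shows "x = 0"
proof (rule ccontr)
  assume "x \<noteq> 0"
  then have "x \<notin> span {}" by simp
  then obtain \<phi> where \<phi>: "Vector_Spaces.linear (smult H) (*) \<phi>" "\<phi> x = 1"
    using linear_separation[OF vector_space_axioms] by metis
  show False
    using assms(2)[OF dual_spaceI[OF linear_from_linear[OF \<phi>(1)]]] assms(1) \<phi>(2) by simp
qed

text \<open>Reflexivity in finite dimension: the point is the sum of the basis vectors
  \<open>e\<close>, weighted by the values of \<Phi> at the dual basis.\<close>

lemma dual_functional_eval:
  assumes fd: "finite_dimensional H"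
    and \<Phi>: "linear_from (dual_space H) (\<lambda>c f x. c * f x) (*) \<Phi>"
  obtains x where "x \<in> carrier H" "\<And>f. f \<in> dual_space H \<Longrightarrow> \<Phi> f = f x"
proof -
  obtain E c where E: "finite E" "E \<subseteq> carrier H" and c: "\<And>e. c e \<in> dual_space H"
    and c_sum: "\<And>x. x \<in> carrier H \<Longrightarrow> (\<Sum>e\<in>E. smult H (c e x) e) = x"
    and expand: "\<And>f. f \<in> dual_space H \<Longrightarrow> f = (\<Sum>e\<in>E. (\<lambda>x. f e * c e x))"
    by (rule dual_coordinates[OF fd]) (rule that)
  have EH [simp]: "e \<in> carrier H" if "e \<in> E" for e using E(2) that by blast
  have scD: "(\<lambda>x. k * c e x) \<in> dual_space H" for k e
    using module.subspace_scale[OF module_of_vector_space[OF vector_space_functions] dual_subspace c] .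
  have "\<Phi> f = f (\<Sum>e\<in>E. smult H (\<Phi> (c e)) e)" if f: "f \<in> dual_space H" for f
  proof -
    have "\<Phi> f = \<Phi> (\<Sum>e\<in>E. (\<lambda>x. f e * c e x))" using expand[OF f] by simp
    also have "\<dots> = (\<Sum>e\<in>E. \<Phi> (\<lambda>x. f e * c e x))"
      by (rule linear_from_sum[OF \<Phi> dual_subspace vector_space_functions scD])
    also have "\<dots> = (\<Sum>e\<in>E. f (smult H (\<Phi> (c e)) e))"
      by (rule sum.cong) (simp_all add: linear_from_scale[OF \<Phi> c] linear_from_scale[OF dual_spaceD(1)[OF f]])
    also have "\<dots> = f (\<Sum>e\<in>E. smult H (\<Phi> (c e)) e)"
      by (rule linear_from_sum[OF dual_spaceD(1)[OF f] carrier_subspace vector_space_axioms, symmetric]) simp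
    finally show ?thesis .
  qed
  then show ?thesis by (intro that[of "\<Sum>e\<in>E. smult H (\<Phi> (c e)) e"]) simp_all
qed

text \<open>A functional on the dual that separates \<open>f\<close> from \<open>J\<close> is
  evaluation at a point of \<open>H\<close>. Equations for subspaces of the dual are thereby reduced
  to statements about elements of \<open>H\<close>.\<close>

lemma dual_point:
  assumes fd: "finite_dimensional H"
    and J: "module.subspace (\<lambda>(c::'k) f x. c * f x) J" and f: "f \<in> dual_space H" "f \<notin> J"
  obtains x where "x \<in> carrier H" "\<And>g. g \<in> J \<Longrightarrow> g \<in> dual_space H \<Longrightarrow> g x = 0" "f x \<noteq> 0"
proof -
  obtain \<Phi> where \<Phi>: "Vector_Spaces.linear (\<lambda>(c::'k) (f::'a \<Rightarrow> 'k) x. c * f x) (*) \<Phi>"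
    "\<And>g. g \<in> J \<Longrightarrow> \<Phi> g = 0" "\<Phi> f = 1"
    using linear_separation_subspace[OF vector_space_functions J f(2)] by metis
  obtain x where "x \<in> carrier H" "\<And>f. f \<in> dual_space H \<Longrightarrow> \<Phi> f = f x"
    by (rule dual_functional_eval[OF fd linear_from_linear[OF \<Phi>(1)]]) (rule that)
  then show ?thesis using that \<Phi>(2,3) f(1) by (metis zero_neq_one)
qed

text \<open>Evaluation at points is the isomorphism. It is needed for the simplicity of the dual of
  a simple Hopf algebra.\<close>

lemma hopf_iso_double_dual:
  assumes fd: "finite_dimensional H"
  shows "hopf_iso H (dual_hopf (dual_hopf H))"
proof -
  let ?D = "dual_hopf H"
  interpret D: hopf_algebra ?D by (rule hopf_algebra_dual[OF fd])
  have fdD: "finite_dimensional ?D" by (rule finite_dimensional_dual[OF fd])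
  define ev where "ev x = (\<lambda>f. if f \<in> dual_space H then f x else (0::'k))" for x
  have ev_apply [simp]: "ev x f = f x" if "f \<in> dual_space H" for f x using that by (simp add: ev_def)
  have ev_mem: "ev x \<in> dual_space ?D" for x
    unfolding ev_def by (rule D.dual_spaceI[of "\<lambda>f. f x", unfolded dual_hopf_simps, OF linear_from_apply])
  have ext: "\<Phi> = \<Psi>" if "\<Phi> \<in> dual_space ?D" "\<Psi> \<in> dual_space ?D" "\<And>f. f \<in> dual_space H \<Longrightarrow> \<Phi> f = \<Psi> f"
    for \<Phi> \<Psi>
    using that by (intro dual_space_ext[OF that(1,2)]) simp
  have multD: "mult ?D f g \<in> dual_space H" if "f \<in> dual_space H" "g \<in> dual_space H" for f g
    using D.mult_closed that by simp
  have SD: "(\<lambda>x. if x \<in> carrier H then f (\<S> x) else 0) \<in> dual_space H" if "f \<in> dual_space H" for f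
    using D.antipode_closed that by simp
  note DD = D.hopf_algebra_dual[OF fdD]
  have hom: "hopf_hom H (dual_hopf ?D) ev"
  proof (rule hopf_homI)
    fix x y assume xy: "x \<in> carrier H" "y \<in> carrier H"
    show "ev (x \<odot> y) = mult (dual_hopf ?D) (ev x) (ev y)"
    proof (rule ext)
      show "mult (dual_hopf ?D) (ev x) (ev y) \<in> dual_space ?D"
        using hopf_algebra.mult_closed[OF DD, of "ev x" "ev y"] ev_mem by simp
      fix f assume f: "f \<in> dual_space H"
      have "D.sw f (\<lambda>g k. ev x g * ev y k) = D.sw f (\<lambda>g k. g x * k y)"
        by (rule D.sw_cong) (simp_all add: f)
      then show "ev (x \<odot> y) f = mult (dual_hopf ?D) (ev x) (ev y) f"
        using f by (simp add: sweedler_dual[OF fd f xy])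
    qed (rule ev_mem)
  next
    show "linear_from (carrier H) (smult H) (smult (dual_hopf ?D)) ev"
      unfolding dual_hopf_simps
    proof (rule linear_from_fun)
      show "linear_from (carrier H) (smult H) (*) (\<lambda>x. ev x f)" for f
        using dual_spaceD(1)[of f H] by (cases "f \<in> dual_space H") (simp_all add: ev_def linear_from_def)
    qed
    show "ev \<one> = unit (dual_hopf ?D)"
      by (rule ext) (use ev_mem hopf_algebra.unit_closed[OF DD] in auto)
    show "ev (\<S> x) = antipode (dual_hopf ?D) (ev x)" if "x \<in> carrier H" for x
    proof (rule ext)
      show "antipode (dual_hopf ?D) (ev x) \<in> dual_space ?D"
        using hopf_algebra.antipode_closed[OF DD, of "ev x"] ev_mem by simp
    qed (use ev_mem that in \<open>simp_all add: SD\<close>)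
    show "counit (dual_hopf ?D) (ev x) = \<epsilon> x" if "x \<in> carrier H" for x
      using that D.unit_closed by simp
  next
    fix x and \<beta> :: "(('a \<Rightarrow> 'k) \<Rightarrow> 'k) \<Rightarrow> (('a \<Rightarrow> 'k) \<Rightarrow> 'k) \<Rightarrow> 'k"
    assume x: "x \<in> carrier H" and \<beta>: "bilinear_from (carrier (dual_hopf ?D)) (smult (dual_hopf ?D)) (*) \<beta>"
    define t where "t = map (\<lambda>(a, b). (ev a, ev b)) (comult H x)"
    have t_sum: "(\<Sum>(g, k)\<leftarrow>t. \<gamma> g k) = sw x (\<lambda>a b. \<gamma> (ev a) (ev b))"
      for \<gamma> :: "(('a \<Rightarrow> 'k) \<Rightarrow> 'k) \<Rightarrow> (('a \<Rightarrow> 'k) \<Rightarrow> 'k) \<Rightarrow> 'k"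
      unfolding t_def sweedler_def by (simp add: case_prod_unfold comp_def)
    have "sweedler (dual_hopf ?D) (ev x) \<beta> = (\<Sum>(g, k)\<leftarrow>t. \<beta> g k)"
    proof (rule D.sweedler_dual_eqI[OF fdD ev_mem \<beta>[unfolded dual_hopf_simps]])
      show "set t \<subseteq> dual_space ?D \<times> dual_space ?D" unfolding t_def using ev_mem by auto
      fix f g assume fg: "f \<in> carrier ?D" "g \<in> carrier ?D"
      then show "(\<Sum>(a, b)\<leftarrow>t. a f * b g) = ev x (mult ?D f g)"
        unfolding t_sum using x multD[of f g] by (simp del: dual_hopf_mult) simp
    qed
    then show "sweedler (dual_hopf ?D) (ev x) \<beta> = sw x (\<lambda>a b. \<beta> (ev a) (ev b))" by (simp only: t_sum)
  qed (simp_all add: hopf_algebra_axioms DD ev_mem)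
  have "bij_betw ev (carrier H) (dual_space ?D)"
  proof (rule bij_betw_imageI)
    show "inj_on ev (carrier H)"
    proof (rule inj_onI)
      fix x y assume xy: "x \<in> carrier H" "y \<in> carrier H" "ev x = ev y"
      have "x - y = 0"
      proof (rule dual_separates)
        fix f assume f: "f \<in> dual_space H"
        have "f (x - y) = f x - f y"
          by (rule linear_from_diff[OF dual_spaceD(1)[OF f] carrier_subspace vector_space_axioms xy(1,2)])
        also have "f x = f y" using xy(3) f by (metis ev_apply)
        finally show "f (x - y) = 0" by simp
      qed (simp add: xy)
      then show "x = y" by simp
    qed
    show "ev ` carrier H = dual_space ?D"
    proof
      show "dual_space ?D \<subseteq> ev ` carrier H"
      proof
        fix \<Phi> assume \<Phi>: "\<Phi> \<in> dual_space ?D"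
        then have "linear_from (dual_space H) (\<lambda>c f x. c * f x) (*) \<Phi>" using dual_spaceD(1)[OF \<Phi>] by simp
        then obtain x where x: "x \<in> carrier H" "\<And>f. f \<in> dual_space H \<Longrightarrow> \<Phi> f = f x"
          by (rule dual_functional_eval[OF fd]) (rule that)
        then have "\<Phi> = ev x" by (intro ext \<Phi> ev_mem) simp
        then show "\<Phi> \<in> ev ` carrier H" using x(1) by blast
      qed
    qed (use ev_mem in blast)
  qed
  then show ?thesis unfolding hopf_iso_def using hom by auto
qed

text \<open>The functionals that vanish on HA+, not those that vanish on \<open>A\<close>. This is
  the copy of the dual of H/HA+ inside the dual of \<open>H\<close>.\<close>

definition annihilator :: "'a set \<Rightarrow> ('a \<Rightarrow> 'k) set" where
  "annihilator A = {f \<in> dual_space H. \<forall>y\<in>augmentation_ideal H A. f y = 0}"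

lemma annihilator_of_quotient:
  assumes Q: "is_hopf_quotient H A Q p"
  shows "dual_map H p ` dual_space Q = annihilator A"
proof
  note p = Q[unfolded is_hopf_quotient_def, THEN conjunct1]
  note pD = hopf_homD[OF p]
  interpret Q: hopf_algebra Q by (rule pD)
  have surj: "p ` carrier H = carrier Q"
    and ker: "\<And>x y. x \<in> carrier H \<Longrightarrow> y \<in> carrier H \<Longrightarrow> p x = p y \<longleftrightarrow> x - y \<in> augmentation_ideal H A"
    using Q by (auto simp: is_hopf_quotient_def)
  show "dual_map H p ` dual_space Q \<subseteq> annihilator A"
  proof (rule image_subsetI)
    fix n assume n: "n \<in> dual_space Q"
    have "dual_map H p n y = 0" if y: "y \<in> augmentation_ideal H A" for y
    proof (cases "y \<in> carrier H")
      case True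
      then have "p y = p 0" using ker[of y 0] y by simp
      then show ?thesis
        using True linear_from_zero[OF pD(4)] linear_from_zero[OF dual_spaceD(1)[OF n]] by simp
    qed (simp add: dual_map_def)
    then show "dual_map H p n \<in> annihilator A" by (simp add: annihilator_def dual_map_mem[OF p n])
  qed
  show "annihilator A \<subseteq> dual_map H p ` dual_space Q"
  proof
    fix f assume "f \<in> annihilator A"
    then have f: "f \<in> dual_space H" "\<And>y. y \<in> augmentation_ideal H A \<Longrightarrow> f y = 0"
      by (auto simp: annihilator_def)
    note f_lin = dual_spaceD(1)[OF f(1)]
    \<comment> \<open>A section of \<open>p\<close>. Since \<open>f\<close> is constant on the
      cosets of HA+, the composition of \<open>f\<close> with \<open>r\<close> is independent of the
      choice and therefore linear.\<close>
    define r where "r = inv_into (carrier H) p"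
    have r: "r y \<in> carrier H" "p (r y) = y" if "y \<in> carrier Q" for y
      using that surj by (auto simp: r_def inv_into_into f_inv_into_f)
    have f_eq: "f x = f y" if "x \<in> carrier H" "y \<in> carrier H" "p x = p y" for x y
      using f(2)[of "x - y"] ker[OF that(1,2)] that
        linear_from_diff[OF f_lin carrier_subspace vector_space_axioms that(1,2)] by simp
    have "linear_from (carrier Q) (smult Q) (*) (\<lambda>y. f (r y))"
      unfolding linear_from_def
    proof (intro conjI ballI allI)
      fix y z assume yz: "y \<in> carrier Q" "z \<in> carrier Q"
      have "f (r (y + z)) = f (r y + r z)"
        by (rule f_eq) (use r yz linear_from_add[OF pD(4)] in simp_all)
      then show "f (r (y + z)) = f (r y) + f (r z)" using r yz by (simp add: linear_from_add[OF f_lin])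
    next
      fix c y assume y: "y \<in> carrier Q"
      have "f (r (smult Q c y)) = f (smult H c (r y))"
        by (rule f_eq) (use r y linear_from_scale[OF pD(4)] in simp_all)
      then show "f (r (smult Q c y)) = c * f (r y)" using r y by (simp add: linear_from_scale[OF f_lin])
    qed
    then have n: "(\<lambda>y. if y \<in> carrier Q then f (r y) else 0) \<in> dual_space Q" by (rule Q.dual_spaceI)
    have "f = dual_map H p (\<lambda>y. if y \<in> carrier Q then f (r y) else 0)"
    proof (rule dual_space_ext[OF f(1) dual_map_mem[OF p n]])
      fix x assume x: "x \<in> carrier H"
      have "f x = f (r (p x))" by (rule f_eq) (use x r pD(3) in simp_all)
      then show "f x = dual_map H p (\<lambda>y. if y \<in> carrier Q then f (r y) else 0) x" using x pD(3) by simp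
    qed
    then show "f \<in> dual_map H p ` dual_space Q" using n by blast
  qed
qed

text \<open>The passage to \<open>sub_hopf H A\<close> and back in a single rule: forms on
  \<open>H\<close> need to agree only on pairs from \<open>A\<close>.\<close>

lemma sw_sub_cong:
  fixes \<beta> :: "'a \<Rightarrow> 'a \<Rightarrow> 'b::ab_group_add"
  assumes A: "hopf_subalgebra H A" "a \<in> A" and vs': "vector_space s'"
    and bil: "bilinear_from (carrier H) (smult H) s' \<beta>" "bilinear_from (carrier H) (smult H) s' \<gamma>"
    and eq: "\<And>x y. x \<in> A \<Longrightarrow> y \<in> A \<Longrightarrow> \<beta> x y = \<gamma> x y"
  shows "sw a \<beta> = sw a \<gamma>"
  using sweedler_sub_hopf[OF A bil(1) vs'] sweedler_sub_hopf[OF A bil(2) vs']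
    sweedler_sub_hopf_cong[OF A eq] by simp

text \<open>Summing over the factors of \<open>f\<close> first recombines them into one value, at x1
  S(x3) on the left and S(x1) x3 on the right, while \<open>n\<close> is evaluated at the middle
  factor x2. Normality in the dual becomes a statement about these tensors.\<close>

lemma adjoint_dual:
  assumes fd: "finite_dimensional H" and f: "f \<in> dual_space H" and x: "x \<in> carrier H"
  shows "adjoint_left (dual_hopf H) f n x = sw x (\<lambda>u c. sw u (\<lambda>a b. f (a \<odot> \<S> c) * n b))"
    "adjoint_right (dual_hopf H) f n x = sw x (\<lambda>u c. sw u (\<lambda>a b. f (\<S> a \<odot> c) * n b))"
proof -
  let ?D = "dual_hopf H"
  have calc: "sweedler ?D f (\<lambda>g k. sw x (\<lambda>u c. sw u (\<lambda>a b. g (v a) * n b) * k (w c))) =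
      sw x (\<lambda>u c. sw u (\<lambda>a b. f (v a \<odot> w c) * n b))"
    if vw: "\<And>y. y \<in> carrier H \<Longrightarrow> v y \<in> carrier H" "\<And>y. y \<in> carrier H \<Longrightarrow> w y \<in> carrier H" for v w
  proof -
    have "sweedler ?D f (\<lambda>g k. sw x (\<lambda>u c. sw u (\<lambda>a b. g (v a) * n b) * k (w c))) =
        sw x (\<lambda>u c. sweedler ?D f (\<lambda>g k. sw u (\<lambda>a b. g (v a) * n b) * k (w c)))"
      by (rule sweedler_exchange)
    also have "\<dots> = sw x (\<lambda>u c. sw u (\<lambda>a b. f (v a \<odot> w c) * n b))"
    proof (rule sw_cong[OF x])
      fix u c assume uc: "u \<in> carrier H" "c \<in> carrier H"
      have "sweedler ?D f (\<lambda>g k. sw u (\<lambda>a b. g (v a) * n b) * k (w c)) =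
          sweedler ?D f (\<lambda>g k. sw u (\<lambda>a b. g (v a) * n b * k (w c)))"
        unfolding sweedler_scale_right[OF vector_space_field] ..
      also have "\<dots> = sw u (\<lambda>a b. sweedler ?D f (\<lambda>g k. g (v a) * n b * k (w c)))"
        by (rule sweedler_exchange)
      also have "\<dots> = sw u (\<lambda>a b. f (v a \<odot> w c) * n b)"
      proof (rule sw_cong[OF uc(1)])
        fix a b assume ab: "a \<in> carrier H" "b \<in> carrier H"
        have "sweedler ?D f (\<lambda>g k. g (v a) * n b * k (w c)) = sweedler ?D f (\<lambda>g k. g (v a) * k (w c) * n b)"
          by (simp only: mult.assoc mult.commute[of "n b"])
        also have "\<dots> = f (v a \<odot> w c) * n b"
          unfolding sweedler_scale_right[OF vector_space_field] using sweedler_dual[OF fd f vw(1)[OF ab(1)] vw(2)[OF uc(2)]] by simp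
        finally show "sweedler ?D f (\<lambda>g k. g (v a) * n b * k (w c)) = f (v a \<odot> w c) * n b" .
      qed
      finally show "sweedler ?D f (\<lambda>g k. sw u (\<lambda>a b. g (v a) * n b) * k (w c)) =
          sw u (\<lambda>a b. f (v a \<odot> w c) * n b)" .
    qed
    finally show ?thesis .
  qed
  have "adjoint_left ?D f n x = sweedler ?D f (\<lambda>g k. sw x (\<lambda>u c. sw u (\<lambda>a b. g a * n b) * k (\<S> c)))"
    by (simp add: adjoint_left_def sweedler_apply x cong: sw_cong)
  also have "\<dots> = sw x (\<lambda>u c. sw u (\<lambda>a b. f (a \<odot> \<S> c) * n b))"
    using calc[of "\<lambda>y. y" \<S>] by simp
  finally show "adjoint_left ?D f n x = sw x (\<lambda>u c. sw u (\<lambda>a b. f (a \<odot> \<S> c) * n b))" .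
  have "adjoint_right ?D f n x = sweedler ?D f (\<lambda>g k. sw x (\<lambda>u c. sw u (\<lambda>a b. g (\<S> a) * n b) * k c))"
    by (simp add: adjoint_right_def sweedler_apply x cong: sw_cong)
  also have "\<dots> = sw x (\<lambda>u c. sw u (\<lambda>a b. f (\<S> a \<odot> c) * n b))"
    using calc[of \<S> "\<lambda>y. y"] by simp
  finally show "adjoint_right ?D f n x = sw x (\<lambda>u c. sw u (\<lambda>a b. f (\<S> a \<odot> c) * n b))" .
qed

text \<open>The elements h a - \<epsilon>(a) h and a h - \<epsilon>(a) h lie in HA+; for the second
  one HA+ has to be a two-sided ideal, hence normality.\<close>

lemma annihilator_mult:
  assumes A: "normal_hopf_subalgebra H A" and n: "n \<in> annihilator A" and a: "a \<in> A" and h: "h \<in> carrier H"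
  shows "n (h \<odot> a) = \<epsilon> a * n h" "n (a \<odot> h) = \<epsilon> a * n h"
proof -
  note AD = normal_hopf_subalgebraD[OF A]
  have [simp]: "a \<in> carrier H" using hopf_subalgebraD(2)[OF AD(1)] a by blast
  have n_lin: "linear_from (carrier H) (smult H) (*) n" and n_zero: "\<And>y. y \<in> augmentation_ideal H A \<Longrightarrow> n y = 0"
    using n dual_spaceD(1) by (auto simp: annihilator_def)
  note diff = linear_from_diff[OF _ carrier_subspace vector_space_axioms]
  have "n (h \<odot> a - smult H (\<epsilon> a) h) = 0"
    by (rule n_zero, rule augmentation_ideal_mult_diff[OF AD(1) a h])
  then show "n (h \<odot> a) = \<epsilon> a * n h" using h by (simp add: diff[OF n_lin] linear_from_scale[OF n_lin])
  have "\<one> \<odot> a - smult H (\<epsilon> a) \<one> \<in> augmentation_ideal H A"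
    by (rule augmentation_ideal_mult_diff[OF AD(1) a]) simp
  then have "(\<one> \<odot> a - smult H (\<epsilon> a) \<one>) \<odot> h \<in> augmentation_ideal H A"
    by (rule normal_augmentation_ideal(2)[OF A _ h])
  then have "n ((\<one> \<odot> a - smult H (\<epsilon> a) \<one>) \<odot> h) = 0" by (rule n_zero)
  then have "n (a \<odot> h - smult H (\<epsilon> a) h) = 0"
    using h by (simp add: diff[OF mult_linear_left] mult_unit_left mult_smult_left)
  then show "n (a \<odot> h) = \<epsilon> a * n h" using h by (simp add: diff[OF n_lin] linear_from_scale[OF n_lin])
qed

text \<open>
  The quotient \<open>H \<rightarrow> H/HA\<^sup>+\<close> is conormal: the class of \<open>x\<^sub>2\<close> and \<open>x\<^sub>1 \<S>(x\<^sub>3)\<close> (respectively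
  \<open>\<S>(x\<^sub>1) x\<^sub>3\<close>) depend on \<open>x\<close> only modulo \<open>HA\<^sup>+\<close>.
\<close>

lemma conormal_left:
  assumes A: "normal_hopf_subalgebra H A" and n: "n \<in> annihilator A" and f: "f \<in> dual_space H"
    and x: "x \<in> augmentation_ideal H A"
  shows "sw x (\<lambda>u c. sw u (\<lambda>a b. f (a \<odot> \<S> c) * n b)) = 0"
proof -
  note AD = normal_hopf_subalgebraD[OF A]
  have AH [simp]: "a \<in> carrier H" if "a \<in> A" for a using hopf_subalgebraD(2)[OF AD(1)] that by blast
  have n_lin: "linear_from (carrier H) (smult H) (*) n" using n dual_spaceD(1) by (auto simp: annihilator_def)
  note [lin] = linear_from_comp[OF dual_spaceD(1)[OF f]] linear_from_comp[OF n_lin]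
  let ?\<Theta> = "\<lambda>x. sw x (\<lambda>u c. sw u (\<lambda>a b. f (a \<odot> \<S> c) * n b))"
  have "x \<in> {x \<in> carrier H. ?\<Theta> x \<in> {0}}"
    using x
  proof (rule augmentation_ideal_induct)
    show "subspace {x \<in> carrier H. ?\<Theta> x \<in> {0}}"
      by (rule subspace_linear_preimage[OF _ carrier_subspace vector_space_axioms vector_space_field
            module.subspace_single_0[OF module_of_vector_space[OF vector_space_field]]]) (auto intro!: lin)
    fix h a assume h [simp]: "h \<in> carrier H" and a [simp]: "a \<in> A" and eps: "\<epsilon> a = 0"
    \<comment> \<open>The second factor of \<open>v\<close> lies in \<open>A\<close> and is absorbed
      by \<open>n\<close> as a counit, so all of \<open>v\<close> ends up inside \<open>f\<close>,
      where it will meet S(z) for the next factor \<open>z\<close> of the generator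
      \<open>a\<close>.\<close>
    have inner: "sw (u \<odot> v) (\<lambda>a b. f (a \<odot> \<S> z) * n b) = sw u (\<lambda>u1 u2. f (u1 \<odot> v \<odot> \<S> z) * n u2)"
      if [simp]: "u \<in> carrier H" "v \<in> A" "z \<in> carrier H" for u v z
    proof -
      have "sw (u \<odot> v) (\<lambda>a b. f (a \<odot> \<S> z) * n b) =
          sw u (\<lambda>u1 u2. sw v (\<lambda>v1 v2. f (u1 \<odot> v1 \<odot> \<S> z) * n (u2 \<odot> v2)))"
        by (rule sw_mult) (auto intro!: lin)
      also have "\<dots> = sw u (\<lambda>u1 u2. f (u1 \<odot> v \<odot> \<S> z) * n u2)"
      proof (rule sw_cong)
        fix u1 u2 assume [simp]: "u1 \<in> carrier H" "u2 \<in> carrier H"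
        have "sw v (\<lambda>v1 v2. f (u1 \<odot> v1 \<odot> \<S> z) * n (u2 \<odot> v2)) =
            sw v (\<lambda>v1 v2. \<epsilon> v2 * (f (u1 \<odot> v1 \<odot> \<S> z) * n u2))"
          by (rule sw_sub_cong[OF AD(1) \<open>v \<in> A\<close> vector_space_field])
            (auto intro!: lin simp: annihilator_mult(1)[OF A n])
        also have "\<dots> = f (u1 \<odot> v \<odot> \<S> z) * n u2"
          by (rule sw_counit_right[where f = "\<lambda>v1. f (u1 \<odot> v1 \<odot> \<S> z) * n u2"]) (auto intro!: lin)
        finally show "sw v (\<lambda>v1 v2. f (u1 \<odot> v1 \<odot> \<S> z) * n (u2 \<odot> v2)) = f (u1 \<odot> v \<odot> \<S> z) * n u2" .
      qed simp
      finally show ?thesis .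
    qed
    have "?\<Theta> (h \<odot> a) = sw h (\<lambda>u w. sw a (\<lambda>v z. sw (u \<odot> v) (\<lambda>a b. f (a \<odot> \<S> (w \<odot> z)) * n b)))"
      by (rule sw_mult) (auto intro!: lin)
    also have "\<dots> = sw h (\<lambda>u w. 0)"
    proof (rule sw_cong)
      fix u w assume [simp]: "u \<in> carrier H" "w \<in> carrier H"
      have "sw a (\<lambda>v z. sw (u \<odot> v) (\<lambda>a b. f (a \<odot> \<S> (w \<odot> z)) * n b)) =
          sw a (\<lambda>v z. sw u (\<lambda>u1 u2. f (u1 \<odot> v \<odot> \<S> (w \<odot> z)) * n u2))"
        by (rule sw_sub_cong[OF AD(1) a vector_space_field]) (auto intro!: lin simp: inner)
      also have "\<dots> = sw u (\<lambda>u1 u2. sw a (\<lambda>v z. f (u1 \<odot> v \<odot> \<S> (w \<odot> z)) * n u2))"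
        by (rule sweedler_exchange)
      also have "\<dots> = sw u (\<lambda>u1 u2. 0)"
      proof (rule sw_cong)
        fix u1 u2 assume [simp]: "u1 \<in> carrier H" "u2 \<in> carrier H"
        have "sw a (\<lambda>v z. f (u1 \<odot> v \<odot> \<S> (w \<odot> z)) * n u2) =
            sw a (\<lambda>v z. f (u1 \<odot> (v \<odot> \<S> z \<odot> \<S> w)) * n u2)"
          by (rule sw_cong) (simp_all add: antipode_mult mult_assoc)
        also have "\<dots> = \<epsilon> a * (f (u1 \<odot> (\<one> \<odot> \<S> w)) * n u2)"
          by (rule sw_antipode_right[where f = "\<lambda>y. f (u1 \<odot> (y \<odot> \<S> w)) * n u2"]) (auto intro!: lin)
        finally show "sw a (\<lambda>v z. f (u1 \<odot> v \<odot> \<S> (w \<odot> z)) * n u2) = 0" by (simp add: eps)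
      qed simp
      finally show "sw a (\<lambda>v z. sw (u \<odot> v) (\<lambda>a b. f (a \<odot> \<S> (w \<odot> z)) * n b)) = 0" by simp
    qed simp
    finally show "h \<odot> a \<in> {x \<in> carrier H. ?\<Theta> x \<in> {0}}" by simp
  qed
  then show ?thesis by simp
qed

lemma conormal_right:
  assumes A: "normal_hopf_subalgebra H A" and n: "n \<in> annihilator A" and f: "f \<in> dual_space H"
    and x: "x \<in> augmentation_ideal H A"
  shows "sw x (\<lambda>u c. sw u (\<lambda>a b. f (\<S> a \<odot> c) * n b)) = 0"
proof -
  note AD = normal_hopf_subalgebraD[OF A]
  have AH [simp]: "a \<in> carrier H" if "a \<in> A" for a using hopf_subalgebraD(2)[OF AD(1)] that by blast
  have n_lin: "linear_from (carrier H) (smult H) (*) n" using n dual_spaceD(1) by (auto simp: annihilator_def)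
  note [lin] = linear_from_comp[OF dual_spaceD(1)[OF f]] linear_from_comp[OF n_lin]
  let ?\<Theta> = "\<lambda>x. sw x (\<lambda>u c. sw u (\<lambda>a b. f (\<S> a \<odot> c) * n b))"
  have "x \<in> {x \<in> carrier H. ?\<Theta> x \<in> {0}}"
    \<comment> \<open>Generators of the form a h are taken here: in S(v u1) z w = S(u1) S(v) z w the
      factors \<open>v\<close> and \<open>z\<close> of \<open>a\<close> are adjacent only if
      \<open>a\<close> stands on the left.\<close>
    using A x
  proof (rule normal_augmentation_ideal_induct)
    show "subspace {x \<in> carrier H. ?\<Theta> x \<in> {0}}"
      by (rule subspace_linear_preimage[OF _ carrier_subspace vector_space_axioms vector_space_field
            module.subspace_single_0[OF module_of_vector_space[OF vector_space_field]]]) (auto intro!: lin)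
    fix h a assume h [simp]: "h \<in> carrier H" and a [simp]: "a \<in> A" and eps: "\<epsilon> a = 0"
    have inner: "sw (v \<odot> u) (\<lambda>a b. f (\<S> a \<odot> z) * n b) = sw u (\<lambda>u1 u2. f (\<S> (v \<odot> u1) \<odot> z) * n u2)"
      if [simp]: "u \<in> carrier H" "v \<in> A" "z \<in> carrier H" for u v z
    proof -
      have "sw (v \<odot> u) (\<lambda>a b. f (\<S> a \<odot> z) * n b) =
          sw v (\<lambda>v1 v2. sw u (\<lambda>u1 u2. f (\<S> (v1 \<odot> u1) \<odot> z) * n (v2 \<odot> u2)))"
        by (rule sw_mult) (auto intro!: lin)
      also have "\<dots> = sw u (\<lambda>u1 u2. sw v (\<lambda>v1 v2. f (\<S> (v1 \<odot> u1) \<odot> z) * n (v2 \<odot> u2)))"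
        by (rule sweedler_exchange)
      also have "\<dots> = sw u (\<lambda>u1 u2. f (\<S> (v \<odot> u1) \<odot> z) * n u2)"
      proof (rule sw_cong)
        fix u1 u2 assume [simp]: "u1 \<in> carrier H" "u2 \<in> carrier H"
        have "sw v (\<lambda>v1 v2. f (\<S> (v1 \<odot> u1) \<odot> z) * n (v2 \<odot> u2)) =
            sw v (\<lambda>v1 v2. \<epsilon> v2 * (f (\<S> (v1 \<odot> u1) \<odot> z) * n u2))"
          by (rule sw_sub_cong[OF AD(1) \<open>v \<in> A\<close> vector_space_field])
            (auto intro!: lin simp: annihilator_mult(2)[OF A n])
        also have "\<dots> = f (\<S> (v \<odot> u1) \<odot> z) * n u2"
          by (rule sw_counit_right[where f = "\<lambda>v1. f (\<S> (v1 \<odot> u1) \<odot> z) * n u2"]) (auto intro!: lin)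
        finally show "sw v (\<lambda>v1 v2. f (\<S> (v1 \<odot> u1) \<odot> z) * n (v2 \<odot> u2)) = f (\<S> (v \<odot> u1) \<odot> z) * n u2" .
      qed simp
      finally show ?thesis .
    qed
    have "?\<Theta> (a \<odot> h) = sw a (\<lambda>v z. sw h (\<lambda>u w. sw (v \<odot> u) (\<lambda>a b. f (\<S> a \<odot> (z \<odot> w)) * n b)))"
      by (rule sw_mult) (auto intro!: lin)
    also have "\<dots> = sw h (\<lambda>u w. sw a (\<lambda>v z. sw (v \<odot> u) (\<lambda>a b. f (\<S> a \<odot> (z \<odot> w)) * n b)))"
      by (rule sweedler_exchange)
    also have "\<dots> = sw h (\<lambda>u w. 0)"
    proof (rule sw_cong)
      fix u w assume [simp]: "u \<in> carrier H" "w \<in> carrier H"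
      have "sw a (\<lambda>v z. sw (v \<odot> u) (\<lambda>a b. f (\<S> a \<odot> (z \<odot> w)) * n b)) =
          sw a (\<lambda>v z. sw u (\<lambda>u1 u2. f (\<S> (v \<odot> u1) \<odot> (z \<odot> w)) * n u2))"
        by (rule sw_sub_cong[OF AD(1) a vector_space_field]) (auto intro!: lin simp: inner)
      also have "\<dots> = sw u (\<lambda>u1 u2. sw a (\<lambda>v z. f (\<S> (v \<odot> u1) \<odot> (z \<odot> w)) * n u2))"
        by (rule sweedler_exchange)
      also have "\<dots> = sw u (\<lambda>u1 u2. 0)"
      proof (rule sw_cong)
        fix u1 u2 assume [simp]: "u1 \<in> carrier H" "u2 \<in> carrier H"
        have "sw a (\<lambda>v z. f (\<S> (v \<odot> u1) \<odot> (z \<odot> w)) * n u2) =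
            sw a (\<lambda>v z. f (\<S> u1 \<odot> (\<S> v \<odot> z \<odot> w)) * n u2)"
          by (rule sw_cong) (simp_all add: antipode_mult mult_assoc)
        also have "\<dots> = \<epsilon> a * (f (\<S> u1 \<odot> (\<one> \<odot> w)) * n u2)"
          by (rule sw_antipode_left[where f = "\<lambda>y. f (\<S> u1 \<odot> (y \<odot> w)) * n u2"]) (auto intro!: lin)
        finally show "sw a (\<lambda>v z. f (\<S> (v \<odot> u1) \<odot> (z \<odot> w)) * n u2) = 0" by (simp add: eps)
      qed simp
      finally show "sw a (\<lambda>v z. sw (v \<odot> u) (\<lambda>a b. f (\<S> a \<odot> (z \<odot> w)) * n b)) = 0" by simp
    qed simp
    finally show "a \<odot> h \<in> {x \<in> carrier H. ?\<Theta> x \<in> {0}}" by simp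
  qed
  then show ?thesis by simp
qed

text \<open>As the image of the transposed projection it is a Hopf subalgebra. An adjoint action on
  it vanishes on HA+ by the conormality of the projection.\<close>

lemma normal_annihilator:
  assumes fd: "finite_dimensional H" and A: "normal_hopf_subalgebra H A"
  shows "normal_hopf_subalgebra (dual_hopf H) (annihilator A)"
proof -
  obtain Q p where Q: "is_hopf_quotient H A Q p" using hopf_quotient_exists[OF A] by blast
  have p: "hopf_hom H Q p" "p ` carrier H = carrier Q" using Q by (auto simp: is_hopf_quotient_def)
  have fdQ: "finite_dimensional Q" by (rule finite_dimensional_image(1)[OF fd p])
  have sub: "hopf_subalgebra (dual_hopf H) (annihilator A)"
    using hopf_subalgebra_image[OF hopf_hom_dual[OF p(1) fd fdQ]] annihilator_of_quotient[OF Q] by simp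
  interpret D: hopf_algebra "dual_hopf H" by (rule hopf_algebra_dual[OF fd])
  have IH: "y \<in> carrier H" if "y \<in> augmentation_ideal H A" for y
    using that augmentation_ideal_carrier[OF hopf_subalgebraD(2)[OF normal_hopf_subalgebraD(1)[OF A]]] by blast
  show ?thesis
    unfolding normal_hopf_subalgebra_iff
  proof (intro conjI ballI sub)
    fix f n assume "f \<in> carrier (dual_hopf H)" and n: "n \<in> annihilator A"
    then have f: "f \<in> dual_space H" and nD: "n \<in> dual_space H" by (auto simp: annihilator_def)
    show "adjoint_left (dual_hopf H) f n \<in> annihilator A" "adjoint_right (dual_hopf H) f n \<in> annihilator A"
      using D.adjoint_closed[of f n] f nD
      by (auto simp: annihilator_def adjoint_dual[OF fd f IH] conormal_left[OF A n f] conormal_right[OF A n f])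
  qed
qed

end

lemma scalars_subset:
  assumes "hopf_subalgebra H A"
  shows "scalars H \<subseteq> A"
proof -
  note AD = hopf_subalgebraD[OF assms]
  interpret hopf_algebra H by (rule AD)
  show ?thesis using subspace_scale[OF AD(3,4)] by (auto simp: scalars_def)
qed

section \<open>The quotient of the dual by an annihilator\<close>

context hopf_algebra
begin

text \<open>Let N be the transported annihilator in the dual of \<open>K\<close>. Vanishing at
  \<open>x\<close> of the ideal of N says that \<open>i x\<close> is coinvariant, so
  \<open>coinvariant_mem\<close> applies. The case i = identity computes the quotient of the dual,
  the case of an inclusion serves the second isomorphism theorem.\<close>

lemma annihilator_point:
  fixes K :: "('k, 'b::ab_group_add) hopf"
  assumes fd: "finite_dimensional H" and fdK: "finite_dimensional K"
    and A: "normal_hopf_subalgebra H A" and i: "hopf_hom K H i"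
    and N: "normal_hopf_subalgebra (dual_hopf K) (dual_map K i ` annihilator A)"
    and x: "x \<in> carrier K"
    and zero: "\<And>g. g \<in> augmentation_ideal (dual_hopf K) (dual_map K i ` annihilator A) \<Longrightarrow> g x = 0"
  shows "i x \<in> A"
proof (rule coinvariant_mem[OF fd normal_hopf_subalgebraD(1)[OF A] hopf_homD(3)[OF i x]])
  note iD = hopf_homD[OF i]
  interpret K: hopf_algebra K by (rule iD)
  interpret D: hopf_algebra "dual_hopf K" by (rule K.hopf_algebra_dual[OF fdK])
  note ND = hopf_subalgebraD[OF normal_hopf_subalgebraD(1)[OF N]]
  fix \<phi> assume \<phi>: "linear_from (carrier H) (smult H) (*) \<phi>"
    "\<And>y. y \<in> augmentation_ideal H A \<Longrightarrow> \<phi> y = 0"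
  have \<phi>_ann: "(\<lambda>y. if y \<in> carrier H then \<phi> y else 0) \<in> annihilator A"
    using dual_spaceI[OF \<phi>(1)] \<phi>(2) by (simp add: annihilator_def)
  define n where "n = dual_map K i (\<lambda>y. if y \<in> carrier H then \<phi> y else 0)"
  \<comment> \<open>The functional \<phi> transported to \<open>K\<close> and corrected by a
    multiple of the unit of the dual, so that it lies in the augmentation ideal of N.\<close>
  define m where "m = n - (\<lambda>y. \<phi> \<one> * unit (dual_hopf K) y)"
  have nN: "n \<in> dual_map K i ` annihilator A" unfolding n_def using \<phi>_ann by blast
  have mN: "m \<in> dual_map K i ` annihilator A"
    unfolding m_def using D.subspace_diff[OF ND(3) nN] D.subspace_scale[OF ND(3,4), of "\<phi> \<one>"] by simp
  have m_eq: "m a = \<phi> (i a) - \<phi> \<one> * counit K a" if "a \<in> carrier K" for a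
    using that iD(3) by (simp add: m_def n_def)
  have m1: "counit (dual_hopf K) m = 0" using m_eq[OF K.unit_closed] iD(6) K.counit_unit by simp
  have "mult (dual_hopf K) (unit (dual_hopf K)) m \<in> augmentation_ideal (dual_hopf K) (dual_map K i ` annihilator A)"
    by (rule D.augmentation_ideal_mem[OF D.unit_closed mN m1])
  then have m_ideal: "m \<in> augmentation_ideal (dual_hopf K) (dual_map K i ` annihilator A)"
    using D.mult_unit_left[of m] mN ND(2) by auto
  have eval: "K.sw x (\<lambda>a b. \<phi> (i a) * g b) = \<phi> \<one> * g x" if g: "g \<in> dual_space K" for g
  proof -
    \<comment> \<open>The factor \<open>m\<close> stands on the left here, while the ideal is
      generated by products with \<open>m\<close> on the right; normality of N makes the ideal
      two-sided.\<close>
    have "mult (dual_hopf K) m g x = 0"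
      by (rule zero, rule D.normal_augmentation_ideal(2)[OF N m_ideal]) (simp add: g)
    then have "0 = K.sw x (\<lambda>a b. m a * g b)" using x by simp
    also have "\<dots> = K.sw x (\<lambda>a b. \<phi> (i a) * g b + - \<phi> \<one> * (counit K a * g b))"
      by (rule K.sw_cong[OF x]) (simp add: m_eq algebra_simps)
    also have "\<dots> = K.sw x (\<lambda>a b. \<phi> (i a) * g b) + - \<phi> \<one> * K.sw x (\<lambda>a b. counit K a * g b)"
      unfolding sweedler_add sweedler_scale[OF vector_space_field] ..
    also have "K.sw x (\<lambda>a b. counit K a * g b) = g x"
      by (rule K.sw_counit_left[OF dual_spaceD(1)[OF g] x])
    finally show ?thesis by simp
  qed
  have ix: "i x \<in> carrier H" using iD(3) x by simp
  have closed: "sw (i x) (\<lambda>a b. smult H (\<phi> a) b) \<in> carrier H" using ix by simp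
  have "sw (i x) (\<lambda>a b. smult H (\<phi> a) b) - smult H (\<phi> \<one>) (i x) = 0"
  proof (rule dual_separates)
    fix f assume f: "f \<in> dual_space H"
    note f_lin = dual_spaceD(1)[OF f]
    have bil: "bilinear_from (carrier H) (smult H) (*) (\<lambda>a b. \<phi> a * f b)"
      using \<phi>(1) f_lin by (auto intro!: lin)
    have "f (sw (i x) (\<lambda>a b. smult H (\<phi> a) b)) = sw (i x) (\<lambda>a b. f (smult H (\<phi> a) b))"
      by (rule linear_sw_carrier[OF f_lin ix]) simp
    also have "\<dots> = sw (i x) (\<lambda>a b. \<phi> a * f b)"
      by (rule sw_cong[OF ix]) (simp add: linear_from_scale[OF f_lin])
    also have "\<dots> = K.sw x (\<lambda>a b. \<phi> (i a) * f (i b))"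
      by (rule hopf_hom_sweedler[OF i bil vector_space_field x])
    also have "\<dots> = K.sw x (\<lambda>a b. \<phi> (i a) * dual_map K i f b)"
      by (rule K.sw_cong[OF x]) simp
    also have "\<dots> = \<phi> \<one> * f (i x)" using eval[OF dual_map_mem[OF i f]] x by simp
    finally show "f (sw (i x) (\<lambda>a b. smult H (\<phi> a) b) - smult H (\<phi> \<one>) (i x)) = 0"
      using closed ix by (simp add: linear_from_diff[OF f_lin carrier_subspace vector_space_axioms]
          linear_from_scale[OF f_lin])
  qed (use closed ix in simp)
  then show "sw (i x) (\<lambda>a b. smult H (\<phi> a) b) = smult H (\<phi> \<one>) (i x)" by simp
qed

lemma dual_map_id: "f \<in> dual_space H \<Longrightarrow> dual_map H (\<lambda>x. x) f = f"
  by (auto simp: dual_map_def fun_eq_iff dual_spaceD(2))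

text \<open>An element n of the annihilator with n(1) = 0 vanishes on \<open>A\<close>, hence so
  does g n, whose value at \<open>a\<close> is the sum of g(a1) n(a2). Conversely, if
  \<open>f\<close> were outside the ideal, a point \<open>x\<close> would kill the ideal but not
  \<open>f\<close>; such a point lies in \<open>A\<close>.\<close>

lemma dual_augmentation_ideal_iff:
  assumes fd: "finite_dimensional H" and A: "normal_hopf_subalgebra H A" and f: "f \<in> dual_space H"
  shows "f \<in> augmentation_ideal (dual_hopf H) (annihilator A) \<longleftrightarrow> (\<forall>a\<in>A. f a = 0)"
proof
  note AD = normal_hopf_subalgebraD[OF A]
  interpret D: hopf_algebra "dual_hopf H" by (rule hopf_algebra_dual[OF fd])
  have annD: "n \<in> dual_space H" if "n \<in> annihilator A" for n using that by (simp add: annihilator_def)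
  have AH: "a \<in> carrier H" if "a \<in> A" for a using hopf_subalgebraD(2)[OF AD(1)] that by blast
  show "\<forall>a\<in>A. f a = 0" if "f \<in> augmentation_ideal (dual_hopf H) (annihilator A)"
  proof
    fix a assume a: "a \<in> A"
    have "f \<in> {f. f a \<in> {0}}"
      using that
    proof (rule D.augmentation_ideal_induct)
      show "D.subspace {f. f a \<in> {0}}"
        unfolding D.subspace_def by simp
      fix g n assume g: "g \<in> carrier (dual_hopf H)" and n: "n \<in> annihilator A" "counit (dual_hopf H) n = 0"
      have bil: "bilinear_from (carrier H) (smult H) (*) (\<lambda>x y. g x * n y)"
        using dual_spaceD(1)[of g H] dual_spaceD(1)[OF annD[OF n(1)]] g by (auto intro!: lin)
      have "n y = 0" if "y \<in> A" for y
        using annihilator_mult(1)[OF A n(1) that unit_closed] n(2) AH[OF that] by (simp add: mult_unit_left)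
      then have "sweedler (sub_hopf H A) a (\<lambda>x y. g x * n y) = sweedler (sub_hopf H A) a (\<lambda>x y. 0)"
        by (intro sweedler_sub_hopf_cong[OF AD(1) a]) simp
      then show "mult (dual_hopf H) g n \<in> {f. f a \<in> {0}}"
        using sweedler_sub_hopf[OF AD(1) a bil vector_space_field] AH[OF a] by simp
    qed
    then show "f a = 0" by simp
  qed
  show "f \<in> augmentation_ideal (dual_hopf H) (annihilator A)" if zero: "\<forall>a\<in>A. f a = 0"
  proof (rule ccontr)
    assume not: "f \<notin> augmentation_ideal (dual_hopf H) (annihilator A)"
    have "D.subspace (augmentation_ideal (dual_hopf H) (annihilator A))" by (rule D.augmentation_ideal_subspace)
    then obtain x where x: "x \<in> carrier H" "f x \<noteq> 0"
      "\<And>g. g \<in> augmentation_ideal (dual_hopf H) (annihilator A) \<Longrightarrow> g \<in> dual_space H \<Longrightarrow> g x = 0"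
      unfolding dual_hopf_simps by (rule dual_point[OF fd _ f not]) blast
    have ann: "dual_map H (\<lambda>x. x) ` annihilator A = annihilator A"
      using annD dual_map_id by force
    have sub: "annihilator A \<subseteq> carrier (dual_hopf H)" using annD by auto
    have "x \<in> A"
    proof (rule annihilator_point[OF fd fd A hopf_hom_id[OF hopf_algebra_axioms] _ x(1)])
      show "normal_hopf_subalgebra (dual_hopf H) (dual_map H (\<lambda>x. x) ` annihilator A)"
        using normal_annihilator[OF fd A] by (simp add: ann)
      show "g x = 0" if "g \<in> augmentation_ideal (dual_hopf H) (dual_map H (\<lambda>x. x) ` annihilator A)" for g
        using that x(3) D.augmentation_ideal_carrier[OF sub] by (auto simp: ann)
    qed
    then show False using zero x(2) by simp
  qed
qed

lemma restriction_surj: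
  assumes B: "hopf_subalgebra H B"
  shows "dual_map (sub_hopf H B) (\<lambda>x. x) ` dual_space H = dual_space (sub_hopf H B)"
proof
  note BD = hopf_subalgebraD[OF B]
  show "dual_map (sub_hopf H B) (\<lambda>x. x) ` dual_space H \<subseteq> dual_space (sub_hopf H B)"
    using dual_map_mem[OF hopf_hom_inclusion[OF B]] by blast
  show "dual_space (sub_hopf H B) \<subseteq> dual_map (sub_hopf H B) (\<lambda>x. x) ` dual_space H"
  proof
    fix g assume g: "g \<in> dual_space (sub_hopf H B)"
    then have "linear_from B (smult H) (*) g" using dual_spaceD(1)[OF g] by simp
    then obtain f where f: "Vector_Spaces.linear (smult H) (*) f" "\<And>x. x \<in> B \<Longrightarrow> f x = g x"
      using linear_from_extend[OF vector_space_axioms vector_space_field BD(3)] by metis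
    have fD: "(\<lambda>x. if x \<in> carrier H then f x else 0) \<in> dual_space H"
      by (rule dual_spaceI[OF linear_from_linear[OF f(1)]])
    have "g = dual_map (sub_hopf H B) (\<lambda>x. x) (\<lambda>x. if x \<in> carrier H then f x else 0)"
      by (rule dual_space_ext[OF g dual_map_mem[OF hopf_hom_inclusion[OF B] fD]]) (use f(2) BD(2) in auto)
    then show "g \<in> dual_map (sub_hopf H B) (\<lambda>x. x) ` dual_space H" using fD by blast
  qed
qed

text \<open>Two functionals have the same restriction to \<open>A\<close> iff their difference
  vanishes on \<open>A\<close>, that is, lies in the ideal of the annihilator. So restriction is the
  projection onto the quotient.\<close>

lemma dual_quotient:
  assumes fd: "finite_dimensional H" and A: "normal_hopf_subalgebra H A"
  shows "is_hopf_quotient (dual_hopf H) (annihilator A) (dual_hopf (sub_hopf H A))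
    (dual_map (sub_hopf H A) (\<lambda>x. x))"
  unfolding is_hopf_quotient_def
proof (intro conjI ballI)
  note AD = normal_hopf_subalgebraD[OF A]
  note ASD = hopf_subalgebraD[OF AD(1)]
  interpret D: hopf_algebra "dual_hopf H" by (rule hopf_algebra_dual[OF fd])
  show "hopf_hom (dual_hopf H) (dual_hopf (sub_hopf H A)) (dual_map (sub_hopf H A) (\<lambda>x. x))"
    by (rule hopf_hom_dual[OF hopf_hom_inclusion[OF AD(1)] finite_dimensional_sub_hopf[OF fd AD(1)] fd])
  show "dual_map (sub_hopf H A) (\<lambda>x. x) ` carrier (dual_hopf H) = carrier (dual_hopf (sub_hopf H A))"
    using restriction_surj[OF AD(1)] by simp
  fix f g assume fg: "f \<in> carrier (dual_hopf H)" "g \<in> carrier (dual_hopf H)"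
  have diff: "f - g \<in> dual_space H" using D.carrier_diff[OF fg] by simp
  have "dual_map (sub_hopf H A) (\<lambda>x. x) f = dual_map (sub_hopf H A) (\<lambda>x. x) g \<longleftrightarrow> (\<forall>a\<in>A. (f - g) a = 0)"
    by (auto simp: dual_map_def fun_eq_iff)
  then show "dual_map (sub_hopf H A) (\<lambda>x. x) f = dual_map (sub_hopf H A) (\<lambda>x. x) g \<longleftrightarrow>
      f - g \<in> augmentation_ideal (dual_hopf H) (annihilator A)"
    using dual_augmentation_ideal_iff[OF fd A diff] by simp
qed

lemma dual_of_quotient:
  assumes fd: "finite_dimensional H" and Q: "is_hopf_quotient H A Q p"
  shows "hopf_iso (dual_hopf Q) (sub_hopf (dual_hopf H) (annihilator A))"
proof -
  have p: "hopf_hom H Q p" "p ` carrier H = carrier Q" using Q by (auto simp: is_hopf_quotient_def)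
  have fdQ: "finite_dimensional Q" by (rule finite_dimensional_image(1)[OF fd p])
  note hom = hopf_hom_dual[OF p(1) fd fdQ]
  note img = annihilator_of_quotient[OF Q]
  have sub: "hopf_subalgebra (dual_hopf H) (annihilator A)"
    using hopf_subalgebra_image[OF hom] img by simp
  have hom': "hopf_hom (dual_hopf Q) (sub_hopf (dual_hopf H) (annihilator A)) (dual_map H p)"
    by (rule hopf_hom_corestrict[OF hom sub]) (simp add: img)
  have "inj_on (dual_map H p) (dual_space Q)"
  proof (rule inj_onI)
    fix f g assume fg: "f \<in> dual_space Q" "g \<in> dual_space Q" "dual_map H p f = dual_map H p g"
    show "f = g"
    proof (rule dual_space_ext[OF fg(1,2)])
      fix y assume "y \<in> carrier Q"
      then obtain x where x: "x \<in> carrier H" "y = p x" using p(2) by blast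
      have "dual_map H p f x = dual_map H p g x" using fg(3) by simp
      then show "f y = g y" using x by simp
    qed
  qed
  then have "bij_betw (dual_map H p) (dual_space Q) (annihilator A)"
    using img by (simp add: bij_betw_def)
  then show ?thesis unfolding hopf_iso_def using hom' by auto
qed

lemma nonscalar_augmentation:
  assumes A: "hopf_subalgebra H A" and strict: "scalars H \<subset> A"
  obtains y where "y \<in> A" "y \<in> carrier H" "\<epsilon> y = 0" "y \<noteq> 0" "y \<in> augmentation_ideal H A"
proof -
  obtain a where a: "a \<in> A" "a \<notin> scalars H" using strict by blast
  let ?y = "a - smult H (\<epsilon> a) \<one>"
  have y: "?y \<in> A" "\<epsilon> ?y = 0" by (rule augmentation_mem[OF A a(1)])+
  moreover have "?y \<noteq> 0" using a(2) by (auto simp: scalars_def)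
  moreover have yH: "?y \<in> carrier H" using y(1) hopf_subalgebraD(2)[OF A] by blast
  moreover have "?y \<in> augmentation_ideal H A"
    using augmentation_ideal_mem[OF unit_closed y] yH by (simp add: mult_unit_left)
  ultimately show ?thesis using that by blast
qed

text \<open>If only the multiples of \<epsilon> vanished on HA+, then HA+ would be the whole
  augmentation ideal and \<open>A\<close> would be \<open>H\<close>. If all functionals vanished on
  it, then HA+ would be 0, but it contains a - \<epsilon>(a) 1 for a nonscalar \<open>a\<close> in
  \<open>A\<close>.\<close>

lemma annihilator_strict:
  assumes fd: "finite_dimensional H" and A: "normal_hopf_subalgebra H A"
    and strict: "scalars H \<subset> A" "A \<subset> carrier H"
  shows "scalars (dual_hopf H) \<subset> annihilator A" "annihilator A \<subset> carrier (dual_hopf H)"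
proof -
  note AD = normal_hopf_subalgebraD[OF A]
  have "\<not> annihilator A \<subseteq> scalars (dual_hopf H)"
  proof
    assume sub: "annihilator A \<subseteq> scalars (dual_hopf H)"
    have "A = carrier H"
    proof (rule eq_carrier_of_augmentation_ideal[OF fd AD(1)], rule ccontr)
      fix x assume x: "x \<in> carrier H" "\<epsilon> x = 0" "x \<notin> augmentation_ideal H A"
      obtain \<phi> where \<phi>: "Vector_Spaces.linear (smult H) (*) \<phi>"
        "\<And>y. y \<in> augmentation_ideal H A \<Longrightarrow> \<phi> y = 0" "\<phi> x = 1"
        using linear_separation_subspace[OF vector_space_axioms augmentation_ideal_subspace x(3)] by metis
      have "(\<lambda>y. if y \<in> carrier H then \<phi> y else 0) \<in> annihilator A"
        using dual_spaceI[OF linear_from_linear[OF \<phi>(1)]] \<phi>(2) by (simp add: annihilator_def)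
      then obtain k where "(\<lambda>y. if y \<in> carrier H then \<phi> y else 0) =
          (\<lambda>y. k * (if y \<in> carrier H then \<epsilon> y else 0))"
        using sub by (auto simp: scalars_def)
      from fun_cong[OF this, of x] show False using x \<phi>(3) by simp
    qed
    then show False using strict by blast
  qed
  then show "scalars (dual_hopf H) \<subset> annihilator A"
    using scalars_subset[OF normal_hopf_subalgebraD(1)[OF normal_annihilator[OF fd A]]] by blast
  obtain y where y: "y \<in> carrier H" "y \<noteq> 0" "y \<in> augmentation_ideal H A"
    by (rule nonscalar_augmentation[OF AD(1) strict(1)]) (rule that)
  have "annihilator A \<noteq> dual_space H"
    using dual_separates[OF y(1)] y(2,3) by (auto simp: annihilator_def)
  then show "annihilator A \<subset> carrier (dual_hopf H)" by (auto simp: annihilator_def)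
qed

end

lemma simple_hopf_iso:
  assumes iso: "hopf_iso H K" and simple: "simple_hopf H"
  shows "simple_hopf K"
  unfolding simple_hopf_def
proof (intro conjI notI)
  obtain f where f: "hopf_hom K H f" "bij_betw f (carrier K) (carrier H)"
    using hopf_iso_sym[OF iso] by (auto simp: hopf_iso_def)
  note fD = hopf_homD[OF f(1)]
  show "hopf_algebra K" by (rule fD)
  interpret K: hopf_algebra K by (rule fD)
  have img: "f ` carrier K = carrier H" using f(2) by (simp add: bij_betw_def)
  have scal: "f ` scalars K = scalars H"
    unfolding scalars_def image_image using linear_from_scale[OF fD(4)] fD(6) by auto
  assume "\<exists>A. normal_hopf_subalgebra K A \<and> scalars K \<subset> A \<and> A \<subset> carrier K"
  then obtain A where A: "normal_hopf_subalgebra K A" "scalars K \<subset> A" "A \<subset> carrier K" by blast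
  have inj: "inj_on f (carrier K)" using f(2) by (simp add: bij_betw_def)
  have "f ` scalars K \<subset> f ` A" "f ` A \<subset> f ` carrier K"
    using A(2,3) inj_on_image_eq_iff[OF inj, of "scalars K" A] inj_on_image_eq_iff[OF inj, of A "carrier K"]
    by (simp_all add: psubset_eq image_mono) blast
  then show False
    using simple normal_hopf_subalgebra_image[OF f(1) img A(1)] unfolding simple_hopf_def scal img by blast
qed

text \<open>A proper nontrivial normal Hopf subalgebra of the dual has an annihilator of the same
  kind in the double dual, which is isomorphic to the simple \<open>H\<close>.\<close>

lemma simple_hopf_dual:
  assumes fd: "finite_dimensional H" and simple: "simple_hopf H"
  shows "simple_hopf (dual_hopf H)"
  unfolding simple_hopf_def
proof (intro conjI notI)
  interpret H: hopf_algebra H using simple by (simp add: simple_hopf_def)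
  let ?D = "dual_hopf H"
  interpret D: hopf_algebra ?D by (rule H.hopf_algebra_dual[OF fd])
  note fdD = H.finite_dimensional_dual[OF fd]
  show "hopf_algebra ?D" by (rule D.hopf_algebra_axioms)
  assume "\<exists>A. normal_hopf_subalgebra ?D A \<and> scalars ?D \<subset> A \<and> A \<subset> carrier ?D"
  then obtain A where A: "normal_hopf_subalgebra ?D A" "scalars ?D \<subset> A" "A \<subset> carrier ?D" by blast
  have "simple_hopf (dual_hopf ?D)" by (rule simple_hopf_iso[OF H.hopf_iso_double_dual[OF fd] simple])
  then show False
    using D.normal_annihilator[OF fdD A(1)] D.annihilator_strict[OF fdD A] by (auto simp: simple_hopf_def)
qed

subsection \<open>Isomorphism theorems\<close>

lemma hopf_hom_factor:
  fixes H :: "('k::field, 'a::ab_group_add) hopf" and Q :: "('k, 'b::ab_group_add) hopf"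
    and R :: "('k, 'c::ab_group_add) hopf"
  assumes p: "hopf_hom H Q p" and surj: "p ` carrier H = carrier Q" and p': "hopf_hom H R p'"
    and ker: "\<And>x y. x \<in> carrier H \<Longrightarrow> y \<in> carrier H \<Longrightarrow> p x = p y \<Longrightarrow> p' x = p' y"
  obtains r where "hopf_hom Q R r" "\<And>x. x \<in> carrier H \<Longrightarrow> r (p x) = p' x"
proof -
  note pD = hopf_homD[OF p] and pD' = hopf_homD[OF p']
  interpret H: hopf_algebra H by (rule pD)
  interpret Q: hopf_algebra Q by (rule pD)
  define r where "r y = p' (inv_into (carrier H) p y)" for y
  have r: "r (p x) = p' x" if "x \<in> carrier H" for x
  proof -
    have "p x \<in> p ` carrier H" using that by simp
    then show ?thesis
      unfolding r_def using that by (intro ker) (simp_all add: inv_into_into f_inv_into_f)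
  qed
  have lift: "\<exists>x\<in>carrier H. y = p x" if "y \<in> carrier Q" for y using that surj by blast
  have r_lin: "linear_from (carrier Q) (smult Q) (smult R) r"
    unfolding linear_from_def
  proof (intro conjI ballI allI)
    fix y z c assume "y \<in> carrier Q" "z \<in> carrier Q"
    then obtain u v where uv: "u \<in> carrier H" "v \<in> carrier H" "y = p u" "z = p v" using lift by blast
    show "r (y + z) = r y + r z"
      using uv r[of "u + v"] linear_from_add[OF pD(4)] linear_from_add[OF pD'(4)] r by simp
  next
    fix c y assume "y \<in> carrier Q"
    then obtain u where u: "u \<in> carrier H" "y = p u" using lift by blast
    show "r (smult Q c y) = smult R c (r y)"
      using u r[of "smult H c u"] linear_from_scale[OF pD(4)] linear_from_scale[OF pD'(4)] r by simp
  qed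
  have r_mem: "r y \<in> carrier R" if "y \<in> carrier Q" for y using lift[OF that] r pD'(3) by auto
  have "hopf_hom Q R r"
  proof (rule hopf_homI)
    fix y and \<beta> :: "'c \<Rightarrow> 'c \<Rightarrow> 'k"
    assume y: "y \<in> carrier Q" and \<beta>: "bilinear_from (carrier R) (smult R) (*) \<beta>"
    obtain x where x: "x \<in> carrier H" "y = p x" using lift[OF y] by blast
    have "sweedler R (r y) \<beta> = H.sw x (\<lambda>a b. \<beta> (p' a) (p' b))"
      using hopf_hom_sweedler[OF p' \<beta> vector_space_field x(1)] x r by simp
    also have "\<dots> = H.sw x (\<lambda>a b. \<beta> (r (p a)) (r (p b)))"
      by (rule H.sw_cong[OF x(1)]) (simp add: r)
    also have "\<dots> = sweedler Q y (\<lambda>a b. \<beta> (r a) (r b))"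
      using hopf_hom_sweedler[OF p bilinear_from_comp[OF \<beta> r_lin r_mem] vector_space_field x(1)] x by simp
    finally show "sweedler R (r y) \<beta> = sweedler Q y (\<lambda>a b. \<beta> (r a) (r b))" .
  next
    fix y z assume "y \<in> carrier Q" "z \<in> carrier Q"
    then obtain u v where uv: "u \<in> carrier H" "v \<in> carrier H" "y = p u" "z = p v" using lift by blast
    then show "r (mult Q y z) = mult R (r y) (r z)"
      using r[of "mult H u v"] r pD(5) pD'(5) by simp
  next
    show "r (unit Q) = unit R" using r[of "unit H"] pD(6) pD'(6) by simp
  next
    fix y assume "y \<in> carrier Q"
    then obtain u where u: "u \<in> carrier H" "y = p u" using lift by blast
    show "counit R (r y) = counit Q y" using u r pD(7) pD'(7) by simp
    show "r (antipode Q y) = antipode R (r y)"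
      using u r[of "antipode H u"] r pD(8) pD'(8) by simp
  qed (use pD pD' r_mem r_lin in auto)
  then show ?thesis using that r by blast
qed

lemma is_hopf_quotientD:
  assumes "is_hopf_quotient H A Q p"
  shows "hopf_hom H Q p" "p ` carrier H = carrier Q"
    "\<And>x y. x \<in> carrier H \<Longrightarrow> y \<in> carrier H \<Longrightarrow> p x = p y \<longleftrightarrow> x - y \<in> augmentation_ideal H A"
  using assms by (auto simp: is_hopf_quotient_def)

lemma is_hopf_quotient_zero:
  assumes Q: "is_hopf_quotient H A Q p" and x: "x \<in> carrier H"
  shows "p x = 0 \<longleftrightarrow> x \<in> augmentation_ideal H A"
proof -
  note QD = is_hopf_quotientD[OF Q]
  interpret H: hopf_algebra H using QD(1) by (rule hopf_homD)
  have "p 0 = 0" by (rule linear_from_zero[OF hopf_homD(4)[OF QD(1)]]) simp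
  then show ?thesis using QD(3)[OF x, of 0] by simp
qed

lemma hopf_quotient_unique:
  assumes Q: "is_hopf_quotient H A Q p" and R: "is_hopf_quotient H A R p'"
  shows "hopf_iso Q R"
proof -
  note QD = is_hopf_quotientD[OF Q] and RD = is_hopf_quotientD[OF R]
  obtain r where r: "hopf_hom Q R r" "\<And>x. x \<in> carrier H \<Longrightarrow> r (p x) = p' x"
    by (rule hopf_hom_factor[OF QD(1,2) RD(1)]) (use QD(3) RD(3) in blast)+
  have "bij_betw r (carrier Q) (carrier R)"
  proof (rule bij_betw_imageI)
    show "inj_on r (carrier Q)"
    proof (rule inj_onI)
      fix y z assume "y \<in> carrier Q" "z \<in> carrier Q" "r y = r z"
      moreover then obtain u v where "u \<in> carrier H" "v \<in> carrier H" "y = p u" "z = p v"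
        using QD(2) by blast
      ultimately show "y = z" using r(2) QD(3) RD(3) by metis
    qed
    have "r ` p ` carrier H = p' ` carrier H" unfolding image_image using r(2) by (intro image_cong) auto
    then show "r ` carrier Q = carrier R" using QD(2) RD(2) by simp
  qed
  then show ?thesis using r(1) by (auto simp: hopf_iso_def)
qed

lemma hopf_hom_augmentation_ideal:
  assumes f: "hopf_hom H Q f" and A: "A \<subseteq> carrier H" and x: "x \<in> augmentation_ideal H A"
  shows "f x \<in> augmentation_ideal Q (f ` A)"
proof -
  note fD = hopf_homD[OF f]
  interpret H: hopf_algebra H by (rule fD)
  interpret Q: hopf_algebra Q by (rule fD)
  have "x \<in> {x \<in> carrier H. f x \<in> augmentation_ideal Q (f ` A)}"
    using x
  proof (rule H.augmentation_ideal_induct)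
    show "H.subspace {x \<in> carrier H. f x \<in> augmentation_ideal Q (f ` A)}"
      by (rule subspace_linear_preimage[OF fD(4) H.carrier_subspace H.vector_space_axioms
            Q.vector_space_axioms Q.augmentation_ideal_subspace])
    fix h a assume ha: "h \<in> carrier H" "a \<in> A" "counit H a = 0"
    have aH: "a \<in> carrier H" using A ha(2) by blast
    have "mult Q (f h) (f a) \<in> augmentation_ideal Q (f ` A)"
      by (rule Q.augmentation_ideal_mem) (simp_all add: fD(3,7) ha aH)
    then show "mult H h a \<in> {x \<in> carrier H. f x \<in> augmentation_ideal Q (f ` A)}"
      using ha aH by (simp add: fD(5))
  qed
  then show ?thesis by simp
qed

text \<open>The projection \<open>p\<close> restricted to \<open>B\<close> identifies elements
  modulo the intersection of HA+ with \<open>B\<close>, which is BA+ by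
  \<open>augmentation_ideal_inter\<close>.\<close>

lemma third_isomorphism_sub:
  assumes fd: "finite_dimensional H" and A: "normal_hopf_subalgebra H A" and B: "normal_hopf_subalgebra H B"
    and AB: "A \<subseteq> B" and Q: "is_hopf_quotient H A Q p"
  shows "is_hopf_quotient (sub_hopf H B) A (sub_hopf Q (p ` B)) p"
  unfolding is_hopf_quotient_def
proof (intro conjI ballI)
  note BD = normal_hopf_subalgebraD[OF B]
  note QD = is_hopf_quotientD[OF Q]
  interpret H: hopf_algebra H using QD(1) by (rule hopf_homD)
  show "hopf_hom (sub_hopf H B) (sub_hopf Q (p ` B)) p"
    by (rule hopf_subalgebra_image_sub(2)[OF QD(1) BD(1)])
  show "p ` carrier (sub_hopf H B) = carrier (sub_hopf Q (p ` B))" by simp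
  fix x y assume xy: "x \<in> carrier (sub_hopf H B)" "y \<in> carrier (sub_hopf H B)"
  then have "x \<in> carrier H" "y \<in> carrier H" using hopf_subalgebraD(2)[OF BD(1)] by auto
  moreover have "x - y \<in> B" using xy H.subspace_diff[OF hopf_subalgebraD(3)[OF BD(1)]] by simp
  ultimately show "p x = p y \<longleftrightarrow> x - y \<in> augmentation_ideal (sub_hopf H B) A"
    using QD(3) H.augmentation_ideal_inter[OF fd BD(1) AB] by blast
qed

lemma third_isomorphism_quotient:
  assumes A: "normal_hopf_subalgebra H A" and B: "normal_hopf_subalgebra H B"
    and AB: "A \<subseteq> B" and Q: "is_hopf_quotient H A Q p" and R: "is_hopf_quotient H B R p'"
  shows "\<exists>r. is_hopf_quotient Q (p ` B) R r"
proof -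
  note BD = normal_hopf_subalgebraD[OF B]
  note QD = is_hopf_quotientD[OF Q] and RD = is_hopf_quotientD[OF R]
  note pD = hopf_homD[OF QD(1)] and pD' = hopf_homD[OF RD(1)]
  interpret H: hopf_algebra H by (rule pD)
  interpret Q: hopf_algebra Q by (rule pD)
  interpret R: hopf_algebra R by (rule pD')
  have BH: "B \<subseteq> carrier H" by (rule hopf_subalgebraD(2)[OF BD(1)])
  have mono: "x \<in> augmentation_ideal H B" if "x \<in> augmentation_ideal H A" for x
    by (rule H.augmentation_ideal_induct[OF that H.augmentation_ideal_subspace])
      (use AB in \<open>auto intro: H.augmentation_ideal_mem\<close>)
  obtain r where r: "hopf_hom Q R r" "\<And>x. x \<in> carrier H \<Longrightarrow> r (p x) = p' x"
    by (rule hopf_hom_factor[OF QD(1,2) RD(1)]) (use QD(3) RD(3) mono in blast)+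
  note rD = hopf_homD[OF r(1)]
  have r_zero: "r y = 0 \<longleftrightarrow> y \<in> augmentation_ideal Q (p ` B)" if y: "y \<in> carrier Q" for y
  proof -
    obtain x where x: "x \<in> carrier H" "y = p x" using y QD(2) by blast
    show ?thesis
    proof
      assume "r y = 0"
      then have "x \<in> augmentation_ideal H B" using x r(2) is_hopf_quotient_zero[OF R x(1)] by simp
      then show "y \<in> augmentation_ideal Q (p ` B)"
        unfolding x(2) by (rule hopf_hom_augmentation_ideal[OF QD(1) BH])
    next
      assume "y \<in> augmentation_ideal Q (p ` B)"
      then have "y \<in> {y \<in> carrier Q. r y \<in> {0}}"
      proof (rule Q.augmentation_ideal_induct)
        show "Q.subspace {y \<in> carrier Q. r y \<in> {0}}"
          by (rule subspace_linear_preimage[OF rD(4) Q.carrier_subspace Q.vector_space_axioms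
                R.vector_space_axioms]) simp
        fix k c assume k: "k \<in> carrier Q" and c: "c \<in> p ` B" "counit Q c = 0"
        obtain h b where hb: "h \<in> carrier H" "k = p h" "b \<in> B" "c = p b" using k c QD(2) by blast
        have bH: "b \<in> carrier H" using hb BH by blast
        have "mult H h b \<in> augmentation_ideal H B"
          using hb c(2) bH pD(7) by (intro H.augmentation_ideal_mem) auto
        then have "p' (mult H h b) = 0" using is_hopf_quotient_zero[OF R, of "mult H h b"] hb bH by simp
        then show "mult Q k c \<in> {y \<in> carrier Q. r y \<in> {0}}"
          using hb bH pD(3,5) r(2)[of "mult H h b"] by simp
      qed
      then show "r y = 0" by simp
    qed
  qed
  have "is_hopf_quotient Q (p ` B) R r"
    unfolding is_hopf_quotient_def
  proof (intro conjI ballI r(1))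
    have "r ` p ` carrier H = p' ` carrier H" unfolding image_image using r(2) by (intro image_cong) auto
    then show "r ` carrier Q = carrier R" using QD(2) RD(2) by simp
    fix y z assume yz: "y \<in> carrier Q" "z \<in> carrier Q"
    then show "r y = r z \<longleftrightarrow> y - z \<in> augmentation_ideal Q (p ` B)"
      using r_zero[of "y - z"] linear_from_diff[OF rD(4) Q.carrier_subspace Q.vector_space_axioms yz] by simp
  qed
  then show ?thesis by blast
qed

text \<open>If the image of \<open>B\<close> were scalar, the counit would force B+ into HA+ and
  hence into BA+, so A = B. If the image were everything, then H = B + HA+, so H+ would lie in HB+
  and B = H. Both conclusions use \<open>eq_carrier_of_augmentation_ideal\<close>.\<close>

lemma quotient_image_strict:
  assumes fd: "finite_dimensional H" and A: "normal_hopf_subalgebra H A" and B: "normal_hopf_subalgebra H B"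
    and AB: "A \<subset> B" and BH: "B \<subset> carrier H" and Q: "is_hopf_quotient H A Q p"
  shows "scalars Q \<subset> p ` B" "p ` B \<subset> carrier Q"
proof -
  note BD = normal_hopf_subalgebraD[OF B]
  note AD = normal_hopf_subalgebraD[OF A]
  note BSD = hopf_subalgebraD[OF BD(1)]
  note QD = is_hopf_quotientD[OF Q]
  note pD = hopf_homD[OF QD(1)]
  interpret H: hopf_algebra H by (rule pD)
  interpret Q: hopf_algebra Q by (rule pD)
  interpret KB: hopf_algebra "sub_hopf H B" by (rule hopf_algebra_sub_hopf[OF BD(1)])
  have sub: "hopf_subalgebra Q (p ` B)" by (rule hopf_subalgebra_image_sub(1)[OF QD(1) BD(1)])
  have "\<not> p ` B \<subseteq> scalars Q"
  proof
    assume scal: "p ` B \<subseteq> scalars Q"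
    have "A = carrier (sub_hopf H B)"
    proof (rule KB.eq_carrier_of_augmentation_ideal[OF finite_dimensional_sub_hopf[OF fd BD(1)]
          hopf_subalgebra_sub[OF AD(1) BD(1)]])
      fix b assume "b \<in> carrier (sub_hopf H B)" "counit (sub_hopf H B) b = 0"
      then have b: "b \<in> B" "b \<in> carrier H" "counit H b = 0" using BSD(2) by auto
      obtain c where c: "p b = smult Q c (unit Q)" using scal b(1) by (auto simp: scalars_def)
      have "counit Q (p b) = 0" using b pD(7) by simp
      then have "c = 0" unfolding c by (simp add: Q.counit_smult Q.counit_unit)
      then have "p b = 0" using c by simp
      then show "b \<in> augmentation_ideal (sub_hopf H B) A"
        using is_hopf_quotient_zero[OF Q b(2)] H.augmentation_ideal_inter[OF fd BD(1), of A] AB b(1) by blast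
    qed (use AB in auto)
    then show False using AB by simp
  qed
  then show "scalars Q \<subset> p ` B" using scalars_subset[OF sub] by blast
  have "p ` B \<noteq> carrier Q"
  proof
    assume full: "p ` B = carrier Q"
    have "B = carrier H"
    proof (rule H.eq_carrier_of_augmentation_ideal[OF fd BD(1)])
      fix x assume x: "x \<in> carrier H" "counit H x = 0"
      obtain b where b: "b \<in> B" "p x = p b" using pD(3)[OF x(1)] full by (metis imageE)
      have bH: "b \<in> carrier H" using b BSD(2) by blast
      have "x - b \<in> augmentation_ideal H A" using QD(3)[OF x(1) bH] b(2) by simp
      then have 1: "x - b \<in> augmentation_ideal H B"
        by (rule H.augmentation_ideal_induct[OF _ H.augmentation_ideal_subspace])
          (use AB in \<open>auto intro: H.augmentation_ideal_mem\<close>)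
      have "counit H b = counit H x" using pD(7)[OF bH] pD(7)[OF x(1)] b(2) by simp
      then have "mult H (unit H) b \<in> augmentation_ideal H B"
        using x(2) b(1) by (intro H.augmentation_ideal_mem) simp_all
      then have "b \<in> augmentation_ideal H B" using bH by (simp add: H.mult_unit_left)
      from H.subspace_add[OF H.augmentation_ideal_subspace 1 this]
      show "x \<in> augmentation_ideal H B" by simp
    qed
    then show False using BH by simp
  qed
  then show "p ` B \<subset> carrier Q" using hopf_subalgebraD(2)[OF sub] by blast
qed

text \<open>
  Injectivity of \<open>B \<rightarrow> H/HA\<^sup>+\<close> is proved on the dual side: the image of \<open>(H/HA\<^sup>+)\<^sup>*\<close> in \<open>B\<^sup>*\<close>
  is a normal Hopf subalgebra \<open>N\<close>, and a point of \<open>B\<close> killed by \<open>B\<^sup>*N\<^sup>+\<close> lies in \<open>A \<inter> B = k\<close>.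
  Hence \<open>B\<^sup>*N\<^sup>+\<close> is all of \<open>(B\<^sup>*)\<^sup>+\<close>, which forces \<open>N = B\<^sup>*\<close>.
\<close>

lemma second_isomorphism:
  assumes fd: "finite_dimensional H" and A: "normal_hopf_subalgebra H A" and B: "hopf_subalgebra H B"
    and int: "A \<inter> B \<subseteq> scalars H" and prod: "hopf_algebra.product_span H A B = carrier H"
    and Q: "is_hopf_quotient H A Q p"
  shows "hopf_iso (sub_hopf H B) Q"
proof -
  note AD = normal_hopf_subalgebraD[OF A]
  note ASD = hopf_subalgebraD[OF AD(1)] and BSD = hopf_subalgebraD[OF B]
  note QD = is_hopf_quotientD[OF Q]
  note pD = hopf_homD[OF QD(1)]
  interpret H: hopf_algebra H by (rule pD)
  interpret Q: hopf_algebra Q by (rule pD)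
  let ?K = "sub_hopf H B"
  interpret K: hopf_algebra ?K by (rule hopf_algebra_sub_hopf[OF B])
  note fdK = finite_dimensional_sub_hopf[OF fd B]
  let ?res = "dual_map ?K (\<lambda>x. x)"
  let ?N = "?res ` H.annihilator A"
  interpret D: hopf_algebra "dual_hopf ?K" by (rule K.hopf_algebra_dual[OF fdK])
  have N: "normal_hopf_subalgebra (dual_hopf ?K) ?N"
    by (rule normal_hopf_subalgebra_image[OF hopf_hom_dual[OF hopf_hom_inclusion[OF B] fdK fd] _
          H.normal_annihilator[OF fd A]]) (simp add: H.restriction_surj[OF B])
  note ND = normal_hopf_subalgebraD[OF N]
  have Nsub: "?N \<subseteq> carrier (dual_hopf ?K)" by (rule hopf_subalgebraD(2)[OF ND(1)])
  have N_full: "?N = carrier (dual_hopf ?K)"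
  proof (rule D.eq_carrier_of_augmentation_ideal[OF K.finite_dimensional_dual[OF fdK] ND(1)], rule ccontr)
    fix g assume g: "g \<in> carrier (dual_hopf ?K)" "counit (dual_hopf ?K) g = 0"
      and not: "g \<notin> augmentation_ideal (dual_hopf ?K) ?N"
    have gD: "g \<in> dual_space ?K" using g(1) by simp
    have "D.subspace (augmentation_ideal (dual_hopf ?K) ?N)" by (rule D.augmentation_ideal_subspace)
    then obtain x where x: "x \<in> carrier ?K" "g x \<noteq> 0"
      "\<And>f. f \<in> augmentation_ideal (dual_hopf ?K) ?N \<Longrightarrow> f \<in> dual_space ?K \<Longrightarrow> f x = 0"
      unfolding dual_hopf_simps by (rule K.dual_point[OF fdK _ gD not]) blast
    have "x \<in> A"
    proof (rule H.annihilator_point[OF fd fdK A hopf_hom_inclusion[OF B] N x(1)])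
      show "f x = 0" if "f \<in> augmentation_ideal (dual_hopf ?K) ?N" for f
        using that x(3) D.augmentation_ideal_carrier[OF Nsub] by auto
    qed
    \<comment> \<open>A point of both \<open>A\<close> and \<open>B\<close> is a scalar, and a
      functional with value 0 at the unit vanishes on scalars.\<close>
    then obtain c where "x = smult H c (unit H)" using int x(1) by (auto simp: scalars_def)
    then show False
      using x(2) g(2) linear_from_scale[OF dual_spaceD(1)[OF gD] K.unit_closed, of c] by simp
  qed
  \<comment> \<open>Every functional on \<open>B\<close> is now the restriction of one that vanishes
    on HA+, so an element of \<open>B\<close> inside HA+ is killed by all functionals on
    \<open>B\<close>.\<close>
  have inj0: "x = 0" if x: "x \<in> B" "x \<in> augmentation_ideal H A" for x
  proof (rule K.dual_separates)
    fix g assume "g \<in> dual_space ?K"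
    then obtain n where "n \<in> H.annihilator A" "g = ?res n" using N_full by auto
    then show "g x = 0" using x by (simp add: H.annihilator_def)
  qed (use x in simp)
  have BH: "x \<in> carrier H" if "x \<in> B" for x using that BSD(2) by blast
  have "inj_on p B"
  proof (rule inj_onI)
    fix x y assume xy: "x \<in> B" "y \<in> B" "p x = p y"
    have "x - y \<in> augmentation_ideal H A" using QD(3)[OF BH[OF xy(1)] BH[OF xy(2)]] xy(3) by simp
    then have "x - y = 0" using inj0 H.subspace_diff[OF BSD(3) xy(1,2)] by blast
    then show "x = y" by simp
  qed
  \<comment> \<open>\<open>H\<close> is spanned by products a b, and p(a b) = \<epsilon>(a) p(b)
    because a - \<epsilon>(a) 1 lies in HA+.\<close>
  moreover have "p ` B = carrier Q"
  proof
    show "p ` B \<subseteq> carrier Q" using pD(3) BH by blast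
    show "carrier Q \<subseteq> p ` B"
    proof
      fix y assume "y \<in> carrier Q"
      then obtain x where x: "x \<in> carrier H" "y = p x" using QD(2) by blast
      have img: "Q.subspace (p ` B)" by (rule hopf_subalgebraD(3)[OF hopf_subalgebra_image_sub(1)[OF QD(1) B]])
      have "x \<in> {x \<in> carrier H. p x \<in> p ` B}"
      proof (rule H.product_span_induct[of x A B])
        show "H.subspace {x \<in> carrier H. p x \<in> p ` B}"
          by (rule subspace_linear_preimage[OF pD(4) H.carrier_subspace H.vector_space_axioms
                Q.vector_space_axioms img])
        fix a b assume ab: "a \<in> A" "b \<in> B"
        have aH: "a \<in> carrier H" using ASD(2) ab by blast
        have "mult H (unit H) a - smult H (counit H a) (unit H) \<in> augmentation_ideal H A"
          by (rule H.augmentation_ideal_mult_diff[OF AD(1) ab(1) H.unit_closed])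
        then have "p a = p (smult H (counit H a) (unit H))"
          using QD(3)[OF aH, of "smult H (counit H a) (unit H)"] aH by (simp add: H.mult_unit_left)
        also have "\<dots> = smult Q (counit H a) (unit Q)" by (simp add: linear_from_scale[OF pD(4)] pD(6))
        finally have "p (mult H a b) = p (smult H (counit H a) b)"
          using aH BH[OF ab(2)] pD(3) by (simp add: pD(5) Q.mult_smult_left Q.mult_unit_left linear_from_scale[OF pD(4)])
        then show "mult H a b \<in> {x \<in> carrier H. p x \<in> p ` B}"
          using aH BH[OF ab(2)] H.subspace_scale[OF BSD(3) ab(2)] by auto
      qed (use x prod in simp)
      then show "y \<in> p ` B" using x by simp
    qed
  qed
  ultimately have "bij_betw p (carrier ?K) (carrier Q)" by (simp add: bij_betw_def)
  then show ?thesis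
    unfolding hopf_iso_def using hopf_hom_comp[OF hopf_hom_inclusion[OF B] QD(1)] by blast
qed

subsection \<open>Composition series\<close>

lemma rel_mset_union:
  assumes "rel_mset R X Y" "rel_mset R X' Y'"
  shows "rel_mset R (X + X') (Y + Y')"
proof -
  obtain xs ys xs' ys' where "mset xs = X" "mset ys = Y" "list_all2 R xs ys"
    "mset xs' = X'" "mset ys' = Y'" "list_all2 R xs' ys'"
    using assms by (auto simp: rel_mset_def)
  then show ?thesis
    unfolding rel_mset_def
    by (intro exI[of _ "xs @ xs'"] exI[of _ "ys @ ys'"]) (simp add: list_all2_appendI)
qed

lemma same_factors_append:
  "same_factors Fs Gs \<Longrightarrow> same_factors Fs' Gs' \<Longrightarrow> same_factors (Fs @ Fs') (Gs @ Gs')"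
  by (simp add: same_factors_def rel_mset_union)

lemma same_factors_mset_eq:
  "same_factors Fs Gs \<Longrightarrow> mset Fs = mset Fs' \<Longrightarrow> mset Gs = mset Gs' \<Longrightarrow> same_factors Fs' Gs'"
  by (simp add: same_factors_def)

lemma same_factors_sym:
  assumes "same_factors Fs Gs"
  shows "same_factors Gs Fs"
proof -
  obtain xs ys where "mset xs = mset Fs" "mset ys = mset Gs" "list_all2 hopf_iso xs ys"
    using assms by (auto simp: same_factors_def rel_mset_def)
  moreover then have "list_all2 hopf_iso ys xs"
    by (simp add: list_all2_conv_all_nth hopf_iso_sym)
  ultimately show ?thesis by (auto simp: same_factors_def rel_mset_def)
qed

lemma same_factors_trans:
  fixes Fs :: "('k::field, 'a::ab_group_add) hopf list" and Gs :: "('k, 'b::ab_group_add) hopf list"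
    and Hs :: "('k, 'c::ab_group_add) hopf list"
  assumes "same_factors Fs Gs" "same_factors Gs Hs"
  shows "same_factors Fs Hs"
proof -
  let ?R = "(hopf_iso :: ('k, 'a) hopf \<Rightarrow> ('k, 'b) hopf \<Rightarrow> bool) OO (hopf_iso :: _ \<Rightarrow> ('k, 'c) hopf \<Rightarrow> bool)"
  have "rel_mset ?R (mset Fs) (mset Hs)"
    unfolding multiset.rel_compp using assms by (auto simp: same_factors_def)
  moreover have "?R \<le> hopf_iso" using hopf_iso_trans by blast
  ultimately show ?thesis unfolding same_factors_def using multiset.rel_mono by blast
qed

text \<open>\<open>hopf_iso\<close> includes that both sides are Hopf algebras, so reflexivity is
  restricted to lists of Hopf algebras.\<close>

lemma same_factors_refl:
  assumes "\<And>F. F \<in> set Fs \<Longrightarrow> hopf_algebra F"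
  shows "same_factors Fs Fs"
  using assms
proof (induction Fs)
  case (Cons F Fs)
  then have "hopf_iso F F" "same_factors Fs Fs" by (simp_all add: hopf_iso_refl)
  then show ?case by (simp add: same_factors_def rel_mset_Plus)
qed (simp add: same_factors_def)

lemma same_factors_length: "same_factors Fs Gs \<Longrightarrow> length Fs = length Gs"
  unfolding same_factors_def using rel_mset_size by fastforce

lemma composition_series_hopf_algebra:
  "composition_series H Fs \<Longrightarrow> F \<in> set Fs \<Longrightarrow> hopf_algebra F"
  by (induction rule: composition_series.induct) (auto simp: simple_hopf_def)

lemma composition_series_same_refl: "composition_series H Fs \<Longrightarrow> same_factors Fs Fs"
  by (rule same_factors_refl) (rule composition_series_hopf_algebra)

section \<open>Existence of composition series and transport along isomorphisms\<close>

lemma extension_dim: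
  assumes fd: "finite_dimensional H" and A: "normal_hopf_subalgebra H A"
    and strict: "scalars H \<subset> A" "A \<subset> carrier H" and Q: "is_hopf_quotient H A Q p"
  shows "finite_dimensional (sub_hopf H A)" "finite_dimensional Q"
    "hopf_dim (sub_hopf H A) < hopf_dim H" "hopf_dim Q < hopf_dim H"
proof -
  note AD = normal_hopf_subalgebraD[OF A]
  note QD = is_hopf_quotientD[OF Q]
  interpret H: hopf_algebra H using QD(1) by (rule hopf_homD)
  show "finite_dimensional (sub_hopf H A)" by (rule finite_dimensional_sub_hopf[OF fd AD(1)])
  show "hopf_dim (sub_hopf H A) < hopf_dim H" by (rule hopf_dim_sub_hopf_less[OF fd AD(1) strict(2)])
  show "finite_dimensional Q" by (rule finite_dimensional_image(1)[OF fd QD(1,2)])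
  obtain y where y: "y \<in> carrier H" "y \<noteq> 0" "y \<in> augmentation_ideal H A"
    by (rule H.nonscalar_augmentation[OF AD(1) strict(1)]) (rule that)
  then show "hopf_dim Q < hopf_dim H"
    using finite_dimensional_image(2)[OF fd QD(1,2)] is_hopf_quotient_zero[OF Q] by blast
qed

theorem composition_series_exists:
  fixes H :: "('k::field, 'a::ab_group_add) hopf"
  assumes "hopf_algebra H" "finite_dimensional H"
  shows "\<exists>Fs. composition_series H Fs"
  using assms
proof (induction "hopf_dim H" arbitrary: H rule: less_induct)
  case less
  show ?case
  proof (cases "simple_hopf H")
    case True
    then show ?thesis using composition_series.simple by blast
  next
    case False
    then obtain A where A: "normal_hopf_subalgebra H A" "scalars H \<subset> A" "A \<subset> carrier H"
      using less.prems(1) by (auto simp: simple_hopf_def)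
    obtain Q p where Q: "is_hopf_quotient H A Q p"
      using hopf_algebra.hopf_quotient_exists[OF less.prems(1) A(1)] by blast
    note dims = extension_dim[OF less.prems(2) A Q]
    have "hopf_algebra (sub_hopf H A)"
      by (rule hopf_algebra_sub_hopf[OF normal_hopf_subalgebraD(1)[OF A(1)]])
    then obtain As where As: "composition_series (sub_hopf H A) As"
      using less.hyps[OF dims(3)] dims(1) by blast
    obtain Bs where Bs: "composition_series Q Bs"
      using less.hyps[OF dims(4)] dims(2) hopf_homD(2)[OF is_hopf_quotientD(1)[OF Q]] by blast
    show ?thesis using composition_series.extension[OF A Q As Bs] by blast
  qed
qed

text \<open>A series is attached to a record, not to its isomorphism class, so moving it to an
  isomorphic copy takes an induction. The subalgebra is replaced by its image, whereas the quotient
  can be kept, since \<open>is_hopf_quotient\<close> accepts any copy.\<close>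

lemma composition_series_iso:
  fixes H K :: "('k::field, 'a::ab_group_add) hopf"
  assumes "composition_series H Fs" "hopf_iso H K"
  shows "\<exists>Gs. composition_series K Gs \<and> same_factors Fs Gs"
  using assms
proof (induction arbitrary: K rule: composition_series.induct)
  case (simple H)
  have "composition_series K [K]"
    by (rule composition_series.simple, rule simple_hopf_iso[OF simple.prems simple.hyps])
  moreover have "same_factors [H] [K]"
    using simple.prems by (simp add: same_factors_def rel_mset_Plus)
  ultimately show ?case by blast
next
  case (extension H A Q p As Bs)
  obtain f where f: "hopf_hom H K f" "bij_betw f (carrier H) (carrier K)"
    using extension.prems by (auto simp: hopf_iso_def)
  note fD = hopf_homD[OF f(1)]
  interpret H: hopf_algebra H by (rule fD)
  interpret K: hopf_algebra K by (rule fD)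
  note AD = normal_hopf_subalgebraD[OF extension.hyps(1)]
  note QD = is_hopf_quotientD[OF extension.hyps(4)]
  have AH: "A \<subseteq> carrier H" by (rule hopf_subalgebraD(2)[OF AD(1)])
  have inj: "inj_on f (carrier H)" and img: "f ` carrier H = carrier K"
    using f(2) by (auto simp: bij_betw_def)
  define g where "g = inv_into (carrier H) f"
  have gf: "g (f x) = x" if "x \<in> carrier H" for x using inj that by (simp add: g_def)
  have fg: "g y \<in> carrier H" "f (g y) = y" if "y \<in> carrier K" for y
    using that img by (auto simp: g_def inv_into_into f_inv_into_f)
  have g: "hopf_hom K H g" by (rule hopf_hom_inverse[OF f gf])
  have gA: "g ` f ` A = A" using gf AH by (force simp: image_image)
  have N: "normal_hopf_subalgebra K (f ` A)"
    by (rule normal_hopf_subalgebra_image[OF f(1) img extension.hyps(1)])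
  have scal: "f ` scalars H = scalars K"
    unfolding scalars_def image_image using linear_from_scale[OF fD(4)] fD(6) by auto
  have strict: "scalars K \<subset> f ` A" "f ` A \<subset> carrier K"
    using extension.hyps(2,3) inj_on_image_eq_iff[OF inj, of "scalars H" A]
      inj_on_image_eq_iff[OF inj, of A "carrier H"] AH
    unfolding scal[symmetric] img[symmetric] by (simp_all add: psubset_eq image_mono) blast
  \<comment> \<open>The same record \<open>Q\<close> is a quotient of \<open>K\<close>: its
    projection first goes back to \<open>H\<close> by \<open>g\<close>, and both \<open>f\<close>
    and \<open>g\<close> preserve the ideals.\<close>
  have quot: "is_hopf_quotient K (f ` A) Q (\<lambda>x. p (g x))"
    unfolding is_hopf_quotient_def
  proof (intro conjI ballI)
    show "hopf_hom K Q (\<lambda>x. p (g x))" by (rule hopf_hom_comp[OF g QD(1)])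
    have "g ` carrier K = carrier H" using gf img by (force simp: image_image)
    then have "p ` g ` carrier K = carrier Q" using QD(2) by simp
    then show "(\<lambda>x. p (g x)) ` carrier K = carrier Q" by (simp add: image_image)
    fix x y assume xy: "x \<in> carrier K" "y \<in> carrier K"
    have diff: "g x - g y = g (x - y)"
      using linear_from_diff[OF hopf_homD(4)[OF g] K.carrier_subspace K.vector_space_axioms xy] by simp
    have "g (x - y) \<in> augmentation_ideal H A \<longleftrightarrow> x - y \<in> augmentation_ideal K (f ` A)"
    proof
      assume "g (x - y) \<in> augmentation_ideal H A"
      from hopf_hom_augmentation_ideal[OF f(1) AH this]
      show "x - y \<in> augmentation_ideal K (f ` A)" using fg(2) xy by simp
    next
      assume "x - y \<in> augmentation_ideal K (f ` A)"
      from hopf_hom_augmentation_ideal[OF g _ this]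
      show "g (x - y) \<in> augmentation_ideal H A"
        using gA hopf_subalgebraD(2)[OF normal_hopf_subalgebraD(1)[OF N]] by simp
    qed
    then show "p (g x) = p (g y) \<longleftrightarrow> x - y \<in> augmentation_ideal K (f ` A)"
      using QD(3)[OF fg(1)[OF xy(1)] fg(1)[OF xy(2)]] diff by simp
  qed
  have "hopf_iso (sub_hopf H A) (sub_hopf K (f ` A))"
    unfolding hopf_iso_def
    using hopf_subalgebra_image_sub(2)[OF f(1) AD(1)] inj_on_subset[OF inj AH]
    by (auto simp: bij_betw_def)
  then obtain Cs where Cs: "composition_series (sub_hopf K (f ` A)) Cs" "same_factors As Cs"
    using extension.IH(1) by blast
  have "composition_series K (Cs @ Bs)"
    by (rule composition_series.extension[OF N strict quot Cs(1) extension.hyps(6)])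
  moreover have "same_factors (As @ Bs) (Cs @ Bs)"
    by (rule same_factors_append[OF Cs(2) composition_series_same_refl[OF extension.hyps(6)]])
  ultimately show ?case by blast
qed

section \<open>The theorem of Jordan and Hoelder\<close>

definition unique_factors :: "('k::field, 'a::ab_group_add) hopf \<Rightarrow> bool" where
  "unique_factors H \<longleftrightarrow>
     (\<forall>Fs Gs. composition_series H Fs \<longrightarrow> composition_series H Gs \<longrightarrow> same_factors Fs Gs)"

lemma unique_factors_iso:
  fixes H K :: "('k::field, 'a::ab_group_add) hopf"
  assumes "unique_factors K" "hopf_iso H K" "composition_series H Fs" "composition_series K Gs"
  shows "same_factors Fs Gs"
proof -
  obtain Fs' where Fs': "composition_series K Fs'" "same_factors Fs Fs'"
    using composition_series_iso[OF assms(3,2)] by blast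
  then show ?thesis using assms(1,4) same_factors_trans unfolding unique_factors_def by blast
qed

text \<open>Both lists are compared with the factors of \<open>A\<close>, of the image of
  \<open>B\<close> in H/HA+, and of H/HB+. The first two form a series of \<open>B\<close>, the last
  two one of H/HA+, and these smaller Hopf algebras have unique factors by the induction
  hypothesis.\<close>

lemma comparable_factors:
  fixes H :: "('k::field, 'a::ab_group_add) hopf"
  assumes fd: "finite_dimensional H"
    and IH: "\<And>K :: ('k, 'a) hopf. hopf_algebra K \<Longrightarrow> finite_dimensional K \<Longrightarrow> hopf_dim K < hopf_dim H \<Longrightarrow>
      unique_factors K"
    and A: "normal_hopf_subalgebra H A" "scalars H \<subset> A"
    and B: "normal_hopf_subalgebra H B" "B \<subset> carrier H" and AB: "A \<subset> B"
    and Q: "is_hopf_quotient H A Q p" and R: "is_hopf_quotient H B R p'"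
    and As: "composition_series (sub_hopf H A) As" and Qs: "composition_series Q Qs"
    and Bs: "composition_series (sub_hopf H B) Bs" and Rs: "composition_series R Rs"
  shows "same_factors (As @ Qs) (Bs @ Rs)"
proof -
  note AD = normal_hopf_subalgebraD[OF A(1)] and BD = normal_hopf_subalgebraD[OF B(1)]
  have strict: "A \<subset> carrier H" "scalars H \<subset> B" using A(2) B(2) AB by auto
  note QD = is_hopf_quotientD[OF Q]
  note dimA = extension_dim[OF fd A strict(1) Q]
  note dimB = extension_dim[OF fd B(1) strict(2) B(2) R]
  let ?B = "sub_hopf H B"
  have hB: "hopf_algebra ?B" by (rule hopf_algebra_sub_hopf[OF BD(1)])
  have pB: "normal_hopf_subalgebra Q (p ` B)"
    by (rule normal_hopf_subalgebra_image[OF QD(1,2) B(1)])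
  note pB_strict = quotient_image_strict[OF fd A(1) B(1) AB B(2) Q]
  let ?K = "sub_hopf Q (p ` B)"
  have fdK: "finite_dimensional ?K"
    by (rule finite_dimensional_sub_hopf[OF dimA(2) normal_hopf_subalgebraD(1)[OF pB]])
  obtain Ks where Ks: "composition_series ?K Ks"
    using composition_series_exists[OF hopf_algebra_sub_hopf[OF normal_hopf_subalgebraD(1)[OF pB]] fdK] by blast
  obtain As' where As': "composition_series (sub_hopf ?B A) As'" "same_factors As As'"
    using composition_series_iso[OF As hopf_iso_sub_sub[OF AD(1) BD(1)]] AB by blast
  have "composition_series ?B (As' @ Ks)"
  proof (rule composition_series.extension[OF _ _ _ _ As'(1) Ks])
    show "normal_hopf_subalgebra ?B A" by (rule normal_hopf_subalgebra_sub[OF A(1) BD(1)]) (use AB in blast)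
    show "is_hopf_quotient ?B A ?K p" by (rule third_isomorphism_sub[OF fd A(1) B(1) _ Q]) (use AB in blast)
  qed (use A(2) AB in \<open>auto simp: scalars_def\<close>)
  then have 1: "same_factors (As' @ Ks) Bs"
    using IH[OF hB dimB(1,3)] Bs by (simp add: unique_factors_def)
  obtain r where r: "is_hopf_quotient Q (p ` B) R r"
    using third_isomorphism_quotient[OF A(1) B(1) _ Q R] AB by blast
  have "composition_series Q (Ks @ Rs)"
    by (rule composition_series.extension[OF pB pB_strict r Ks Rs])
  then have 2: "same_factors Qs (Ks @ Rs)"
    using IH[OF hopf_homD(2)[OF QD(1)] dimA(2,4)] Qs by (simp add: unique_factors_def)
  have "same_factors (As @ Qs) ((As' @ Ks) @ Rs)"
    using same_factors_append[OF As'(2) 2] by simp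
  moreover have "same_factors ((As' @ Ks) @ Rs) (Bs @ Rs)"
    by (rule same_factors_append[OF 1 composition_series_same_refl[OF Rs]])
  ultimately show ?thesis by (rule same_factors_trans)
qed

text \<open>
  Two incomparable normal Hopf subalgebras \<open>A\<close> and \<open>B\<close> are
  compared through \<open>AB\<close> or through \<open>A \<inter> B\<close>, unless \<open>AB = H\<close> and \<open>A \<inter> B = k\<close>, in which case
  \<open>B \<cong> H/HA\<^sup>+\<close> and \<open>A \<cong> H/HB\<^sup>+\<close>.
\<close>

theorem jordan_hoelder:
  fixes H :: "('k::field, 'a::ab_group_add) hopf"
  assumes "hopf_algebra H" "finite_dimensional H"
  shows "unique_factors H"
  using assms
proof (induction "hopf_dim H" arbitrary: H rule: less_induct)
  case (less H)
  interpret H: hopf_algebra H by (rule less.prems)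
  note fd = less.prems(2)
  have IH: "unique_factors K" if "hopf_algebra K" "finite_dimensional K" "hopf_dim K < hopf_dim H"
    for K :: "('k, 'a) hopf"
    using less.hyps that by blast
  note comparable = comparable_factors[OF fd IH]
  have main: "same_factors (As @ Qs) (Bs @ Rs)"
    if A: "normal_hopf_subalgebra H A" "scalars H \<subset> A" "A \<subset> carrier H"
      and Q: "is_hopf_quotient H A Q p"
      and As: "composition_series (sub_hopf H A) As" and Qs: "composition_series Q Qs"
      and B: "normal_hopf_subalgebra H B" "scalars H \<subset> B" "B \<subset> carrier H"
      and R: "is_hopf_quotient H B R p'"
      and Bs: "composition_series (sub_hopf H B) Bs" and Rs: "composition_series R Rs"
    for A Q p As Qs B R p' Bs Rs
  proof -
    note dimA = extension_dim[OF fd A Q] and dimB = extension_dim[OF fd B R]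
    note AD = normal_hopf_subalgebraD[OF A(1)] and BD = normal_hopf_subalgebraD[OF B(1)]
    note QD = is_hopf_quotientD[OF Q] and RD = is_hopf_quotientD[OF R]
    note uQ = IH[OF hopf_homD(2)[OF QD(1)] dimA(2,4)] and uR = IH[OF hopf_homD(2)[OF RD(1)] dimB(2,4)]
    have series: "\<exists>S q Cs Ss. is_hopf_quotient H C S q \<and> composition_series (sub_hopf H C) Cs \<and>
        composition_series S Ss" if C: "normal_hopf_subalgebra H C" for C
    proof -
      obtain S q where S: "is_hopf_quotient H C S q" using H.hopf_quotient_exists[OF C] by blast
      note SD = is_hopf_quotientD[OF S]
      note CD = normal_hopf_subalgebraD(1)[OF C]
      show ?thesis
        using S composition_series_exists[OF hopf_algebra_sub_hopf[OF CD] finite_dimensional_sub_hopf[OF fd CD]]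
          composition_series_exists[OF hopf_homD(2)[OF SD(1)] finite_dimensional_image(1)[OF fd SD(1,2)]]
        by blast
    qed
    consider "A = B" | "A \<subset> B" | "B \<subset> A" | "\<not> A \<subseteq> B" "\<not> B \<subseteq> A" by blast
    then show ?thesis
    proof cases
      case 1
      have "same_factors As Bs"
        using IH[OF hopf_algebra_sub_hopf[OF AD(1)] dimA(1,3)] As Bs 1 by (simp add: unique_factors_def)
      moreover have "same_factors Qs Rs"
        using unique_factors_iso[OF uR hopf_quotient_unique[OF Q] Qs Rs] R 1 by simp
      ultimately show ?thesis by (rule same_factors_append)
    next
      case 2
      show ?thesis by (rule comparable[OF _ _ _ A(1,2) B(1,3) 2 Q R As Qs Bs Rs])
    next
      case 3
      show ?thesis
        by (rule same_factors_sym, rule comparable[OF _ _ _ B(1,2) A(1,3) 3 R Q Bs Rs As Qs])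
    next
      case 4
      note D = H.normal_hopf_subalgebra_product[OF fd A(1) B(1)]
      note C = H.normal_hopf_subalgebra_Int[OF fd A(1) B(1)]
      let ?D = "H.product_span A B"
      have AD': "A \<subset> ?D" "B \<subset> ?D" using D(2,3) 4 by auto
      show ?thesis
      proof (cases "?D = carrier H")
        case False
        have DH: "?D \<subset> carrier H"
          using False hopf_subalgebraD(2)[OF normal_hopf_subalgebraD(1)[OF D(1)]] by blast
        obtain S q Ds Ss where S: "is_hopf_quotient H ?D S q" "composition_series (sub_hopf H ?D) Ds"
          "composition_series S Ss" using series[OF D(1)] by blast
        have "same_factors (As @ Qs) (Ds @ Ss)"
          by (rule comparable[OF _ _ _ A(1,2) D(1) DH AD'(1) Q S(1) As Qs S(2,3)])
        moreover have "same_factors (Ds @ Ss) (Bs @ Rs)"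
          by (rule same_factors_sym, rule comparable[OF _ _ _ B(1,2) D(1) DH AD'(2) R S(1) Bs Rs S(2,3)])
        ultimately show ?thesis by (rule same_factors_trans)
      next
        case prod: True
        show ?thesis
        proof (cases "A \<inter> B \<subseteq> scalars H")
          case False
          have CH: "scalars H \<subset> A \<inter> B" using False A(2) B(2) by blast
          have sub: "A \<inter> B \<subset> A" "A \<inter> B \<subset> B" using 4 by auto
          obtain S q Cs Ss where S: "is_hopf_quotient H (A \<inter> B) S q"
            "composition_series (sub_hopf H (A \<inter> B)) Cs" "composition_series S Ss"
            using series[OF C] by blast
          have "same_factors (Cs @ Ss) (Bs @ Rs)"
            by (rule comparable[OF _ _ _ C CH B(1,3) sub(2) S(1) R S(2,3) Bs Rs])
          moreover have "same_factors (As @ Qs) (Cs @ Ss)"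
            by (rule same_factors_sym, rule comparable[OF _ _ _ C CH A(1,3) sub(1) S(1) Q S(2,3) As Qs])
          ultimately show ?thesis by (blast intro: same_factors_trans)
        next
          case int: True
          note D' = H.normal_hopf_subalgebra_product[OF fd B(1) A(1)]
          note D'S = hopf_subalgebraD[OF normal_hopf_subalgebraD(1)[OF D'(1)]]
          \<comment> \<open>The second isomorphism theorem is applied twice with the roles
            exchanged, so BA = \<open>H\<close> is needed too: BA is a Hopf subalgebra containing
            \<open>A\<close> and \<open>B\<close>, hence the products a b that span
            \<open>H\<close>.\<close>
          have "carrier H \<subseteq> H.product_span B A"
          proof
            fix x assume "x \<in> carrier H"
            then show "x \<in> H.product_span B A"
              unfolding prod[symmetric]
              by (rule H.product_span_induct[OF _ D'S(3)]) (use D'S(5) D'(2,3) in blast)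
          qed
          then have prod': "H.product_span B A = carrier H" using D'S(2) by blast
          have "hopf_iso (sub_hopf H B) Q"
            by (rule second_isomorphism[OF fd A(1) BD(1) int prod Q])
          then have "same_factors Bs Qs" by (rule unique_factors_iso[OF uQ _ Bs Qs])
          moreover have "hopf_iso (sub_hopf H A) R"
            by (rule second_isomorphism[OF fd B(1) AD(1) _ prod' R]) (use int in blast)
          then have "same_factors As Rs" by (rule unique_factors_iso[OF uR _ As Rs])
          ultimately have "same_factors (As @ Qs) (Rs @ Bs)"
            by (intro same_factors_append same_factors_sym[of Bs Qs])
          then show ?thesis by (rule same_factors_mset_eq) (simp_all add: union_commute)
        qed
      qed
    qed
  qed
  show ?case
    unfolding unique_factors_def
  proof (intro allI impI)
    fix Fs Gs assume F: "composition_series H Fs" and G: "composition_series H Gs"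
    from F show "same_factors Fs Gs"
    proof cases
      case simple
      from G show ?thesis
      proof cases
        case simple': simple
        then show ?thesis using simple(1) composition_series_same_refl[OF F] by simp
      next
        case (extension A Q p As Bs)
        then show ?thesis using simple(2) by (auto simp: simple_hopf_def)
      qed
    next
      case (extension A Q p As Qs)
      note ext = extension
      from G show ?thesis
      proof cases
        case simple
        then show ?thesis using ext by (auto simp: simple_hopf_def)
      next
        case (extension B R p' Bs Rs)
        show ?thesis unfolding ext(1) extension(1) by (rule main[OF ext(2-7) extension(2-7)])
      qed
    qed
  qed
qed

section \<open>Length and duality\<close>

lemma hopf_length_eq:
  assumes "hopf_algebra H" "finite_dimensional H" "composition_series H Fs"
  shows "hopf_length H = length Fs"
  unfolding hopf_length_def
proof (rule the_equality)
  show "\<exists>Gs. composition_series H Gs \<and> length Gs = length Fs" using assms(3) by blast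
  fix n assume "\<exists>Gs. composition_series H Gs \<and> length Gs = n"
  then show "n = length Fs"
    using jordan_hoelder[OF assms(1,2)] assms(3) same_factors_length unfolding unique_factors_def by blast
qed

lemma composition_series_dual:
  assumes "composition_series H Hs" "finite_dimensional H"
  shows "\<exists>Ds. composition_series (dual_hopf H) Ds \<and> same_factors Ds (map dual_hopf Hs)"
  using assms
proof (induction rule: composition_series.induct)
  case (simple H)
  have "composition_series (dual_hopf H) [dual_hopf H]"
    by (rule composition_series.simple, rule simple_hopf_dual[OF simple.prems simple.hyps])
  then show ?case using composition_series_same_refl by fastforce
next
  case (extension H A Q p As Bs)
  note dims = extension_dim[OF extension.prems extension.hyps(1-4)]
  interpret H: hopf_algebra H by (rule hopf_homD(1)[OF is_hopf_quotientD(1)[OF extension.hyps(4)]])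
  let ?N = "H.annihilator A"
  obtain Ds where Ds: "composition_series (dual_hopf (sub_hopf H A)) Ds" "same_factors Ds (map dual_hopf As)"
    using extension.IH(1)[OF dims(1)] by blast
  obtain Es where Es: "composition_series (dual_hopf Q) Es" "same_factors Es (map dual_hopf Bs)"
    using extension.IH(2)[OF dims(2)] by blast
  \<comment> \<open>The induction gives a series of the dual of \<open>Q\<close>, while the
    extension rule asks for one of the annihilator as a Hopf subalgebra. The transposed projection
    is an isomorphism between the two, and both live on the same type of functionals.\<close>
  obtain Es' where Es': "composition_series (sub_hopf (dual_hopf H) ?N) Es'" "same_factors Es Es'"
    using composition_series_iso[OF Es(1) H.dual_of_quotient[OF extension.prems extension.hyps(4)]] by blast
  have "composition_series (dual_hopf H) (Es' @ Ds)"
    by (rule composition_series.extension[OF H.normal_annihilator[OF extension.prems extension.hyps(1)]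
          H.annihilator_strict[OF extension.prems extension.hyps(1-3)]
          H.dual_quotient[OF extension.prems extension.hyps(1)] Es'(1) Ds(1)])
  moreover have "same_factors Es' (map dual_hopf Bs)"
    by (rule same_factors_trans[OF same_factors_sym[OF Es'(2)] Es(2)])
  then have "same_factors (Es' @ Ds) (map dual_hopf Bs @ map dual_hopf As)"
    by (rule same_factors_append[OF _ Ds(2)])
  then have "same_factors (Es' @ Ds) (map dual_hopf (As @ Bs))"
    by (rule same_factors_mset_eq) (simp_all add: union_commute)
  ultimately show ?case by blast
qed

theorem corollary4p4:
  fixes H :: "('k::field, 'a::ab_group_add) hopf" and Hs :: "('k, 'a) hopf list"
  assumes "hopf_algebra H" and "finite_dimensional H"
    and "composition_series H Hs"
  shows "(\<exists>Ds. composition_series (dual_hopf H) Ds) \<and>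
         (\<forall>Ds. composition_series (dual_hopf H) Ds \<longrightarrow> same_factors Ds (map dual_hopf Hs)) \<and>
         hopf_length (dual_hopf H) = hopf_length H"
proof -
  interpret hopf_algebra H by fact
  note hD = hopf_algebra_dual[OF assms(2)] and fdD = finite_dimensional_dual[OF assms(2)]
  obtain Ds where Ds: "composition_series (dual_hopf H) Ds" "same_factors Ds (map dual_hopf Hs)"
    using composition_series_dual[OF assms(3,2)] by blast
  have "same_factors Es (map dual_hopf Hs)" if "composition_series (dual_hopf H) Es" for Es
    using jordan_hoelder[OF hD fdD] that Ds same_factors_trans unfolding unique_factors_def by blast
  moreover have "hopf_length (dual_hopf H) = hopf_length H"
    using hopf_length_eq[OF hD fdD Ds(1)] hopf_length_eq[OF assms] same_factors_length[OF Ds(2)] by simp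
  ultimately show ?thesis using Ds(1) by blast
qed

end
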